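(* The Parikh coverability problem is PSPACE-complete for serial synchronous QDAS.
   Context: A queue-dispatch asynchronous system (QDAS) $\mathcal A$ consists of: a finite data domain $\mathbb D$ with an initial value $d_0$; a finite set $\mathcal X$ of variables ranging over $\mathbb D$; disjoint finite sets $CQID$ (concurrent queues) and $SQID$ (serial queues); a finite set $\Gamma$ of blocks with a distinguished initial block $main$; and for each block $\gamma\in\Gamma$ a finite labelled transition system with state set $S_\gamma$, initial state $s^0_\gamma$, a distinguished final state $f_\gamma\in S_\gamma$, and transitions $\Delta_\gamma\subseteq S_\gamma\times\Sigma\times S_\gamma$. The state sets are pairwise disjoint and $S=\bigcup_\gamma S_\gamma$. The actions $\Sigma$ are: asynchronous dispatches $\mathrm{dispatch_a}(q,\gamma)$ and synchronous dispatches $\mathrm{dispatch_s}(q,\gamma)$ with $q\in CQID\cup SQID$, $\gamma\in\Gamma\setminus\{main\}$; guards (finite conjunctions of atoms $x=d$, $x\neq d$); and assignments $x\gets d$. A configuration is a pair $(G,\mathbf d)$ of a valuation $\mathbf d:\mathcal X\to\mathbb D$ and a call-task graph $G$: a finite set of vertices, each being either a call vertex (a dispatched block waiting in a queue) or a task vertex (a running instance of a block), each labelled with a block $\lambda(v)$, the queue it was dispatched to (or a special identifier for $main$), and a state $state(v)\in S_{\lambda(v)}$ (call vertices carry the initial state of their block); the call vertices of each queue are ordered FIFO; and wait edges, where a wait edge $v\to w$ means $v$ is blocked until $w$ is removed. A task vertex is unblocked if it has no outgoing wait edge. The initial configuration has a single task vertex for $main$ in $s^0_{main}$ and all variables equal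 to $d_0$. Steps: an unblocked task vertex $v$ in state $s$ with $(s,a,s')\in\Delta_{\lambda(v)}$ moves to $s'$, where: a guard $a$ must be satisfied by $\mathbf d$; an assignment updates $\mathbf d$; $\mathrm{dispatch_a}(q,\gamma)$ appends a new call vertex for $\gamma$ at the end of queue $q$; $\mathrm{dispatch_s}(q,\gamma)$ does the same and adds a wait edge from $v$ to the new vertex. Scheduler steps: remove an unblocked task vertex $v$ with $state(v)=f_{\lambda(v)}$ (together with wait edges into it); turn the first call vertex of a concurrent queue into a task vertex; turn the first call vertex of a serial queue $q$ into a task vertex provided no task previously dequeued from $q$ is still present (so at most one task from a serial queue runs at a time). A configuration is reachable if it is obtained from the initial one by finitely many steps. The Parikh image $\mathrm{Parikh}(G):S\to\mathbb N$ maps $s$ to the number of vertices $v$ of $G$ with $state(v)=s$. The Parikh coverability problem: given a QDAS $\mathcal A$ and $f:S\to\mathbb N$, decide whether some reachable $(G,\mathbf d)$ satisfies $f(s)\le\mathrm{Parikh}(G)(s)$ for all $s\in S$. A QDAS is synchronous if no transition is labelled by an asynchronous dispatch; it is serial if $CQID=\emptyset$ and $SQID\neq\emptyset$. *)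

theory Defs
  imports "HOL-Computational_Algebra.Polynomial"
begin

section \<open>Queue-dispatch asynchronous systems\<close>

datatype ('x, 'd) atom = Eq 'x 'd | Neq 'x 'd

datatype ('x, 'd, 'q, 'b) action =
    Dispatch_a 'q 'b
  | Dispatch_s 'q 'b
  | Guard "('x, 'd) atom list"
  | Assign 'x 'd

record ('x, 'd, 'q, 'b, 's) qdas =
  data :: "'d set"
  init_data :: 'd
  variables :: "'x set"
  cqid :: "'q set"
  sqid :: "'q set"
  blocks :: "'b set"
  main_block :: 'b
  states :: "'b \<Rightarrow> 's set"
  init_state :: "'b \<Rightarrow> 's"
  final_state :: "'b \<Rightarrow> 's"
  transitions :: "'b \<Rightarrow> ('s \<times> ('x, 'd, 'q, 'b) action \<times> 's) set"

fun atom_over :: "'x set \<Rightarrow> 'd set \<Rightarrow> ('x, 'd) atom \<Rightarrow> bool" where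
  "atom_over X D (Eq x d) \<longleftrightarrow> x \<in> X \<and> d \<in> D"
| "atom_over X D (Neq x d) \<longleftrightarrow> x \<in> X \<and> d \<in> D"

fun action_of :: "('x, 'd, 'q, 'b, 's) qdas \<Rightarrow> ('x, 'd, 'q, 'b) action \<Rightarrow> bool" where
  "action_of A (Dispatch_a q b) \<longleftrightarrow> q \<in> cqid A \<union> sqid A \<and> b \<in> blocks A - {main_block A}"
| "action_of A (Dispatch_s q b) \<longleftrightarrow> q \<in> cqid A \<union> sqid A \<and> b \<in> blocks A - {main_block A}"
| "action_of A (Guard g) \<longleftrightarrow> (\<forall>a \<in> set g. atom_over (variables A) (data A) a)"
| "action_of A (Assign x d) \<longleftrightarrow> x \<in> variables A \<and> d \<in> data A"

text \<open>The values of the block-indexed fields outside \<open>blocks A\<close> are irrelevant.\<close>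

definition wf_qdas :: "('x, 'd, 'q, 'b, 's) qdas \<Rightarrow> bool" where
  "wf_qdas A \<longleftrightarrow>
     finite (data A) \<and> init_data A \<in> data A \<and>
     finite (variables A) \<and>
     finite (cqid A) \<and> finite (sqid A) \<and> cqid A \<inter> sqid A = {} \<and>
     finite (blocks A) \<and> main_block A \<in> blocks A \<and>
     (\<forall>b \<in> blocks A.
        finite (states A b) \<and> init_state A b \<in> states A b \<and> final_state A b \<in> states A b \<and>
        finite (transitions A b) \<and>
        transitions A b \<subseteq> states A b \<times> Collect (action_of A) \<times> states A b) \<and>
     (\<forall>b \<in> blocks A. \<forall>c \<in> blocks A. b \<noteq> c \<longrightarrow> states A b \<inter> states A c = {})"

definition all_states :: "('x, 'd, 'q, 'b, 's) qdas \<Rightarrow> 's set" where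
  "all_states A = (\<Union>b \<in> blocks A. states A b)"

definition synchronous :: "('x, 'd, 'q, 'b, 's) qdas \<Rightarrow> bool" where
  "synchronous A \<longleftrightarrow>
     (\<forall>b \<in> blocks A. \<forall>(s, a, s') \<in> transitions A b. \<forall>q c. a \<noteq> Dispatch_a q c)"

definition serial :: "('x, 'd, 'q, 'b, 's) qdas \<Rightarrow> bool" where
  "serial A \<longleftrightarrow> cqid A = {} \<and> sqid A \<noteq> {}"


section \<open>Call-task graphs and the transition relation\<close>

text \<open>
  Vertices are natural numbers. The call vertices are those listed in the FIFO lists \<open>fifo\<close>
  (head = first element of the queue). The queue label is \<open>None\<close> for \<open>main\<close>. Labels of numbers
  that are not vertices are irrelevant.
\<close>

record ('q, 'b, 's) ctg =
  tasks :: "nat set"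
  fifo :: "'q \<Rightarrow> nat list"
  block :: "nat \<Rightarrow> 'b"
  queue :: "nat \<Rightarrow> 'q option"
  state :: "nat \<Rightarrow> 's"
  waits :: "(nat \<times> nat) set"

definition calls :: "('q, 'b, 's) ctg \<Rightarrow> nat set" where
  "calls G = (\<Union>q. set (fifo G q))"

definition vertices :: "('q, 'b, 's) ctg \<Rightarrow> nat set" where
  "vertices G = tasks G \<union> calls G"

definition unblocked :: "('q, 'b, 's) ctg \<Rightarrow> nat \<Rightarrow> bool" where
  "unblocked G v \<longleftrightarrow> (\<forall>w. (v, w) \<notin> waits G)"

definition parikh :: "('q, 'b, 's) ctg \<Rightarrow> 's \<Rightarrow> nat" where
  "parikh G s = card {v \<in> vertices G. state G v = s}"

type_synonym ('x, 'd, 'q, 'b, 's) config = "('q, 'b, 's) ctg \<times> ('x \<Rightarrow> 'd)"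

definition init_config :: "('x, 'd, 'q, 'b, 's) qdas \<Rightarrow> ('x, 'd, 'q, 'b, 's) config" where
  "init_config A =
     (\<lparr> tasks = {0}, fifo = (\<lambda>_. []), block = (\<lambda>_. main_block A), queue = (\<lambda>_. None),
        state = (\<lambda>_. init_state A (main_block A)), waits = {} \<rparr>,
      \<lambda>_. init_data A)"

fun sat_atom :: "('x \<Rightarrow> 'd) \<Rightarrow> ('x, 'd) atom \<Rightarrow> bool" where
  "sat_atom \<nu> (Eq x d) \<longleftrightarrow> \<nu> x = d"
| "sat_atom \<nu> (Neq x d) \<longleftrightarrow> \<nu> x \<noteq> d"

definition set_state :: "nat \<Rightarrow> 's \<Rightarrow> ('q, 'b, 's) ctg \<Rightarrow> ('q, 'b, 's) ctg" where
  "set_state v s G = G\<lparr>state := (state G)(v := s)\<rparr>"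

definition add_call ::
  "('x, 'd, 'q, 'b, 's) qdas \<Rightarrow> nat \<Rightarrow> 'q \<Rightarrow> 'b \<Rightarrow> ('q, 'b, 's) ctg \<Rightarrow> ('q, 'b, 's) ctg" where
  "add_call A w q b G = G\<lparr>
     fifo := (fifo G)(q := fifo G q @ [w]),
     block := (block G)(w := b),
     queue := (queue G)(w := Some q),
     state := (state G)(w := init_state A b)\<rparr>"

definition add_wait :: "nat \<Rightarrow> nat \<Rightarrow> ('q, 'b, 's) ctg \<Rightarrow> ('q, 'b, 's) ctg" where
  "add_wait v w G = G\<lparr>waits := insert (v, w) (waits G)\<rparr>"

definition remove_task :: "nat \<Rightarrow> ('q, 'b, 's) ctg \<Rightarrow> ('q, 'b, 's) ctg" where
  "remove_task v G = G\<lparr>tasks := tasks G - {v}, waits := {(u, w) \<in> waits G. w \<noteq> v}\<rparr>"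

text \<open>The vertex keeps its identity, hence its labels and the wait edge into it.\<close>

definition dequeue :: "'q \<Rightarrow> ('q, 'b, 's) ctg \<Rightarrow> ('q, 'b, 's) ctg" where
  "dequeue q G = G\<lparr>
     tasks := insert (hd (fifo G q)) (tasks G),
     fifo := (fifo G)(q := tl (fifo G q))\<rparr>"

inductive step ::
  "('x, 'd, 'q, 'b, 's) qdas \<Rightarrow> ('x, 'd, 'q, 'b, 's) config \<Rightarrow>
   ('x, 'd, 'q, 'b, 's) config \<Rightarrow> bool"
  for A where
  step_guard:
    "\<lbrakk> v \<in> tasks G; unblocked G v; (state G v, Guard g, s') \<in> transitions A (block G v);
       \<forall>a \<in> set g. sat_atom \<nu> a \<rbrakk>
     \<Longrightarrow> step A (G, \<nu>) (set_state v s' G, \<nu>)"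
| step_assign:
    "\<lbrakk> v \<in> tasks G; unblocked G v; (state G v, Assign x d, s') \<in> transitions A (block G v) \<rbrakk>
     \<Longrightarrow> step A (G, \<nu>) (set_state v s' G, \<nu>(x := d))"
| step_dispatch_a:
    "\<lbrakk> v \<in> tasks G; unblocked G v; (state G v, Dispatch_a q b, s') \<in> transitions A (block G v);
       w \<notin> vertices G \<rbrakk>
     \<Longrightarrow> step A (G, \<nu>) (add_call A w q b (set_state v s' G), \<nu>)"
| step_dispatch_s:
    "\<lbrakk> v \<in> tasks G; unblocked G v; (state G v, Dispatch_s q b, s') \<in> transitions A (block G v);
       w \<notin> vertices G \<rbrakk>
     \<Longrightarrow> step A (G, \<nu>) (add_wait v w (add_call A w q b (set_state v s' G)), \<nu>)"
| step_terminate: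
    "\<lbrakk> v \<in> tasks G; unblocked G v; state G v = final_state A (block G v) \<rbrakk>
     \<Longrightarrow> step A (G, \<nu>) (remove_task v G, \<nu>)"
| step_dequeue_concurrent:
    "\<lbrakk> q \<in> cqid A; fifo G q \<noteq> [] \<rbrakk> \<Longrightarrow> step A (G, \<nu>) (dequeue q G, \<nu>)"
| step_dequeue_serial:
    "\<lbrakk> q \<in> sqid A; fifo G q \<noteq> []; \<forall>u \<in> tasks G. queue G u \<noteq> Some q \<rbrakk>
     \<Longrightarrow> step A (G, \<nu>) (dequeue q G, \<nu>)"

definition reachable ::
  "('x, 'd, 'q, 'b, 's) qdas \<Rightarrow> ('x, 'd, 'q, 'b, 's) config \<Rightarrow> bool" where
  "reachable A C \<longleftrightarrow> (step A)\<^sup>*\<^sup>* (init_config A) C"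

definition parikh_coverable :: "('x, 'd, 'q, 'b, 's) qdas \<Rightarrow> ('s \<Rightarrow> nat) \<Rightarrow> bool" where
  "parikh_coverable A f \<longleftrightarrow>
     (\<exists>G \<nu>. reachable A (G, \<nu>) \<and> (\<forall>s \<in> all_states A. f s \<le> parikh G s))"


section \<open>Problem instances as bit strings\<close>

text \<open>
  Identifiers of all kinds are natural numbers. An instance is written as a nested list of
  numbers; numbers (including the values of \<open>f\<close>) are in binary, least significant digit first.
  Each of the four characters (digits 0 and 1, opening and closing bracket) takes two bits.
\<close>

datatype code = N nat | L "code list"

fun binary :: "nat \<Rightarrow> bool list" where
  "binary n = (if n < 2 then [odd n] else odd n # binary (n div 2))"

declare binary.simps [simp del]

fun bits :: "code \<Rightarrow> bool list" where
  "bits (N n) = [False, False] @ concat (map (\<lambda>b. [True, b]) (binary n)) @ [False, True]"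
| "bits (L cs) = [False, False] @ concat (map bits cs) @ [False, True]"

fun code_atom :: "(nat, nat) atom \<Rightarrow> code" where
  "code_atom (Eq x d) = L [N 0, N x, N d]"
| "code_atom (Neq x d) = L [N 1, N x, N d]"

fun code_action :: "(nat, nat, nat, nat) action \<Rightarrow> code" where
  "code_action (Dispatch_a q b) = L [N 0, N q, N b]"
| "code_action (Dispatch_s q b) = L [N 1, N q, N b]"
| "code_action (Guard g) = L [N 2, L (map code_atom g)]"
| "code_action (Assign x d) = L [N 3, N x, N d]"

fun code_transition :: "nat \<times> (nat, nat, nat, nat) action \<times> nat \<Rightarrow> code" where
  "code_transition (s, a, s') = L [N s, code_action a, N s']"

text \<open>An instance has one code for each way of listing its finite sets.\<close>

definition lists_set :: "'a list \<Rightarrow> 'a set \<Rightarrow> bool" where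
  "lists_set xs X \<longleftrightarrow> distinct xs \<and> set xs = X"

type_synonym nat_qdas = "(nat, nat, nat, nat, nat) qdas"

definition codes_block :: "nat_qdas \<Rightarrow> (nat \<Rightarrow> nat) \<Rightarrow> nat \<Rightarrow> code set" where
  "codes_block A f b =
     {L [N b, L (map (\<lambda>s. L [N s, N (f s)]) ss), N (init_state A b), N (final_state A b),
         L (map code_transition ts)] | ss ts.
      lists_set ss (states A b) \<and> lists_set ts (transitions A b)}"

definition codes_instance :: "nat_qdas \<Rightarrow> (nat \<Rightarrow> nat) \<Rightarrow> code set" where
  "codes_instance A f =
     {L [L (map N ds), N (init_data A), L (map N xs), L (map N cs), L (map N ss),
         N (main_block A), L ls] | ds xs cs ss bs ls.
      lists_set ds (data A) \<and> lists_set xs (variables A) \<and>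
      lists_set cs (cqid A) \<and> lists_set ss (sqid A) \<and> lists_set bs (blocks A) \<and>
      list_all2 (\<lambda>l b. l \<in> codes_block A f b) ls bs}"

definition PARIKH_COVERABILITY :: "nat_qdas set \<Rightarrow> bool list set" where
  "PARIKH_COVERABILITY K =
     {bits c | c A f. A \<in> K \<and> wf_qdas A \<and> c \<in> codes_instance A f \<and> parikh_coverable A f}"


section \<open>Deterministic multi-tape Turing machines and PSPACE-completeness\<close>

datatype dir = Left | Stay | Right

text \<open>
  A machine has \<open>ntapes\<close> tapes infinite to the right, tape symbols \<open>{..<nsymbols}\<close> and control
  states \<open>{..<nstates}\<close>. Symbol 0 is the blank, symbol 1 initially marks cell 0 of every tape,
  and symbols 2 and 3 are the bits.
\<close>

record tm =
  ntapes :: nat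
  nsymbols :: nat
  nstates :: nat
  start :: nat
  accept :: nat
  reject :: nat
  delta :: "nat \<Rightarrow> nat list \<Rightarrow> nat \<times> (nat \<times> dir) list"

definition wf_tm :: "tm \<Rightarrow> bool" where
  "wf_tm M \<longleftrightarrow>
     ntapes M \<ge> 1 \<and> nsymbols M \<ge> 4 \<and>
     start M < nstates M \<and> accept M < nstates M \<and> reject M < nstates M \<and>
     accept M \<noteq> reject M \<and>
     (\<forall>p < nstates M. \<forall>rs. length rs = ntapes M \<and> set rs \<subseteq> {..<nsymbols M} \<longrightarrow>
        (case delta M p rs of (p', acts) \<Rightarrow>
           p' < nstates M \<and> length acts = ntapes M \<and> fst ` set acts \<subseteq> {..<nsymbols M}))"

text \<open>A tape is its content together with the head position.\<close>

type_synonym tape = "(nat \<Rightarrow> nat) \<times> nat"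
type_synonym tm_config = "nat \<times> tape list"

text \<open>A left move on cell 0 leaves the head there.\<close>

fun move :: "dir \<Rightarrow> nat \<Rightarrow> nat" where
  "move Left h = h - 1"
| "move Stay h = h"
| "move Right h = h + 1"

fun act :: "tape \<Rightarrow> nat \<times> dir \<Rightarrow> tape" where
  "act (c, h) (a, m) = (c(h := a), move m h)"

definition halted :: "tm \<Rightarrow> tm_config \<Rightarrow> bool" where
  "halted M C \<longleftrightarrow> fst C \<in> {accept M, reject M}"

definition tm_step :: "tm \<Rightarrow> tm_config \<Rightarrow> tm_config" where
  "tm_step M C =
     (if halted M C then C
      else case C of (p, ts) \<Rightarrow>
        (case delta M p (map (\<lambda>(c, h). c h) ts) of (p', acts) \<Rightarrow> (p', map2 act ts acts)))"

definition bit_symbol :: "bool \<Rightarrow> nat" where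
  "bit_symbol b = (if b then 3 else 2)"

definition tape_content :: "bool list \<Rightarrow> nat \<Rightarrow> nat" where
  "tape_content w i =
     (if i = 0 then 1 else if i \<le> length w then bit_symbol (w ! (i - 1)) else 0)"

definition tm_init :: "tm \<Rightarrow> bool list \<Rightarrow> tm_config" where
  "tm_init M w =
     (start M, (tape_content w, 0) # replicate (ntapes M - 1) (tape_content [], 0))"

definition tm_run :: "tm \<Rightarrow> bool list \<Rightarrow> nat \<Rightarrow> tm_config" where
  "tm_run M w t = (tm_step M ^^ t) (tm_init M w)"

definition decides :: "tm \<Rightarrow> bool list set \<Rightarrow> bool" where
  "decides M X \<longleftrightarrow>
     (\<forall>w. \<exists>t. fst (tm_run M w t) = (if w \<in> X then accept M else reject M))"

definition runs_in_space :: "tm \<Rightarrow> (nat \<Rightarrow> nat) \<Rightarrow> bool" where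
  "runs_in_space M S \<longleftrightarrow>
     (\<forall>w t. \<forall>(c, h) \<in> set (snd (tm_run M w t)). h \<le> S (length w))"

text \<open>
  The input tape counts towards the space; for polynomial bounds this makes no difference.
\<close>

definition PSPACE :: "bool list set set" where
  "PSPACE = {X. \<exists>M (p :: nat poly). wf_tm M \<and> decides M X \<and> runs_in_space M (poly p)}"

text \<open>The output is the bit string on the last tape, up to the first blank after the marker.\<close>

definition outputs :: "tm_config \<Rightarrow> bool list \<Rightarrow> bool" where
  "outputs C y \<longleftrightarrow>
     (\<forall>i \<in> {1..length y + 1}. fst (last (snd C)) i = tape_content y i)"

definition computes_in_time :: "tm \<Rightarrow> (bool list \<Rightarrow> bool list) \<Rightarrow> (nat \<Rightarrow> nat) \<Rightarrow> bool" where
  "computes_in_time M g T \<longleftrightarrow>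
     (\<forall>w. \<exists>t \<le> T (length w). fst (tm_run M w t) = accept M \<and> outputs (tm_run M w t) (g w))"

definition polytime_computable :: "(bool list \<Rightarrow> bool list) \<Rightarrow> bool" where
  "polytime_computable g \<longleftrightarrow>
     (\<exists>M (p :: nat poly). wf_tm M \<and> computes_in_time M g (poly p))"

definition polytime_reducible :: "bool list set \<Rightarrow> bool list set \<Rightarrow> bool" where
  "polytime_reducible X Y \<longleftrightarrow>
     (\<exists>g. polytime_computable g \<and> (\<forall>w. w \<in> X \<longleftrightarrow> g w \<in> Y))"

definition PSPACE_hard :: "bool list set \<Rightarrow> bool" where
  "PSPACE_hard Y \<longleftrightarrow> (\<forall>X \<in> PSPACE. polytime_reducible X Y)"

definition PSPACE_complete :: "bool list set \<Rightarrow> bool" where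
  "PSPACE_complete Y \<longleftrightarrow> Y \<in> PSPACE \<and> PSPACE_hard Y"

end

(* Membership: in a serial synchronous system every vertex lies on one chain of wait edges and a
   serial queue runs at most one task, so a configuration is a stack of at most |SQID| + 2 frames
   with a valuation, which is of polynomial size. Reachability in the exponentially large graph of
   configurations is decided as in Savitch's theorem, with the recursion written as a prefix of
   quantified bits that is explored depth first. Polynomial-time computability is obtained from a
   language of stacks of bits, compiled to Turing machines, in which functions on binary trees and
   then on encoded types are closed under composition and bounded iteration.

   Hardness: a machine with polynomial space is simulated by the block main alone, without any
   dispatch. Variables hold the tape cells and the head positions, the state holds the control state
   and the symbols read so far; the function f asks for one vertex in the accepting state. *)

theory Submission
  imports Defs
begin

section \<open>A stack language and its compilation to Turing machines\<close>

text \<open>Machines are never programmed directly: the compiled machine follows the step semantics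
  of the stack language one step at a time, so that time bounds and space bounds both carry over.
  Polynomial time is closed under composition because an output is at most as long as the input plus
  the running time. It is not closed under iteration, since sizes may double in every round; a loop
  therefore needs a polynomial bound on all its iterates besides one on the number of rounds. The
  loop of the decision procedure may have exponentially many rounds and is run under the size bound
  alone. Reachability is asked between the strings of ones and of zeros of one length. A code starts
  with \<open>False\<close> and ends with \<open>True\<close>: padding by leading ones can be
  removed, the string of ones is free to denote the initial configuration, and the string of zeros
  is free to be the target. In the reduction all variables start with the same value, so the input
  word cannot be part of the initial valuation. The transitions that read an untouched cell supply
  its input symbol instead.\<close>

datatype cmd =
    Skip
  | Push nat bool
  | Put nat bool
  | Case nat cmd cmd cmd
  | Seq cmd cmd (infixr ";;" 60)
  | While nat cmd

type_synonym store = "nat \<Rightarrow> bool list"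

text \<open>
  \<open>Case\<close> pops the top symbol and branches on it. A push takes two machine steps, moving and then
  writing; \<open>Put\<close> is the intermediate state and does not occur in programs.
\<close>

fun sstep :: "cmd list \<times> store \<Rightarrow> cmd list \<times> store" where
  "sstep ([], \<sigma>) = ([], \<sigma>)"
| "sstep (Skip # ks, \<sigma>) = (ks, \<sigma>)"
| "sstep (Push r b # ks, \<sigma>) = (Put r b # ks, \<sigma>)"
| "sstep (Put r b # ks, \<sigma>) = (ks, \<sigma>(r := b # \<sigma> r))"
| "sstep (Case r c d e # ks, \<sigma>) =
     (case \<sigma> r of [] \<Rightarrow> (c # ks, \<sigma>) | b # l \<Rightarrow> ((if b then e else d) # ks, \<sigma>(r := l)))"
| "sstep ((c ;; d) # ks, \<sigma>) = (c # d # ks, \<sigma>)"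
| "sstep (While r c # ks, \<sigma>) = (if \<sigma> r = [] then (ks, \<sigma>) else (c # While r c # ks, \<sigma>))"

inductive runs :: "cmd \<Rightarrow> store \<Rightarrow> nat \<Rightarrow> store \<Rightarrow> bool" where
  runs_Skip: "runs Skip \<sigma> 1 \<sigma>"
| runs_Push: "runs (Push r b) \<sigma> 2 (\<sigma>(r := b # \<sigma> r))"
| runs_Case_Nil: "\<sigma> r = [] \<Longrightarrow> runs c \<sigma> n \<sigma>' \<Longrightarrow> runs (Case r c d e) \<sigma> (Suc n) \<sigma>'"
| runs_Case_Cons: "\<sigma> r = b # l \<Longrightarrow> runs (if b then e else d) (\<sigma>(r := l)) n \<sigma>' \<Longrightarrow>
    runs (Case r c d e) \<sigma> (Suc n) \<sigma>'"
| runs_Seq: "runs c \<sigma> n \<sigma>' \<Longrightarrow> runs d \<sigma>' m \<sigma>'' \<Longrightarrow> runs (c ;; d) \<sigma> (Suc (n + m)) \<sigma>''"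
| runs_While_Nil: "\<sigma> r = [] \<Longrightarrow> runs (While r c) \<sigma> 1 \<sigma>"
| runs_While_Cons: "\<sigma> r \<noteq> [] \<Longrightarrow> runs c \<sigma> n \<sigma>' \<Longrightarrow> runs (While r c) \<sigma>' m \<sigma>'' \<Longrightarrow>
    runs (While r c) \<sigma> (Suc (n + m)) \<sigma>''"

lemma funpow_add_apply: "(f ^^ (n + m)) x = (f ^^ m) ((f ^^ n) x)"
  by (metis add.commute comp_apply funpow_add)

text \<open>The continuation \<open>ks\<close> below \<open>c\<close> is arbitrary and untouched, so
  in the cases of \<open>;;\<close> and \<open>While\<close> the runs of the parts can be chained.
  The step counts of the two semantics agree exactly.\<close>

lemma runs_sstep: "runs c \<sigma> n \<sigma>' \<Longrightarrow> (sstep ^^ n) (c # ks, \<sigma>) = (ks, \<sigma>')"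
proof (induction arbitrary: ks rule: runs.induct)
  case (runs_Push r b \<sigma>)
  show ?case by (simp add: numeral_2_eq_2 fun_upd_def)
qed (simp_all add: funpow_swap1 funpow_add_apply del: funpow.simps(2) add: funpow_Suc_right)

fun regs_below :: "nat \<Rightarrow> cmd \<Rightarrow> bool" where
  "regs_below K Skip \<longleftrightarrow> True"
| "regs_below K (Push r b) \<longleftrightarrow> r < K"
| "regs_below K (Put r b) \<longleftrightarrow> False"
| "regs_below K (Case r c d e) \<longleftrightarrow> r < K \<and> regs_below K c \<and> regs_below K d \<and> regs_below K e"
| "regs_below K (c ;; d) \<longleftrightarrow> regs_below K c \<and> regs_below K d"
| "regs_below K (While r c) \<longleftrightarrow> r < K \<and> regs_below K c"

text \<open>A program that mentions only stacks below \<open>K\<close> neither reads nor writes the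
  others. A program verified on an otherwise empty store can therefore be reused, with the same step
  count, while data are kept on stacks from \<open>K\<close> on.\<close>

lemma runs_frame:
  assumes "runs c \<sigma> n \<sigma>'" "regs_below K c" "\<And>r. r < K \<Longrightarrow> \<tau> r = \<sigma> r"
  shows "runs c \<tau> n (\<lambda>r. if r < K then \<sigma>' r else \<tau> r)"
  using assms
proof (induction arbitrary: \<tau> rule: runs.induct)
  case (runs_Skip \<sigma>)
  then have "(\<lambda>r. if r < K then \<sigma> r else \<tau> r) = \<tau>" by auto
  then show ?case using runs.runs_Skip[of \<tau>] by simp
next
  case (runs_Push r b \<sigma>)
  then have "(\<lambda>x. if x < K then (\<sigma>(r := b # \<sigma> r)) x else \<tau> x) = \<tau>(r := b # \<tau> r)" by auto
  then show ?case using runs.runs_Push[of r b \<tau>] by simp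
next
  case (runs_Case_Nil \<sigma> r c n \<sigma>' d e)
  then show ?case by (auto intro!: runs.runs_Case_Nil)
next
  case (runs_Case_Cons \<sigma> r b l e d n \<sigma>' c)
  have "regs_below K (if b then e else d)" using runs_Case_Cons.prems by auto
  moreover have "(\<lambda>x. if x < K then \<sigma>' x else (\<tau>(r := l)) x) = (\<lambda>x. if x < K then \<sigma>' x else \<tau> x)"
    using runs_Case_Cons.prems by auto
  moreover have "(\<tau>(r := l)) x = (\<sigma>(r := l)) x" if "x < K" for x
    using that runs_Case_Cons.prems by simp
  ultimately have "runs (if b then e else d) (\<tau>(r := l)) n (\<lambda>x. if x < K then \<sigma>' x else \<tau> x)"
    using runs_Case_Cons.IH[of "\<tau>(r := l)"] by metis
  moreover have "\<tau> r = b # l" using runs_Case_Cons by auto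
  ultimately show ?case by (rule runs.runs_Case_Cons[rotated])
next
  case (runs_Seq c \<sigma> n \<sigma>' d m \<sigma>'')
  let ?\<tau> = "\<lambda>r. if r < K then \<sigma>' r else \<tau> r"
  have "runs c \<tau> n ?\<tau>" using runs_Seq by auto
  moreover have "runs d ?\<tau> m (\<lambda>r. if r < K then \<sigma>'' r else ?\<tau> r)" using runs_Seq by auto
  moreover have "(\<lambda>r. if r < K then \<sigma>'' r else ?\<tau> r) = (\<lambda>r. if r < K then \<sigma>'' r else \<tau> r)" by auto
  ultimately show ?case by (metis runs.runs_Seq)
next
  case (runs_While_Nil \<sigma> r c)
  then have "(\<lambda>r. if r < K then \<sigma> r else \<tau> r) = \<tau>" by auto
  then show ?case using runs.runs_While_Nil[of \<tau> r c] runs_While_Nil by auto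
next
  case (runs_While_Cons \<sigma> r c n \<sigma>' m \<sigma>'')
  let ?\<tau> = "\<lambda>r. if r < K then \<sigma>' r else \<tau> r"
  have "runs c \<tau> n ?\<tau>" using runs_While_Cons by auto
  moreover have "runs (While r c) ?\<tau> m (\<lambda>r. if r < K then \<sigma>'' r else ?\<tau> r)"
    using runs_While_Cons by auto
  moreover have "(\<lambda>r. if r < K then \<sigma>'' r else ?\<tau> r) = (\<lambda>r. if r < K then \<sigma>'' r else \<tau> r)" by auto
  moreover have "\<tau> r \<noteq> []" using runs_While_Cons by auto
  ultimately show ?case by (metis runs.runs_While_Cons)
qed

section \<open>Control states, tapes and single steps of the compiled machine\<close>

datatype mstate = Load | Run "cmd list" | Acc | Rej

text \<open>The default 0 matters in two states: for \<open>Load\<close> it is the input tape, and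
  for \<open>Run []\<close> it is the stack whose top symbol decides between acceptance and
  rejection.\<close>

fun active :: "mstate \<Rightarrow> nat" where
  "active (Run (Push r b # ks)) = r"
| "active (Run (Put r b # ks)) = r"
| "active (Run (Case r c d e # ks)) = r"
| "active (Run (While r c # ks)) = r"
| "active _ = 0"

text \<open>\<open>Load\<close> moves to the last input bit, so the program starts with the reversed input on stack 0.\<close>

fun mtrans :: "cmd \<Rightarrow> mstate \<Rightarrow> nat \<Rightarrow> mstate \<times> nat \<times> dir" where
  "mtrans p Load a = (if a = 0 then (Run [p], 0, Left) else (Load, a, Right))"
| "mtrans p (Run []) a = (if a = 3 then Acc else Rej, a, Stay)"
| "mtrans p (Run (Skip # ks)) a = (Run ks, a, Stay)"
| "mtrans p (Run (Push r b # ks)) a = (Run (Put r b # ks), a, Right)"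
| "mtrans p (Run (Put r b # ks)) a = (Run ks, bit_symbol b, Stay)"
| "mtrans p (Run (Case r c d e # ks)) a =
     (if a = 1 then (Run (c # ks), a, Stay) else (Run ((if a = 3 then e else d) # ks), 0, Left))"
| "mtrans p (Run ((c ;; d) # ks)) a = (Run (c # d # ks), a, Stay)"
| "mtrans p (Run (While r c # ks)) a = (if a = 1 then (Run ks, a, Stay) else (Run (c # While r c # ks), a, Stay))"
| "mtrans p s a = (s, a, Stay)"

text \<open>The continuation lists that can occur while \<open>c\<close> runs on top of
  \<open>ks\<close>. They are finitely many because the body of a loop always returns to the same
  list \<open>While r c # ks\<close>; this makes the control of the machine finite.\<close>

fun conts :: "cmd \<Rightarrow> cmd list \<Rightarrow> cmd list set" where
  "conts Skip ks = {Skip # ks}"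
| "conts (Push r b) ks = {Push r b # ks, Put r b # ks}"
| "conts (Put r b) ks = {Put r b # ks}"
| "conts (Case r c d e) ks = {Case r c d e # ks} \<union> conts c ks \<union> conts d ks \<union> conts e ks"
| "conts (c ;; d) ks = {(c ;; d) # ks} \<union> conts c (d # ks) \<union> conts d ks"
| "conts (While r c) ks = {While r c # ks} \<union> conts c (While r c # ks)"

definition mstates :: "cmd \<Rightarrow> mstate set" where
  "mstates p = {Load, Acc, Rej, Run []} \<union> Run ` conts p []"

lemma finite_mstates: "finite (mstates p)"
proof -
  have "finite (conts c ks)" for c ks by (induction c ks rule: conts.induct) auto
  then show ?thesis by (simp add: mstates_def)
qed

lemma conts_self: "c # ks \<in> conts c ks"
  by (cases c) auto

text \<open>The last step of \<open>c\<close> uncovers \<open>ks\<close>, which is why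
  \<open>ks\<close> is added. In the induction that \<open>ks\<close> is a list of the enclosing
  command, for a loop the loop itself.\<close>

lemma conts_mtrans:
  "l \<in> conts c ks \<Longrightarrow> fst (mtrans p (Run l) a) \<in> Run ` (insert ks (conts c ks))"
proof (induction c ks arbitrary: l rule: conts.induct)
  case (4 r c d e ks)
  from 4(4) consider "l = Case r c d e # ks" | "l \<in> conts c ks" | "l \<in> conts d ks" | "l \<in> conts e ks"
    by auto
  then show ?case
  proof cases
    case 1 then show ?thesis using conts_self by auto
  next
    case 2 with 4(1)[OF 2] show ?thesis by auto
  next
    case 3 with 4(2)[OF 3] show ?thesis by auto
  next
    case prems: 4 with 4(3)[OF prems] show ?thesis by auto
  qed
next
  case (5 c d ks)
  from 5(3) consider "l = (c ;; d) # ks" | "l \<in> conts c (d # ks)" | "l \<in> conts d ks" by auto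
  then show ?case
  proof cases
    case 1 then show ?thesis using conts_self by auto
  next
    case 2 with 5(1)[OF 2] show ?thesis using conts_self[of d ks] by auto
  next
    case 3 with 5(2)[OF 3] show ?thesis by auto
  qed
next
  case (6 r c ks)
  from 6(2) consider "l = While r c # ks" | "l \<in> conts c (While r c # ks)" by auto
  then show ?case
  proof cases
    case 1 then show ?thesis using conts_self by auto
  next
    case 2 with 6(1)[OF 2] show ?thesis by auto
  qed
qed auto

lemma mstates_mtrans: "s \<in> mstates p \<Longrightarrow> fst (mtrans p s a) \<in> mstates p"
proof -
  assume "s \<in> mstates p"
  then consider "s = Load" | "s = Acc" | "s = Rej" | "s = Run []" | l where "s = Run l" "l \<in> conts p []"
    by (auto simp: mstates_def)
  then show ?thesis
  proof cases
    case 1 then show ?thesis using conts_self[of p "[]"] by (auto simp: mstates_def)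
  next
    case 5 then show ?thesis using conts_mtrans[OF 5(2), of p a] by (auto simp: mstates_def)
  qed (auto simp: mstates_def)
qed

text \<open>\<open>regs_below\<close> rejects \<open>Put\<close>, yet \<open>Put\<close> arises from
  a \<open>Push\<close> as the head of a continuation; the head gets a disjunct of its own, and the
  tail consists of program commands.\<close>

lemma conts_regs_below:
  "l \<in> conts c ks \<Longrightarrow> regs_below K c \<Longrightarrow> \<forall>k \<in> set ks. regs_below K k \<Longrightarrow>
   \<exists>a l'. l = a # l' \<and> (regs_below K a \<or> (\<exists>r b. a = Put r b \<and> r < K)) \<and> (\<forall>k \<in> set l'. regs_below K k)"
  by (induction c ks arbitrary: l rule: conts.induct) auto

definition state_index :: "cmd \<Rightarrow> mstate \<Rightarrow> nat" where
  "state_index p = (SOME h. bij_betw h (mstates p) {0..<card (mstates p)})"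

lemma state_index: "bij_betw (state_index p) (mstates p) {0..<card (mstates p)}"
  unfolding state_index_def by (rule someI_ex[OF ex_bij_betw_finite_nat[OF finite_mstates]])

definition machine :: "cmd \<Rightarrow> nat \<Rightarrow> tm" where
  "machine p K = \<lparr>ntapes = K, nsymbols = 4, nstates = card (mstates p),
     start = state_index p Load, accept = state_index p Acc, reject = state_index p Rej,
     delta = (\<lambda>n rs. let s = inv_into (mstates p) (state_index p) n;
                         (s', a, m) = mtrans p s (rs ! active s)
       in (state_index p s', map (\<lambda>i. if i = active s then (a, m) else (rs ! i, Stay)) [0..<K]))\<rparr>"

lemma inv_state_index: "s \<in> mstates p \<Longrightarrow> inv_into (mstates p) (state_index p) (state_index p s) = s"
  using state_index[of p] by (simp add: bij_betw_def)

lemma state_index_less: "s \<in> mstates p \<Longrightarrow> state_index p s < card (mstates p)"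
  using state_index[of p] by (auto simp: bij_betw_def)

lemma state_index_eq: "s \<in> mstates p \<Longrightarrow> s' \<in> mstates p \<Longrightarrow> state_index p s = state_index p s' \<longleftrightarrow> s = s'"
  using inv_state_index by metis

lemma special_mstates: "Load \<in> mstates p" "Acc \<in> mstates p" "Rej \<in> mstates p" "Run [] \<in> mstates p"
    "Run [p] \<in> mstates p"
  using conts_self[of p "[]"] by (auto simp: mstates_def)

lemma mtrans_symbol: "a < 4 \<Longrightarrow> mtrans p s a = (s', a', m) \<Longrightarrow> a' < 4"
  by (induction p s a rule: mtrans.induct) (auto split: if_splits simp: bit_symbol_def)

lemma active_less:
  assumes "s \<in> mstates p" "regs_below K p" "0 < K"
  shows "active s < K"
proof -
  from assms(1) consider "s \<in> {Load, Acc, Rej, Run []}" | l where "s = Run l" "l \<in> conts p []"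
    by (auto simp: mstates_def)
  then show ?thesis
  proof cases
    case 2
    then obtain a l' where "l = a # l'" "regs_below K a \<or> (\<exists>r b. a = Put r b \<and> r < K)"
      using conts_regs_below[OF 2(2) assms(2)] by auto
    then show ?thesis using 2 assms by (cases a) auto
  qed (use assms in auto)
qed

lemma wf_machine:
  assumes "regs_below K p" "0 < K"
  shows "wf_tm (machine p K)"
  unfolding wf_tm_def
proof (intro conjI allI impI)
  fix n rs assume n: "n < nstates (machine p K)"
    and rs: "length rs = ntapes (machine p K) \<and> set rs \<subseteq> {..<nsymbols (machine p K)}"
  let ?s = "inv_into (mstates p) (state_index p) n"
  have s: "?s \<in> mstates p"
    using n state_index[of p] by (intro inv_into_into) (auto simp: machine_def bij_betw_def)
  obtain s' a m where t: "mtrans p ?s (rs ! active ?s) = (s', a, m)" by (metis prod_cases3)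
  have sym: "rs ! i < 4" if "i < K" for i
    using rs that nth_mem[of i rs] by (force simp: machine_def)
  have "s' \<in> mstates p" using mstates_mtrans[OF s] t by (metis fst_conv)
  moreover have "a < 4" using mtrans_symbol[OF _ t] sym active_less[OF s assms] by blast
  ultimately show "case delta (machine p K) n rs of (p', acts) \<Rightarrow>
     p' < nstates (machine p K) \<and> length acts = ntapes (machine p K) \<and>
     fst ` set acts \<subseteq> {..<nsymbols (machine p K)}"
    using t sym state_index_less by (auto simp: machine_def Let_def split: if_splits)
next
  show "accept (machine p K) \<noteq> reject (machine p K)"
    using special_mstates by (simp add: machine_def state_index_eq)
qed (use assms special_mstates in \<open>simp_all add: machine_def state_index_less\<close>)

text \<open>Stack \<open>i\<close> is kept on tape \<open>i\<close> with the head on its top symbol, or on the marker if it is empty.\<close>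

definition lift_head :: "cmd list \<Rightarrow> nat \<Rightarrow> nat" where
  "lift_head ks i = (case ks of Put r b # _ \<Rightarrow> if i = r then 1 else 0 | _ \<Rightarrow> 0)"

lemma lift_head_simps [simp]:
  "lift_head [] i = 0" "lift_head (Skip # l) i = 0" "lift_head (Push r b # l) i = 0"
  "lift_head (Put r b # l) i = (if i = r then 1 else 0)" "lift_head (Case r c d e # l) i = 0"
  "lift_head ((c ;; d) # l) i = 0" "lift_head (While r c # l) i = 0"
  by (simp_all add: lift_head_def)

fun rep :: "cmd \<Rightarrow> nat \<Rightarrow> cmd list \<times> store \<Rightarrow> tm_config" where
  "rep p K (ks, \<sigma>) = (state_index p (Run ks),
     map (\<lambda>i. (tape_content (rev (\<sigma> i)), length (\<sigma> i) + lift_head ks i)) [0..<K])"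

lemma tape_content_top: "tape_content (rev l) (length l) = (case l of [] \<Rightarrow> 1 | b # _ \<Rightarrow> bit_symbol b)"
  by (auto simp: tape_content_def nth_append split: list.split)

lemma tape_content_snoc: "tape_content (rev l @ [b]) (Suc (length l)) = bit_symbol b"
  by (simp add: tape_content_def nth_append)

lemma tape_content_push: "(tape_content (rev l))(Suc (length l) := bit_symbol b) = tape_content (rev l @ [b])"
  by (auto simp: tape_content_def nth_append fun_eq_iff)

lemma tape_content_pop: "(tape_content (rev l @ [b]))(Suc (length l) := 0) = tape_content (rev l)"
  by (auto simp: tape_content_def nth_append fun_eq_iff)

lemma machine_step:
  assumes s: "s \<in> mstates p" "s \<noteq> Acc" "s \<noteq> Rej" and K: "regs_below K p" "0 < K"
    and len: "length ts = K"
    and t: "mtrans p s (fst (ts ! active s) (snd (ts ! active s))) = (s', a, m)"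
  shows "tm_step (machine p K) (state_index p s, ts) = (state_index p s', ts[active s := act (ts ! active s) (a, m)])"
proof -
  have nh: "\<not> halted (machine p K) (state_index p s, ts)"
    using s special_mstates by (simp add: halted_def machine_def state_index_eq)
  have r: "active s < K" using active_less[OF s(1) K] .
  have read: "map (\<lambda>(c, h). c h) ts ! active s = fst (ts ! active s) (snd (ts ! active s))"
    using r len by (simp add: case_prod_beta)
  have "map2 act ts (map (\<lambda>i. if i = active s then (a, m) else (map (\<lambda>(c, h). c h) ts ! i, Stay)) [0..<K])
    = ts[active s := act (ts ! active s) (a, m)]"
  proof (rule nth_equalityI)
    fix i assume "i < length (map2 act ts (map (\<lambda>i. if i = active s then (a, m) else (map (\<lambda>(c, h). c h) ts ! i, Stay)) [0..<K]))"
    then show "map2 act ts (map (\<lambda>i. if i = active s then (a, m) else (map (\<lambda>(c, h). c h) ts ! i, Stay)) [0..<K]) ! i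
      = ts[active s := act (ts ! active s) (a, m)] ! i"
      using len by (cases "ts ! i") (auto simp: nth_list_update)
  qed (use len in simp)
  moreover have "delta (machine p K) (state_index p s) (map (\<lambda>(c, h). c h) ts) =
    (state_index p s', map (\<lambda>i. if i = active s then (a, m) else (map (\<lambda>(c, h). c h) ts ! i, Stay)) [0..<K])"
    by (simp add: machine_def inv_state_index[OF s(1)] read t Let_def)
  ultimately show ?thesis using nh by (simp add: tm_step_def)
qed

text \<open>A pop erases the cell that it leaves, so every cell above the top of a stack is blank
  and the stack alone determines the content of its tape. Hence one interpreter step is exactly one
  machine step.\<close>

lemma tm_step_rep:
  assumes ks: "ks \<in> conts p []" "ks \<noteq> []" and K: "regs_below K p" "0 < K"
  shows "tm_step (machine p K) (rep p K (ks, \<sigma>)) = rep p K (sstep (ks, \<sigma>))"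
proof -
  let ?ts = "map (\<lambda>i. (tape_content (rev (\<sigma> i)), length (\<sigma> i) + lift_head ks i)) [0..<K]"
  let ?s = "Run ks"
  have s: "?s \<in> mstates p" using ks by (auto simp: mstates_def)
  have r: "active ?s < K" using active_less[OF s K] .
  obtain s' a m where t: "mtrans p ?s (fst (?ts ! active ?s) (snd (?ts ! active ?s))) = (s', a, m)"
    using prod_cases3 by blast
  have "tm_step (machine p K) (rep p K (ks, \<sigma>)) = (state_index p s', ?ts[active ?s := act (?ts ! active ?s) (a, m)])"
    unfolding rep.simps by (rule machine_step[OF s _ _ K _ t]) simp_all
  also have "\<dots> = rep p K (sstep (ks, \<sigma>))"
  proof -
    obtain c l where l: "ks = c # l" "regs_below K c \<or> (\<exists>r b. c = Put r b \<and> r < K)" "\<forall>k \<in> set l. regs_below K k"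
      using conts_regs_below[OF ks(1) K(1)] by auto
    \<comment> \<open>Program commands are never \<open>Put\<close>, so a head stands above the top
      of its stack only directly after a \<open>Push\<close>.\<close>
    have lift0: "lift_head (k # ks') i = 0" if "regs_below K k" for k ks' i
      using that by (cases k) (auto simp: lift_head_def)
    have liftl: "lift_head l i = 0" for i
      using l(3) lift0 by (cases l) (auto simp: lift_head_def)
    have keep: "(tape_content (rev x @ [b]))(Suc (length x) := bit_symbol b) = tape_content (rev x @ [b])" for x b
      using tape_content_snoc by (metis fun_upd_triv)
    have bit: "bit_symbol b \<noteq> Suc 0" for b by (simp add: bit_symbol_def)
    have t': "mtrans p ?s (tape_content (rev (\<sigma> (active ?s))) (length (\<sigma> (active ?s)) + lift_head ks (active ?s))) = (s', a, m)"
      using t r by simp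
    have blank: "tape_content [] 0 = 1" by (simp add: tape_content_def)
    note t = t'
    have upd: "(map g [0..<K])[r := y] = map (g(r := y)) [0..<K]" if "r < K" for g :: "nat \<Rightarrow> tape" and r y
      using that by (intro nth_equalityI) (auto simp: nth_list_update)
    show ?thesis
    proof (cases c)
      case Skip
      then show ?thesis using t r l liftl lift0 K by (auto simp: upd)
    next
      case (Push r b)
      then show ?thesis using t r l liftl lift0 K
        by (auto simp: upd lift_head_def)
    next
      case (Put r b)
      then have "(?ts[active ?s := act (?ts ! active ?s) (a, m)]) = map (\<lambda>i. (tape_content (rev ((\<sigma>(r := b # \<sigma> r)) i)), length ((\<sigma>(r := b # \<sigma> r)) i))) [0..<K]"
        using t r l by (auto simp: upd lift_head_def tape_content_push)
      then show ?thesis using t r l liftl lift0 K Put by simp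
    next
      case (Case r c1 c2 c3)
      show ?thesis
      proof (cases "\<sigma> r")
        case Nil
        then show ?thesis using t r l Case lift0 blank by (auto simp: upd tape_content_top)
      next
        case (Cons b x)
        then show ?thesis using t r l Case lift0 blank
          by (cases b) (auto simp: upd tape_content_top tape_content_pop tape_content_snoc bit_symbol_def)
      qed
    next
      case (Seq c1 c2)
      then show ?thesis using t r l liftl lift0 K by (auto simp: upd)
    next
      case (While r c1)
      show ?thesis using t r l liftl lift0 While blank
        by (cases "\<sigma> r") (auto simp: upd tape_content_top tape_content_snoc keep bit)
    qed
  qed
  finally show ?thesis .
qed


section \<open>Complete runs of the compiled machine\<close>

definition input_store :: "bool list \<Rightarrow> store" where
  "input_store w = (\<lambda>_. [])(0 := rev w)"

lemma sstep_conts: "ks \<in> insert [] (conts p []) \<Longrightarrow> fst (sstep (ks, \<sigma>)) \<in> insert [] (conts p [])"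
proof (cases ks)
  case (Cons c l)
  assume "ks \<in> insert [] (conts p [])"
  then have ks: "ks \<in> conts p []" using Cons by simp
  \<comment> \<open>A symbol on which the control of the machine moves as the interpreter does; for
    \<open>While\<close> any symbol other than the marker will do on a non-empty stack. Closure of
    the control states then carries over to \<open>sstep\<close>.\<close>
  let ?a = "case c of Case r _ _ _ \<Rightarrow> (case \<sigma> r of [] \<Rightarrow> 1 | b # _ \<Rightarrow> bit_symbol b)
     | While r _ \<Rightarrow> if \<sigma> r = [] then 1 else 2 | _ \<Rightarrow> 0"
  have "Run (fst (sstep (ks, \<sigma>))) = fst (mtrans p (Run ks) ?a)"
    using Cons by (cases c) (auto simp: bit_symbol_def split: list.split)
  with conts_mtrans[OF ks, of p ?a] show ?thesis by auto
qed simp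

lemma sstep_iter_conts: "fst ((sstep ^^ n) ([p], \<sigma>)) \<in> insert [] (conts p [])"
proof (induction n)
  case 0 show ?case using conts_self[of p "[]"] by simp
next
  case (Suc n) then show ?case using sstep_conts by (metis funpow.simps(2) o_apply prod.collapse)
qed

lemma sstep_iter_stuck: "(sstep ^^ n) ([], \<sigma>) = ([], \<sigma>)"
  by (induction n) auto

context
  fixes p K
  assumes K: "regs_below K p" "0 < K"
begin

lemma tm_run_Suc: "tm_run M w (Suc t) = tm_step M (tm_run M w t)"
  by (simp add: tm_run_def)

lemma tm_run_load:
  "t \<le> length w + 1 \<Longrightarrow>
   tm_run (machine p K) w t = (state_index p Load, (tape_content w, t) # replicate (K - 1) (tape_content [], 0))"
proof (induction t)
  case 0 show ?case by (simp add: tm_run_def tm_init_def machine_def)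
next
  case (Suc t)
  have "tape_content w t \<noteq> 0" using Suc.prems by (auto simp: tape_content_def bit_symbol_def)
  then show ?case
    using Suc machine_step[OF special_mstates(1) _ _ K, of "(tape_content w, t) # replicate (K - 1) (tape_content [], 0)"
       "Run [p]"] K machine_step[OF special_mstates(1) _ _ K, of "(tape_content w, t) # replicate (K - 1) (tape_content [], 0)"
       Load "tape_content w t" Right]
    by (simp add: tm_run_Suc)
qed

lemma tm_run_loaded: "tm_run (machine p K) w (length w + 2) = rep p K ([p], input_store w)"
proof -
  let ?ts = "(tape_content w, length w + 1) # replicate (K - 1) (tape_content [], 0)"
  have z: "tape_content w (length w + 1) = 0" by (simp add: tape_content_def)
  have "tm_run (machine p K) w (length w + 2) = tm_step (machine p K) (state_index p Load, ?ts)"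
    using tm_run_load[of "length w + 1" w] by (simp add: tm_run_Suc)
  also have "\<dots> = (state_index p (Run [p]), ?ts[0 := act (?ts ! 0) (0, Left)])"
    using machine_step[OF special_mstates(1) _ _ K, of ?ts "Run [p]" 0 Left] z K by simp
  also have "?ts[0 := act (?ts ! 0) (0, Left)] = (tape_content w, length w) # replicate (K - 1) (tape_content [], 0)"
    using z by (simp add: fun_upd_idem)
  also have "(state_index p (Run [p]), \<dots>) = rep p K ([p], input_store w)"
  proof -
    have "regs_below K p" by (rule K)
    then have "lift_head [p] i = 0" for i by (cases p) auto
    then show ?thesis
      using K by (auto simp: input_store_def nth_Cons' intro!: nth_equalityI)
  qed
  finally show ?thesis .
qed

lemma tm_run_rep:
  assumes "\<And>i. i < n \<Longrightarrow> fst ((sstep ^^ i) ([p], input_store w)) \<noteq> []"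
  shows "tm_run (machine p K) w (length w + 2 + n) = rep p K ((sstep ^^ n) ([p], input_store w))"
  using assms
proof (induction n)
  case 0 show ?case using tm_run_loaded by simp
next
  case (Suc n)
  obtain ks \<sigma> where e: "(sstep ^^ n) ([p], input_store w) = (ks, \<sigma>)" by fastforce
  have "ks \<noteq> []" using Suc.prems[of n] e by simp
  moreover have "ks \<in> insert [] (conts p [])" using sstep_iter_conts[of n p "input_store w"] e by simp
  ultimately show ?case
    using Suc tm_step_rep[OF _ _ K, of ks \<sigma>] e by (simp add: tm_run_Suc)
qed

text \<open>Loading takes \<open>length w + 2\<close> steps and the final decision one more. The
  head may stand one cell above the top of a stack, after a \<open>Push\<close> or when loading
  meets the first blank, which turns the bound \<open>B\<close> on the stacks into
  \<open>B + 1\<close> for the heads; after halting nothing changes.\<close>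

lemma machine_run:
  assumes fin: "(sstep ^^ n) ([p], input_store w) = ([], \<sigma>)"
    and B: "\<And>i r. i \<le> n \<Longrightarrow> length (snd ((sstep ^^ i) ([p], input_store w)) r) \<le> B"
  shows "\<exists>t \<le> length w + 3 + n. tm_run (machine p K) w t =
     ((if \<sigma> 0 \<noteq> [] \<and> hd (\<sigma> 0) then accept (machine p K) else reject (machine p K)), snd (rep p K ([], \<sigma>)))"
    and "(c, h) \<in> set (snd (tm_run (machine p K) w t)) \<Longrightarrow> h \<le> B + 1"
proof -
  let ?C = "\<lambda>i. (sstep ^^ i) ([p], input_store w)"
  \<comment> \<open>\<open>sstep\<close> idles on the empty continuation, so \<open>n\<close> may
    lie beyond the moment \<open>m\<close> at which the program has actually finished.\<close>
  define m where "m = (LEAST i. fst (?C i) = [])"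
  have m: "fst (?C m) = []" unfolding m_def by (rule LeastI[of _ n]) (simp add: fin)
  have mn: "m \<le> n" unfolding m_def by (rule Least_le) (simp add: fin)
  have least: "fst (?C i) \<noteq> []" if "i < m" for i using that not_less_Least unfolding m_def by blast
  have "?C n = (sstep ^^ (n - m)) (?C m)" using mn funpow_add_apply[of m "n - m" sstep] by simp
  then have Cm: "?C m = ([], \<sigma>)" using m fin sstep_iter_stuck by (metis prod.collapse)
  let ?s = "if \<sigma> 0 \<noteq> [] \<and> hd (\<sigma> 0) then Acc else Rej"
  let ?ts = "snd (rep p K ([], \<sigma>))"
  have end1: "tm_run (machine p K) w (length w + 2 + m) = (state_index p (Run []), ?ts)"
    using tm_run_rep[of m w] least Cm by simp
  have end2: "tm_run (machine p K) w (length w + 3 + m) = (state_index p ?s, ?ts)"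
  proof -
    let ?a = "tape_content (rev (\<sigma> 0)) (length (\<sigma> 0))"
    have nth0: "?ts ! 0 = (tape_content (rev (\<sigma> 0)), length (\<sigma> 0))" using K by simp
    have len: "length ?ts = K" by simp
    have "?a = 3 \<longleftrightarrow> \<sigma> 0 \<noteq> [] \<and> hd (\<sigma> 0)"
      unfolding tape_content_top by (simp add: bit_symbol_def split: list.split)
    then have "mtrans p (Run []) ?a = (?s, ?a, Stay)" by simp
    then have "tm_step (machine p K) (state_index p (Run []), ?ts) = (state_index p ?s, ?ts[0 := act (?ts ! 0) (?a, Stay)])"
      using nth0 len machine_step[OF special_mstates(4) _ _ K, of ?ts ?s ?a Stay] by (simp del: rep.simps)
    also have "act (?ts ! 0) (?a, Stay) = ?ts ! 0" unfolding nth0 by simp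
    finally have "tm_step (machine p K) (state_index p (Run []), ?ts) = (state_index p ?s, ?ts)"
      by (metis list_update_id)
    then show ?thesis using end1 by (simp add: numeral_3_eq_3 tm_run_Suc)
  qed
  then show "\<exists>t \<le> length w + 3 + n. tm_run (machine p K) w t =
     ((if \<sigma> 0 \<noteq> [] \<and> hd (\<sigma> 0) then accept (machine p K) else reject (machine p K)), snd (rep p K ([], \<sigma>)))"
    using mn by (intro exI[of _ "length w + 3 + m"]) (auto simp: machine_def)
  have halt: "tm_run (machine p K) w (length w + 3 + m + t) = (state_index p ?s, ?ts)" for t
  proof (induction t)
    case 0 show ?case using end2 by simp
  next
    case (Suc t)
    have "halted (machine p K) (state_index p ?s, ?ts)" by (simp add: halted_def machine_def)
    then show ?case by (simp only: add_Suc_right tm_run_Suc Suc.IH tm_step_def if_True)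
  qed
  have repB: "h \<le> B + 1" if ch: "(c, h) \<in> set (snd (rep p K (?C i)))" and im: "i \<le> m" for i c h
  proof -
    obtain ks \<tau> where e: "?C i = (ks, \<tau>)" by fastforce
    obtain r where "h = length (\<tau> r) + lift_head ks r" using ch unfolding e by auto
    moreover have "lift_head ks r \<le> 1" by (auto simp: lift_head_def split: list.split cmd.split)
    moreover have "length (\<tau> r) \<le> B" using B[of i r] e im mn by simp
    ultimately show ?thesis by simp
  qed
  have B0: "length w \<le> B" using B[of 0 0] by (simp add: input_store_def)
  show "h \<le> B + 1" if ch: "(c, h) \<in> set (snd (tm_run (machine p K) w t))"
  proof -
    consider "t \<le> length w + 1" | i where "t = length w + 2 + i" "i \<le> m" | i where "t = length w + 3 + m + i"
    proof -
      have "t \<le> length w + 1 \<or> (t = length w + 2 + (t - (length w + 2)) \<and> t - (length w + 2) \<le> m) \<or>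
        t = length w + 3 + m + (t - (length w + 3 + m))" by linarith
      then show ?thesis using that by blast
    qed
    then show ?thesis
    proof cases
      case 1 then show ?thesis using ch tm_run_load[OF 1] B0 by auto
    next
      case 2 then show ?thesis using ch tm_run_rep[of i w] least repB[of c h i] by simp
    next
      case 3 then show ?thesis using ch halt[of i] repB[of c h m] Cm by simp
    qed
  qed
qed

end

section \<open>Polynomial-time functions on binary trees\<close>

datatype tree = Tip | Bin tree tree

text \<open>The preorder code with \<open>True\<close> for inner nodes. It is prefix-free, so two
  codes can be put one after the other without a separator.\<close>

fun ser :: "tree \<Rightarrow> bool list" where
  "ser Tip = [False]"
| "ser (Bin a b) = True # ser a @ ser b"

definition tsize :: "tree \<Rightarrow> nat" where
  "tsize t = length (ser t)"

lemma tsize_simps [simp]: "tsize Tip = 1" "tsize (Bin a b) = Suc (tsize a + tsize b)"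
  by (simp_all add: tsize_def)

lemma length_ser [simp]: "length (ser t) = tsize t"
  by (simp add: tsize_def)

lemma tsize_pos: "0 < tsize t"
  by (cases t) auto

lemma ser_append_inj: "ser a @ l = ser b @ m \<Longrightarrow> a = b \<and> l = m"
proof (induction a arbitrary: b l m)
  case Tip then show ?case by (cases b) auto
next
  case (Bin a1 a2)
  obtain b1 b2 where b: "b = Bin b1 b2" using Bin.prems by (cases b) auto
  then have "ser a1 @ (ser a2 @ l) = ser b1 @ (ser b2 @ m)" using Bin.prems by simp
  then have "a1 = b1" "ser a2 @ l = ser b2 @ m" using Bin.IH(1) by blast+
  then show ?case using Bin.IH(2) b by blast
qed

lemma ser_inj: "ser a = ser b \<longleftrightarrow> a = b"
  using ser_append_inj[of a "[]" b "[]"] by auto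

section \<open>Polynomial bounds and timed execution\<close>

lemma nat_poly_mono: "x \<le> y \<Longrightarrow> poly (p :: nat poly) x \<le> poly p y"
  by (induction p) (auto intro!: add_mono mult_mono)

text \<open>The size measure is a parameter because bounds are taken in the size of a tree, in the
  size of an encoded value and in the length of an input word.\<close>

definition pbounded :: "('a \<Rightarrow> nat) \<Rightarrow> ('a \<Rightarrow> nat) \<Rightarrow> bool" where
  "pbounded m g \<longleftrightarrow> (\<exists>p :: nat poly. \<forall>x. g x \<le> poly p (m x))"

lemma pbounded_const: "pbounded m (\<lambda>_. c)"
  unfolding pbounded_def by (rule exI[of _ "[:c:]"]) simp

lemma pbounded_self: "pbounded m m"
  unfolding pbounded_def by (rule exI[of _ "[:0, 1:]"]) simp

lemma pbounded_add: "pbounded m f \<Longrightarrow> pbounded m g \<Longrightarrow> pbounded m (\<lambda>x. f x + g x)"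
  unfolding pbounded_def by (metis add_mono poly_add)

lemma pbounded_Suc: "pbounded m f \<Longrightarrow> pbounded m (\<lambda>x. Suc (f x))"
  using pbounded_add[OF _ pbounded_const, of m f 1] by simp

lemma pbounded_mult: "pbounded m f \<Longrightarrow> pbounded m g \<Longrightarrow> pbounded m (\<lambda>x. f x * g x)"
  unfolding pbounded_def by (metis mult_mono poly_mult zero_le)

lemma pbounded_poly: "pbounded m f \<Longrightarrow> pbounded m (\<lambda>x. poly p (f x))"
proof -
  assume "pbounded m f"
  then obtain q where "\<And>x. f x \<le> poly q (m x)" unfolding pbounded_def by blast
  then have "poly p (f x) \<le> poly (p \<circ>\<^sub>p q) (m x)" for x
    using nat_poly_mono by (simp add: poly_pcompose)
  then show ?thesis unfolding pbounded_def by blast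
qed

lemma pbounded_le: "pbounded m g \<Longrightarrow> (\<And>x. f x \<le> g x) \<Longrightarrow> pbounded m f"
  unfolding pbounded_def by (meson le_trans)

lemmas pbounded_intros = pbounded_const pbounded_self pbounded_add pbounded_Suc pbounded_mult pbounded_poly

text \<open>An upper bound in place of the exact step count allows costs to be rounded up to a
  common polynomial.\<close>

definition exec :: "cmd \<Rightarrow> store \<Rightarrow> nat \<Rightarrow> store \<Rightarrow> bool" where
  "exec c \<sigma> n \<tau> \<longleftrightarrow> (\<exists>m \<le> n. runs c \<sigma> m \<tau>)"

lemma exec_mono: "exec c \<sigma> n \<tau> \<Longrightarrow> n \<le> m \<Longrightarrow> exec c \<sigma> m \<tau>"
  unfolding exec_def by (meson le_trans)

lemma exec_Skip: "1 \<le> n \<Longrightarrow> exec Skip \<sigma> n \<sigma>"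
  unfolding exec_def using runs_Skip by blast

lemma exec_Push: "\<tau> = \<sigma>(r := b # \<sigma> r) \<Longrightarrow> 2 \<le> n \<Longrightarrow> exec (Push r b) \<sigma> n \<tau>"
  unfolding exec_def using runs_Push by blast

lemma exec_Seq: "exec c \<sigma> n \<sigma>' \<Longrightarrow> exec d \<sigma>' m \<tau> \<Longrightarrow> Suc (n + m) \<le> N2 \<Longrightarrow> exec (c ;; d) \<sigma> N2 \<tau>"
proof -
  assume "exec c \<sigma> n \<sigma>'" "exec d \<sigma>' m \<tau>" "Suc (n + m) \<le> N2"
  then obtain i j where "runs c \<sigma> i \<sigma>'" "runs d \<sigma>' j \<tau>" "i \<le> n" "j \<le> m" unfolding exec_def by blast
  with \<open>Suc (n + m) \<le> N2\<close> runs_Seq show ?thesis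
    unfolding exec_def by (intro exI[of _ "Suc (i + j)"]) auto
qed

lemma exec_Case_Nil: "\<sigma> r = [] \<Longrightarrow> exec c \<sigma> n \<tau> \<Longrightarrow> Suc n \<le> N2 \<Longrightarrow> exec (Case r c d e) \<sigma> N2 \<tau>"
  unfolding exec_def by (meson Suc_le_mono le_trans runs_Case_Nil)

lemma exec_Case_Cons:
  "\<sigma> r = b # l \<Longrightarrow> \<sigma>' = \<sigma>(r := l) \<Longrightarrow> exec (if b then e else d) \<sigma>' n \<tau> \<Longrightarrow> Suc n \<le> N2 \<Longrightarrow>
   exec (Case r c d e) \<sigma> N2 \<tau>"
  unfolding exec_def by (metis Suc_le_mono le_trans runs_Case_Cons)

lemma exec_pop: "\<tau> = \<sigma>(r := tl (\<sigma> r)) \<Longrightarrow> 2 \<le> n \<Longrightarrow> exec (Case r Skip Skip Skip) \<sigma> n \<tau>"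
proof (cases "\<sigma> r")
  case Nil
  assume "\<tau> = \<sigma>(r := tl (\<sigma> r))" "2 \<le> n"
  moreover from this Nil have "\<tau> = \<sigma>" by (simp add: fun_upd_idem)
  ultimately show ?thesis using Nil exec_Case_Nil[of \<sigma> r Skip 1 \<sigma> n] exec_Skip by simp
next
  case (Cons b l)
  assume "\<tau> = \<sigma>(r := tl (\<sigma> r))" "2 \<le> n"
  then show ?thesis
    by (intro exec_Case_Cons[where b = b and l = l and \<sigma>' = \<tau> and n = 1]) (use Cons exec_Skip in auto)
qed

lemma exec_While_Nil: "\<sigma> r = [] \<Longrightarrow> 1 \<le> n \<Longrightarrow> exec (While r c) \<sigma> n \<sigma>"
  unfolding exec_def using runs_While_Nil by blast

lemma exec_While_Cons:
  "\<sigma> r \<noteq> [] \<Longrightarrow> exec c \<sigma> n \<sigma>' \<Longrightarrow> exec (While r c) \<sigma>' m \<tau> \<Longrightarrow> Suc (n + m) \<le> N2 \<Longrightarrow>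
   exec (While r c) \<sigma> N2 \<tau>"
proof -
  assume "\<sigma> r \<noteq> []" "exec c \<sigma> n \<sigma>'" "exec (While r c) \<sigma>' m \<tau>" "Suc (n + m) \<le> N2"
  moreover from this obtain i j where "runs c \<sigma> i \<sigma>'" "runs (While r c) \<sigma>' j \<tau>" "i \<le> n" "j \<le> m"
    unfolding exec_def by blast
  ultimately show ?thesis
    unfolding exec_def using runs_While_Cons by (intro exI[of _ "Suc (i + j)"]) auto
qed

lemma exec_frame:
  "exec c \<sigma> n \<sigma>' \<Longrightarrow> regs_below K c \<Longrightarrow> (\<And>r. r < K \<Longrightarrow> \<tau> r = \<sigma> r) \<Longrightarrow>
   exec c \<tau> n (\<lambda>r. if r < K then \<sigma>' r else \<tau> r)"
  unfolding exec_def using runs_frame by blast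

lemma runs_length: "runs c \<sigma> n \<tau> \<Longrightarrow> length (\<tau> r) \<le> length (\<sigma> r) + n"
  by (induction rule: runs.induct) (auto split: if_splits)

lemma exec_length: "exec c \<sigma> n \<tau> \<Longrightarrow> length (\<tau> r) \<le> length (\<sigma> r) + n"
  unfolding exec_def using runs_length by (meson add_left_mono le_trans)

lemma regs_below_mono: "regs_below K c \<Longrightarrow> K \<le> K' \<Longrightarrow> regs_below K' c"
  by (induction c) auto

section \<open>Elementary stack programs\<close>

definition move_stack :: "nat \<Rightarrow> nat \<Rightarrow> cmd" where
  "move_stack r s = While r (Case r Skip (Push s False) (Push s True))"

definition copy_stack :: "nat \<Rightarrow> nat \<Rightarrow> nat \<Rightarrow> cmd" where
  "copy_stack r s t = While r (Case r Skip (Push s False ;; Push t False) (Push s True ;; Push t True))"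

definition clear_stack :: "nat \<Rightarrow> cmd" where
  "clear_stack r = While r (Case r Skip Skip Skip)"

primrec push_list :: "nat \<Rightarrow> bool list \<Rightarrow> cmd" where
  "push_list r [] = Skip"
| "push_list r (b # l) = (push_list r l ;; Push r b)"

lemma exec_move:
  "r \<noteq> s \<Longrightarrow> \<tau> = \<sigma>(r := [], s := rev (\<sigma> r) @ \<sigma> s) \<Longrightarrow> 4 * length (\<sigma> r) + 1 \<le> n \<Longrightarrow>
   exec (move_stack r s) \<sigma> n \<tau>"
proof (induction "\<sigma> r" arbitrary: \<sigma> n)
  case Nil
  then have "\<tau> = \<sigma>" by (auto simp: fun_eq_iff)
  then show ?case using Nil unfolding move_stack_def by (auto intro!: exec_While_Nil)
next
  case (Cons b l)
  have sr: "\<sigma> r = b # l" using Cons(2) by simp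
  let ?\<sigma> = "\<sigma>(r := l, s := b # \<sigma> s)"
  have "exec (Case r Skip (Push s False) (Push s True)) \<sigma> 3 ?\<sigma>"
    by (rule exec_Case_Cons[where r = r and b = b and l = l and \<sigma>' = "\<sigma>(r := l)" and n = 2]) (use Cons(3) sr in \<open>auto intro!: exec_Push simp: fun_eq_iff\<close>)
  moreover have "exec (move_stack r s) ?\<sigma> (4 * length l + 1) \<tau>"
    by (rule Cons(1)) (use Cons(3-) sr in \<open>auto simp: fun_eq_iff\<close>)
  ultimately show ?case
    unfolding move_stack_def by (rule exec_While_Cons[rotated]) (use Cons(3-) sr in auto)
qed

lemma exec_copy:
  "distinct [r, s, t] \<Longrightarrow> \<tau> = \<sigma>(r := [], s := rev (\<sigma> r) @ \<sigma> s, t := rev (\<sigma> r) @ \<sigma> t) \<Longrightarrow>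
   7 * length (\<sigma> r) + 1 \<le> n \<Longrightarrow> exec (copy_stack r s t) \<sigma> n \<tau>"
proof (induction "\<sigma> r" arbitrary: \<sigma> n)
  case Nil
  then have "\<tau> = \<sigma>" by (auto simp: fun_eq_iff)
  then show ?case using Nil unfolding copy_stack_def by (auto intro!: exec_While_Nil)
next
  case (Cons b l)
  have sr: "\<sigma> r = b # l" using Cons(2) by simp
  let ?\<sigma> = "\<sigma>(r := l, s := b # \<sigma> s, t := b # \<sigma> t)"
  have "exec (Push s b ;; Push t b) (\<sigma>(r := l)) 5 ?\<sigma>"
    by (rule exec_Seq[OF exec_Push[OF refl order_refl] exec_Push[OF _ order_refl]]) (use Cons(3) in \<open>auto simp: fun_eq_iff\<close>)
  then have "exec (Case r Skip (Push s False ;; Push t False) (Push s True ;; Push t True)) \<sigma> 6 ?\<sigma>"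
    by (intro exec_Case_Cons[where r = r and b = b and l = l and \<sigma>' = "\<sigma>(r := l)" and n = 5]) (use Cons(3) sr in \<open>auto split: if_splits\<close>)
  moreover have "exec (copy_stack r s t) ?\<sigma> (7 * length l + 1) \<tau>"
    by (rule Cons(1)) (use Cons(3-) sr in \<open>auto simp: fun_eq_iff\<close>)
  ultimately show ?case
    unfolding copy_stack_def by (rule exec_While_Cons[rotated]) (use Cons(3-) sr in auto)
qed

lemma exec_clear: "\<tau> = \<sigma>(r := []) \<Longrightarrow> 3 * length (\<sigma> r) + 1 \<le> n \<Longrightarrow> exec (clear_stack r) \<sigma> n \<tau>"
proof (induction "\<sigma> r" arbitrary: \<sigma> n)
  case Nil
  then have "\<tau> = \<sigma>" by (auto simp: fun_eq_iff)
  then show ?case using Nil unfolding clear_stack_def by (auto intro!: exec_While_Nil)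
next
  case (Cons b l)
  have sr: "\<sigma> r = b # l" using Cons(2) by simp
  have "exec (Case r Skip Skip Skip) \<sigma> 2 (\<sigma>(r := l))"
    by (rule exec_Case_Cons[where r = r and b = b and l = l and \<sigma>' = "\<sigma>(r := l)" and n = 1]) (use sr in \<open>auto intro!: exec_Skip\<close>)
  moreover have "exec (clear_stack r) (\<sigma>(r := l)) (3 * length l + 1) \<tau>"
    by (rule Cons(1)) (use Cons(3-) sr in \<open>auto simp: fun_eq_iff\<close>)
  ultimately show ?case
    unfolding clear_stack_def by (rule exec_While_Cons[rotated]) (use Cons(3-) sr in auto)
qed

lemma exec_push_list: "\<tau> = \<sigma>(r := l @ \<sigma> r) \<Longrightarrow> 3 * length l + 1 \<le> n \<Longrightarrow> exec (push_list r l) \<sigma> n \<tau>"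
proof (induction l arbitrary: n \<tau>)
  case Nil then show ?case by (auto intro!: exec_Skip)
next
  case (Cons b l)
  then show ?case by (auto intro!: exec_Seq[OF Cons.IH[OF refl order_refl] exec_Push[where n = 2]])
qed

lemma regs_below_macros [simp]:
  "regs_below K (move_stack r s) \<longleftrightarrow> r < K \<and> s < K"
  "regs_below K (copy_stack r s t) \<longleftrightarrow> r < K \<and> s < K \<and> t < K"
  "regs_below K (clear_stack r) \<longleftrightarrow> r < K"
  "r < K \<Longrightarrow> regs_below K (push_list r l)"
  by (auto simp: move_stack_def copy_stack_def clear_stack_def) (induction l, auto)

text \<open>The layout shared by all constructions: stack 0 holds the current value,
  \<open>K\<close> a saved argument, \<open>K + 1\<close> an intermediate result,
  \<open>K + 2\<close> is scratch space and \<open>K + 3\<close> carries a flag. A program confined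
  to the stacks below \<open>K\<close> cannot disturb the last four.\<close>

definition st :: "nat \<Rightarrow> bool list \<Rightarrow> bool list \<Rightarrow> bool list \<Rightarrow> bool list \<Rightarrow> bool list \<Rightarrow> store" where
  "st K a b c d e = (\<lambda>_. [])(0 := a, K := b, K + 1 := c, K + 2 := d, K + 3 := e)"

lemma st_nth: "0 < K \<Longrightarrow> st K a b c d e 0 = a" "st K a b c d e K = b" "st K a b c d e (K + 1) = c"
    "st K a b c d e (K + 2) = d" "st K a b c d e (K + 3) = e"
  by (auto simp: st_def)

lemma st_1: "st (Suc 0) a b c d e = (\<lambda>_. [])(0 := a, 1 := b, 2 := c, 3 := d, 4 := e)"
  by (auto simp: st_def fun_eq_iff eval_nat_numeral)

text \<open>All stacks other than 0 are empty before and after, so that programs compose. Arguments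
  are seen through \<open>e\<close>, which makes one notion serve both for trees and for encoded
  types.\<close>

definition implements :: "cmd \<Rightarrow> nat \<Rightarrow> ('a \<Rightarrow> nat) \<Rightarrow> ('a \<Rightarrow> tree) \<Rightarrow> ('a \<Rightarrow> tree) \<Rightarrow> bool" where
  "implements c K T e F \<longleftrightarrow> regs_below K c \<and> 0 < K \<and>
     (\<forall>x. exec c ((\<lambda>_. [])(0 := ser (e x))) (T x) ((\<lambda>_. [])(0 := ser (F x))))"

definition ptimeT :: "('a \<Rightarrow> tree) \<Rightarrow> ('a \<Rightarrow> tree) \<Rightarrow> bool" where
  "ptimeT e F \<longleftrightarrow> (\<exists>c K (p :: nat poly). implements c K (\<lambda>x. poly p (tsize (e x))) e F)"

lemma ptimeTI: "implements c K T e F \<Longrightarrow> pbounded (\<lambda>x. tsize (e x)) T \<Longrightarrow> ptimeT e F"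
  unfolding ptimeT_def implements_def pbounded_def using exec_mono by metis

lemma implements_exec:
  assumes "implements c K T e F" "K \<le> K'"
  shows "exec c (st K' (ser (e x)) a b d u) (T x) (st K' (ser (F x)) a b d u)"
proof -
  have K: "regs_below K c" "0 < K" "exec c ((\<lambda>_. [])(0 := ser (e x))) (T x) ((\<lambda>_. [])(0 := ser (F x)))"
    using assms by (auto simp: implements_def)
  have "exec c (st K' (ser (e x)) a b d u) (T x)
    (\<lambda>r. if r < K then ((\<lambda>_. [])(0 := ser (F x))) r else st K' (ser (e x)) a b d u r)"
    by (rule exec_frame[OF K(3,1)]) (use assms in \<open>auto simp: st_def\<close>)
  also have "(\<lambda>r. if r < K then ((\<lambda>_. [])(0 := ser (F x))) r else st K' (ser (e x)) a b d u r) = st K' (ser (F x)) a b d u"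
    using assms K by (auto simp: st_def fun_eq_iff)
  finally show ?thesis .
qed

text \<open>A step lengthens a stack by at most one symbol. Polynomial time therefore implies
  polynomial output size, which is what composition needs.\<close>

lemma implements_size: "implements c K T e F \<Longrightarrow> tsize (F x) \<le> tsize (e x) + T x"
  using exec_length[of c "(\<lambda>_. [])(0 := ser (e x))" "T x" "(\<lambda>_. [])(0 := ser (F x))" 0]
  by (auto simp: implements_def)

lemma ptimeT_size: "ptimeT e F \<Longrightarrow> pbounded (\<lambda>x. tsize (e x)) (\<lambda>x. tsize (F x))"
proof -
  assume "ptimeT e F"
  then obtain c K p where "implements c K (\<lambda>x. poly p (tsize (e x))) e F" unfolding ptimeT_def by blast
  from implements_size[OF this] show ?thesis
    by (rule pbounded_le[where g = "\<lambda>x. tsize (e x) + poly p (tsize (e x))", rotated]) (intro pbounded_intros)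
qed

section \<open>Closure properties: constants, composition, pairing, branching, iteration\<close>

lemma ptimeT_self: "ptimeT e e"
  by (rule ptimeTI[of Skip 1 "\<lambda>_. 1"]) (auto simp: implements_def intro!: exec_Skip pbounded_intros)

lemma ptimeT_const: "ptimeT e (\<lambda>_. t)"
proof (rule ptimeTI)
  show "implements (clear_stack 0 ;; push_list 0 (ser t)) 1 (\<lambda>x. 3 * tsize (e x) + (3 * tsize t + 3)) e (\<lambda>_. t)"
    unfolding implements_def
    by (auto intro!: exec_Seq[OF exec_clear[OF refl order_refl] exec_push_list[OF _ order_refl]])
qed (intro pbounded_intros)

lemma ptimeT_comp:
  assumes "ptimeT e' F" "ptimeT e (\<lambda>x. e' (g x))"
  shows "ptimeT e (\<lambda>x. F (g x))"
proof -
  obtain c K p where c: "implements c K (\<lambda>x. poly p (tsize (e' x))) e' F" using assms unfolding ptimeT_def by blast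
  obtain d L q where d: "implements d L (\<lambda>x. poly q (tsize (e x))) e (\<lambda>x. e' (g x))" using assms unfolding ptimeT_def by blast
  have "implements (d ;; c) (max K L) (\<lambda>x. Suc (poly q (tsize (e x)) + poly p (tsize (e' (g x))))) e (\<lambda>x. F (g x))"
    using c d regs_below_mono[of K c "max K L"] regs_below_mono[of L d "max K L"]
    unfolding implements_def by (auto intro: exec_Seq)
  then show ?thesis
    by (rule ptimeTI) (intro pbounded_intros ptimeT_size assms)
qed

text \<open>Both loops reverse what they transport, so the move followed by the copy leaves two
  copies in the original order, at 4 + 7 steps per symbol.\<close>

lemma exec_save:
  assumes "0 < K"
  shows "exec (move_stack 0 (K + 1) ;; copy_stack (K + 1) 0 K) (st K (ser x) [] [] [] u)
    (11 * tsize x + 3) (st K (ser x) (ser x) [] [] u)"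
  by (rule exec_Seq[OF exec_move[OF _ refl order_refl] exec_copy[OF _ _ order_refl]])
    (use assms in \<open>auto simp: st_def fun_eq_iff\<close>)

lemma exec_restore:
  assumes "0 < K"
  shows "exec (move_stack K (K + 2) ;; move_stack (K + 2) 0) (st K [] (ser x) c [] u)
    (8 * tsize x + 3) (st K (ser x) [] c [] u)"
  by (rule exec_Seq[OF exec_move[OF _ refl order_refl] exec_move[OF _ _ order_refl]])
    (use assms in \<open>auto simp: st_def fun_eq_iff\<close>)

text \<open>\<open>F x\<close> is computed on a copy of the argument and parked in reverse on
  \<open>K + 1\<close>. Moving it onto \<open>ser (G x)\<close> restores its order, and one leading
  \<open>True\<close> completes the preorder code of the pair.\<close>

lemma ptimeT_Bin:
  assumes "ptimeT e F" "ptimeT e G"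
  shows "ptimeT e (\<lambda>x. Bin (F x) (G x))"
proof -
  obtain c K1 p where c: "implements c K1 (\<lambda>x. poly p (tsize (e x))) e F" using assms unfolding ptimeT_def by blast
  obtain d K2 q where d: "implements d K2 (\<lambda>x. poly q (tsize (e x))) e G" using assms unfolding ptimeT_def by blast
  define K where "K = max K1 K2"
  have K: "K1 \<le> K" "K2 \<le> K" "0 < K" using c by (auto simp: K_def implements_def)
  let ?c = "(move_stack 0 (K + 1) ;; copy_stack (K + 1) 0 K) ;; c ;; move_stack 0 (K + 1) ;;
     (move_stack K (K + 2) ;; move_stack (K + 2) 0) ;; d ;; move_stack (K + 1) 0 ;; Push 0 True"
  let ?T = "\<lambda>x. 11 * tsize (e x) + 3 + poly p (tsize (e x)) + (4 * tsize (F x) + 1) + (8 * tsize (e x) + 3)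
     + poly q (tsize (e x)) + (4 * tsize (F x) + 1) + 2 + 6"
  have "exec ?c (st K (ser (e x)) [] [] [] []) (?T x) (st K (ser (Bin (F x) (G x))) [] [] [] [])" for x
  proof -
    have 1: "exec c (st K (ser (e x)) (ser (e x)) [] [] []) (poly p (tsize (e x))) (st K (ser (F x)) (ser (e x)) [] [] [])"
      using implements_exec[OF c K(1)] .
    have 2: "exec (move_stack 0 (K + 1)) (st K (ser (F x)) (ser (e x)) [] [] []) (4 * tsize (F x) + 1)
       (st K [] (ser (e x)) (rev (ser (F x))) [] [])"
      by (rule exec_move) (use K in \<open>auto simp: st_def fun_eq_iff\<close>)
    have 3: "exec d (st K (ser (e x)) [] (rev (ser (F x))) [] []) (poly q (tsize (e x)))
       (st K (ser (G x)) [] (rev (ser (F x))) [] [])"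
      using implements_exec[OF d K(2)] .
    have 4: "exec (move_stack (K + 1) 0) (st K (ser (G x)) [] (rev (ser (F x))) [] []) (4 * tsize (F x) + 1)
       (st K (ser (F x) @ ser (G x)) [] [] [] [])"
      by (rule exec_move) (use K in \<open>auto simp: st_def fun_eq_iff\<close>)
    have 5: "exec (Push 0 True) (st K (ser (F x) @ ser (G x)) [] [] [] []) 2 (st K (ser (Bin (F x) (G x))) [] [] [] [])"
      by (rule exec_Push) (use K in \<open>auto simp: st_def fun_eq_iff\<close>)
    show ?thesis
      by (rule exec_Seq[OF exec_save[OF K(3)] exec_Seq[OF 1 exec_Seq[OF 2 exec_Seq[OF exec_restore[OF K(3)]
         exec_Seq[OF 3 exec_Seq[OF 4 5 order_refl] order_refl] order_refl] order_refl] order_refl]]) simp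
  qed
  moreover have "st K a [] [] [] [] = (\<lambda>_. [])(0 := a)" for a using K by (auto simp: st_def)
  moreover have "regs_below (K + 4) ?c"
    using c d K regs_below_mono[of K1 c "K + 4"] regs_below_mono[of K2 d "K + 4"] by (auto simp: implements_def)
  ultimately have "implements ?c (K + 4) ?T e (\<lambda>x. Bin (F x) (G x))"
    by (auto simp: implements_def)
  then show ?thesis
    by (rule ptimeTI) (intro pbounded_intros ptimeT_size assms)
qed

text \<open>The first symbol of a preorder code tells \<open>Tip\<close> from an inner node, so a
  single pop sets the flag and the rest of the computed value is discarded; the argument is put back
  afterwards.\<close>

definition test :: "nat \<Rightarrow> cmd \<Rightarrow> cmd" where
  "test K c = (move_stack 0 (K + 1) ;; copy_stack (K + 1) 0 K) ;; c ;; Case 0 Skip Skip (Push (K + 3) True) ;;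
     clear_stack 0 ;; (move_stack K (K + 2) ;; move_stack (K + 2) 0)"

lemma exec_test:
  assumes c: "implements c K1 T e B" "K1 \<le> K" "0 < K"
  shows "exec (test K c) (st K (ser (e x)) [] [] [] u) (19 * tsize (e x) + T x + 3 * tsize (B x) + 14)
    (st K (ser (e x)) [] [] [] ((if B x = Tip then [] else [True]) @ u))"
proof -
  let ?u = "(if B x = Tip then [] else [True]) @ u"
  have 1: "exec c (st K (ser (e x)) (ser (e x)) [] [] u) (T x) (st K (ser (B x)) (ser (e x)) [] [] u)"
    using implements_exec[OF c(1,2)] .
  have 2: "exec (Case 0 Skip Skip (Push (K + 3) True)) (st K (ser (B x)) (ser (e x)) [] [] u) 3
     (st K (tl (ser (B x))) (ser (e x)) [] [] ?u)"
    by (cases "B x"; rule exec_Case_Cons[where n = 2 and b = "B x \<noteq> Tip" and l = "tl (ser (B x))" and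
        \<sigma>' = "st K (tl (ser (B x))) (ser (e x)) [] [] u"])
      (use c in \<open>auto simp: st_def fun_eq_iff intro!: exec_Skip exec_Push\<close>)
  have 3: "exec (clear_stack 0) (st K (tl (ser (B x))) (ser (e x)) [] [] ?u) (3 * tsize (B x) + 1)
     (st K [] (ser (e x)) [] [] ?u)"
    by (rule exec_clear) (use c in \<open>auto simp: st_def fun_eq_iff\<close>)
  show ?thesis unfolding test_def
    by (rule exec_Seq[OF exec_save[OF c(3)] exec_Seq[OF 1 exec_Seq[OF 2 exec_Seq[OF 3 exec_restore[OF c(3)]
         order_refl] order_refl] order_refl]]) simp
qed

lemma regs_below_test: "regs_below K1 c \<Longrightarrow> K1 \<le> K \<Longrightarrow> regs_below (K + 4) (test K c)"
  using regs_below_mono[of K1 c "K + 4"] by (auto simp: test_def)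

lemma ptimeT_if:
  assumes "ptimeT e B" "ptimeT e F" "ptimeT e G"
  shows "ptimeT e (\<lambda>x. if B x = Tip then G x else F x)"
proof -
  obtain b K0 s where b: "implements b K0 (\<lambda>x. poly s (tsize (e x))) e B" using assms unfolding ptimeT_def by blast
  obtain c K1 p where c: "implements c K1 (\<lambda>x. poly p (tsize (e x))) e F" using assms unfolding ptimeT_def by blast
  obtain d K2 q where d: "implements d K2 (\<lambda>x. poly q (tsize (e x))) e G" using assms unfolding ptimeT_def by blast
  define K where "K = max K0 (max K1 K2)"
  have K: "K0 \<le> K" "K1 \<le> K" "K2 \<le> K" "0 < K" using c by (auto simp: K_def implements_def)
  let ?c = "test K b ;; Case (K + 3) d Skip c"
  let ?T = "\<lambda>x. 19 * tsize (e x) + poly s (tsize (e x)) + 3 * tsize (B x) + 14 + (poly p (tsize (e x)) + poly q (tsize (e x)) + 1) + 1"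
  have "exec ?c (st K (ser (e x)) [] [] [] []) (?T x) (st K (ser (if B x = Tip then G x else F x)) [] [] [] [])" for x
  proof -
    have "exec (Case (K + 3) d Skip c) (st K (ser (e x)) [] [] [] ((if B x = Tip then [] else [True]) @ []))
      (poly p (tsize (e x)) + poly q (tsize (e x)) + 1) (st K (ser (if B x = Tip then G x else F x)) [] [] [] [])"
    proof (cases "B x = Tip")
      case True
      then show ?thesis using K implements_exec[OF d K(3)]
        by (intro exec_Case_Nil[where n = "poly q (tsize (e x))"]) (auto simp: st_nth)
    next
      case False
      have "exec (Case (K + 3) d Skip c) (st K (ser (e x)) [] [] [] [True]) (poly p (tsize (e x)) + 1) (st K (ser (F x)) [] [] [] [])"
        by (rule exec_Case_Cons[where b = True and l = "[]" and \<sigma>' = "st K (ser (e x)) [] [] [] []" and n = "poly p (tsize (e x))"])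
          (use K implements_exec[OF c K(2)] in \<open>auto simp: st_nth\<close>, auto simp: st_def fun_eq_iff)
      from exec_mono[OF this, of "poly p (tsize (e x)) + poly q (tsize (e x)) + 1"] False show ?thesis by simp
    qed
    from exec_Seq[OF exec_test[OF b K(1,4)] this order_refl] show ?thesis by simp
  qed
  moreover have "st K a [] [] [] [] = (\<lambda>_. [])(0 := a)" for a using K by (auto simp: st_def)
  moreover have "regs_below (K + 4) ?c"
    using b c d K regs_below_mono[of K1 c "K + 4"] regs_below_mono[of K2 d "K + 4"] regs_below_test[of K0 b K]
    by (auto simp: implements_def)
  ultimately have "implements ?c (K + 4) ?T e (\<lambda>x. if B x = Tip then G x else F x)"
    by (auto simp: implements_def)
  then show ?thesis
    by (rule ptimeTI) (intro pbounded_intros ptimeT_size assms)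
qed

definition loop :: "nat \<Rightarrow> cmd \<Rightarrow> cmd \<Rightarrow> cmd" where
  "loop K b c = While (K + 3) (Case (K + 3) Skip Skip Skip ;; c ;; test K b)"

lemma exec_loop_body:
  assumes b: "implements b K0 S e B" "K0 \<le> K" "0 < K" and c: "implements c K1 T e (\<lambda>x. e (f x))" "K1 \<le> K"
  shows "exec (Case (K + 3) Skip Skip Skip ;; c ;; test K b) (st K (ser (e x)) [] [] [] [True])
     (T x + (19 * tsize (e (f x)) + S (f x) + 3 * tsize (B (f x)) + 14) + 4)
     (st K (ser (e (f x))) [] [] [] (if B (f x) = Tip then [] else [True]))"
proof -
  have 1: "exec (Case (K + 3) Skip Skip Skip) (st K (ser (e x)) [] [] [] [True]) 2 (st K (ser (e x)) [] [] [] [])"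
    by (rule exec_pop) (use b(3) in \<open>auto simp: st_def fun_eq_iff\<close>)
  show ?thesis
    using exec_Seq[OF 1 exec_Seq[OF implements_exec[OF c] exec_test[OF b, of "f x" "[]"] order_refl] order_refl]
    unfolding append_Nil2 by (rule exec_mono) simp
qed

lemma exec_loop:
  assumes b: "implements b K0 S e B" "K0 \<le> K" "0 < K" and c: "implements c K1 T e (\<lambda>x. e (f x))" "K1 \<le> K"
  assumes fin: "B ((f ^^ t) x) = Tip" "\<And>s. s < t \<Longrightarrow> B ((f ^^ s) x) \<noteq> Tip"
    and U: "\<And>s. s < t \<Longrightarrow> T ((f ^^ s) x) + (19 * tsize (e ((f ^^ Suc s) x)) + S ((f ^^ Suc s) x) + 3 * tsize (B ((f ^^ Suc s) x)) + 14) + 4 \<le> U"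
  shows "exec (loop K b c) (st K (ser (e x)) [] [] [] (if B x = Tip then [] else [True])) (t * (U + 1) + 1)
     (st K (ser (e ((f ^^ t) x))) [] [] [] [])"
  using fin U
proof (induction t arbitrary: x)
  case 0
  then show ?case using b(3) by (auto simp: loop_def st_nth intro!: exec_While_Nil)
next
  case (Suc t)
  have "B x \<noteq> Tip" using Suc.prems(2)[of 0] by simp
  have rest: "exec (loop K b c) (st K (ser (e (f x))) [] [] [] (if B (f x) = Tip then [] else [True])) (t * (U + 1) + 1)
     (st K (ser (e ((f ^^ t) (f x)))) [] [] [] [])"
    using Suc.prems(1) Suc.prems(2,3)[of "Suc _"] by (intro Suc.IH) (auto simp: funpow_swap1)
  have body: "exec (Case (K + 3) Skip Skip Skip ;; c ;; test K b) (st K (ser (e x)) [] [] [] [True]) U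
     (st K (ser (e (f x))) [] [] [] (if B (f x) = Tip then [] else [True]))"
    by (rule exec_mono[OF exec_loop_body[OF b c, of x]]) (use Suc.prems(3)[of 0] in simp)
  have "exec (loop K b c) (st K (ser (e x)) [] [] [] [True]) (Suc t * (U + 1) + 1) (st K (ser (e ((f ^^ t) (f x)))) [] [] [] [])"
    unfolding loop_def by (rule exec_While_Cons[OF _ body rest[unfolded loop_def]]) (simp_all add: st_nth)
  then show ?case using \<open>B x \<noteq> Tip\<close> by (simp only: funpow_Suc_right o_apply if_False)
qed

text \<open>The number of rounds is polynomial by the bound on \<open>t\<close>, and the cost of a
  round is polynomial in the current iterate. The hypothesis on the sizes of the iterates keeps that
  cost polynomial in the original argument.\<close>

lemma ptimeT_while:
  assumes G: "ptimeT e' (\<lambda>x. e (g x))" and F: "ptimeT e (\<lambda>y. e (f y))" and B: "ptimeT e B"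
    and t: "\<And>x. B ((f ^^ t x) (g x)) = Tip" "\<And>x s. s < t x \<Longrightarrow> B ((f ^^ s) (g x)) \<noteq> Tip"
    and tb: "pbounded (\<lambda>x. tsize (e' x)) t"
    and sz: "\<And>x s. s \<le> t x \<Longrightarrow> tsize (e ((f ^^ s) (g x))) \<le> poly r (tsize (e' x))"
  shows "ptimeT e' (\<lambda>x. e ((f ^^ t x) (g x)))"
proof -
  obtain b K0 q where b: "implements b K0 (\<lambda>x. poly q (tsize (e x))) e B" using B unfolding ptimeT_def by blast
  obtain c K1 p where c: "implements c K1 (\<lambda>x. poly p (tsize (e x))) e (\<lambda>y. e (f y))" using F unfolding ptimeT_def by blast
  obtain d K2 v where d: "implements d K2 (\<lambda>x. poly v (tsize (e' x))) e' (\<lambda>x. e (g x))" using G unfolding ptimeT_def by blast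
  obtain u where u: "\<And>x. tsize (B x) \<le> poly u (tsize (e x))" using ptimeT_size[OF B] unfolding pbounded_def by blast
  define K where "K = max K0 (max K1 K2)"
  have K: "K0 \<le> K" "K1 \<le> K" "K2 \<le> K" "0 < K" using c by (auto simp: K_def implements_def)
  let ?R = "\<lambda>x. poly r (tsize (e' x))"
  \<comment> \<open>\<open>?R\<close> bounds every iterate and \<open>?U\<close> the cost of any
    single round, the renewed test included.\<close>
  let ?U = "\<lambda>x. poly p (?R x) + (19 * ?R x + poly q (?R x) + 3 * poly u (?R x) + 14) + 4"
  let ?c = "d ;; test K b ;; loop K b c"
  let ?T = "\<lambda>x. Suc (poly v (tsize (e' x)) + Suc ((19 * ?R x + poly q (?R x) + 3 * poly u (?R x) + 14) + (t x * (?U x + 1) + 1)))"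
  have uR: "tsize (B ((f ^^ s) (g x))) \<le> poly u (?R x)" if "s \<le> t x" for s x
    using u[of "(f ^^ s) (g x)"] nat_poly_mono[OF sz[OF that]] by (meson le_trans)
  have "exec ?c (st K (ser (e' x)) [] [] [] []) (?T x) (st K (ser (e ((f ^^ t x) (g x)))) [] [] [] [])" for x
  proof -
    have 1: "exec (loop K b c) (st K (ser (e (g x))) [] [] [] (if B (g x) = Tip then [] else [True])) (t x * (?U x + 1) + 1)
     (st K (ser (e ((f ^^ t x) (g x)))) [] [] [] [])"
    proof (rule exec_loop[OF b K(1,4) c K(2) t])
      fix s assume s: "s < t x"
      let ?y = "(f ^^ Suc s) (g x)"
      have "tsize (B ?y) \<le> poly u (?R x)" using uR[of "Suc s" x] s by simp
      moreover have "tsize (e ?y) \<le> ?R x" "tsize (e ((f ^^ s) (g x))) \<le> ?R x" using sz[of "Suc s" x] sz[of s x] s by auto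
      ultimately show "poly p (tsize (e ((f ^^ s) (g x)))) + (19 * tsize (e ?y) + poly q (tsize (e ?y)) + 3 * tsize (B ?y) + 14) + 4 \<le> ?U x"
        by (intro add_mono mult_le_mono nat_poly_mono) auto
    qed
    have 2: "exec (test K b) (st K (ser (e (g x))) [] [] [] []) (19 * ?R x + poly q (?R x) + 3 * poly u (?R x) + 14)
        (st K (ser (e (g x))) [] [] [] (if B (g x) = Tip then [] else [True]))"
      by (rule exec_mono[OF exec_test[OF b K(1,4), of "g x" "[]", unfolded append_Nil2]], intro add_mono mult_le_mono nat_poly_mono)
        (use sz[of 0 x] uR[of 0 x] in auto)
    show ?thesis
      by (rule exec_Seq[OF implements_exec[OF d K(3)] exec_Seq[OF 2 1 order_refl] order_refl])
  qed
  moreover have "st K a [] [] [] [] = (\<lambda>_. [])(0 := a)" for a using K by (auto simp: st_def)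
  moreover have "regs_below (K + 4) ?c"
    using b c d K regs_below_mono[of K1 c "K + 4"] regs_below_mono[of K2 d "K + 4"] regs_below_test[of K0 b K]
    by (auto simp: implements_def loop_def)
  ultimately have "implements ?c (K + 4) ?T e' (\<lambda>x. e ((f ^^ t x) (g x)))"
    by (auto simp: implements_def)
  then show ?thesis
    by (rule ptimeTI) (intro pbounded_intros tb)
qed

section \<open>Subtrees and equality of trees\<close>

text \<open>Stack 2 counts the subtrees still to be read.\<close>

definition split_tree :: cmd where
  "split_tree = Push 2 True ;; While 2 (Case 0 Skip
     (Case 2 Skip Skip Skip ;; Push 1 False) (Push 2 True ;; Push 1 True))"

text \<open>Stated backwards: a run from the state in which \<open>a\<close> has been read extends
  to a run from the state before. With arbitrary rest, output and counter, the induction passes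
  through the left subtree and then through the right one. A symbol costs 7 steps, 6 for the body
  and 1 for the loop.\<close>

lemma exec_split_loop:
  fixes W defines "W \<equiv> While 2 (Case 0 Skip (Case 2 Skip Skip Skip ;; Push 1 False) (Push 2 True ;; Push 1 True))"
  shows "exec W (st 1 rest (rev (ser a) @ l) k d e) n \<tau> \<Longrightarrow>
     exec W (st 1 (ser a @ rest) l (True # k) d e) (n + 7 * tsize a) \<tau>"
proof (induction a arbitrary: rest l k n)
  case Tip
  have body: "exec (Case 0 Skip (Case 2 Skip Skip Skip ;; Push 1 False) (Push 2 True ;; Push 1 True))
      (st 1 (False # rest) l (True # k) d e) 6 (st 1 rest (False # l) k d e)"
  proof (rule exec_Case_Cons[where n = 5 and b = False and l = rest and \<sigma>' = "st 1 rest l (True # k) d e"])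
    show "exec (if False then Push 2 True ;; Push 1 True else Case 2 Skip Skip Skip ;; Push 1 False)
      (st 1 rest l (True # k) d e) 5 (st 1 rest (False # l) k d e)"
      by (simp, rule exec_Seq[where \<sigma>' = "st 1 rest l k d e" and n = 2 and m = 2, OF exec_pop exec_Push])
        (auto simp: st_1 fun_eq_iff)
  qed (auto simp: st_1 fun_eq_iff)
  have tail: "exec W (st 1 rest (False # l) k d e) n \<tau>" using Tip by simp
  have "exec W (st 1 (False # rest) l (True # k) d e) (n + 7) \<tau>"
    unfolding W_def by (rule exec_While_Cons[OF _ body tail[unfolded W_def]]) (simp_all add: st_1)
  then show ?case by simp
next
  case (Bin a b)
  let ?\<sigma> = "st 1 (ser a @ ser b @ rest) (True # l) (True # True # k) d e"
  have body: "exec (Case 0 Skip (Case 2 Skip Skip Skip ;; Push 1 False) (Push 2 True ;; Push 1 True))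
      (st 1 (True # ser a @ ser b @ rest) l (True # k) d e) 6 ?\<sigma>"
  proof (rule exec_Case_Cons[where n = 5 and b = True and l = "ser a @ ser b @ rest" and
        \<sigma>' = "st 1 (ser a @ ser b @ rest) l (True # k) d e"])
    show "exec (if True then Push 2 True ;; Push 1 True else Case 2 Skip Skip Skip ;; Push 1 False)
      (st 1 (ser a @ ser b @ rest) l (True # k) d e) 5 ?\<sigma>"
      by (simp, rule exec_Seq[where \<sigma>' = "st 1 (ser a @ ser b @ rest) l (True # True # k) d e" and n = 2 and m = 2, OF exec_Push exec_Push])
        (auto simp: st_1 fun_eq_iff)
  qed (auto simp: st_1 fun_eq_iff)
  have tail: "exec W ?\<sigma> (n + 7 * tsize b + 7 * tsize a) \<tau>"
    by (rule Bin.IH(1), rule Bin.IH(2)) (use Bin.prems in simp)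
  have "exec W (st 1 (True # ser a @ ser b @ rest) l (True # k) d e) (n + 7 * tsize (Bin a b)) \<tau>"
    unfolding W_def by (rule exec_While_Cons[OF _ body tail[unfolded W_def]]) (simp_all add: st_1)
  then show ?case by simp
qed

lemma exec_split: "exec split_tree (st 1 (ser a @ l) [] [] d e) (7 * tsize a + 4) (st 1 l (rev (ser a)) [] d e)"
proof -
  have "exec (Push 2 True) (st 1 (ser a @ l) [] [] d e) 2 (st 1 (ser a @ l) [] [True] d e)"
    by (rule exec_Push) (auto simp: st_1 fun_eq_iff)
  moreover have "exec (While 2 (Case 0 Skip (Case 2 Skip Skip Skip ;; Push 1 False) (Push 2 True ;; Push 1 True)))
     (st 1 (ser a @ l) [] [True] d e) (1 + 7 * tsize a) (st 1 l (rev (ser a)) [] d e)"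
    by (rule exec_split_loop) (auto simp: st_1 intro!: exec_While_Nil)
  ultimately show ?thesis unfolding split_tree_def by (rule exec_Seq) simp
qed

lemma regs_below_split: "regs_below 5 split_tree"
  by (simp add: split_tree_def)

text \<open>A frame for functions that treat the two subtrees separately: \<open>c\<close> starts
  with the right one on stack 0 and the reversed left one on stack 1, and only its own effect
  remains to be verified.\<close>

lemma implements_split:
  assumes "\<And>a b. exec c (st 1 (ser b) (rev (ser a)) [] [] []) (T a b) (st 1 (ser (F a b)) [] [] [] [])"
    and "regs_below 5 c"
  shows "implements (Case 0 Skip (Push 0 False) (split_tree ;; c)) 5
     (\<lambda>x. case x of Tip \<Rightarrow> 3 | Bin a b \<Rightarrow> 7 * tsize a + T a b + 6) (\<lambda>x. x) (\<lambda>x. case x of Tip \<Rightarrow> Tip | Bin a b \<Rightarrow> F a b)"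
proof -
  have *: "st 1 a [] [] [] [] = (\<lambda>_. [])(0 := a)" for a by (auto simp: st_def)
  have "exec (Case 0 Skip (Push 0 False) (split_tree ;; c)) (st 1 (ser x) [] [] [] [])
     (case x of Tip \<Rightarrow> 3 | Bin a b \<Rightarrow> 7 * tsize a + T a b + 6)
     (st 1 (ser (case x of Tip \<Rightarrow> Tip | Bin a b \<Rightarrow> F a b)) [] [] [] [])" for x
  proof (cases x)
    case Tip
    have "exec (Case 0 Skip (Push 0 False) (split_tree ;; c)) (st 1 [False] [] [] [] []) 3 (st 1 [False] [] [] [] [])"
      by (rule exec_Case_Cons[where n = 2 and b = False and l = "[]" and \<sigma>' = "st 1 [] [] [] [] []"])
        (auto simp: st_1 fun_eq_iff intro!: exec_Push)
    then show ?thesis using Tip by simp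
  next
    case (Bin a b)
    have "exec (split_tree ;; c) (st 1 (ser a @ ser b) [] [] [] []) (7 * tsize a + T a b + 5) (st 1 (ser (F a b)) [] [] [] [])"
      by (rule exec_Seq[OF exec_split assms(1)]) simp
    then have "exec (Case 0 Skip (Push 0 False) (split_tree ;; c)) (st 1 (True # ser a @ ser b) [] [] [] [])
       (7 * tsize a + T a b + 6) (st 1 (ser (F a b)) [] [] [] [])"
      by (intro exec_Case_Cons[where n = "7 * tsize a + T a b + 5" and b = True and l = "ser a @ ser b" and
           \<sigma>' = "st 1 (ser a @ ser b) [] [] [] []"]) (auto simp: st_1 fun_eq_iff)
    then show ?thesis using Bin by simp
  qed
  then show ?thesis
    using assms(2) regs_below_split unfolding implements_def * by simp
qed

lemma ptimeT_left: "ptimeT (\<lambda>x. x) (\<lambda>x. case x of Tip \<Rightarrow> Tip | Bin a b \<Rightarrow> a)"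
proof (rule ptimeTI[OF implements_split])
  show "exec (clear_stack 0 ;; move_stack 1 0) (st 1 (ser b) (rev (ser a)) [] [] []) (3 * tsize b + 4 * tsize a + 3)
     (st 1 (ser a) [] [] [] [])" for a b
    by (rule exec_Seq[OF exec_clear[OF refl order_refl] exec_move[OF _ _ order_refl]]) (auto simp: st_1 fun_eq_iff)
  show "pbounded tsize (\<lambda>x. case x of Tip \<Rightarrow> 3 | Bin a b \<Rightarrow> 7 * tsize a + (3 * tsize b + 4 * tsize a + 3) + 6)"
    by (rule pbounded_le[where g = "\<lambda>x. 20 * tsize x + 20"], intro pbounded_intros) (auto split: tree.split)
qed simp

lemma ptimeT_right: "ptimeT (\<lambda>x. x) (\<lambda>x. case x of Tip \<Rightarrow> Tip | Bin a b \<Rightarrow> b)"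
proof (rule ptimeTI[OF implements_split])
  show "exec (clear_stack 1) (st 1 (ser b) (rev (ser a)) [] [] []) (3 * tsize a + 1)
     (st 1 (ser b) [] [] [] [])" for a b
    by (rule exec_clear) (auto simp: st_1 fun_eq_iff)
  show "pbounded tsize (\<lambda>x. case x of Tip \<Rightarrow> 3 | Bin a b \<Rightarrow> 7 * tsize a + (3 * tsize a + 1) + 6)"
    by (rule pbounded_le[where g = "\<lambda>x. 20 * tsize x + 20"], intro pbounded_intros) (auto split: tree.split)
qed simp

text \<open>Compares stacks 0 and 2; stack 3 is emptied at the first difference.\<close>

definition compare_stacks :: cmd where
  "compare_stacks = While 0 (Case 0 Skip (Case 2 (clear_stack 3) Skip (clear_stack 3))
     (Case 2 (clear_stack 3) (clear_stack 3) Skip))"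

text \<open>The flag has at most one symbol, so clearing it takes constant time and every symbol of
  \<open>l\<close> costs at most 8 steps.\<close>

lemma exec_compare:
  "length f \<le> 1 \<Longrightarrow> exec compare_stacks (st 1 l b m f e) (8 * length l + 1)
     (st 1 [] b (drop (length l) m) (if take (length l) m = l then f else []) e)"
proof (induction l arbitrary: m f)
  case Nil
  then show ?case by (auto simp: compare_stacks_def st_1 intro!: exec_While_Nil)
next
  case (Cons x l)
  let ?f = "if m \<noteq> [] \<and> hd m = x then f else []"
  have clear: "exec (clear_stack 3) (st 1 l b m' f e) 5 (st 1 l b m' [] e)" for m'
    by (rule exec_clear) (use Cons.prems in \<open>auto simp: st_1 fun_eq_iff\<close>)
  have "exec (if x then Case 2 (clear_stack 3) (clear_stack 3) Skip else Case 2 (clear_stack 3) Skip (clear_stack 3))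
      (st 1 l b m f e) 6 (st 1 l b (tl m) ?f e)"
  proof (cases m)
    case Nil
    then show ?thesis using clear[of "[]"] by (auto intro!: exec_Case_Nil[where n = 5] simp: st_1)
  next
    case (Cons y m')
    have "exec (Case 2 (clear_stack 3) (if x then clear_stack 3 else Skip) (if x then Skip else clear_stack 3))
      (st 1 l b m f e) 6 (st 1 l b (tl m) ?f e)"
      by (rule exec_Case_Cons[where n = 5 and b = y and l = m' and \<sigma>' = "st 1 l b m' f e"])
        (use Cons clear[of m'] exec_Skip[of 5 "st 1 l b m' f e"] in \<open>auto simp: st_1 fun_eq_iff\<close>)
    then show ?thesis by (cases x) simp_all
  qed
  then have "exec (Case 0 Skip (Case 2 (clear_stack 3) Skip (clear_stack 3))
     (Case 2 (clear_stack 3) (clear_stack 3) Skip)) (st 1 (x # l) b m f e) 7 (st 1 l b (tl m) ?f e)"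
    by (intro exec_Case_Cons[where n = 6 and r = 0 and l = l and b = x and \<sigma>' = "st 1 l b m f e"])
      (auto simp: st_1 fun_eq_iff)
  moreover have "exec compare_stacks (st 1 l b (tl m) ?f e) (8 * length l + 1)
     (st 1 [] b (drop (length l) (tl m)) (if take (length l) (tl m) = l then ?f else []) e)"
    using Cons.prems by (intro Cons.IH) auto
  ultimately have "exec compare_stacks (st 1 (x # l) b m f e) (8 * length (x # l) + 1)
     (st 1 [] b (drop (length l) (tl m)) (if take (length l) (tl m) = l then ?f else []) e)"
    unfolding compare_stacks_def by (rule exec_While_Cons[rotated]) (simp_all add: st_1)
  then show ?case by (cases m) (auto split: if_splits)
qed

lemma exec_clear_flag:
  "length f \<le> 1 \<Longrightarrow> exec (While 2 (Case 2 Skip Skip Skip ;; clear_stack 3)) (st 1 [] [] m f e) (9 * length m + 1)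
     (st 1 [] [] [] (if m = [] then f else []) e)"
proof (induction m arbitrary: f)
  case Nil
  then show ?case by (auto simp: st_1 intro!: exec_While_Nil)
next
  case (Cons x m)
  have "exec (Case 2 Skip Skip Skip ;; clear_stack 3) (st 1 [] [] (x # m) f e) 8 (st 1 [] [] m [] e)"
    by (rule exec_Seq[where n = 2 and m = 5 and \<sigma>' = "st 1 [] [] m f e", OF exec_pop exec_clear])
      (use Cons.prems in \<open>auto simp: st_1 fun_eq_iff\<close>)
  moreover have "exec (While 2 (Case 2 Skip Skip Skip ;; clear_stack 3)) (st 1 [] [] m [] e) (9 * length m + 1)
     (st 1 [] [] [] [] e)"
    using Cons.IH[of "[]"] by simp
  ultimately have "exec (While 2 (Case 2 Skip Skip Skip ;; clear_stack 3)) (st 1 [] [] (x # m) f e)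
     (9 * length (x # m) + 1) (st 1 [] [] [] [] e)"
    by (rule exec_While_Cons[rotated]) (simp_all add: st_1)
  then show ?case by simp
qed

text \<open>Trees are equal exactly if their codes are. A remainder of \<open>ser a\<close> after
  all of \<open>ser b\<close> has been consumed is a difference too, and the second loop clears the
  flag in that case.\<close>

lemma ptimeT_eq: "ptimeT (\<lambda>x. x) (\<lambda>x. case x of Tip \<Rightarrow> Tip | Bin a b \<Rightarrow> if a = b then Bin Tip Tip else Tip)"
proof (rule ptimeTI[OF implements_split])
  show "exec (move_stack 1 2 ;; Push 3 True ;; compare_stacks ;; While 2 (Case 2 Skip Skip Skip ;; clear_stack 3) ;;
       Case 3 (Push 0 False) Skip (push_list 0 [True, False, False]))
     (st 1 (ser b) (rev (ser a)) [] [] []) (8 * tsize b + 13 * tsize a + 20)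
     (st 1 (ser (if a = b then Bin Tip Tip else Tip)) [] [] [] [])" for a b
  proof -
    have 1: "exec (move_stack 1 2) (st 1 (ser b) (rev (ser a)) [] [] []) (4 * tsize a + 1) (st 1 (ser b) [] (ser a) [] [])"
      by (rule exec_move) (auto simp: st_1 fun_eq_iff)
    have 2: "exec (Push 3 True) (st 1 (ser b) [] (ser a) [] []) 2 (st 1 (ser b) [] (ser a) [True] [])"
      by (rule exec_Push) (auto simp: st_1 fun_eq_iff)
    let ?m = "drop (tsize b) (ser a)" and ?f = "if take (tsize b) (ser a) = ser b then [True] else []"
    have 3: "exec compare_stacks (st 1 (ser b) [] (ser a) [True] []) (8 * tsize b + 1) (st 1 [] [] ?m ?f [])"
      using exec_compare[of "[True]" "ser b" "[]" "ser a" "[]"] by simp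
    have 4: "exec (While 2 (Case 2 Skip Skip Skip ;; clear_stack 3)) (st 1 [] [] ?m ?f []) (9 * tsize a + 1)
       (st 1 [] [] [] (if ?m = [] then ?f else []) [])"
      by (rule exec_mono[OF exec_clear_flag]) auto
    have "(if ?m = [] then ?f else []) = (if a = b then [True] else [])"
    proof (cases "a = b")
      case False
      then have "take (tsize b) (ser a) @ ?m \<noteq> ser b" by (simp add: ser_inj)
      with False show ?thesis by auto
    qed simp
    moreover have "exec (Case 3 (Push 0 False) Skip (push_list 0 [True, False, False]))
        (st 1 [] [] [] (if a = b then [True] else []) []) 11 (st 1 (ser (if a = b then Bin Tip Tip else Tip)) [] [] [] [])"
    proof (cases "a = b")
      case True
      have "exec (Case 3 (Push 0 False) Skip (push_list 0 [True, False, False])) (st 1 [] [] [] [True] []) 11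
          (st 1 [True, False, False] [] [] [] [])"
        by (rule exec_Case_Cons[where n = 10 and b = True and l = "[]" and \<sigma>' = "st 1 [] [] [] [] []"])
          (auto simp: st_1 fun_eq_iff simp del: push_list.simps intro!: exec_push_list)
      then show ?thesis using True by simp
    next
      case False
      have "exec (Case 3 (Push 0 False) Skip (push_list 0 [True, False, False])) (st 1 [] [] [] [] []) 11
          (st 1 [False] [] [] [] [])"
        by (rule exec_Case_Nil[where n = 10]) (auto simp: st_1 fun_eq_iff intro!: exec_Push)
      then show ?thesis using False by simp
    qed
    ultimately have 5: "exec (Case 3 (Push 0 False) Skip (push_list 0 [True, False, False]))
        (st 1 [] [] [] (if ?m = [] then ?f else []) []) 11 (st 1 (ser (if a = b then Bin Tip Tip else Tip)) [] [] [] [])"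
      by simp
    show ?thesis
      by (rule exec_Seq[OF 1 exec_Seq[OF 2 exec_Seq[OF 3 exec_Seq[OF 4 5 order_refl] order_refl] order_refl]]) simp
  qed
  show "pbounded tsize (\<lambda>x. case x of Tip \<Rightarrow> 3 | Bin a b \<Rightarrow> 7 * tsize a + (8 * tsize b + 13 * tsize a + 20) + 6)"
    by (rule pbounded_le[where g = "\<lambda>x. 50 * tsize x + 50"], intro pbounded_intros) (auto split: tree.split)
qed (simp add: compare_stacks_def)

section \<open>Polynomial-time functions on encoded types\<close>

text \<open>Injectivity lets the one equality test on trees decide equality in every encoded
  type.\<close>

class enc =
  fixes enc :: "'a \<Rightarrow> tree"
  assumes enc_inj: "enc x = enc y \<Longrightarrow> x = y"

definition sz :: "'a::enc \<Rightarrow> nat" where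
  "sz x = tsize (enc x)"

definition ptime :: "('a::enc \<Rightarrow> 'b::enc) \<Rightarrow> bool" where
  "ptime f \<longleftrightarrow> ptimeT enc (\<lambda>x. enc (f x))"

lemma enc_eq_iff: "enc x = enc y \<longleftrightarrow> x = y"
  using enc_inj by blast

instantiation bool :: enc
begin
definition "enc_bool b = (if b then Bin Tip Tip else Tip)"
instance by standard (auto simp: enc_bool_def split: if_splits)
end

instantiation unit :: enc
begin
definition "enc_unit (u :: unit) = Tip"
instance by standard simp
end

instantiation prod :: (enc, enc) enc
begin
definition "enc_prod p = Bin (enc (fst p)) (enc (snd p))"
instance by standard (auto simp: enc_prod_def enc_eq_iff prod_eq_iff)
end

instantiation option :: (enc) enc
begin
definition "enc_option p = (case p of None \<Rightarrow> Tip | Some x \<Rightarrow> Bin (enc x) Tip)"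
instance by standard (auto simp: enc_option_def enc_eq_iff split: option.splits)
end

instantiation list :: (enc) enc
begin
definition "enc_list xs = foldr (\<lambda>x. Bin (enc x)) xs Tip"
instance
proof
  fix xs ys :: "'a list"
  show "enc xs = enc ys \<Longrightarrow> xs = ys"
  proof (induction xs arbitrary: ys)
    case Nil then show ?case by (cases ys) (auto simp: enc_list_def)
  next
    case (Cons x xs) then show ?case by (cases ys) (auto simp: enc_list_def enc_eq_iff)
  qed
qed
end

fun numof :: "bool list \<Rightarrow> nat" where
  "numof [] = 0"
| "numof (b # bs) = of_bool b + 2 * numof bs"

lemma numof_binary [simp]: "numof (binary n) = n"
proof (induction n rule: less_induct)
  case (less n)
  show ?case
  proof (cases "n < 2")
    case True then show ?thesis by (subst binary.simps) (auto simp: less_2_cases_iff)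
  next
    case False
    then have "numof (binary (n div 2)) = n div 2" by (intro less) auto
    then show ?thesis using False by (subst binary.simps) (auto simp: odd_iff_mod_2_eq_one)
  qed
qed

text \<open>Binary digits keep the size of a number proportional to its length in an instance, where
  the values of \<open>f\<close> may be exponentially large.\<close>

instantiation nat :: enc
begin
definition "enc_nat n = enc (binary n)"
instance by standard (metis enc_nat_def enc_eq_iff numof_binary)
end

fun enc_code :: "code \<Rightarrow> tree" where
  "enc_code (N n) = Bin Tip (enc n)"
| "enc_code (L cs) = Bin (Bin Tip Tip) (foldr (\<lambda>c. Bin (enc_code c)) cs Tip)"

instantiation code :: enc
begin
definition "enc = enc_code"
instance
proof
  have "enc_code c = enc_code d \<longrightarrow> c = d" for c d
  proof (induction c arbitrary: d)
    case (N n) then show ?case by (cases d) (auto simp: enc_eq_iff)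
  next
    case (L cs)
    have "foldr (\<lambda>c. Bin (enc_code c)) cs Tip = foldr (\<lambda>c. Bin (enc_code c)) ds Tip \<longrightarrow> cs = ds" for ds
      using L
    proof (induction cs arbitrary: ds)
      case Nil then show ?case by (cases ds) auto
    next
      case (Cons c cs) then show ?case by (cases ds) auto
    qed
    then show ?case by (cases d) auto
  qed
  then show "enc c = enc d \<Longrightarrow> c = d" for c d :: code by (simp add: enc_code_def)
qed
end

lemma enc_simps [simp]:
  "enc True = Bin Tip Tip" "enc False = Tip" "enc () = Tip" "enc (a, b) = Bin (enc a) (enc b)"
  "enc None = Tip" "enc (Some x) = Bin (enc x) Tip" "enc [] = Tip" "enc (x # xs) = Bin (enc x) (enc xs)"
  "enc (N n) = Bin Tip (enc n)" "enc (L cs) = Bin (Bin Tip Tip) (enc cs)"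
  by (simp_all add: enc_bool_def enc_unit_def enc_prod_def enc_option_def enc_list_def enc_code_def)

lemma sz_simps [simp]:
  "sz True = 3" "sz False = 1" "sz () = 1" "sz (a, b) = Suc (sz a + sz b)"
  "sz None = 1" "sz (Some x) = sz x + 2" "sz [] = 1" "sz (x # xs) = Suc (sz x + sz xs)"
  "sz (N n) = sz n + 2" "sz (L cs) = sz cs + 4"
  by (simp_all add: sz_def)

lemma sz_pos [simp]: "0 < sz x" "Suc 0 \<le> sz x"
  using tsize_pos[of "enc x"] by (simp_all add: sz_def Suc_le_eq)

lemma sz_bool: "sz (b :: bool) \<le> 3"
  by (cases b) auto

lemma sz_append: "sz (xs @ ys) + 1 = sz xs + sz ys"
  by (induction xs) auto

lemma length_sz: "length xs \<le> sz xs"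
  by (induction xs) auto

lemma sz_mem: "x \<in> set xs \<Longrightarrow> sz x \<le> sz xs"
  by (induction xs) auto

lemma sz_rev [simp]: "sz (rev xs) = sz xs"
proof (induction xs)
  case (Cons x xs) then show ?case using sz_append[of "rev xs" "[x]"] by simp
qed simp

lemma sz_drop: "sz (drop k xs) \<le> sz xs"
proof -
  have "sz (take k xs @ drop k xs) + 1 = sz (take k xs) + sz (drop k xs)" by (rule sz_append)
  then show ?thesis using sz_pos(1)[of "take k xs"] by (simp only: append_take_drop_id)
qed

lemma ptime_size: "ptime f \<Longrightarrow> pbounded sz (\<lambda>x. sz (f x))"
  unfolding ptime_def using ptimeT_size[of enc "\<lambda>x. enc (f x)"] by (simp add: pbounded_def sz_def)

section \<open>Closure rules for polynomial-time functions on encoded types\<close>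

named_theorems ptime_intros

lemma ptime_const [ptime_intros]: "ptime (\<lambda>_. c)"
  unfolding ptime_def by (rule ptimeT_const)

lemma ptime_id [ptime_intros]: "ptime (\<lambda>x. x)"
  unfolding ptime_def by (rule ptimeT_self)

lemma ptime_comp: "ptime f \<Longrightarrow> ptime g \<Longrightarrow> ptime (\<lambda>x. f (g x))"
  unfolding ptime_def by (rule ptimeT_comp[of enc "\<lambda>y. enc (f y)"])

lemma ptime_Pair [ptime_intros]: "ptime f \<Longrightarrow> ptime g \<Longrightarrow> ptime (\<lambda>x. (f x, g x))"
  unfolding ptime_def by (simp add: ptimeT_Bin)

text \<open>Functions of several arguments are treated as functions on nested pairs; these forms of
  composition let them be used curried.\<close>

lemma ptime_comp2: "ptime (\<lambda>z. f (fst z) (snd z)) \<Longrightarrow> ptime g \<Longrightarrow> ptime h \<Longrightarrow> ptime (\<lambda>x. f (g x) (h x))"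
  using ptime_comp[OF _ ptime_Pair, of "\<lambda>z. f (fst z) (snd z)" g h] by simp

lemma ptime_comp3:
  "ptime (\<lambda>z. f (fst z) (fst (snd z)) (snd (snd z))) \<Longrightarrow> ptime g \<Longrightarrow> ptime h \<Longrightarrow> ptime k \<Longrightarrow>
   ptime (\<lambda>x. f (g x) (h x) (k x))"
  using ptime_comp[OF _ ptime_Pair[OF _ ptime_Pair], of "\<lambda>z. f (fst z) (fst (snd z)) (snd (snd z))" g h k] by simp

definition left :: "tree \<Rightarrow> tree" where "left t = (case t of Tip \<Rightarrow> Tip | Bin a b \<Rightarrow> a)"
definition right :: "tree \<Rightarrow> tree" where "right t = (case t of Tip \<Rightarrow> Tip | Bin a b \<Rightarrow> b)"

lemma left_right_simps [simp]: "left Tip = Tip" "right Tip = Tip" "left (Bin a b) = a" "right (Bin a b) = b"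
  by (simp_all add: left_def right_def)

lemma ptimeT_left': "ptimeT e F \<Longrightarrow> ptimeT e (\<lambda>x. left (F x))"
  unfolding left_def by (rule ptimeT_comp[OF ptimeT_left])

lemma ptimeT_right': "ptimeT e F \<Longrightarrow> ptimeT e (\<lambda>x. right (F x))"
  unfolding right_def by (rule ptimeT_comp[OF ptimeT_right])

lemma ptime_fst [ptime_intros]: "ptime f \<Longrightarrow> ptime (\<lambda>x. fst (f x))"
  unfolding ptime_def by (drule ptimeT_left') (simp add: enc_prod_def)

lemma ptime_snd [ptime_intros]: "ptime f \<Longrightarrow> ptime (\<lambda>x. snd (f x))"
  unfolding ptime_def by (drule ptimeT_right') (simp add: enc_prod_def)

lemma ptime_if [ptime_intros]:
  "ptime b \<Longrightarrow> ptime f \<Longrightarrow> ptime g \<Longrightarrow> ptime (\<lambda>x. if b x then f x else g x)"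
proof -
  assume "ptime b" "ptime f" "ptime g"
  then have "ptimeT enc (\<lambda>x. if enc (b x) = Tip then enc (g x) else enc (f x))"
    unfolding ptime_def by (rule ptimeT_if)
  moreover have "(\<lambda>x. if enc (b x) = Tip then enc (g x) else enc (f x)) = (\<lambda>x. enc (if b x then f x else g x))"
    by (auto simp: enc_bool_def)
  ultimately show ?thesis unfolding ptime_def by simp
qed

lemma ptime_eq [ptime_intros]:
  "ptime f \<Longrightarrow> ptime g \<Longrightarrow> ptime (\<lambda>x. f x = g x)"
proof -
  assume "ptime f" "ptime g"
  then have "ptimeT enc (\<lambda>x. case Bin (enc (f x)) (enc (g x)) of Tip \<Rightarrow> Tip | Bin a b \<Rightarrow> if a = b then Bin Tip Tip else Tip)"
    unfolding ptime_def by (intro ptimeT_comp[OF ptimeT_eq] ptimeT_Bin)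
  then show ?thesis unfolding ptime_def by (simp add: enc_bool_def enc_eq_iff)
qed

lemma ptime_not [ptime_intros]: "ptime f \<Longrightarrow> ptime (\<lambda>x. \<not> f x)"
proof -
  assume "ptime f"
  moreover have "(\<lambda>x. \<not> f x) = (\<lambda>x. if f x then False else True)" by auto
  ultimately show ?thesis by (simp only: ptime_if ptime_const)
qed

lemma ptime_and [ptime_intros]: "ptime f \<Longrightarrow> ptime g \<Longrightarrow> ptime (\<lambda>x. f x \<and> g x)"
proof -
  assume "ptime f" "ptime g"
  moreover have "(\<lambda>x. f x \<and> g x) = (\<lambda>x. if f x then g x else False)" by auto
  ultimately show ?thesis by (simp only: ptime_if ptime_const)
qed

lemma ptime_or [ptime_intros]: "ptime f \<Longrightarrow> ptime g \<Longrightarrow> ptime (\<lambda>x. f x \<or> g x)"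
proof -
  assume "ptime f" "ptime g"
  moreover have "(\<lambda>x. f x \<or> g x) = (\<lambda>x. if f x then True else g x)" by auto
  ultimately show ?thesis by (simp only: ptime_if ptime_const)
qed

lemma ptime_imp [ptime_intros]: "ptime f \<Longrightarrow> ptime g \<Longrightarrow> ptime (\<lambda>x. f x \<longrightarrow> g x)"
proof -
  assume "ptime f" "ptime g"
  moreover have "(\<lambda>x. f x \<longrightarrow> g x) = (\<lambda>x. if f x then g x else True)" by auto
  ultimately show ?thesis by (simp only: ptime_if ptime_const)
qed

lemma ptime_Cons [ptime_intros]: "ptime f \<Longrightarrow> ptime g \<Longrightarrow> ptime (\<lambda>x. f x # g x)"
  unfolding ptime_def by (simp add: ptimeT_Bin)

lemma ptime_tl [ptime_intros]: "ptime f \<Longrightarrow> ptime (\<lambda>x. tl (f x))"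
proof -
  assume "ptime f"
  then have "ptimeT enc (\<lambda>x. right (enc (f x)))" unfolding ptime_def by (rule ptimeT_right')
  moreover have "right (enc xs) = enc (tl xs)" for xs :: "'b list" by (cases xs) auto
  ultimately show ?thesis unfolding ptime_def by simp
qed

lemma ptime_Some [ptime_intros]: "ptime f \<Longrightarrow> ptime (\<lambda>x. Some (f x))"
  unfolding ptime_def by (simp add: ptimeT_Bin ptimeT_const)

lemma ptime_N [ptime_intros]: "ptime f \<Longrightarrow> ptime (\<lambda>x. N (f x))"
  unfolding ptime_def by (simp add: ptimeT_Bin ptimeT_const)

lemma ptime_L [ptime_intros]: "ptime f \<Longrightarrow> ptime (\<lambda>x. L (f x))"
  unfolding ptime_def by (simp add: ptimeT_Bin ptimeT_const)

lemma ptime_Let [ptime_intros]: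
  "ptime g \<Longrightarrow> ptime (\<lambda>z. f (fst z) (snd z)) \<Longrightarrow> ptime (\<lambda>x. let y = g x in f x y)"
  using ptime_comp2[of f "\<lambda>x. x" g] ptime_id by simp

text \<open>For partial operations such as \<open>hd\<close>: their value at the undefined argument
  is unspecified but fixed, so it enters as the constant tree \<open>c\<close>.\<close>

lemma ptimeT_enc_if:
  "ptimeT enc (\<lambda>x. t (enc (f x))) \<Longrightarrow> ptimeT enc (\<lambda>x. r (enc (f x))) \<Longrightarrow>
   (\<And>y. enc (h y) = (if t (enc y) = Tip then c else r (enc y))) \<Longrightarrow> ptime (\<lambda>x. h (f x))"
  unfolding ptime_def using ptimeT_if[of enc "\<lambda>x. t (enc (f x))" "\<lambda>x. r (enc (f x))" "\<lambda>_. c"] ptimeT_const by auto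

lemma ptime_hd [ptime_intros]:
  fixes f :: "_ \<Rightarrow> ('a::enc) list"
  assumes "ptime f" shows "ptime (\<lambda>x. hd (f x))"
proof (rule ptimeT_enc_if[where f = f and h = hd and t = "\<lambda>x. x" and r = left and c = "enc (hd [] :: 'a)"])
  show "enc (hd y) = (if enc y = Tip then enc (hd [] :: 'a) else left (enc y))" for y :: "'a list"
    by (cases y) auto
qed (use assms in \<open>auto simp: ptime_def intro: ptimeT_left'\<close>)

lemma ptime_the [ptime_intros]:
  fixes f :: "_ \<Rightarrow> ('a::enc) option"
  assumes "ptime f" shows "ptime (\<lambda>x. the (f x))"
proof (rule ptimeT_enc_if[where f = f and h = the and t = "\<lambda>x. x" and r = left and c = "enc (the None :: 'a)"])
  show "enc (the y) = (if enc y = Tip then enc (the None :: 'a) else left (enc y))" for y :: "'a option"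
    by (cases y) auto
qed (use assms in \<open>auto simp: ptime_def intro: ptimeT_left'\<close>)

lemma ptime_case_list [ptime_intros]:
  assumes "ptime l" "ptime a" "ptime (\<lambda>z. b (fst z) (fst (snd z)) (snd (snd z)))"
  shows "ptime (\<lambda>x. case l x of [] \<Rightarrow> a x | y # ys \<Rightarrow> b x y ys)"
proof -
  have "ptime (\<lambda>x. if l x = [] then a x else b x (hd (l x)) (tl (l x)))"
    using assms by (intro ptime_intros ptime_comp3[OF assms(3)])
  moreover have "(case l x of [] \<Rightarrow> a x | y # ys \<Rightarrow> b x y ys) = (if l x = [] then a x else b x (hd (l x)) (tl (l x)))" for x
    by (cases "l x") auto
  ultimately show ?thesis by simp
qed

lemma ptime_case_option [ptime_intros]:
  assumes "ptime l" "ptime a" "ptime (\<lambda>z. b (fst z) (snd z))"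
  shows "ptime (\<lambda>x. case l x of None \<Rightarrow> a x | Some y \<Rightarrow> b x y)"
proof -
  have "ptime (\<lambda>x. if l x = None then a x else b x (the (l x)))"
    using assms by (intro ptime_intros ptime_comp2[OF assms(3)])
  moreover have "(case l x of None \<Rightarrow> a x | Some y \<Rightarrow> b x y) = (if l x = None then a x else b x (the (l x)))" for x
    by (cases "l x") auto
  ultimately show ?thesis by simp
qed

fun num :: "code \<Rightarrow> nat" where
  "num (N n) = n"
| "num (L cs) = 0"

fun kids :: "code \<Rightarrow> code list" where
  "kids (N n) = []"
| "kids (L cs) = cs"

lemma ptime_num [ptime_intros]: "ptime f \<Longrightarrow> ptime (\<lambda>x. num (f x))"
proof -
  assume "ptime f"
  then have f: "ptimeT enc (\<lambda>x. enc (f x))" by (simp add: ptime_def)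
  have "ptimeT enc (\<lambda>x. if left (enc (f x)) = Tip then right (enc (f x)) else enc (0 :: nat))"
    by (intro ptimeT_if ptimeT_left' ptimeT_right' ptimeT_const f)
  moreover have "enc (num c) = (if left (enc c) = Tip then right (enc c) else enc (0 :: nat))" for c
    by (cases c) auto
  ultimately show ?thesis by (simp add: ptime_def)
qed

lemma ptime_kids [ptime_intros]: "ptime f \<Longrightarrow> ptime (\<lambda>x. kids (f x))"
proof -
  assume "ptime f"
  then have f: "ptimeT enc (\<lambda>x. enc (f x))" by (simp add: ptime_def)
  have "ptimeT enc (\<lambda>x. if left (enc (f x)) = Tip then Tip else right (enc (f x)))"
    by (intro ptimeT_if ptimeT_left' ptimeT_right' ptimeT_const f)
  moreover have "enc (kids c) = (if left (enc c) = Tip then Tip else right (enc c))" for c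
    by (cases c) auto
  ultimately show ?thesis by (simp add: ptime_def)
qed

lemma ptime_binary [ptime_intros]: "ptime f \<Longrightarrow> ptime (\<lambda>x. binary (f x))"
  unfolding ptime_def by (simp add: enc_nat_def)

text \<open>A number and its digit list are the same tree, so the conversion is the identity on
  trees. The premise says that only digit lists of numbers occur.\<close>

lemma ptime_numof: "(\<And>x. binary (numof (f x)) = f x) \<Longrightarrow> ptime f \<Longrightarrow> ptime (\<lambda>x. numof (f x))"
  unfolding ptime_def by (simp add: enc_nat_def)

lemma pbounded_sz: "pbounded sz g \<longleftrightarrow> (\<exists>p. \<forall>x. g x \<le> poly p (sz x))"
  by (simp add: pbounded_def)

section \<open>Folds and list functions\<close>

lemma foldl_step:
  fixes f :: "'x \<Rightarrow> 'b \<Rightarrow> 'a \<Rightarrow> 'b"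
  defines "g \<equiv> \<lambda>s. case fst (snd s) of [] \<Rightarrow> s | a # l \<Rightarrow> (fst s, l, f (fst s) (snd (snd s)) a)"
  shows "k \<le> length l \<Longrightarrow> (g ^^ k) (x, l, i) = (x, drop k l, foldl (f x) i (take k l))"
proof (induction k)
  case (Suc k)
  then have "drop k l = l ! k # drop (Suc k) l" "take (Suc k) l = take k l @ [l ! k]"
    by (simp_all add: Cons_nth_drop_Suc take_Suc_conv_app_nth)
  with Suc show ?case by (simp add: g_def)
qed simp

text \<open>The fold is a loop on triples of context, remaining list and accumulator that goes on
  while the remaining list is non-empty. Only the accumulator can grow, so only its size is assumed
  to be bounded.\<close>

lemma ptime_foldl:
  fixes f :: "'x::enc \<Rightarrow> 'b::enc \<Rightarrow> 'a::enc \<Rightarrow> 'b"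
  assumes f: "ptime (\<lambda>z. f (fst z) (fst (snd z)) (snd (snd z)))" and l: "ptime l" and i: "ptime i"
    and bound: "\<And>x k. k \<le> length (l x) \<Longrightarrow> sz (foldl (f x) (i x) (take k (l x))) \<le> poly r (sz x)"
  shows "ptime (\<lambda>x. foldl (f x) (i x) (l x))"
proof -
  define g where "g = (\<lambda>s :: 'x \<times> 'a list \<times> 'b. case fst (snd s) of [] \<Rightarrow> s | a # l \<Rightarrow> (fst s, l, f (fst s) (snd (snd s)) a))"
  have gk: "k \<le> length l \<Longrightarrow> (g ^^ k) (x, l, i) = (x, drop k l, foldl (f x) i (take k l))" for k l x i
    unfolding g_def by (rule foldl_step)
  have "ptime g"
    unfolding g_def by (intro ptime_intros ptime_comp3[OF f])
  then have g: "ptimeT enc (\<lambda>s. enc (g s))" by (simp add: ptime_def)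
  have l': "pbounded sz (\<lambda>x. sz (l x))" using ptime_size[OF l] .
  then obtain q where q: "\<And>x. sz (l x) \<le> poly q (sz x)" unfolding pbounded_sz by blast
  have "ptimeT enc (\<lambda>x. enc ((g ^^ length (l x)) (x, l x, i x)))"
  proof (rule ptimeT_while[OF _ g])
    show "ptimeT enc (\<lambda>x. enc (x, l x, i x))"
      using ptime_Pair[OF ptime_id ptime_Pair[OF l i]] by (simp add: ptime_def)
    show "ptimeT enc (\<lambda>s :: 'x \<times> 'a list \<times> 'b. enc (fst (snd s)))"
      using ptime_fst[OF ptime_snd[OF ptime_id]] by (simp add: ptime_def)
    show "enc (fst (snd ((g ^^ length (l x)) (x, l x, i x)))) = Tip" for x by (simp add: gk)
    show "enc (fst (snd ((g ^^ s) (x, l x, i x)))) \<noteq> Tip" if s: "s < length (l x)" for x s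
    proof -
      have "drop s (l x) \<noteq> []" using s by simp
      then show ?thesis using s by (cases "drop s (l x)") (auto simp: gk)
    qed
    show "pbounded (\<lambda>x. tsize (enc x)) (\<lambda>x. length (l x))"
      using pbounded_le[OF l' length_sz] by (simp add: sz_def[abs_def])
    \<comment> \<open>The two pair nodes and the context give \<open>[:2, 1:]\<close>, the remaining
      list gives \<open>q\<close> and the accumulator \<open>r\<close>.\<close>
    show "tsize (enc ((g ^^ s) (x, l x, i x))) \<le> poly ([:2, 1:] + q + r) (tsize (enc x))" if "s \<le> length (l x)" for x s
    proof -
      have "sz (drop s (l x)) \<le> poly q (sz x)" using sz_drop q le_trans by blast
      then have "sz ((g ^^ s) (x, l x, i x)) \<le> poly ([:2, 1:] + q + r) (sz x)"
        using bound[OF that] that by (simp add: gk)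
      then show ?thesis by (simp add: sz_def)
    qed
  qed
  then have "ptime (\<lambda>x. (g ^^ length (l x)) (x, l x, i x))" by (simp add: ptime_def)
  from ptime_snd[OF ptime_snd[OF this]] show ?thesis by (simp add: gk)
qed

text \<open>If a step enlarges the accumulator by at most a polynomial in context and element, then
  after \<open>k\<close> steps the growth is at most \<open>k\<close> such terms. A factor on the
  accumulator is excluded, as it would lead to exponential size.\<close>

lemma ptime_foldl_additive:
  fixes f :: "'x::enc \<Rightarrow> 'b::enc \<Rightarrow> 'a::enc \<Rightarrow> 'b"
  assumes f: "ptime (\<lambda>z. f (fst z) (fst (snd z)) (snd (snd z)))" and l: "ptime l" and i: "ptime i"
    and add: "\<And>x acc a. sz (f x acc a) \<le> sz acc + poly r (sz x + sz a)"
  shows "ptime (\<lambda>x. foldl (f x) (i x) (l x))"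
proof -
  have "pbounded sz (\<lambda>x. sz (i x) + sz (l x) * poly r (sz x + sz (l x)))"
    by (intro pbounded_intros ptime_size i l)
  then obtain p where p: "\<And>x. sz (i x) + sz (l x) * poly r (sz x + sz (l x)) \<le> poly p (sz x)"
    unfolding pbounded_sz by blast
  show ?thesis
  proof (rule ptime_foldl[OF f l i])
    fix x k assume k: "k \<le> length (l x)"
    have "k \<le> length (l x) \<Longrightarrow> sz (foldl (f x) (i x) (take k (l x))) \<le> sz (i x) + k * poly r (sz x + sz (l x))"
    proof (induction k)
      case (Suc k)
      let ?a = "l x ! k"
      have "sz ?a \<le> sz (l x)" using Suc.prems by (intro sz_mem) simp
      then have "poly r (sz x + sz ?a) \<le> poly r (sz x + sz (l x))" by (intro nat_poly_mono) simp
      moreover have "take (Suc k) (l x) = take k (l x) @ [?a]" using Suc.prems by (simp add: take_Suc_conv_app_nth)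
      ultimately show ?case
        using Suc add[of x "foldl (f x) (i x) (take k (l x))" ?a] by simp
    qed simp
    moreover have "k * poly r (sz x + sz (l x)) \<le> sz (l x) * poly r (sz x + sz (l x))"
      using k length_sz[of "l x"] by (intro mult_right_mono) auto
    ultimately show "sz (foldl (f x) (i x) (take k (l x))) \<le> poly p (sz x)"
      using k p[of x] by linarith
  qed
qed

lemma ptime_size2:
  assumes "ptime (\<lambda>z. f (fst z) (snd z))"
  obtains r where "\<And>x a. sz (f x a) \<le> poly r (sz x + sz a)"
proof -
  obtain p where p: "\<And>z. sz (f (fst z) (snd z)) \<le> poly p (sz z)"
    using ptime_size[OF assms] unfolding pbounded_sz by blast
  have "sz (f x a) \<le> poly (p \<circ>\<^sub>p [:1, 1:]) (sz x + sz a)" for x a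
    using p[of "(x, a)"] by (simp add: poly_pcompose)
  then show ?thesis by (rule that)
qed

lemma foldl_rev_map: "foldl (\<lambda>acc a. f a # acc) acc l = rev (map f l) @ acc"
  by (induction l arbitrary: acc) auto

lemma ptime_rev [ptime_intros]: "ptime l \<Longrightarrow> ptime (\<lambda>x. rev (l x))"
proof -
  assume "ptime l"
  then have "ptime (\<lambda>x. foldl (\<lambda>acc a. a # acc) [] (l x))"
    by (intro ptime_foldl_additive[where r = "[:1, 1:]"] ptime_intros) simp_all
  then show ?thesis by (simp add: foldl_rev_map[where f = "\<lambda>x. x"])
qed

lemma ptime_append [ptime_intros]: "ptime l \<Longrightarrow> ptime m \<Longrightarrow> ptime (\<lambda>x. l x @ m x)"
proof -
  assume "ptime l" "ptime m"
  then have "ptime (\<lambda>x. foldl (\<lambda>acc a. a # acc) (m x) (rev (l x)))"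
    by (intro ptime_foldl_additive[where r = "[:1, 1:]"] ptime_intros) simp_all
  then show ?thesis by (simp add: foldl_rev_map[where f = "\<lambda>x. x"])
qed

lemma ptime_map [ptime_intros]:
  assumes "ptime (\<lambda>z. f (fst z) (snd z))" "ptime l"
  shows "ptime (\<lambda>x. map (f x) (l x))"
proof -
  obtain r where r: "\<And>x a. sz (f x a) \<le> poly r (sz x + sz a)" using ptime_size2[OF assms(1)] by blast
  have "ptime (\<lambda>x. foldl (\<lambda>acc a. f x a # acc) [] (l x))"
    by (intro ptime_foldl_additive[where r = "[:1:] + r"] ptime_intros ptime_comp2[OF assms(1)] assms(2)) (simp_all add: r)
  from ptime_rev[OF this] show ?thesis by (simp add: foldl_rev_map)
qed

lemma foldl_append: "foldl (@) acc ls = acc @ concat ls"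
  by (induction ls arbitrary: acc) auto

lemma ptime_concat [ptime_intros]: "ptime l \<Longrightarrow> ptime (\<lambda>x. concat (l x))"
proof -
  assume "ptime l"
  have "ptime (\<lambda>x. foldl (@) [] (l x))"
  proof (rule ptime_foldl_additive[where r = "[:0, 1:]" and f = "\<lambda>_. (@)"])
    show "sz (acc @ a) \<le> sz acc + poly [:0, 1:] (sz x + sz a)" for x :: 'a and acc a :: "'b list"
      using sz_append[of acc a] by simp
  qed (intro ptime_intros \<open>ptime l\<close>)+
  then show ?thesis by (simp add: foldl_append)
qed

lemma foldl_rev_filter: "foldl (\<lambda>acc a. if P a then a # acc else acc) acc l = rev (filter P l) @ acc"
  by (induction l arbitrary: acc) auto

lemma ptime_filter [ptime_intros]:
  assumes "ptime (\<lambda>z. P (fst z) (snd z))" "ptime l"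
  shows "ptime (\<lambda>x. filter (P x) (l x))"
proof -
  have "ptime (\<lambda>x. foldl (\<lambda>acc a. if P x a then a # acc else acc) [] (l x))"
    by (intro ptime_foldl_additive[where r = "[:1, 1:]"] ptime_intros ptime_comp2[OF assms(1)] assms(2)) simp_all
  from ptime_rev[OF this] show ?thesis by (simp add: foldl_rev_filter)
qed

lemma ptime_Ball [ptime_intros]:
  assumes "ptime (\<lambda>z. P (fst z) (snd z))" "ptime l"
  shows "ptime (\<lambda>x. \<forall>a \<in> set (l x). P x a)"
proof -
  have "ptime (\<lambda>x. filter (\<lambda>a. \<not> P x a) (l x) = [])"
    by (intro ptime_intros ptime_comp2[OF assms(1)] assms)
  then show ?thesis by (simp add: filter_empty_conv)
qed

lemma ptime_Bex [ptime_intros]: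
  assumes "ptime (\<lambda>z. P (fst z) (snd z))" "ptime l"
  shows "ptime (\<lambda>x. \<exists>a \<in> set (l x). P x a)"
proof -
  have "ptime (\<lambda>x. \<not> (\<forall>a \<in> set (l x). \<not> P x a))"
    by (intro ptime_intros ptime_comp2[OF assms(1)] assms)
  then show ?thesis by simp
qed

lemma ptime_mem [ptime_intros]: "ptime f \<Longrightarrow> ptime l \<Longrightarrow> ptime (\<lambda>x. f x \<in> set (l x))"
proof -
  assume f: "ptime f" and "ptime l"
  then have "ptime (\<lambda>x. \<exists>a \<in> set (l x). a = f x)"
    by (intro ptime_intros ptime_comp[OF f])
  then show ?thesis by simp
qed

lemma ptime_distinct [ptime_intros]:
  fixes l :: "'x::enc \<Rightarrow> 'a::enc list"
  assumes "ptime l" shows "ptime (\<lambda>x. distinct (l x))"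
proof -
  let ?f = "\<lambda>acc (a :: 'a). (fst acc \<and> a \<notin> set (snd acc), a # snd acc)"
  have "ptime (\<lambda>x. foldl ?f (True, []) (l x))"
  proof (rule ptime_foldl_additive[where r = "[:3, 1:]"])
    show "sz (?f acc a) \<le> sz acc + poly [:3, 1:] (sz x + sz a)" for x :: 'x and acc and a :: 'a
    proof (cases acc)
      case (Pair b m)
      have "sz (b \<and> a \<notin> set m) \<le> 2 + sz b"
        using sz_bool[of "b \<and> a \<notin> set m"] sz_pos(2)[of b] by linarith
      then show ?thesis using Pair by simp
    qed
  qed (intro ptime_intros assms)+
  moreover have "foldl ?f (b, m) l = (b \<and> distinct l \<and> set l \<inter> set m = {}, rev l @ m)" for b m l
    by (induction l arbitrary: b m) auto
  ultimately show ?thesis using ptime_fst[of "\<lambda>x. foldl ?f (True, []) (l x)"] by simp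
qed

section \<open>From programs to complexity classes\<close>

subsection \<open>Polynomial time\<close>

text \<open>The last input bit is on top, so the list is built from its end on stack 1: putting
  \<open>False\<close> in front pushes \<open>[True, False]\<close>, putting \<open>True\<close> in
  front pushes \<open>[True, True, False, False]\<close>, each being the new node followed by its
  element. Two moves then bring the list to stack 0 in the same order.\<close>

definition load_input :: cmd where
  "load_input = Push 1 False ;;
     While 0 (Case 0 Skip (push_list 1 [True, False]) (push_list 1 [True, True, False, False])) ;;
     move_stack 1 2 ;; move_stack 2 0"

lemma exec_load_loop:
  "exec (While 0 (Case 0 Skip (push_list 1 [True, False]) (push_list 1 [True, True, False, False])))
     (st 1 u (ser (enc l)) [] [] []) (15 * length u + 1) (st 1 [] (ser (enc (rev u @ l))) [] [] [])"
proof (induction u arbitrary: l)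
  case Nil
  then show ?case by (auto simp: st_1 intro!: exec_While_Nil)
next
  case (Cons b u)
  have "exec (Case 0 Skip (push_list 1 [True, False]) (push_list 1 [True, True, False, False]))
    (st 1 (b # u) (ser (enc l)) [] [] []) 14 (st 1 u (ser (enc (b # l))) [] [] [])"
    by (rule exec_Case_Cons[where b = b and l = u and \<sigma>' = "st 1 u (ser (enc l)) [] [] []" and n = 13])
      (auto simp: st_1 fun_eq_iff simp del: push_list.simps intro!: exec_push_list)
  moreover have "exec (While 0 (Case 0 Skip (push_list 1 [True, False]) (push_list 1 [True, True, False, False])))
     (st 1 u (ser (enc (b # l))) [] [] []) (15 * length u + 1) (st 1 [] (ser (enc (rev u @ b # l))) [] [] [])"
    by (rule Cons.IH)
  ultimately have "exec (While 0 (Case 0 Skip (push_list 1 [True, False]) (push_list 1 [True, True, False, False])))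
     (st 1 (b # u) (ser (enc l)) [] [] []) (15 * length (b # u) + 1) (st 1 [] (ser (enc (rev u @ b # l))) [] [] [])"
    by (rule exec_While_Cons[rotated]) (auto simp: st_1)
  then show ?case by simp
qed

lemma sz_bits: "sz (w :: bool list) \<le> 4 * length w + 1"
proof (induction w)
  case (Cons b w) then show ?case by (cases b) auto
qed simp

lemma exec_load_input: "exec load_input (input_store w) (60 * length w + 30) ((\<lambda>_. [])(0 := ser (enc w)))"
proof -
  have 1: "exec (Push 1 False) (input_store w) 2 (st 1 (rev w) (ser (enc ([] :: bool list))) [] [] [])"
    by (rule exec_Push) (auto simp: input_store_def st_1 fun_eq_iff)
  have 2: "exec (move_stack 1 2) (st 1 [] (ser (enc w)) [] [] []) (16 * length w + 5) (st 1 [] [] (rev (ser (enc w))) [] [])"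
    by (rule exec_move) (use sz_bits[of w] in \<open>auto simp: st_1 fun_eq_iff sz_def\<close>)
  have 3: "exec (move_stack 2 0) (st 1 [] [] (rev (ser (enc w))) [] []) (16 * length w + 5) (st 1 (ser (enc w)) [] [] [] [])"
    by (rule exec_move) (use sz_bits[of w] in \<open>auto simp: st_1 fun_eq_iff sz_def\<close>)
  have 4: "st 1 (ser (enc w)) [] [] [] [] = (\<lambda>_. [])(0 := ser (enc w))" by (auto simp: st_1 fun_eq_iff)
  have 5: "exec (While 0 (Case 0 Skip (push_list 1 [True, False]) (push_list 1 [True, True, False, False])))
     (st 1 (rev w) (ser (enc ([] :: bool list))) [] [] []) (15 * length w + 1) (st 1 [] (ser (enc w)) [] [] [])"
    using exec_load_loop[of "rev w" "[]"] by simp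
  show ?thesis unfolding load_input_def 4[symmetric]
    by (rule exec_Seq[OF 1 exec_Seq[OF 5 exec_Seq[OF 2 3 order_refl] order_refl]]) simp
qed

lemma regs_below_load_input: "regs_below 5 load_input"
  by (simp add: load_input_def)

text \<open>A tape shows its stack from the bottom upwards, so pushing the bits in order, which
  yields \<open>rev y\<close> as a stack, spells \<open>y\<close> on the tape. After an element
  \<open>True\<close> the two \<open>Tip\<close> symbols of its code are popped.\<close>

definition write_output :: "nat \<Rightarrow> cmd" where
  "write_output r = While 0 (Case 0 Skip Skip
     (Case 0 Skip (Push r False) (Case 0 Skip Skip Skip ;; Case 0 Skip Skip Skip ;; Push r True)))"

lemma exec_write_output:
  "r \<noteq> 0 \<Longrightarrow> \<sigma> 0 = ser (enc y) \<Longrightarrow> exec (write_output r) \<sigma> (12 * length y + 4) (\<sigma>(0 := [], r := rev y @ \<sigma> r))"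
proof (induction y arbitrary: \<sigma>)
  case Nil
  have "exec (Case 0 Skip Skip (Case 0 Skip (Push r False) (Case 0 Skip Skip Skip ;; Case 0 Skip Skip Skip ;; Push r True)))
     \<sigma> 2 (\<sigma>(0 := []))"
    by (rule exec_Case_Cons[where b = False and l = "[]" and \<sigma>' = "\<sigma>(0 := [])" and n = 1]) (use Nil in \<open>auto intro: exec_Skip\<close>)
  then have e: "exec (write_output r) \<sigma> 4 (\<sigma>(0 := []))"
    unfolding write_output_def
    by (rule exec_While_Cons[rotated, where m = 1]) (use Nil in \<open>auto intro: exec_While_Nil\<close>)
  have eq: "\<sigma>(0 := [], r := rev [] @ \<sigma> r) = \<sigma>(0 := [])" using Nil(1) by (auto simp: fun_eq_iff)
  show ?case unfolding eq list.size mult_0_right add_0 by (rule e)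
next
  case (Cons b y)
  let ?\<sigma> = "\<sigma>(0 := ser (enc y), r := b # \<sigma> r)"
  let ?c = "Case 0 Skip (Push r False) (Case 0 Skip Skip Skip ;; Case 0 Skip Skip Skip ;; Push r True)"
  have 1: "exec ?c (\<sigma>(0 := ser (enc b) @ ser (enc y))) 10 ?\<sigma>"
  proof (cases b)
    case True
    have "exec (Case 0 Skip Skip Skip ;; Case 0 Skip Skip Skip ;; Push r True) (\<sigma>(0 := [False, False] @ ser (enc y))) 8 ?\<sigma>"
      by (rule exec_Seq[where \<sigma>' = "\<sigma>(0 := [False] @ ser (enc y))" and n = 2 and m = 5, OF exec_pop
           exec_Seq[where \<sigma>' = "\<sigma>(0 := ser (enc y))" and n = 2 and m = 2, OF exec_pop exec_Push]])
        (use Cons(2) True in \<open>auto simp: fun_eq_iff\<close>)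
    then show ?thesis
      by (intro exec_Case_Cons[where b = True and l = "[False, False] @ ser (enc y)" and
            \<sigma>' = "\<sigma>(0 := [False, False] @ ser (enc y))" and n = 8]) (use True in auto)
  next
    case False
    have "exec (Push r False) (\<sigma>(0 := ser (enc y))) 2 ?\<sigma>"
      by (rule exec_Push) (use Cons(2) False in \<open>auto simp: fun_eq_iff\<close>)
    then show ?thesis
      by (intro exec_Case_Cons[where b = False and l = "ser (enc y)" and \<sigma>' = "\<sigma>(0 := ser (enc y))" and n = 2])
        (use False in auto)
  qed
  have "exec (Case 0 Skip Skip ?c) \<sigma> 11 ?\<sigma>"
    by (rule exec_Case_Cons[where b = True and l = "ser (enc b) @ ser (enc y)" and
          \<sigma>' = "\<sigma>(0 := ser (enc b) @ ser (enc y))" and n = 10]) (use Cons(3) 1 in auto)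
  moreover have "exec (write_output r) ?\<sigma> (12 * length y + 4) (?\<sigma>(0 := [], r := rev y @ ?\<sigma> r))"
    by (rule Cons.IH) (use Cons(2) in auto)
  ultimately have e: "exec (write_output r) \<sigma> (12 * length (b # y) + 4) (?\<sigma>(0 := [], r := rev y @ ?\<sigma> r))"
    unfolding write_output_def by (rule exec_While_Cons[rotated]) (use Cons(3) in auto)
  have eq: "?\<sigma>(0 := [], r := rev y @ ?\<sigma> r) = \<sigma>(0 := [], r := rev (b # y) @ \<sigma> r)"
    using Cons(2) by (auto simp: fun_eq_iff)
  from e show ?case unfolding eq .
qed

definition bounded_by :: "nat \<Rightarrow> store \<Rightarrow> bool" where
  "bounded_by B \<sigma> \<longleftrightarrow> (\<forall>r. length (\<sigma> r) \<le> B)"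

lemma sstep_length: "length (snd (sstep C) r) \<le> Suc (length (snd C r))"
  by (induction C rule: sstep.induct) (auto split: list.split)

lemma sstep_iter_length: "length (snd ((sstep ^^ i) C) r) \<le> length (snd C r) + i"
proof (induction i)
  case (Suc i) then show ?case using sstep_length[of "(sstep ^^ i) C" r] by simp
qed simp

lemma ptime_polytime_computable:
  fixes g :: "bool list \<Rightarrow> bool list"
  assumes "ptime g"
  shows "polytime_computable g"
proof -
  obtain c K p where c: "implements c K (\<lambda>x. poly p (tsize (enc x))) enc (\<lambda>x. enc (g x))"
    using assms unfolding ptime_def ptimeT_def by blast
  obtain q where q: "\<And>x. sz (g x) \<le> poly q (sz x)" using ptime_size[OF assms] unfolding pbounded_sz by blast
  \<comment> \<open>Large enough for the stacks of \<open>load_input\<close> and of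
    \<open>c\<close>; with \<open>Suc R\<close> tapes, stack \<open>R\<close> is the last one and
    thus the output tape.\<close>
  define R where "R = max K 5"
  \<comment> \<open>The final push makes the machine halt in its accepting state.\<close>
  let ?p = "load_input ;; c ;; write_output R ;; Push 0 True"
  have K: "regs_below (Suc R) ?p"
    using c regs_below_load_input regs_below_mono[of K c "Suc R"] regs_below_mono[of 5 load_input "Suc R"]
    by (auto simp: implements_def R_def write_output_def)
  let ?T = "\<lambda>n. Suc (60 * n + 30 + Suc (poly p (4 * n + 1) + Suc (12 * poly q (4 * n + 1) + 4 + 2)))"
  have run: "exec ?p (input_store w) (?T (length w)) ((\<lambda>_. [])(0 := [True], R := rev (g w)))" for w
  proof -
    have 1: "exec c ((\<lambda>_. [])(0 := ser (enc w))) (poly p (4 * length w + 1)) ((\<lambda>_. [])(0 := ser (enc (g w))))"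
      using c sz_bits[of w] by (auto simp: implements_def sz_def intro: exec_mono nat_poly_mono)
    have "length (g w) \<le> poly q (4 * length w + 1)"
      using q[of w] length_sz[of "g w"] nat_poly_mono[OF sz_bits[of w], of q] by linarith
    then have 2: "exec (write_output R) ((\<lambda>_. [])(0 := ser (enc (g w)))) (12 * poly q (4 * length w + 1) + 4)
        ((\<lambda>_. [])(0 := [], R := rev (g w)))"
      using exec_mono[OF exec_write_output[of R "(\<lambda>_. [])(0 := ser (enc (g w)))" "g w"]]
      by (auto simp: R_def)
    have 3: "exec (Push 0 True) ((\<lambda>_. [])(0 := [], R := rev (g w))) 2 ((\<lambda>_. [])(0 := [True], R := rev (g w)))"
      by (rule exec_Push) (auto simp: R_def fun_eq_iff)
    show ?thesis
      by (rule exec_Seq[OF exec_load_input exec_Seq[OF 1 exec_Seq[OF 2 3 order_refl] order_refl] order_refl])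
  qed
  have "pbounded (\<lambda>n. n) (\<lambda>n. n + 3 + ?T n)" by (intro pbounded_intros)
  then obtain r where r: "\<And>n. n + 3 + ?T n \<le> poly r n" unfolding pbounded_def by blast
  have "\<exists>t \<le> poly r (length w). fst (tm_run (machine ?p (Suc R)) w t) = accept (machine ?p (Suc R)) \<and>
      outputs (tm_run (machine ?p (Suc R)) w t) (g w)" for w
  proof -
    let ?\<sigma> = "(\<lambda>_. [])(0 := [True], R := rev (g w)) :: store"
    obtain n where n: "n \<le> ?T (length w)" "runs ?p (input_store w) n ?\<sigma>" using run unfolding exec_def by blast
    have "(sstep ^^ n) ([?p], input_store w) = ([], ?\<sigma>)" using runs_sstep[OF n(2)] .
    moreover have "length (snd ((sstep ^^ i) ([?p], input_store w)) r) \<le> length w + n" if "i \<le> n" for i r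
      using sstep_iter_length[of i "([?p], input_store w)" r] that by (auto simp: input_store_def split: if_splits)
    ultimately obtain t where t: "t \<le> length w + 3 + n" "tm_run (machine ?p (Suc R)) w t =
     ((if ?\<sigma> 0 \<noteq> [] \<and> hd (?\<sigma> 0) then accept (machine ?p (Suc R)) else reject (machine ?p (Suc R))), snd (rep ?p (Suc R) ([], ?\<sigma>)))"
      using machine_run(1)[OF K, of n w ?\<sigma> "length w + n"] by blast
    have "?\<sigma> 0 = [True]" "?\<sigma> R = rev (g w)" by (auto simp: R_def)
    then have "fst (tm_run (machine ?p (Suc R)) w t) = accept (machine ?p (Suc R))"
      "outputs (tm_run (machine ?p (Suc R)) w t) (g w)"
      unfolding t(2) by (auto simp: outputs_def)
    moreover have "t \<le> poly r (length w)" using t(1) n(1) r[of "length w"] by linarith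
    ultimately show ?thesis by blast
  qed
  then show ?thesis
    unfolding polytime_computable_def computes_in_time_def using wf_machine[OF K] by blast
qed

subsection \<open>Polynomial space\<close>

definition path :: "nat \<Rightarrow> cmd list \<times> store \<Rightarrow> nat \<Rightarrow> cmd list \<times> store \<Rightarrow> bool" where
  "path B C n D \<longleftrightarrow> (sstep ^^ n) C = D \<and> (\<forall>i \<le> n. bounded_by B (snd ((sstep ^^ i) C)))"

lemma path_trans: "path B C n D \<Longrightarrow> path B D m E \<Longrightarrow> path B C (n + m) E"
proof -
  assume CD: "path B C n D" and DE: "path B D m E"
  have "bounded_by B (snd ((sstep ^^ i) C))" if "i \<le> n + m" for i
  proof (cases "i \<le> n")
    case False
    then have "(sstep ^^ i) C = (sstep ^^ (i - n)) D"
      using CD funpow_add_apply[of n "i - n" sstep C] by (simp add: path_def)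
    then show ?thesis using DE that False by (simp add: path_def)
  qed (use CD in \<open>simp add: path_def\<close>)
  then show ?thesis using CD DE by (simp add: path_def funpow_add_apply)
qed

text \<open>The number of steps is left open: the main loop of the decision procedure may take
  exponential time, where \<open>exec\<close> would give no useful bound on the stacks.\<close>

definition inspace :: "nat \<Rightarrow> cmd \<Rightarrow> store \<Rightarrow> store \<Rightarrow> bool" where
  "inspace B c \<sigma> \<tau> \<longleftrightarrow> (\<forall>ks. \<exists>n. path B (c # ks, \<sigma>) n (ks, \<tau>))"

text \<open>In \<open>n\<close> steps a stack grows by at most \<open>n\<close> symbols, so for the
  polynomial-time pieces a time bound doubles as a space bound.\<close>

lemma inspace_exec: "exec c \<sigma> n \<tau> \<Longrightarrow> bounded_by b \<sigma> \<Longrightarrow> b + n \<le> B \<Longrightarrow> inspace B c \<sigma> \<tau>"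
proof -
  assume "exec c \<sigma> n \<tau>" "bounded_by b \<sigma>" "b + n \<le> B"
  then obtain m where m: "m \<le> n" "runs c \<sigma> m \<tau>" unfolding exec_def by blast
  have "path B (c # ks, \<sigma>) m (ks, \<tau>)" for ks
    unfolding path_def bounded_by_def
  proof (intro conjI allI impI)
    show "(sstep ^^ m) (c # ks, \<sigma>) = (ks, \<tau>)" using runs_sstep[OF m(2)] .
    show "length (snd ((sstep ^^ i) (c # ks, \<sigma>)) r) \<le> B" if "i \<le> m" for i r
    proof -
      have "length (\<sigma> r) \<le> b" using \<open>bounded_by b \<sigma>\<close> by (simp add: bounded_by_def)
      then show ?thesis using sstep_iter_length[of i "(c # ks, \<sigma>)" r] that m(1) \<open>b + n \<le> B\<close> by simp
    qed
  qed
  then show ?thesis unfolding inspace_def by blast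
qed

lemma path_bounded: "path B C n D \<Longrightarrow> bounded_by B (snd C)"
  unfolding path_def by (metis funpow_0 le0)

lemma path_step: "bounded_by B (snd C) \<Longrightarrow> bounded_by B (snd (sstep C)) \<Longrightarrow> path B C 1 (sstep C)"
  by (auto simp: path_def le_Suc_eq)

lemma inspace_Seq: "inspace B c \<sigma> \<sigma>' \<Longrightarrow> inspace B d \<sigma>' \<tau> \<Longrightarrow> inspace B (c ;; d) \<sigma> \<tau>"
  unfolding inspace_def
proof
  fix ks
  assume c: "\<forall>ks. \<exists>n. path B (c # ks, \<sigma>) n (ks, \<sigma>')" and d: "\<forall>ks. \<exists>n. path B (d # ks, \<sigma>') n (ks, \<tau>)"
  obtain n where n: "path B (c # d # ks, \<sigma>) n (d # ks, \<sigma>')" using c by blast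
  obtain m where m: "path B (d # ks, \<sigma>') m (ks, \<tau>)" using d by blast
  have "path B ((c ;; d) # ks, \<sigma>) 1 (c # d # ks, \<sigma>)"
    using path_step[of B "((c ;; d) # ks, \<sigma>)"] path_bounded[OF n] by simp
  from path_trans[OF this path_trans[OF n m]] show "\<exists>n. path B ((c ;; d) # ks, \<sigma>) n (ks, \<tau>)" by blast
qed

lemma inspace_While_Nil: "\<sigma> r = [] \<Longrightarrow> bounded_by B \<sigma> \<Longrightarrow> inspace B (While r c) \<sigma> \<sigma>"
  unfolding inspace_def
proof
  fix ks assume "\<sigma> r = []" "bounded_by B \<sigma>"
  then show "\<exists>n. path B (While r c # ks, \<sigma>) n (ks, \<sigma>)"
    using path_step[of B "(While r c # ks, \<sigma>)"] by auto
qed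

lemma inspace_While_Cons:
  "\<sigma> r \<noteq> [] \<Longrightarrow> inspace B c \<sigma> \<sigma>' \<Longrightarrow> inspace B (While r c) \<sigma>' \<tau> \<Longrightarrow> inspace B (While r c) \<sigma> \<tau>"
  unfolding inspace_def
proof
  fix ks
  assume r: "\<sigma> r \<noteq> []" and c: "\<forall>ks. \<exists>n. path B (c # ks, \<sigma>) n (ks, \<sigma>')"
    and d: "\<forall>ks. \<exists>n. path B (While r c # ks, \<sigma>') n (ks, \<tau>)"
  obtain n where n: "path B (c # While r c # ks, \<sigma>) n (While r c # ks, \<sigma>')" using c by blast
  obtain m where m: "path B (While r c # ks, \<sigma>') m (ks, \<tau>)" using d by blast
  have "path B (While r c # ks, \<sigma>) 1 (c # While r c # ks, \<sigma>)"
    using path_step[of B "(While r c # ks, \<sigma>)"] path_bounded[OF n] r by simp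
  from path_trans[OF this path_trans[OF n m]] show "\<exists>n. path B (While r c # ks, \<sigma>) n (ks, \<tau>)" by blast
qed

lemma bounded_by_st: "length a \<le> B \<Longrightarrow> length e \<le> B \<Longrightarrow> bounded_by B (st K a [] [] [] e)"
  by (auto simp: bounded_by_def st_def)

lemma inspace_loop:
  assumes b: "implements b K0 S e B" "K0 \<le> K" "0 < K" and c: "implements c K1 T e (\<lambda>x. e (f x))" "K1 \<le> K"
  assumes fin: "B ((f ^^ t) x) = Tip" "\<And>s. s < t \<Longrightarrow> B ((f ^^ s) x) \<noteq> Tip"
    and H: "\<And>s. s \<le> t \<Longrightarrow> tsize (e ((f ^^ s) x)) \<le> H"
    and U: "\<And>s. s < t \<Longrightarrow> T ((f ^^ s) x) + (19 * tsize (e ((f ^^ Suc s) x)) + S ((f ^^ Suc s) x) + 3 * tsize (B ((f ^^ Suc s) x)) + 14) + 4 \<le> U"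
    and M: "H + U \<le> M"
  shows "inspace M (loop K b c) (st K (ser (e x)) [] [] [] (if B x = Tip then [] else [True]))
     (st K (ser (e ((f ^^ t) x))) [] [] [] [])"
  using fin H U
proof (induction t arbitrary: x)
  case 0
  then show ?case using b(3) M bounded_by_st[of "ser (e x)" M "[]" K]
    by (auto simp: loop_def st_nth intro!: inspace_While_Nil)
next
  case (Suc t)
  have "B x \<noteq> Tip" using Suc.prems(2)[of 0] by simp
  have rest: "inspace M (loop K b c) (st K (ser (e (f x))) [] [] [] (if B (f x) = Tip then [] else [True]))
     (st K (ser (e ((f ^^ t) (f x)))) [] [] [] [])"
    using Suc.prems(1) Suc.prems(2-4)[of "Suc _"] by (intro Suc.IH) (auto simp: funpow_swap1)
  have H0: "tsize (e x) \<le> H" using Suc.prems(3)[of 0] by simp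
  have "bounded_by H (st K (ser (e x)) [] [] [] [True])"
    using H0 tsize_pos[of "e x"] by (intro bounded_by_st) auto
  then have body: "inspace M (Case (K + 3) Skip Skip Skip ;; c ;; test K b) (st K (ser (e x)) [] [] [] [True])
     (st K (ser (e (f x))) [] [] [] (if B (f x) = Tip then [] else [True]))"
    by (rule inspace_exec[OF exec_loop_body[OF b c, of x]]) (use Suc.prems(4)[of 0] M in simp)
  have "inspace M (loop K b c) (st K (ser (e x)) [] [] [] [True]) (st K (ser (e ((f ^^ t) (f x)))) [] [] [] [])"
    unfolding loop_def by (rule inspace_While_Cons[OF _ body rest[unfolded loop_def]]) (simp add: st_nth)
  then show ?case using \<open>B x \<noteq> Tip\<close> by (simp only: funpow_Suc_right o_apply if_False)
qed

text \<open>Time is bounded within a round and size over all rounds, while the number of rounds is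
  only known to be finite. The Boolean result is left on stack 0; the first symbol of its code is
  \<open>True\<close> exactly for \<open>True\<close>, which is the machine's test for
  acceptance.\<close>

lemma PSPACE_iteration:
  fixes init :: "bool list \<Rightarrow> 's::enc" and f :: "'s \<Rightarrow> 's"
  assumes init: "ptime init" and f: "ptime f" and going: "ptime going" and acc: "ptime acc"
    and size: "\<And>w t. sz ((f ^^ t) (init w)) \<le> poly r (length w)"
    and halts: "\<And>w. \<exists>t. \<not> going ((f ^^ t) (init w))"
    and correct: "\<And>w t. \<not> going ((f ^^ t) (init w)) \<Longrightarrow> \<forall>s < t. going ((f ^^ s) (init w)) \<Longrightarrow> acc ((f ^^ t) (init w)) \<longleftrightarrow> w \<in> X"
  shows "X \<in> PSPACE"
proof -
  obtain d K2 v where d: "implements d K2 (\<lambda>x. poly v (tsize (enc x))) enc (\<lambda>x. enc (init x))"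
    using init unfolding ptime_def ptimeT_def by blast
  obtain c K1 p where c: "implements c K1 (\<lambda>x. poly p (tsize (enc x))) enc (\<lambda>x. enc (f x))"
    using f unfolding ptime_def ptimeT_def by blast
  obtain b K0 q where b: "implements b K0 (\<lambda>x. poly q (tsize (enc x))) enc (\<lambda>x. enc (going x))"
    using going unfolding ptime_def ptimeT_def by blast
  obtain a K3 a' where a: "implements a K3 (\<lambda>x. poly a' (tsize (enc x))) enc (\<lambda>x. enc (acc x))"
    using acc unfolding ptime_def ptimeT_def by blast
  define K where "K = max 5 (max K3 (max K0 (max K1 K2)))"
  have K: "K0 \<le> K" "K1 \<le> K" "K2 \<le> K" "K3 \<le> K" "5 \<le> K" "0 < K" by (auto simp: K_def)
  let ?p = "load_input ;; d ;; test K b ;; loop K b c ;; a"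
  have regs: "regs_below (K + 4) ?p"
    using a b c d K regs_below_mono[of K1 c "K + 4"] regs_below_mono[of K2 d "K + 4"] regs_below_test[of K0 b K]
       regs_below_mono[of K3 a "K + 4"] regs_below_mono[OF regs_below_load_input, of "K + 4"]
    by (auto simp: implements_def loop_def)
  let ?R = "\<lambda>n. poly r n"
  \<comment> \<open>The 9 is three times the largest size of an encoded Boolean.\<close>
  let ?T2 = "\<lambda>n. 19 * ?R n + poly q (?R n) + 9 + 14"
  \<comment> \<open>A common bound for all phases: for each phase it contains the stack size at its
    start and its running time, in the case of the loop the time of a single round.\<close>
  let ?B = "\<lambda>n. n + (60 * n + 30) + (4 * n + 1) + poly v (4 * n + 1) + ?R n + (poly p (?R n) + ?T2 n + 4) + poly a' (?R n)"
  have run: "\<exists>\<tau>. inspace (?B (length w)) ?p (input_store w) \<tau> \<and> (\<tau> 0 \<noteq> [] \<and> hd (\<tau> 0) \<longleftrightarrow> w \<in> X)" for w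
  proof -
    let ?n = "length w" let ?y = "init w"
    define t where "t = (LEAST t. \<not> going ((f ^^ t) ?y))"
    have t: "\<not> going ((f ^^ t) ?y)" unfolding t_def by (rule LeastI_ex) (rule halts)
    have least: "going ((f ^^ s) ?y)" if "s < t" for s using that not_less_Least unfolding t_def by blast
    have st: "st K s [] [] [] [] = (\<lambda>_. [])(0 := s)" for s using K by (auto simp: st_def fun_eq_iff)
    have szb: "tsize (enc ((f ^^ s) ?y)) \<le> ?R ?n" for s using size[of s w] by (simp add: sz_def)
    have b3: "tsize (enc (x :: bool)) \<le> 3" for x using sz_bool[of x] by (simp add: sz_def)
    have w: "tsize (enc w) \<le> 4 * ?n + 1" using sz_bits[of w] by (simp add: sz_def)
    have 1: "inspace (?B ?n) load_input (input_store w) (st K (ser (enc w)) [] [] [] [])"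
      unfolding st by (rule inspace_exec[OF exec_load_input, where b = ?n]) (auto simp: bounded_by_def input_store_def)
    have 2: "inspace (?B ?n) d (st K (ser (enc w)) [] [] [] []) (st K (ser (enc ?y)) [] [] [] [])"
      by (rule inspace_exec[OF implements_exec[OF d K(3)] bounded_by_st[where B = "4 * ?n + 1"]])
        (use w nat_poly_mono[OF w, of v] in auto)
    have 3: "inspace (?B ?n) (test K b) (st K (ser (enc ?y)) [] [] [] [])
        (st K (ser (enc ?y)) [] [] [] (if enc (going ?y) = Tip then [] else [True]))"
      by (rule inspace_exec[OF exec_test[OF b K(1,6), of ?y "[]", unfolded append_Nil2] bounded_by_st[where B = "?R ?n"]])
        (use szb[of 0] nat_poly_mono[OF szb[of 0], of q] b3[of "going ?y"] in auto)
    have 4: "inspace (?B ?n) (loop K b c) (st K (ser (enc ?y)) [] [] [] (if enc (going ?y) = Tip then [] else [True]))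
        (st K (ser (enc ((f ^^ t) ?y))) [] [] [] [])"
    proof (rule inspace_loop[OF b K(1,6) c K(2), where H = "?R ?n" and U = "poly p (?R ?n) + ?T2 ?n + 4"])
      fix s
      let ?z = "(f ^^ Suc s) ?y"
      have "3 * tsize (enc (going ?z)) \<le> 9" using b3[of "going ?z"] by simp
      then show "poly p (tsize (enc ((f ^^ s) ?y))) + (19 * tsize (enc ?z) + poly q (tsize (enc ?z)) + 3 * tsize (enc (going ?z)) + 14) + 4
         \<le> poly p (?R ?n) + ?T2 ?n + 4"
        using szb[of s] szb[of "Suc s"] by (intro add_mono mult_le_mono nat_poly_mono) auto
    qed (use t least szb in \<open>auto simp: enc_bool_def\<close>)
    have 5: "inspace (?B ?n) a (st K (ser (enc ((f ^^ t) ?y))) [] [] [] []) (st K (ser (enc (acc ((f ^^ t) ?y)))) [] [] [] [])"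
      by (rule inspace_exec[OF implements_exec[OF a K(4)] bounded_by_st[where B = "?R ?n"]])
        (use szb[of t] nat_poly_mono[OF szb[of t], of a'] in auto)
    have "inspace (?B ?n) ?p (input_store w) (st K (ser (enc (acc ((f ^^ t) ?y)))) [] [] [] [])"
      by (rule inspace_Seq[OF 1 inspace_Seq[OF 2 inspace_Seq[OF 3 inspace_Seq[OF 4 5]]]])
    moreover have "acc ((f ^^ t) ?y) \<longleftrightarrow> w \<in> X" using correct t least by blast
    ultimately show ?thesis
      using K by (intro exI[of _ "st K (ser (enc (acc ((f ^^ t) ?y)))) [] [] [] []"]) (auto simp: st_nth enc_bool_def)
  qed
  have K0: "0 < K + 4" by simp
  have main: "(\<exists>t. fst (tm_run (machine ?p (K + 4)) w t) = (if w \<in> X then accept (machine ?p (K + 4)) else reject (machine ?p (K + 4))))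
    \<and> (\<forall>t. \<forall>(c, h) \<in> set (snd (tm_run (machine ?p (K + 4)) w t)). h \<le> ?B (length w) + 1)" for w
  proof -
    obtain \<tau> where \<tau>: "inspace (?B (length w)) ?p (input_store w) \<tau>" "\<tau> 0 \<noteq> [] \<and> hd (\<tau> 0) \<longleftrightarrow> w \<in> X"
      using run by blast
    obtain n where n: "path (?B (length w)) ([?p], input_store w) n ([], \<tau>)" using \<tau>(1) unfolding inspace_def by blast
    then have n1: "(sstep ^^ n) ([?p], input_store w) = ([], \<tau>)"
      and n2: "\<And>i r. i \<le> n \<Longrightarrow> length (snd ((sstep ^^ i) ([?p], input_store w)) r) \<le> ?B (length w)"
      unfolding path_def bounded_by_def by auto
    obtain t where "tm_run (machine ?p (K + 4)) w t =
       ((if \<tau> 0 \<noteq> [] \<and> hd (\<tau> 0) then accept (machine ?p (K + 4)) else reject (machine ?p (K + 4))), snd (rep ?p (K + 4) ([], \<tau>)))"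
      using machine_run(1)[OF regs K0 n1 n2] by blast
    then show ?thesis using machine_run(2)[OF regs K0 n1 n2] \<tau>(2) by (auto intro!: exI[of _ t])
  qed
  have "pbounded (\<lambda>n. n) (\<lambda>n. ?B n + 1)" by (intro pbounded_intros)
  then obtain s where s: "\<And>n. ?B n + 1 \<le> poly s n" unfolding pbounded_def by blast
  have "runs_in_space (machine ?p (K + 4)) (poly s)"
    unfolding runs_in_space_def
  proof (intro allI ballI, clarify)
    fix w t ct h assume "(ct, h) \<in> set (snd (tm_run (machine ?p (K + 4)) w t))"
    then have "h \<le> ?B (length w) + 1" using main[of w] by blast
    then show "h \<le> poly s (length w)" using s[of "length w"] by linarith
  qed
  moreover have "decides (machine ?p (K + 4)) X" unfolding decides_def using main by blast
  ultimately show ?thesis unfolding PSPACE_def using wf_machine[OF regs K0] by blast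
qed

section \<open>Quantified reachability in polynomial space\<close>

text \<open>
  A prefix is a list of quantifiers, \<open>True\<close> being universal; the matrix receives the reversed list
  of quantifiers paired with their chosen bits.
\<close>

fun qeval :: "((bool \<times> bool) list \<Rightarrow> bool) \<Rightarrow> bool list \<Rightarrow> (bool \<times> bool) list \<Rightarrow> bool" where
  "qeval R [] dn = R dn"
| "qeval R (q # qs) dn =
     (if q then qeval R qs ((q, False) # dn) \<and> qeval R qs ((q, True) # dn)
      else qeval R qs ((q, False) # dn) \<or> qeval R qs ((q, True) # dn))"

text \<open>
  Depth-first evaluation. The second choice for a quantifier is explored only if the value of
  the first one does not decide it, so no values have to be stored on the way.
\<close>

type_synonym qstate = "bool list \<times> (bool \<times> bool) list \<times> bool list \<times> bool \<times> bool"

fun qstep :: "(bool list \<Rightarrow> (bool \<times> bool) list \<Rightarrow> bool) \<Rightarrow> qstate \<Rightarrow> qstate" where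
  "qstep R (w, dn, td, up, v) =
     (if up then
        (case dn of [] \<Rightarrow> (w, dn, td, True, v)
         | x # dn' \<Rightarrow> if \<not> snd x \<and> fst x = v then (w, (fst x, True) # dn', td, False, v)
             else (w, dn', fst x # td, True, v))
      else
        (case td of [] \<Rightarrow> (w, dn, td, True, R w dn)
         | q # qs \<Rightarrow> (w, (q, False) # dn, qs, False, v)))"

text \<open>\<open>dn\<close> and \<open>td\<close> mark a position in the evaluation tree that is
  restored when a value is returned. The second branch is entered exactly if \<open>q\<close> equals
  the value of the first one, and in either case the branch visited last has the value of the whole
  formula.\<close>

lemma qstep_eval: "\<exists>t. (qstep R ^^ t) (w, dn, td, False, v) = (w, dn, td, True, qeval (R w) td dn)"
proof (induction td arbitrary: dn v)
  case Nil
  show ?case by (rule exI[of _ 1]) simp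
next
  case (Cons q qs)
  let ?v0 = "qeval (R w) qs ((q, False) # dn)" and ?v1 = "qeval (R w) qs ((q, True) # dn)"
  obtain t0 where t0: "(qstep R ^^ t0) (w, (q, False) # dn, qs, False, v) = (w, (q, False) # dn, qs, True, ?v0)"
    using Cons.IH by blast
  have s1: "(qstep R ^^ 1) (w, dn, q # qs, False, v) = (w, (q, False) # dn, qs, False, v)" by simp
  show ?case
  proof (cases "q = ?v0")
    case False
    have "(qstep R ^^ 1) (w, (q, False) # dn, qs, True, ?v0) = (w, dn, q # qs, True, ?v0)" using False by simp
    then have "(qstep R ^^ (1 + (t0 + 1))) (w, dn, q # qs, False, v) = (w, dn, q # qs, True, ?v0)"
      using s1 t0 by (simp only: funpow_add_apply)
    moreover have "qeval (R w) (q # qs) dn = ?v0" using False by auto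
    ultimately show ?thesis by metis
  next
    case True
    obtain t1 where t1: "(qstep R ^^ t1) (w, (q, True) # dn, qs, False, ?v0) = (w, (q, True) # dn, qs, True, ?v1)"
      using Cons.IH by blast
    have s2: "(qstep R ^^ 1) (w, (q, False) # dn, qs, True, ?v0) = (w, (q, True) # dn, qs, False, ?v0)" using True by simp
    have s3: "(qstep R ^^ 1) (w, (q, True) # dn, qs, True, ?v1) = (w, dn, q # qs, True, ?v1)" by simp
    have "(qstep R ^^ (1 + (t0 + (1 + (t1 + 1))))) (w, dn, q # qs, False, v) = (w, dn, q # qs, True, ?v1)"
      using s1 t0 s2 t1 s3 by (simp only: funpow_add_apply)
    moreover have "qeval (R w) (q # qs) dn = ?v1" using True by auto
    ultimately show ?thesis by metis
  qed
qed

text \<open>Each quantifier is either still to be read or paired with its current choice, so a state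
  never outgrows the prefix. This is the space bound.\<close>

lemma qstep_invariant:
  "\<exists>dn' td' up' v'. (qstep R ^^ t) (w, dn, td, up, v) = (w, dn', td', up', v') \<and>
     length dn' + length td' = length dn + length td"
proof (induction t)
  case (Suc t)
  then obtain dn' td' up' v' where "(qstep R ^^ t) (w, dn, td, up, v) = (w, dn', td', up', v')"
     "length dn' + length td' = length dn + length td" by blast
  then show ?case by (cases dn'; cases td') auto
qed simp

lemma PSPACE_qeval:
  fixes R :: "bool list \<Rightarrow> (bool \<times> bool) list \<Rightarrow> bool"
  assumes qs: "ptime qs" and R: "ptime (\<lambda>z. R (fst z) (snd z))"
  shows "{w. qeval (R w) (qs w) []} \<in> PSPACE"
proof -
  let ?going = "\<lambda>s :: qstate. \<not> (fst (snd (snd (snd s))) \<and> fst (snd s) = [])"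
  let ?acc = "\<lambda>s :: qstate. snd (snd (snd (snd s)))"
  let ?init = "\<lambda>w. (w, [], qs w, False, False)"
  have "pbounded sz (\<lambda>w. sz w + 20 * sz (qs w) + 20)"
    by (intro pbounded_intros ptime_size qs)
  then obtain r where r: "\<And>w :: bool list. sz w + 20 * sz (qs w) + 20 \<le> poly r (sz w)" unfolding pbounded_sz by blast
  show ?thesis
  proof (rule PSPACE_iteration[where f = "qstep R" and init = ?init and going = ?going and acc = ?acc and
        \<comment> \<open>The polynomial \<open>[:1, 4:]\<close> is the bound of
          \<open>sz_bits\<close> on the size of the encoded input word.\<close>
        r = "r \<circ>\<^sub>p [:1, 4:]"])
    show "ptime ?init" by (intro ptime_intros qs)
    have "ptime (\<lambda>s :: qstate.
     (if fst (snd (snd (snd s))) then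
        (case fst (snd s) of [] \<Rightarrow> s
         | x # dn' \<Rightarrow> if \<not> snd x \<and> fst x = snd (snd (snd (snd s)))
             then (fst s, (fst x, True) # dn', fst (snd (snd s)), False, snd (snd (snd (snd s))))
             else (fst s, dn', fst x # fst (snd (snd s)), True, snd (snd (snd (snd s)))))
      else
        (case fst (snd (snd s)) of [] \<Rightarrow> (fst s, fst (snd s), fst (snd (snd s)), True, R (fst s) (fst (snd s)))
         | q # qs \<Rightarrow> (fst s, (q, False) # fst (snd s), qs, False, snd (snd (snd (snd s)))))))"
      by (intro ptime_intros ptime_comp2[OF R])
    also have "(\<lambda>s :: qstate.
     (if fst (snd (snd (snd s))) then
        (case fst (snd s) of [] \<Rightarrow> s
         | x # dn' \<Rightarrow> if \<not> snd x \<and> fst x = snd (snd (snd (snd s)))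
             then (fst s, (fst x, True) # dn', fst (snd (snd s)), False, snd (snd (snd (snd s))))
             else (fst s, dn', fst x # fst (snd (snd s)), True, snd (snd (snd (snd s)))))
      else
        (case fst (snd (snd s)) of [] \<Rightarrow> (fst s, fst (snd s), fst (snd (snd s)), True, R (fst s) (fst (snd s)))
         | q # qs \<Rightarrow> (fst s, (q, False) # fst (snd s), qs, False, snd (snd (snd (snd s))))))) = qstep R"
      by (rule ext) (auto split: list.split)
    finally show "ptime (qstep R)" .
    show "ptime ?going" "ptime ?acc" by (intro ptime_intros)+
    show "sz ((qstep R ^^ t) (?init w)) \<le> poly (r \<circ>\<^sub>p [:1, 4:]) (length w)" for w t
    proof -
      obtain dn td up v where e: "(qstep R ^^ t) (?init w) = (w, dn, td, up, v)"
        "length dn + length td = length (qs w)"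
        using qstep_invariant[of t R w "[]" "qs w" False False] by auto
      have "sz (x :: bool \<times> bool) \<le> 7" for x using sz_bool[of "fst x"] sz_bool[of "snd x"] by (cases x) auto
      then have "sz dn \<le> 8 * length dn + 1" for dn :: "(bool \<times> bool) list"
        by (induction dn) (auto intro: order.trans[OF add_mono])
      from this[of dn] have "sz (w, dn, td, up, v) \<le> sz w + 20 * length (qs w) + 20"
        using sz_bits[of td] e(2) sz_bool[of up] sz_bool[of v] by simp
      also have "\<dots> \<le> poly r (sz w)" using r[of w] length_sz[of "qs w"] by linarith
      also have "\<dots> \<le> poly r (4 * length w + 1)" using sz_bits by (rule nat_poly_mono)
      finally show ?thesis using e by (simp add: poly_pcompose algebra_simps)
    qed
    have ev: "\<exists>t. (qstep R ^^ t) (?init w) = (w, [], qs w, True, qeval (R w) (qs w) [])" for w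
      by (rule qstep_eval)
    show "\<exists>t. \<not> ?going ((qstep R ^^ t) (?init w))" for w using ev[of w] by (metis fst_conv snd_conv)
    show "?acc ((qstep R ^^ t) (?init w)) \<longleftrightarrow> w \<in> {w. qeval (R w) (qs w) []}"
      if "\<not> ?going ((qstep R ^^ t) (?init w))" "\<forall>s < t. ?going ((qstep R ^^ s) (?init w))" for w t
    proof -
      obtain t' where t': "(qstep R ^^ t') (?init w) = (w, [], qs w, True, qeval (R w) (qs w) [])" using ev by blast
      have "t \<le> t'" using that(2) t' by (metis fst_conv leI snd_conv)
      \<comment> \<open>Halted states are fixed by \<open>qstep\<close>, so the first halted state
        coincides with the one that \<open>qstep_eval\<close> provides.\<close>
      have stuck: "(qstep R ^^ i) s = s" if "\<not> ?going s" for i s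
      proof -
        have "qstep R s = s" using that by (cases s) auto
        then show ?thesis by (induction i) simp_all
      qed
      have "(qstep R ^^ t') (?init w) = (qstep R ^^ (t' - t)) ((qstep R ^^ t) (?init w))"
        using \<open>t \<le> t'\<close> funpow_add_apply[of t "t' - t" "qstep R" "?init w"] by simp
      also have "\<dots> = (qstep R ^^ t) (?init w)" by (rule stuck[OF that(1)])
      finally have "(qstep R ^^ t) (?init w) = (w, [], qs w, True, qeval (R w) (qs w) [])" using t' by (simp only:)
      then show ?thesis by simp
    qed
  qed
qed

subsection \<open>Savitch's theorem\<close>

text \<open>A universal bit selects one of the two halves of a path; an existential block is its middle vertex.\<close>

fun halve :: "bool list \<times> bool list \<times> bool list \<Rightarrow> bool \<times> bool \<Rightarrow> bool list \<times> bool list \<times> bool list" where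
  "halve (u, v, buf) (q, b) = (if q then (if b then (u, buf, []) else (buf, v, [])) else (u, v, b # buf))"

text \<open>Savitch's recursion for paths with at most \<open>2 ^ k\<close> edges. The second half
  comes first because \<open>halve\<close> selects it by the bit \<open>False\<close>.\<close>

fun reach_within :: "(bool list \<Rightarrow> bool list \<Rightarrow> bool) \<Rightarrow> nat \<Rightarrow> nat \<Rightarrow> bool list \<Rightarrow> bool list \<Rightarrow> bool" where
  "reach_within E m 0 u v \<longleftrightarrow> u = v \<or> E u v"
| "reach_within E m (Suc k) u v \<longleftrightarrow> (\<exists>z. length z = m \<and> reach_within E m k z v \<and> reach_within E m k u z)"

definition edges :: "(bool list \<Rightarrow> bool list \<Rightarrow> bool) \<Rightarrow> nat \<Rightarrow> (bool list \<times> bool list) set" where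
  "edges E m = {(u, v). length u = m \<and> length v = m \<and> E u v}"

lemma edges_relpow_length: "(u, v) \<in> edges E m ^^ n \<Longrightarrow> length u = m \<Longrightarrow> length v = m"
  by (cases n) (auto simp: edges_def)

lemma reach_within_relpow:
  "length u = m \<Longrightarrow> length v = m \<Longrightarrow> reach_within E m k u v \<longleftrightarrow> (\<exists>n \<le> 2 ^ k. (u, v) \<in> edges E m ^^ n)"
proof (induction k arbitrary: u v)
  case 0
  have "(\<exists>n \<le> 2 ^ 0. (u, v) \<in> edges E m ^^ n) \<longleftrightarrow> (u, v) \<in> edges E m ^^ 0 \<or> (u, v) \<in> edges E m ^^ 1"
    by (auto simp: le_Suc_eq)
  then show ?case using 0 by (auto simp: edges_def)
next
  case (Suc k)
  show ?case
  proof
    assume "reach_within E m (Suc k) u v"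
    then obtain z where z: "length z = m" "reach_within E m k z v" "reach_within E m k u z" by auto
    obtain i j where "i \<le> 2 ^ k" "(u, z) \<in> edges E m ^^ i" "j \<le> 2 ^ k" "(z, v) \<in> edges E m ^^ j"
      using z Suc.IH[of u z] Suc.IH[of z v] Suc.prems by auto
    then show "\<exists>n \<le> 2 ^ Suc k. (u, v) \<in> edges E m ^^ n"
      by (intro exI[of _ "i + j"]) (auto simp: relpow_add)
  next
    assume "\<exists>n \<le> 2 ^ Suc k. (u, v) \<in> edges E m ^^ n"
    then obtain n where n: "n \<le> 2 ^ Suc k" "(u, v) \<in> edges E m ^^ n" by blast
    \<comment> \<open>Cutting after \<open>2 ^ k\<close> edges, or at the end of a shorter path,
      leaves at most \<open>2 ^ k\<close> edges on either side.\<close>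
    define i where "i = min n (2 ^ k)"
    have i: "i \<le> 2 ^ k" "n - i \<le> 2 ^ k" "n = i + (n - i)" using n(1) by (auto simp: i_def)
    then have "(u, v) \<in> edges E m ^^ i O edges E m ^^ (n - i)" using n(2) relpow_add by metis
    then obtain z where z: "(u, z) \<in> edges E m ^^ i" "(z, v) \<in> edges E m ^^ (n - i)" by blast
    moreover have "length z = m" using edges_relpow_length[OF z(1)] Suc.prems by simp
    ultimately show "reach_within E m (Suc k) u v"
      using i Suc.IH[of u z] Suc.IH[of z v] Suc.prems by auto
  qed
qed

text \<open>There are at most \<open>2 ^ (m + m)\<close> pairs of strings of length
  \<open>m\<close>, and the closure of a finite relation is exhausted by paths with no more steps
  than the relation has edges. Hence \<open>m + m\<close> levels suffice.\<close>

lemma reach_within_rtrancl: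
  assumes "length u = m" "length v = m"
  shows "reach_within E m (m + m) u v \<longleftrightarrow> (u, v) \<in> (edges E m)\<^sup>*"
proof -
  let ?V = "{u :: bool list. length u = m}"
  have fin: "finite ?V" and card: "card ?V = 2 ^ m"
    using finite_lists_length_eq[of "UNIV :: bool set" m] card_lists_length_eq[of "UNIV :: bool set" m] by auto
  have sub: "edges E m \<subseteq> ?V \<times> ?V" by (auto simp: edges_def)
  then have finE: "finite (edges E m)" using fin by (meson finite_SigmaI finite_subset)
  have "card (edges E m) \<le> card (?V \<times> ?V)" using sub fin by (intro card_mono) auto
  then have le: "card (edges E m) \<le> 2 ^ (m + m)" by (simp add: card card_cartesian_product power_add)
  show ?thesis
    unfolding reach_within_relpow[OF assms] rtrancl_finite_eq_relpow[OF finE]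
  proof
    assume "\<exists>n \<le> 2 ^ (m + m). (u, v) \<in> edges E m ^^ n"
    then have "(u, v) \<in> (edges E m)\<^sup>*" by (auto simp: relpow_imp_rtrancl)
    then show "(u, v) \<in> (\<Union>n \<in> {n. n \<le> card (edges E m)}. edges E m ^^ n)"
      unfolding rtrancl_finite_eq_relpow[OF finE] .
  qed (use le in \<open>auto intro: order.trans\<close>)
qed

lemma qeval_exists_block:
  "qeval R (replicate j False @ rest) dn \<longleftrightarrow> (\<exists>z. length z = j \<and> qeval R rest (map (Pair False) z @ dn))"
proof (induction j arbitrary: dn)
  case (Suc j)
  have "qeval R (replicate (Suc j) False @ rest) dn \<longleftrightarrow>
     (\<exists>b. \<exists>z. length z = j \<and> qeval R rest (map (Pair False) z @ (False, b) # dn))"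
    using Suc.IH[of "(False, False) # dn"] Suc.IH[of "(False, True) # dn"] by (auto simp: ex_bool_eq)
  also have "\<dots> \<longleftrightarrow> (\<exists>z. length z = Suc j \<and> qeval R rest (map (Pair False) z @ dn))"
  proof
    assume "\<exists>b. \<exists>z. length z = j \<and> qeval R rest (map (Pair False) z @ (False, b) # dn)"
    then obtain b z where "length z = j" "qeval R rest (map (Pair False) z @ (False, b) # dn)" by blast
    then show "\<exists>z. length z = Suc j \<and> qeval R rest (map (Pair False) z @ dn)" by (intro exI[of _ "z @ [b]"]) simp
  next
    assume "\<exists>z. length z = Suc j \<and> qeval R rest (map (Pair False) z @ dn)"
    then obtain z where z: "length z = Suc j" "qeval R rest (map (Pair False) z @ dn)" by blast
    then obtain z' b where "z = z' @ [b]" by (metis length_0_conv nat.distinct(1) rev_exhaust)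
    with z show "\<exists>b. \<exists>z. length z = j \<and> qeval R rest (map (Pair False) z @ (False, b) # dn)"
      by (intro exI[of _ b] exI[of _ z']) simp
  qed
  finally show ?case .
qed simp

text \<open>Choices are stored latest first and replayed oldest first; collecting them in the buffer
  restores the stored order, so \<open>z\<close> is the guessed string itself.\<close>

lemma foldl_halve_block: "foldl halve (u, v, buf) (rev (map (Pair False) z)) = (u, v, z @ buf)"
  by (induction z) auto

text \<open>The matrix recomputes the current end points by replaying all choices from the outermost
  ones. Between two blocks the buffer is empty, which is the form in which the induction hypothesis
  applies to either half.\<close>

lemma qeval_reach_within:
  assumes R: "\<And>dn. R dn \<longleftrightarrow> (let s = foldl halve (u0, v0, []) (rev dn) in fst s = fst (snd s) \<or> E (fst s) (fst (snd s)))"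
  shows "foldl halve (u0, v0, []) (rev dn) = (u, v, []) \<Longrightarrow>
     qeval R (concat (replicate k (replicate m False @ [True]))) dn \<longleftrightarrow> reach_within E m k u v"
proof (induction k arbitrary: dn u v)
  case 0
  then show ?case by (simp add: R)
next
  case (Suc k)
  let ?rest = "concat (replicate k (replicate m False @ [True]))"
  have dn: "foldl halve (u0, v0, []) (rev (map (Pair False) z @ dn)) = (u, v, z)" for z
    using Suc.prems foldl_halve_block[of u v "[]" z] by (simp add: foldl_append)
  have "qeval R (concat (replicate (Suc k) (replicate m False @ [True]))) dn \<longleftrightarrow>
    (\<exists>z. length z = m \<and> qeval R (True # ?rest) (map (Pair False) z @ dn))"
    by (simp add: qeval_exists_block)
  also have "\<dots> \<longleftrightarrow> (\<exists>z. length z = m \<and> reach_within E m k z v \<and> reach_within E m k u z)"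
  proof -
    have "qeval R ?rest ((True, False) # map (Pair False) z @ dn) \<longleftrightarrow> reach_within E m k z v" for z
      using dn[of z] by (intro Suc.IH) simp
    moreover have "qeval R ?rest ((True, True) # map (Pair False) z @ dn) \<longleftrightarrow> reach_within E m k u z" for z
      using dn[of z] by (intro Suc.IH) simp
    ultimately show ?thesis by simp
  qed
  finally show ?case by simp
qed

text \<open>The string \<open>m w\<close> stands for its length, a number in unary. Fixing source
  and target as the two constant strings leaves the choice of end points to the edge relation, which
  may treat these strings specially.\<close>

theorem PSPACE_reachability:
  fixes m :: "bool list \<Rightarrow> bool list" and E :: "bool list \<Rightarrow> bool list \<Rightarrow> bool list \<Rightarrow> bool"
  assumes m: "ptime m" and E: "ptime (\<lambda>z. E (fst z) (fst (snd z)) (snd (snd z)))"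
  shows "{w. (replicate (length (m w)) True, replicate (length (m w)) False) \<in> (edges (E w) (length (m w)))\<^sup>*} \<in> PSPACE"
proof -
  define R where "R w dn = (let s = foldl halve (map (\<lambda>_. True) (m w), map (\<lambda>_. False) (m w), []) (rev dn)
      in fst s = fst (snd s) \<or> E w (fst s) (fst (snd s)))" for w dn
  define qs where "qs w = concat (map (\<lambda>_. map (\<lambda>_. False) (m w) @ [True]) (m w @ m w))" for w
  have "ptime qs"
    unfolding qs_def[abs_def] by (intro ptime_intros m ptime_comp[OF m])
  moreover have "ptime (\<lambda>z. R (fst z) (snd z))"
    unfolding R_def
  proof (intro ptime_intros ptime_comp3[OF E])
    have "ptime (\<lambda>z :: bool list \<times> (bool \<times> bool) list.
       foldl (\<lambda>st a. if fst a then (if snd a then (fst st, snd (snd st), []) else (snd (snd st), fst (snd st), []))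
           else (fst st, fst (snd st), snd a # snd (snd st)))
         (map (\<lambda>_. True) (m (fst z)), map (\<lambda>_. False) (m (fst z)), []) (rev (snd z)))"
      (is "ptime (\<lambda>z. foldl ?f _ _)")
    proof (rule ptime_foldl_additive[where r = "[:4:]"])
      show "sz (?f acc a) \<le> sz acc + poly [:4:] (sz x + sz a)"
        for x :: "bool list \<times> (bool \<times> bool) list" and acc a
        by (cases acc; cases a) (auto intro: order.trans[OF sz_bool] simp: add.commute)
    qed (intro ptime_intros ptime_comp[OF m])+
    moreover have "?f = halve" by (auto simp: fun_eq_iff)
    ultimately show "ptime (\<lambda>z. foldl halve (map (\<lambda>_. True) (m (fst z)), map (\<lambda>_. False) (m (fst z)), []) (rev (snd z)))"
      by simp
  qed
  ultimately have "{w. qeval (R w) (qs w) []} \<in> PSPACE" by (rule PSPACE_qeval)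
  moreover have "qeval (R w) (qs w) [] \<longleftrightarrow>
      (replicate (length (m w)) True, replicate (length (m w)) False) \<in> (edges (E w) (length (m w)))\<^sup>*" for w
  proof -
    have "qs w = concat (replicate (length (m w) + length (m w)) (replicate (length (m w)) False @ [True]))"
      by (simp add: qs_def map_replicate_const replicate_add)
    then show ?thesis
      using qeval_reach_within[of "R w" "replicate (length (m w)) True" "replicate (length (m w)) False" "E w" "[]"
          "replicate (length (m w)) True" "replicate (length (m w)) False" "length (m w) + length (m w)" "length (m w)"]
      by (simp add: R_def map_replicate_const reach_within_rtrancl)
  qed
  ultimately show ?thesis by simp
qed

section \<open>Parsing codes\<close>

text \<open>
  The stack consists of the digits (last one first) and the items (last one first) read so far
  in each open bracket; the bottom frame collects the result. The empty stack signals an error.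
\<close>

definition canonical :: "bool list \<Rightarrow> bool" where
  "canonical ds \<longleftrightarrow> ds \<noteq> [] \<and> (hd ds \<or> ds = [False])"

text \<open>The pair of bits is a digit if \<open>a\<close> holds, otherwise an opening or a closing
  bracket. Numbers and lists share their brackets, so a frame may hold digits or items but not both.
  The conditional inside \<open>numof\<close> keeps its argument canonical on all inputs, as
  \<open>ptime_numof\<close> demands.\<close>

definition pchar :: "bool \<Rightarrow> bool \<Rightarrow> (bool list \<times> code list) list \<Rightarrow> (bool list \<times> code list) list" where
  "pchar a b fs = (case fs of [] \<Rightarrow> [] | fr # rest \<Rightarrow>
     if a then (if snd fr = [] then (b # fst fr, []) # rest else [])
     else if \<not> b then (if fst fr = [] then ([], []) # fr # rest else [])
     else (case rest of [] \<Rightarrow> [] | gr # rest' \<Rightarrow>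
       if fst gr = [] \<and> (fst fr = [] \<or> canonical (fst fr) \<and> snd fr = [])
       then ([], (if fst fr = [] then L (rev (snd fr))
                  else N (numof (if canonical (fst fr) then rev (fst fr) else [False]))) # snd gr) # rest'
       else []))"

definition pbit :: "bool list \<times> (bool list \<times> code list) list \<Rightarrow> bool \<Rightarrow> bool list \<times> (bool list \<times> code list) list" where
  "pbit s b = (case fst s of [] \<Rightarrow> ([b], snd s) | a # _ \<Rightarrow> ([], pchar a b (snd s)))"

definition parse :: "bool list \<Rightarrow> code option" where
  "parse w = (let s = foldl pbit ([], [([], [])]) w in
     if fst s = [] \<and> snd s \<noteq> [] \<and> tl (snd s) = [] \<and> fst (hd (snd s)) = [] \<and>
        snd (hd (snd s)) \<noteq> [] \<and> tl (snd (hd (snd s))) = []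
     then Some (hd (snd (hd (snd s)))) else None)"

lemma binary_numof: "canonical ds \<Longrightarrow> binary (numof (rev ds)) = rev ds"
proof -
  have "bs \<noteq> [] \<Longrightarrow> last bs \<or> bs = [False] \<Longrightarrow> binary (numof bs) = bs \<and> (last bs \<longrightarrow> 0 < numof bs)" for bs
  proof (induction bs)
    case (Cons b bs)
    show ?case
    proof (cases "bs = []")
      case True
      then show ?thesis by (cases b) (auto simp: binary.simps)
    next
      case False
      then have "last bs" using Cons.prems by auto
      then have IH: "binary (numof bs) = bs" "0 < numof bs" using Cons.IH False by auto
      have "binary (of_bool b + 2 * numof bs) = b # binary (numof bs)"
        using IH(2) by (subst binary.simps) (auto simp: Suc_double_not_eq_double)
      then show ?thesis using IH by simp
    qed
  qed simp
  from this[of "rev ds"] show "canonical ds \<Longrightarrow> ?thesis" by (auto simp: canonical_def last_rev)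
qed

lemma canonical_binary: "canonical (rev (binary n))"
proof -
  have "binary n \<noteq> [] \<and> (last (binary n) \<or> binary n = [False])"
  proof (induction n rule: less_induct)
    case (less n)
    show ?case
    proof (cases "n < 2")
      case True then show ?thesis by (subst (1 2 3) binary.simps) (auto simp: less_2_cases_iff)
    next
      case False
      have "binary (n div 2) \<noteq> [False]"
      proof
        assume "binary (n div 2) = [False]"
        then have "n div 2 = 0" using numof_binary[of "n div 2"] by simp
        with False show False by simp
      qed
      moreover have "binary n = odd n # binary (n div 2)" using False by (subst binary.simps) simp
      ultimately show ?thesis using less[of "n div 2"] False by simp
    qed
  qed
  then show ?thesis by (auto simp: canonical_def hd_rev)
qed

fun unparse :: "(bool list \<times> code list) list \<Rightarrow> bool list" where
  "unparse [] = []"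
| "unparse (fr # rest) = unparse rest @ (if rest = [] then [] else [False, False]) @
     concat (map bits (rev (snd fr))) @ concat (map (\<lambda>b. [True, b]) (rev (fst fr)))"

text \<open>Soundness through an inverse: a stack without error spells out the characters read so
  far. Only canonical digit strings become numbers, so writing such a number out again reproduces
  its digits.\<close>

lemma unparse_pchar: "pchar a b fs \<noteq> [] \<Longrightarrow> unparse (pchar a b fs) = unparse fs @ [a, b]"
  by (auto simp: pchar_def binary_numof split: list.splits if_splits)

lemma pchar_Nil [simp]: "pchar a b [] = []"
  by (simp add: pchar_def)

lemma unparse_foldl:
  "foldl pbit ([], [([], [])]) w = (h, fs) \<Longrightarrow> length h \<le> 1 \<and> (fs \<noteq> [] \<longrightarrow> unparse fs @ h = w)"
proof (induction w arbitrary: h fs rule: rev_induct)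
  case (snoc b w)
  obtain h' fs' where e: "foldl pbit ([], [([], [])]) w = (h', fs')" by fastforce
  then have s: "pbit (h', fs') b = (h, fs)" using snoc.prems by simp
  note IH = snoc.IH[OF e]
  show ?case
  proof (cases h')
    case Nil
    then show ?thesis using s IH by (auto simp: pbit_def)
  next
    case (Cons a l)
    then have "h' = [a]" "h = []" "fs = pchar a b fs'" using s IH by (auto simp: pbit_def)
    moreover from this have "fs \<noteq> [] \<longrightarrow> fs' \<noteq> []" by auto
    ultimately show ?thesis using IH unparse_pchar[of a b fs'] by auto
  qed
qed auto

lemma parse_sound: "parse w = Some c \<Longrightarrow> w = bits c"
proof -
  assume p: "parse w = Some c"
  obtain h fs where e: "foldl pbit ([], [([], [])]) w = (h, fs)" by fastforce
  have "h = []" "fs \<noteq> []" "tl fs = []" "fst (hd fs) = []" "snd (hd fs) \<noteq> []" "tl (snd (hd fs)) = []" "hd (snd (hd fs)) = c"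
    using p unfolding parse_def e by (auto simp: Let_def split: if_splits)
  then have "fs = [([], [c])]" by (cases fs; cases "snd (hd fs)") (auto simp: prod_eq_iff)
  then show ?thesis using unparse_foldl[OF e] \<open>h = []\<close> by simp
qed

lemma pbit_simps: "pbit ([], fs) b = ([b], fs)" "pbit ([a], fs) b = ([], pchar a b fs)"
  by (simp_all add: pbit_def)

lemma foldl_digits:
  "foldl pbit ([], (ds, []) # rest) (concat (map (\<lambda>b. [True, b]) bs)) = ([], (rev bs @ ds, []) # rest)"
  by (induction bs arbitrary: ds) (auto simp: pbit_simps pchar_def)

lemma foldl_bits: "foldl pbit ([], ([], cs) # rest) (bits c) = ([], ([], c # cs) # rest)"
proof (induction c arbitrary: cs rest)
  case (N n)
  have "rev (binary n) \<noteq> []" using canonical_binary[of n] by (simp add: canonical_def)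
  then show ?case
    by (simp add: foldl_digits pbit_simps pchar_def canonical_binary)
next
  case (L ds)
  have "foldl pbit ([], ([], es) # rest') (concat (map bits ds)) = ([], ([], rev ds @ es) # rest')" for es rest'
    using L by (induction ds arbitrary: es) auto
  then show ?case by (simp add: pbit_simps pchar_def)
qed

lemma parse_bits [simp]: "parse (bits c) = Some c"
  by (simp add: parse_def foldl_bits)

lemma bits_inj: "bits c = bits d \<longleftrightarrow> c = d"
  by (metis option.inject parse_bits)

lemma ptime_canonical: "ptime f \<Longrightarrow> ptime (\<lambda>x. canonical (f x))"
  unfolding canonical_def by (intro ptime_intros)

lemma ptime_numof_canonical:
  "ptime f \<Longrightarrow> ptime (\<lambda>x. numof (if canonical (f x) then rev (f x) else [False]))"
proof (rule ptime_numof)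
  show "binary (numof (if canonical (f x) then rev (f x) else [False])) = (if canonical (f x) then rev (f x) else [False])" for x
    using binary_numof[of "f x"] by (auto simp: binary.simps)
qed (intro ptime_intros ptime_canonical)

lemma ptime_parse: "ptime parse"
proof -
  have pchar: "ptime (\<lambda>z :: bool \<times> bool \<times> (bool list \<times> code list) list. pchar (fst z) (fst (snd z)) (snd (snd z)))"
    unfolding pchar_def by (intro ptime_intros ptime_canonical ptime_numof_canonical)
  have "ptime (\<lambda>z :: bool list \<times> (bool list \<times> (bool list \<times> code list) list) \<times> bool. pbit (fst (snd z)) (snd (snd z)))"
    unfolding pbit_def by (intro ptime_intros ptime_comp3[OF pchar])
  moreover have "sz (pbit s b) \<le> sz s + 20" for s b
  proof -
    have "sz (pchar a b fs) \<le> sz fs + 10" for a fs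
    proof -
      have n: "sz (numof (rev ds)) = sz ds" if "canonical ds" for ds
      proof -
        have "sz (numof (rev ds)) = sz (binary (numof (rev ds)))" by (simp add: sz_def enc_nat_def)
        then show ?thesis using binary_numof[OF that] by simp
      qed
      have p: "sz fr = Suc (sz (fst fr) + sz (snd fr))" for fr :: "bool list \<times> code list" by (cases fr) simp
      show ?thesis
        by (auto simp: pchar_def p n sz_bool split: list.splits)
    qed
    then have c: "sz (pchar a b (snd s)) \<le> sz (snd s) + 10" for a by blast
    have s: "sz s = Suc (sz (fst s) + sz (snd s))" by (cases s) simp
    show ?thesis
    proof (cases "fst s")
      case Nil
      then show ?thesis using s sz_bool[of b] by (simp add: pbit_def)
    next
      case (Cons a l)
      then show ?thesis using s c[of a] by (simp add: pbit_def)
    qed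
  qed
  ultimately have "ptime (\<lambda>w :: bool list. foldl pbit ([], [([], [])]) w)"
    by (intro ptime_foldl_additive[where r = "[:20:]" and f = "\<lambda>_. pbit"] ptime_intros) simp_all
  then show ?thesis
    unfolding parse_def[abs_def] by (intro ptime_intros)
qed

text \<open>Padding with leading ones is removed.\<close>

definition strip :: "bool list \<Rightarrow> bool list" where
  "strip w = rev (foldl (\<lambda>acc b. if acc = [] \<and> b then [] else b # acc) [] w)"

text \<open>A code starts with \<open>False\<close>, so the leading ones end exactly where the code
  begins.\<close>

lemma strip_pad: "strip (replicate j True @ bits c) = bits c"
proof -
  have 1: "foldl (\<lambda>acc b. if acc = [] \<and> b then [] else b # acc) [] (replicate j True) = []" by (induction j) auto
  have 2: "acc \<noteq> [] \<Longrightarrow> foldl (\<lambda>acc b. if acc = [] \<and> b then [] else b # acc) acc w = rev w @ acc" for acc w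
    by (induction w arbitrary: acc) auto
  obtain w where "bits c = False # w" by (cases c) auto
  then show ?thesis using 1 2[of "[False]" w] by (simp add: strip_def)
qed

lemma strip_ones: "strip (replicate j True) = []"
proof -
  have "foldl (\<lambda>acc b. if acc = [] \<and> b then [] else b # acc) [] (replicate j True) = []" by (induction j) auto
  then show ?thesis by (simp add: strip_def)
qed

lemma ptime_strip: "ptime strip"
  unfolding strip_def[abs_def]
proof (intro ptime_intros ptime_foldl_additive[where r = "[:4:]"])
  show "sz (if acc = [] \<and> a then [] else a # acc) \<le> sz acc + poly [:4:] (sz x + sz a)" for acc a and x :: "bool list"
    using sz_bool[of a] by simp
qed

section \<open>Instances as typed data\<close>

text \<open>
  A block is given by its identifier, its states with their values of \<open>f\<close>, the initial and the
  final state and the codes of the transitions; an instance by data, initial value, variables,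
  concurrent and serial queues, main block and blocks.
\<close>

type_synonym binst = "nat \<times> (nat \<times> nat) list \<times> nat \<times> nat \<times> code list"
type_synonym inst = "nat list \<times> nat \<times> nat list \<times> nat list \<times> nat list \<times> nat \<times> binst list"

abbreviation b_id :: "binst \<Rightarrow> nat" where "b_id e \<equiv> fst e"
abbreviation b_sts :: "binst \<Rightarrow> (nat \<times> nat) list" where "b_sts e \<equiv> fst (snd e)"
abbreviation b_init :: "binst \<Rightarrow> nat" where "b_init e \<equiv> fst (snd (snd e))"
abbreviation b_final :: "binst \<Rightarrow> nat" where "b_final e \<equiv> fst (snd (snd (snd e)))"
abbreviation b_trs :: "binst \<Rightarrow> code list" where "b_trs e \<equiv> snd (snd (snd (snd e)))"

abbreviation i_data :: "inst \<Rightarrow> nat list" where "i_data I \<equiv> fst I"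
abbreviation i_d0 :: "inst \<Rightarrow> nat" where "i_d0 I \<equiv> fst (snd I)"
abbreviation i_vars :: "inst \<Rightarrow> nat list" where "i_vars I \<equiv> fst (snd (snd I))"
abbreviation i_cq :: "inst \<Rightarrow> nat list" where "i_cq I \<equiv> fst (snd (snd (snd I)))"
abbreviation i_sq :: "inst \<Rightarrow> nat list" where "i_sq I \<equiv> fst (snd (snd (snd (snd I))))"
abbreviation i_main :: "inst \<Rightarrow> nat" where "i_main I \<equiv> fst (snd (snd (snd (snd (snd I)))))"
abbreviation i_blocks :: "inst \<Rightarrow> binst list" where "i_blocks I \<equiv> snd (snd (snd (snd (snd (snd I)))))"

definition code_of_block :: "binst \<Rightarrow> code" where
  "code_of_block e = L [N (b_id e), L (map (\<lambda>p. L [N (fst p), N (snd p)]) (b_sts e)), N (b_init e), N (b_final e), L (b_trs e)]"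

definition code_of_inst :: "inst \<Rightarrow> code" where
  "code_of_inst I = L [L (map N (i_data I)), N (i_d0 I), L (map N (i_vars I)), L (map N (i_cq I)), L (map N (i_sq I)),
     N (i_main I), L (map code_of_block (i_blocks I))]"

definition sub :: "nat \<Rightarrow> code \<Rightarrow> code" where
  "sub k c = hd ((tl ^^ k) (kids c))"

text \<open>Decoding is total, with arbitrary results on codes of the wrong shape. Such codes are
  recognised later by encoding the result again and comparing.\<close>

definition block_of_code :: "code \<Rightarrow> binst" where
  "block_of_code c = (num (sub 0 c), map (\<lambda>p. (num (sub 0 p), num (sub 1 p))) (kids (sub 1 c)),
     num (sub 2 c), num (sub 3 c), kids (sub 4 c))"

definition inst_of_code :: "code \<Rightarrow> inst" where
  "inst_of_code c = (map num (kids (sub 0 c)), num (sub 1 c), map num (kids (sub 2 c)), map num (kids (sub 3 c)),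
     map num (kids (sub 4 c)), num (sub 5 c), map block_of_code (kids (sub 6 c)))"

lemma sub_simps [simp]:
  "sub 0 (L (a # l)) = a" "sub (Suc 0) (L (a # b # l)) = b" "sub 2 (L (a # b # c # l)) = c"
  "sub 3 (L (a # b # c # d # l)) = d" "sub 4 (L (a # b # c # d # e # l)) = e"
  "sub 5 (L (a # b # c # d # e # g # l)) = g" "sub 6 (L (a # b # c # d # e # g # h # l)) = h"
  by (simp_all add: sub_def eval_nat_numeral)

lemma block_of_code [simp]: "block_of_code (code_of_block e) = e"
  by (simp add: block_of_code_def code_of_block_def o_def prod_eq_iff)

lemma inst_of_code [simp]: "inst_of_code (code_of_inst I) = I"
  by (simp add: inst_of_code_def code_of_inst_def o_def prod_eq_iff)

lemma ptime_sub [ptime_intros]: "ptime f \<Longrightarrow> ptime (\<lambda>x. sub k (f x))"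
proof -
  have "ptime l \<Longrightarrow> ptime (\<lambda>x. (tl ^^ k) (l x))" for l :: "'a \<Rightarrow> code list"
    by (induction k) (simp_all add: ptime_tl)
  then show "ptime f \<Longrightarrow> ?thesis" unfolding sub_def by (intro ptime_hd) (simp add: ptime_kids)
qed

lemma ptime_code_of_inst: "ptime code_of_inst"
proof -
  have 1: "ptime code_of_block" unfolding code_of_block_def[abs_def] by (intro ptime_intros)
  show ?thesis unfolding code_of_inst_def[abs_def] by (intro ptime_intros ptime_comp[OF 1])
qed

lemma ptime_inst_of_code: "ptime inst_of_code"
proof -
  have 1: "ptime block_of_code" unfolding block_of_code_def[abs_def] by (intro ptime_intros)
  show ?thesis unfolding inst_of_code_def[abs_def] by (intro ptime_intros ptime_comp[OF 1])
qed

section \<open>Descriptions, their validity and the systems that they represent\<close>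

lemma code_atom_inj: "code_atom a = code_atom b \<longleftrightarrow> a = b"
  by (cases a; cases b) auto

lemma code_action_inj: "code_action a = code_action b \<longleftrightarrow> a = b"
proof -
  have "inj code_atom" by (simp add: inj_def code_atom_inj)
  then show ?thesis by (cases a; cases b) (auto simp: inj_map_eq_map)
qed

lemma code_transition_inj: "code_transition t = code_transition u \<longleftrightarrow> t = u"
  by (cases t; cases u) (auto simp: code_action_inj)

text \<open>Transitions stay in coded form and are inspected as codes by the programs; since
  \<open>code_transition\<close> is injective, no information is lost.\<close>

definition represents_block :: "binst \<Rightarrow> nat_qdas \<Rightarrow> (nat \<Rightarrow> nat) \<Rightarrow> bool" where
  "represents_block e A f \<longleftrightarrow> lists_set (map fst (b_sts e)) (states A (b_id e)) \<and>
     (\<forall>p \<in> set (b_sts e). snd p = f (fst p)) \<and> b_init e = init_state A (b_id e) \<and> b_final e = final_state A (b_id e) \<and>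
     lists_set (b_trs e) (code_transition ` transitions A (b_id e))"

definition represents :: "inst \<Rightarrow> nat_qdas \<Rightarrow> (nat \<Rightarrow> nat) \<Rightarrow> bool" where
  "represents I A f \<longleftrightarrow> lists_set (i_data I) (data A) \<and> i_d0 I = init_data A \<and> lists_set (i_vars I) (variables A) \<and>
     lists_set (i_cq I) (cqid A) \<and> lists_set (i_sq I) (sqid A) \<and> i_main I = main_block A \<and>
     lists_set (map b_id (i_blocks I)) (blocks A) \<and> (\<forall>e \<in> set (i_blocks I). represents_block e A f)"

lemma codes_block_iff: "c \<in> codes_block A f b \<longleftrightarrow> (\<exists>e. c = code_of_block e \<and> b_id e = b \<and> represents_block e A f)"
proof
  assume "c \<in> codes_block A f b"
  then obtain ss ts where c: "c = L [N b, L (map (\<lambda>s. L [N s, N (f s)]) ss), N (init_state A b), N (final_state A b), L (map code_transition ts)]"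
    and l: "lists_set ss (states A b)" "lists_set ts (transitions A b)"
    unfolding codes_block_def by blast
  let ?e = "(b, map (\<lambda>s. (s, f s)) ss, init_state A b, final_state A b, map code_transition ts)"
  have "c = code_of_block ?e" by (simp add: c code_of_block_def o_def)
  moreover have "represents_block ?e A f"
    using l by (auto simp: represents_block_def lists_set_def o_def distinct_map inj_on_def code_transition_inj)
  ultimately show "\<exists>e. c = code_of_block e \<and> b_id e = b \<and> represents_block e A f" by (intro exI[of _ ?e]) simp
next
  assume "\<exists>e. c = code_of_block e \<and> b_id e = b \<and> represents_block e A f"
  then obtain e where c: "c = code_of_block e" "b_id e = b" and r: "represents_block e A f" by blast
  define ts where "ts = map (inv code_transition) (b_trs e)"
  have inj: "inj code_transition" by (auto simp: inj_def code_transition_inj)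
  have "code_transition (inv code_transition t) = t" if "t \<in> set (b_trs e)" for t
    by (rule f_inv_into_f) (use r that in \<open>auto simp: represents_block_def lists_set_def\<close>)
  then have ts: "map code_transition ts = b_trs e" by (simp add: ts_def map_idI)
  have "lists_set ts (transitions A b)"
    using r c(2) inj unfolding represents_block_def lists_set_def ts[symmetric]
    by (auto simp: distinct_map inj_image_eq_iff)
  moreover have "lists_set (map fst (b_sts e)) (states A b)" using r c(2) by (simp add: represents_block_def)
  moreover have "c = L [N b, L (map (\<lambda>s. L [N s, N (f s)]) (map fst (b_sts e))), N (init_state A b), N (final_state A b), L (map code_transition ts)]"
    using r c by (auto simp: code_of_block_def represents_block_def ts)
  ultimately show "c \<in> codes_block A f b" unfolding codes_block_def by blast
qed

lemma codes_instance_iff: "c \<in> codes_instance A f \<longleftrightarrow> (\<exists>I. c = code_of_inst I \<and> represents I A f)"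
proof
  assume "c \<in> codes_instance A f"
  then obtain ds xs cs ss bs ls where c: "c = L [L (map N ds), N (init_data A), L (map N xs), L (map N cs), L (map N ss), N (main_block A), L ls]"
    and l: "lists_set ds (data A)" "lists_set xs (variables A)" "lists_set cs (cqid A)" "lists_set ss (sqid A)" "lists_set bs (blocks A)"
    and bl: "list_all2 (\<lambda>l b. l \<in> codes_block A f b) ls bs"
    unfolding codes_instance_def by blast
  from bl have "\<exists>es. ls = map code_of_block es \<and> map b_id es = bs \<and> (\<forall>e \<in> set es. represents_block e A f)"
  proof (induction rule: list_all2_induct)
    case Nil then show ?case by simp
  next
    case (Cons x xs y ys)
    then obtain e es where "x = code_of_block e" "b_id e = y" "represents_block e A f"
      "xs = map code_of_block es \<and> map b_id es = ys \<and> (\<forall>e \<in> set es. represents_block e A f)"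
      unfolding codes_block_iff by blast
    then show ?case by (intro exI[of _ "e # es"]) simp
  qed
  then obtain es where "ls = map code_of_block es" "map b_id es = bs" "\<forall>e \<in> set es. represents_block e A f" by blast
  then show "\<exists>I. c = code_of_inst I \<and> represents I A f"
    using c l by (intro exI[of _ "(ds, init_data A, xs, cs, ss, main_block A, es)"]) (simp add: code_of_inst_def represents_def)
next
  assume "\<exists>I. c = code_of_inst I \<and> represents I A f"
  then obtain I where c: "c = code_of_inst I" and r: "represents I A f" by blast
  have "code_of_block e \<in> codes_block A f (b_id e)" if "e \<in> set (i_blocks I)" for e
    using r that unfolding codes_block_iff represents_def by blast
  then have "list_all2 (\<lambda>l b. l \<in> codes_block A f b) (map code_of_block (i_blocks I)) (map b_id (i_blocks I))"
    by (simp add: list_all2_map1 list_all2_map2 list_all2_same)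
  then show "c \<in> codes_instance A f"
    using c r unfolding codes_instance_def represents_def code_of_inst_def by blast
qed

text \<open>The shape of a code is tested by rebuilding it from its parts, for which projections and
  equality are enough. The checks of actions and transitions follow the same pattern.\<close>

definition atom_ok :: "inst \<Rightarrow> code \<Rightarrow> bool" where
  "atom_ok I t \<longleftrightarrow> t = L [N (num (sub 0 t)), N (num (sub 1 t)), N (num (sub 2 t))] \<and>
     (num (sub 0 t) = 0 \<or> num (sub 0 t) = 1) \<and> num (sub 1 t) \<in> set (i_vars I) \<and> num (sub 2 t) \<in> set (i_data I)"

text \<open>Asynchronous dispatches are not admitted.\<close>

definition action_ok :: "inst \<Rightarrow> code \<Rightarrow> bool" where
  "action_ok I a \<longleftrightarrow>
     a = L [N 1, N (num (sub 1 a)), N (num (sub 2 a))] \<and> num (sub 1 a) \<in> set (i_sq I) \<and>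
       num (sub 2 a) \<in> set (map b_id (i_blocks I)) \<and> num (sub 2 a) \<noteq> i_main I \<or>
     a = L [N 2, L (kids (sub 1 a))] \<and> (\<forall>t \<in> set (kids (sub 1 a)). atom_ok I t) \<or>
     a = L [N 3, N (num (sub 1 a)), N (num (sub 2 a))] \<and> num (sub 1 a) \<in> set (i_vars I) \<and> num (sub 2 a) \<in> set (i_data I)"

definition transition_ok :: "inst \<Rightarrow> binst \<Rightarrow> code \<Rightarrow> bool" where
  "transition_ok I e t \<longleftrightarrow> t = L [N (num (sub 0 t)), sub 1 t, N (num (sub 2 t))] \<and>
     num (sub 0 t) \<in> set (map fst (b_sts e)) \<and> num (sub 2 t) \<in> set (map fst (b_sts e)) \<and> action_ok I (sub 1 t)"

definition block_ok :: "inst \<Rightarrow> binst \<Rightarrow> bool" where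
  "block_ok I e \<longleftrightarrow> distinct (map fst (b_sts e)) \<and> b_init e \<in> set (map fst (b_sts e)) \<and> b_final e \<in> set (map fst (b_sts e)) \<and>
     distinct (b_trs e) \<and> (\<forall>t \<in> set (b_trs e). transition_ok I e t) \<and>
     (\<forall>e' \<in> set (i_blocks I). b_id e \<noteq> b_id e' \<longrightarrow> (\<forall>p \<in> set (b_sts e). fst p \<notin> set (map fst (b_sts e'))))"

definition inst_ok :: "inst \<Rightarrow> bool" where
  "inst_ok I \<longleftrightarrow> distinct (i_data I) \<and> i_d0 I \<in> set (i_data I) \<and> distinct (i_vars I) \<and> i_cq I = [] \<and>
     i_sq I \<noteq> [] \<and> distinct (i_sq I) \<and> i_main I \<in> set (map b_id (i_blocks I)) \<and> distinct (map b_id (i_blocks I)) \<and>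
     (\<forall>e \<in> set (i_blocks I). block_ok I e)"

lemma ptime_inst_ok: "ptime inst_ok"
proof -
  have 1: "ptime (\<lambda>z. atom_ok (fst z) (snd z))"
    unfolding atom_ok_def by (intro ptime_intros)
  have 2: "ptime (\<lambda>z. action_ok (fst z) (snd z))"
    unfolding action_ok_def by (intro ptime_intros ptime_comp2[OF 1])
  have 3: "ptime (\<lambda>z. transition_ok (fst z) (fst (snd z)) (snd (snd z)))"
    unfolding transition_ok_def by (intro ptime_intros ptime_comp2[OF 2])
  have 4: "ptime (\<lambda>z. block_ok (fst z) (snd z))"
    unfolding block_ok_def by (intro ptime_intros ptime_comp3[OF 3])
  show ?thesis
    unfolding inst_ok_def[abs_def] by (intro ptime_intros ptime_comp2[OF 4])
qed

lemma atom_ok_iff: "atom_ok I t \<longleftrightarrow> (\<exists>a. t = code_atom a \<and> atom_over (set (i_vars I)) (set (i_data I)) a)"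
proof
  assume t: "atom_ok I t"
  then consider "num (sub 0 t) = 0" | "num (sub 0 t) = 1" by (auto simp: atom_ok_def)
  then show "\<exists>a. t = code_atom a \<and> atom_over (set (i_vars I)) (set (i_data I)) a"
  proof cases
    case 1
    then show ?thesis using t by (intro exI[of _ "Eq (num (sub 1 t)) (num (sub 2 t))"]) (auto simp: atom_ok_def)
  next
    case 2
    then show ?thesis using t by (intro exI[of _ "Neq (num (sub 1 t)) (num (sub 2 t))"]) (auto simp: atom_ok_def)
  qed
next
  assume "\<exists>a. t = code_atom a \<and> atom_over (set (i_vars I)) (set (i_data I)) a"
  then obtain a where "t = code_atom a" "atom_over (set (i_vars I)) (set (i_data I)) a" by blast
  then show "atom_ok I t" by (cases a) (auto simp: atom_ok_def)
qed

lemma action_ok_iff: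
  assumes "represents I A f" "i_cq I = []"
  shows "action_ok I c \<longleftrightarrow> (\<exists>a. c = code_action a \<and> action_of A a \<and> (\<forall>q b. a \<noteq> Dispatch_a q b))"
proof
  have *: "set (i_data I) = data A" "set (i_vars I) = variables A" "cqid A = {}" "set (i_sq I) = sqid A"
    "set (map b_id (i_blocks I)) = blocks A" "i_main I = main_block A"
    using assms by (auto simp: represents_def lists_set_def)
  {
    assume c: "action_ok I c"
    then consider "c = L [N 1, N (num (sub 1 c)), N (num (sub 2 c))]" "num (sub 1 c) \<in> sqid A" "num (sub 2 c) \<in> blocks A - {main_block A}"
      | "c = L [N 2, L (kids (sub 1 c))]" "\<forall>t \<in> set (kids (sub 1 c)). atom_ok I t"
      | "c = L [N 3, N (num (sub 1 c)), N (num (sub 2 c))]" "num (sub 1 c) \<in> variables A" "num (sub 2 c) \<in> data A"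
      unfolding action_ok_def * by auto
    then show "\<exists>a. c = code_action a \<and> action_of A a \<and> (\<forall>q b. a \<noteq> Dispatch_a q b)"
    proof cases
      case 1
      then show ?thesis by (intro exI[of _ "Dispatch_s (num (sub 1 c)) (num (sub 2 c))"]) auto
    next
      case 2
      then obtain g where g: "\<And>t. t \<in> set (kids (sub 1 c)) \<Longrightarrow> t = code_atom (g t) \<and> atom_over (variables A) (data A) (g t)"
        unfolding atom_ok_iff * by metis
      then have "map code_atom (map g (kids (sub 1 c))) = kids (sub 1 c)" by (simp add: map_idI)
      then show ?thesis using 2(1) g by (intro exI[of _ "Guard (map g (kids (sub 1 c)))"]) auto
    next
      case 3
      then show ?thesis by (intro exI[of _ "Assign (num (sub 1 c)) (num (sub 2 c))"]) auto
    qed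
  }
  assume "\<exists>a. c = code_action a \<and> action_of A a \<and> (\<forall>q b. a \<noteq> Dispatch_a q b)"
  then obtain a where a: "c = code_action a" "action_of A a" "\<forall>q b. a \<noteq> Dispatch_a q b" by blast
  have "b_id ` set (i_blocks I) = blocks A" using *(5) by simp
  with a show "action_ok I c"
    by (cases a) (auto simp: action_ok_def atom_ok_iff *(1-4,6))
qed

lemma transition_ok_iff:
  assumes I: "represents I A f" "i_cq I = []" and e: "e \<in> set (i_blocks I)"
  shows "transition_ok I e c \<longleftrightarrow> (\<exists>s a s'. c = code_transition (s, a, s') \<and> s \<in> states A (b_id e) \<and> s' \<in> states A (b_id e) \<and>
     action_of A a \<and> (\<forall>q b. a \<noteq> Dispatch_a q b))"
proof -
  have st: "set (map fst (b_sts e)) = states A (b_id e)"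
    using I(1) e by (auto simp: represents_def represents_block_def lists_set_def)
  show ?thesis
  proof
    assume c: "transition_ok I e c"
    then obtain a where "sub 1 c = code_action a" "action_of A a" "\<forall>q b. a \<noteq> Dispatch_a q b"
      unfolding transition_ok_def action_ok_iff[OF I] by blast
    then show "\<exists>s a s'. c = code_transition (s, a, s') \<and> s \<in> states A (b_id e) \<and> s' \<in> states A (b_id e) \<and>
       action_of A a \<and> (\<forall>q b. a \<noteq> Dispatch_a q b)"
      using c unfolding transition_ok_def st by (intro exI[of _ "num (sub 0 c)"] exI[of _ a] exI[of _ "num (sub 2 c)"]) auto
  next
    assume "\<exists>s a s'. c = code_transition (s, a, s') \<and> s \<in> states A (b_id e) \<and> s' \<in> states A (b_id e) \<and>
       action_of A a \<and> (\<forall>q b. a \<noteq> Dispatch_a q b)"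
    then show "transition_ok I e c"
      unfolding transition_ok_def st action_ok_iff[OF I] by auto
  qed
qed

text \<open>Finiteness is automatic for sets given by lists, and injectivity of the transition codes
  passes it on to the transitions. What remains of the three properties is what
  \<open>inst_ok\<close> tests.\<close>

lemma inst_ok_iff:
  assumes r: "represents I A f"
  shows "inst_ok I \<longleftrightarrow> wf_qdas A \<and> serial A \<and> synchronous A"
proof -
  have *: "set (i_data I) = data A" "distinct (i_data I)" "i_d0 I = init_data A" "set (i_vars I) = variables A" "distinct (i_vars I)"
    "set (i_cq I) = cqid A" "set (i_sq I) = sqid A" "distinct (i_sq I)" "set (map b_id (i_blocks I)) = blocks A"
    "distinct (map b_id (i_blocks I))" "i_main I = main_block A"
    using r by (auto simp: represents_def lists_set_def)
  have fin: "finite (data A)" "finite (variables A)" "finite (cqid A)" "finite (sqid A)" "finite (blocks A)"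
    unfolding *(1,4,6,7,9)[symmetric] by simp_all
  have e: "set (map fst (b_sts e)) = states A (b_id e)" "distinct (map fst (b_sts e))" "b_init e = init_state A (b_id e)"
    "b_final e = final_state A (b_id e)" "set (b_trs e) = code_transition ` transitions A (b_id e)" "distinct (b_trs e)"
    if "e \<in> set (i_blocks I)" for e
    using r that by (auto simp: represents_def represents_block_def lists_set_def)
  have finb: "finite (states A (b_id e))" "finite (transitions A (b_id e))" if "e \<in> set (i_blocks I)" for e
  proof -
    show "finite (states A (b_id e))" unfolding e(1)[OF that, symmetric] by simp
    have "finite (code_transition ` transitions A (b_id e))" unfolding e(5)[OF that, symmetric] by simp
    then show "finite (transitions A (b_id e))"
      by (rule finite_imageD) (auto simp: inj_on_def code_transition_inj)
  qed
  have allb: "(\<forall>b \<in> blocks A. P b) \<longleftrightarrow> (\<forall>e \<in> set (i_blocks I). P (b_id e))" for P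
    unfolding *(9)[symmetric] by simp
  have ser: "serial A \<longleftrightarrow> i_cq I = [] \<and> i_sq I \<noteq> []"
    unfolding serial_def *(6,7)[symmetric] by simp
  show ?thesis
  proof (cases "serial A")
    case False
    then show ?thesis using ser by (auto simp: inst_ok_def)
  next
    case True
    then have cq: "i_cq I = []" using ser by simp
    have trs: "(\<forall>t \<in> set (b_trs e). transition_ok I e t) \<longleftrightarrow>
       transitions A (b_id e) \<subseteq> states A (b_id e) \<times> Collect (action_of A) \<times> states A (b_id e) \<and>
       (\<forall>(s, a, s') \<in> transitions A (b_id e). \<forall>q c. a \<noteq> Dispatch_a q c)" if "e \<in> set (i_blocks I)" for e
      unfolding e(5)[OF that] transition_ok_iff[OF r cq that] by (fastforce simp: code_transition_inj simp del: code_transition.simps)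
    have disj: "(\<forall>p \<in> set (b_sts e). fst p \<notin> set (map fst (b_sts e'))) \<longleftrightarrow> states A (b_id e) \<inter> states A (b_id e') = {}"
      if "e \<in> set (i_blocks I)" "e' \<in> set (i_blocks I)" for e e'
      unfolding e(1)[OF that(1), symmetric] e(1)[OF that(2), symmetric] by auto
    have "block_ok I e \<longleftrightarrow> init_state A (b_id e) \<in> states A (b_id e) \<and> final_state A (b_id e) \<in> states A (b_id e) \<and>
       transitions A (b_id e) \<subseteq> states A (b_id e) \<times> Collect (action_of A) \<times> states A (b_id e) \<and>
       (\<forall>(s, a, s') \<in> transitions A (b_id e). \<forall>q c. a \<noteq> Dispatch_a q c) \<and>
       (\<forall>e' \<in> set (i_blocks I). b_id e \<noteq> b_id e' \<longrightarrow> states A (b_id e) \<inter> states A (b_id e') = {})"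
      if "e \<in> set (i_blocks I)" for e
      unfolding block_ok_def e(1,3,4)[OF that] trs[OF that] using e(2,6)[OF that] disj[OF that] by auto
    then have "inst_ok I \<longleftrightarrow> init_data A \<in> data A \<and> main_block A \<in> blocks A \<and>
      (\<forall>e \<in> set (i_blocks I). init_state A (b_id e) \<in> states A (b_id e) \<and> final_state A (b_id e) \<in> states A (b_id e) \<and>
       transitions A (b_id e) \<subseteq> states A (b_id e) \<times> Collect (action_of A) \<times> states A (b_id e) \<and>
       (\<forall>(s, a, s') \<in> transitions A (b_id e). \<forall>q c. a \<noteq> Dispatch_a q c) \<and>
       (\<forall>e' \<in> set (i_blocks I). b_id e \<noteq> b_id e' \<longrightarrow> states A (b_id e) \<inter> states A (b_id e') = {}))"
      using ser True * by (auto simp: inst_ok_def)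
    also have "\<dots> \<longleftrightarrow> wf_qdas A \<and> synchronous A"
    proof -
      have "cqid A \<inter> sqid A = {}" using True by (simp add: serial_def)
      then show ?thesis unfolding wf_qdas_def synchronous_def allb using fin finb by blast
    qed
    finally show ?thesis using True by simp
  qed
qed

text \<open>The system is read off the lists. The function \<open>f\<close> is well defined because
  a state belongs to only one block and is listed there only once, both of which the check
  guarantees.\<close>

lemma inst_ok_represents:
  assumes "inst_ok I"
  shows "\<exists>A f. represents I A f"
proof -
  define entry where "entry b = (SOME e. e \<in> set (i_blocks I) \<and> b_id e = b)" for b
  have entry: "entry (b_id e) = e" if "e \<in> set (i_blocks I)" for e
  proof -
    have "entry (b_id e) \<in> set (i_blocks I) \<and> b_id (entry (b_id e)) = b_id e"
      unfolding entry_def by (rule someI[of _ e]) (use that in simp)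
    then show ?thesis using assms that unfolding inst_ok_def distinct_map by (meson inj_onD)
  qed
  define f where "f s = (SOME n. \<exists>e \<in> set (i_blocks I). (s, n) \<in> set (b_sts e))" for s
  have f: "n = f s" if e: "e \<in> set (i_blocks I)" and s: "(s, n) \<in> set (b_sts e)" for e s n
  proof -
    have "\<exists>e' \<in> set (i_blocks I). (s, f s) \<in> set (b_sts e')"
      unfolding f_def by (rule someI[of _ n]) (use e s in blast)
    then obtain e' where e': "e' \<in> set (i_blocks I)" "(s, f s) \<in> set (b_sts e')" by blast
    have "b_id e = b_id e'"
    proof (rule ccontr)
      assume "b_id e \<noteq> b_id e'"
      then have "fst (s, n) \<notin> set (map fst (b_sts e'))"
        using assms e e'(1) s unfolding inst_ok_def block_ok_def by blast
      then show False using e'(2) by force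
    qed
    then have "e = e'" using entry e e'(1) by metis
    moreover have "distinct (map fst (b_sts e))" using assms e unfolding inst_ok_def block_ok_def by blast
    ultimately show ?thesis using s e'(2) by (metis eq_key_imp_eq_value)
  qed
  define A where "A = \<lparr>data = set (i_data I), init_data = i_d0 I, variables = set (i_vars I), cqid = set (i_cq I),
    sqid = set (i_sq I), blocks = set (map b_id (i_blocks I)), main_block = i_main I,
    states = (\<lambda>b. set (map fst (b_sts (entry b)))), init_state = (\<lambda>b. b_init (entry b)),
    final_state = (\<lambda>b. b_final (entry b)), transitions = (\<lambda>b. {t. code_transition t \<in> set (b_trs (entry b))})\<rparr>"
  have "represents_block e A f" if e: "e \<in> set (i_blocks I)" for e
  proof -
    have "t \<in> range code_transition" if "t \<in> set (b_trs e)" for t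
    proof -
      have ok: "transition_ok I e t" using assms e that unfolding inst_ok_def block_ok_def by blast
      then have a: "action_ok I (sub 1 t)" and t: "t = L [N (num (sub 0 t)), sub 1 t, N (num (sub 2 t))]"
        unfolding transition_ok_def by auto
      have "sub 1 t \<in> range code_action"
      proof -
        let ?a = "sub 1 t"
        from a consider "?a = L [N 1, N (num (sub 1 ?a)), N (num (sub 2 ?a))]"
          | "?a = L [N 2, L (kids (sub 1 ?a))]" "\<forall>t \<in> set (kids (sub 1 ?a)). atom_ok I t"
          | "?a = L [N 3, N (num (sub 1 ?a)), N (num (sub 2 ?a))]"
          unfolding action_ok_def by blast
        then show ?thesis
        proof cases
          case 1
          then have "?a = code_action (Dispatch_s (num (sub 1 ?a)) (num (sub 2 ?a)))" by simp
          then show ?thesis by blast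
        next
          case 2
          then have "set (kids (sub 1 ?a)) \<subseteq> range code_atom" by (auto simp: atom_ok_iff)
          then have "code_atom (inv code_atom t) = t" if "t \<in> set (kids (sub 1 ?a))" for t
            using that by (intro f_inv_into_f) blast
          then have "map code_atom (map (inv code_atom) (kids (sub 1 ?a))) = kids (sub 1 ?a)"
            by (simp add: map_idI)
          then have "?a = code_action (Guard (map (inv code_atom) (kids (sub 1 ?a))))" using 2(1) by simp
          then show ?thesis by blast
        next
          case 3
          then have "?a = code_action (Assign (num (sub 1 ?a)) (num (sub 2 ?a)))" by simp
          then show ?thesis by blast
        qed
      qed
      then obtain a where "sub 1 t = code_action a" by blast
      with t have "t = code_transition (num (sub 0 t), a, num (sub 2 t))" by simp
      then show ?thesis by blast
    qed
    then have "set (b_trs e) = code_transition ` {t. code_transition t \<in> set (b_trs e)}" by auto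
    moreover have "distinct (map fst (b_sts e))" "distinct (b_trs e)"
      using assms e unfolding inst_ok_def block_ok_def by auto
    ultimately show ?thesis
      using f[OF e] by (auto simp: represents_block_def A_def entry[OF e] lists_set_def)
  qed
  then have "represents I A f"
    using assms by (auto simp: represents_def A_def lists_set_def inst_ok_def)
  then show ?thesis by blast
qed

section \<open>Serial synchronous systems as stacks\<close>

text \<open>
  In a serial synchronous system all vertices lie on one chain of wait edges. A frame is a vertex
  with its block, its queue (the empty list for \<open>main\<close>) and its state; the head of the list is the
  end of the chain, and the flag tells whether it is a call vertex.
\<close>

type_synonym frame = "nat \<times> nat list \<times> nat"

text \<open>Every frame below the top waits for the one above it, so only the top can move. When the
  top is a call, its queue is free exactly if none of the frames below carries the same queue
  label.\<close>

inductive astep :: "nat_qdas \<Rightarrow> frame list \<times> bool \<times> (nat \<Rightarrow> nat) \<Rightarrow> frame list \<times> bool \<times> (nat \<Rightarrow> nat) \<Rightarrow> bool" for A where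
  as_guard: "(s, Guard g, s') \<in> transitions A b \<Longrightarrow> \<forall>a \<in> set g. sat_atom \<nu> a \<Longrightarrow>
    astep A ((b, q, s) # r, False, \<nu>) ((b, q, s') # r, False, \<nu>)"
| as_assign: "(s, Assign x d, s') \<in> transitions A b \<Longrightarrow>
    astep A ((b, q, s) # r, False, \<nu>) ((b, q, s') # r, False, \<nu>(x := d))"
| as_dispatch: "(s, Dispatch_s q' b', s') \<in> transitions A b \<Longrightarrow>
    astep A ((b, q, s) # r, False, \<nu>) ((b', [q'], init_state A b') # (b, q, s') # r, True, \<nu>)"
| as_terminate: "s = final_state A b \<Longrightarrow> astep A ((b, q, s) # r, False, \<nu>) (r, False, \<nu>)"
| as_dequeue: "q \<notin> set (map (fst \<circ> snd) r) \<Longrightarrow>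
    astep A ((b, q, s) # r, True, \<nu>) ((b, q, s) # r, False, \<nu>)"

text \<open>A waiting call is exempt from distinctness: its queue may be occupied by a task below
  it, which in turn waits for the call, a deadlock.\<close>

fun ainv :: "nat_qdas \<Rightarrow> frame list \<times> bool \<times> (nat \<Rightarrow> nat) \<Rightarrow> bool" where
  "ainv A (fr, p, \<nu>) \<longleftrightarrow>
     (\<forall>(b, q, s) \<in> set fr. b \<in> blocks A \<and> s \<in> states A b \<and> (q = [] \<or> (\<exists>q' \<in> sqid A. q = [q']))) \<and>
     distinct (map (fst \<circ> snd) (if p then tl fr else fr)) \<and> (p \<longrightarrow> fr \<noteq> [] \<and> fst (snd (hd fr)) \<noteq> []) \<and>
     (\<forall>x \<in> variables A. \<nu> x \<in> data A)"

definition ainit :: "nat_qdas \<Rightarrow> frame list \<times> bool \<times> (nat \<Rightarrow> nat)" where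
  "ainit A = ([(main_block A, [], init_state A (main_block A))], False, \<lambda>_. init_data A)"

definition frame_of :: "(nat, nat, nat) ctg \<Rightarrow> nat \<Rightarrow> frame" where
  "frame_of G v = (block G v, (case queue G v of None \<Rightarrow> [] | Some q \<Rightarrow> [q]), state G v)"

text \<open>The list \<open>vs\<close> starts at the end of the chain, so
  \<open>zip (tl vs) vs\<close> pairs each vertex with the one that it waits for. The only queue
  that can be non-empty is that of the head, and then the head is its only element.\<close>

definition chain :: "nat list \<Rightarrow> frame list \<Rightarrow> bool \<Rightarrow> (nat, nat, nat) ctg \<Rightarrow> bool" where
  "chain vs fr p G \<longleftrightarrow> distinct vs \<and> fr = map (frame_of G) vs \<and> (p \<longrightarrow> vs \<noteq> []) \<and>
     tasks G = set (if p then tl vs else vs) \<and> waits G = set (zip (tl vs) vs) \<and>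
     fifo G = (if p then (\<lambda>_. [])(the (queue G (hd vs)) := [hd vs]) else (\<lambda>_. []))"

definition count_state :: "frame list \<Rightarrow> nat \<Rightarrow> nat" where
  "count_state fr s = length (filter (\<lambda>f. snd (snd f) = s) fr)"

locale serial_synchronous =
  fixes A :: nat_qdas
  assumes wf: "wf_qdas A" and ser: "serial A" and syn: "synchronous A"
begin

lemma trans_ok:
  assumes "(s, a, s') \<in> transitions A b" "b \<in> blocks A"
  shows "s \<in> states A b" "s' \<in> states A b" "action_of A a" "a \<noteq> Dispatch_a q c"
proof -
  have "transitions A b \<subseteq> states A b \<times> Collect (action_of A) \<times> states A b" using wf assms(2) by (simp add: wf_qdas_def)
  with assms(1) show "s \<in> states A b" "s' \<in> states A b" "action_of A a" by auto
  have "\<forall>(s, a, s') \<in> transitions A b. \<forall>q c. a \<noteq> Dispatch_a q c" using syn assms(2) by (simp add: synchronous_def)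
  with assms(1) show "a \<noteq> Dispatch_a q c" by blast
qed

lemma cq: "cqid A = {}"
  using ser by (simp add: serial_def)

lemma ainv_ainit: "ainv A (ainit A)"
  using wf by (auto simp: ainit_def wf_qdas_def)

lemma ainv_astep: "astep A C C' \<Longrightarrow> ainv A C \<Longrightarrow> ainv A C'"
proof (induction rule: astep.induct)
  case (as_guard s g s' b \<nu> q r)
  then show ?case using trans_ok(2)[OF as_guard(1)] by auto
next
  case (as_assign s x d s' b q r \<nu>)
  then show ?case using trans_ok(2,3)[OF as_assign(1)] by auto
next
  case (as_dispatch s q' b' s' b q r \<nu>)
  then have "b \<in> blocks A" by auto
  from trans_ok(2,3)[OF as_dispatch(1) this] have "s' \<in> states A b" "q' \<in> sqid A" "b' \<in> blocks A" using cq by auto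
  moreover from this have "init_state A b' \<in> states A b'" using wf by (auto simp: wf_qdas_def)
  ultimately show ?case using as_dispatch by auto
qed auto

lemma chain_vertices: "chain vs fr p G \<Longrightarrow> vertices G = set vs"
  by (cases vs) (auto simp: chain_def vertices_def calls_def split: if_splits)

text \<open>All vertices but the head of the list have an outgoing wait edge, and the head is a task
  only if no call is pending.\<close>

lemma chain_unblocked:
  assumes "chain vs fr p G" "v \<in> tasks G" "unblocked G v"
  shows "\<not> p \<and> (\<exists>us. vs = v # us)"
proof -
  have fst_zip: "\<exists>w. (v, w) \<in> set (zip (tl vs) vs)" if v: "v \<in> set (tl vs)"
  proof -
    obtain i where "i < length (tl vs)" "tl vs ! i = v" using v unfolding in_set_conv_nth by blast
    then have "(v, vs ! i) \<in> set (zip (tl vs) vs)"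
      unfolding in_set_zip by (intro exI[of _ i]) auto
    then show ?thesis by blast
  qed
  have "v \<notin> set (tl vs)" using assms fst_zip by (auto simp: chain_def unblocked_def)
  then show ?thesis using assms(1,2) by (cases vs) (auto simp: chain_def split: if_splits)
qed

lemma chain_hd_unblocked: "chain (v # us) fr False G \<Longrightarrow> v \<in> tasks G \<and> unblocked G v"
  by (auto simp: chain_def unblocked_def dest: set_zip_leftD)

lemma chain_step:
  assumes "step A (G, \<nu>) (G', \<nu>')" "chain vs fr p G" "ainv A (fr, p, \<nu>)"
  shows "\<exists>vs' fr' p'. astep A (fr, p, \<nu>) (fr', p', \<nu>') \<and> chain vs' fr' p' G'"
  using assms(1)
proof cases
  case (step_guard v g s')
  then obtain us where vs: "vs = v # us" "p = False" using chain_unblocked[OF assms(2)] by blast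
  then have fr: "fr = (block G v, fst (snd (frame_of G v)), state G v) # map (frame_of G) us"
    using assms(2) by (simp add: chain_def frame_of_def)
  have "chain vs ((block G v, fst (snd (frame_of G v)), s') # map (frame_of G) us) False (set_state v s' G)"
    using assms(2) vs by (auto simp: chain_def frame_of_def set_state_def)
  then show ?thesis unfolding fr vs(2) using step_guard by (metis as_guard)
next
  case (step_assign v x d s')
  then obtain us where vs: "vs = v # us" "p = False" using chain_unblocked[OF assms(2)] by blast
  then have fr: "fr = (block G v, fst (snd (frame_of G v)), state G v) # map (frame_of G) us"
    using assms(2) by (simp add: chain_def frame_of_def)
  have "chain vs ((block G v, fst (snd (frame_of G v)), s') # map (frame_of G) us) False (set_state v s' G)"
    using assms(2) vs by (auto simp: chain_def frame_of_def set_state_def)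
  then show ?thesis unfolding fr vs(2) using step_assign by (metis as_assign)
next
  case (step_dispatch_a v q b s' w)
  then obtain us where vs: "vs = v # us" "p = False" using chain_unblocked[OF assms(2)] by blast
  then have "block G v \<in> blocks A" using assms(2,3) by (auto simp: chain_def frame_of_def)
  then show ?thesis using trans_ok(4)[OF step_dispatch_a(5)] by blast
next
  case (step_dispatch_s v q b s' w)
  then obtain us where vs: "vs = v # us" "p = False" using chain_unblocked[OF assms(2)] by blast
  then have fr: "fr = (block G v, fst (snd (frame_of G v)), state G v) # map (frame_of G) us"
    using assms(2) by (simp add: chain_def frame_of_def)
  have w: "w \<notin> set vs" using step_dispatch_s chain_vertices[OF assms(2)] by simp
  have "chain (w # vs) ((b, [q], init_state A b) # (block G v, fst (snd (frame_of G v)), s') # map (frame_of G) us) True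
      (add_wait v w (add_call A w q b (set_state v s' G)))"
    using assms(2) vs w by (auto simp: chain_def frame_of_def set_state_def add_wait_def add_call_def)
  then show ?thesis unfolding fr vs(2) using step_dispatch_s by (metis as_dispatch)
next
  case (step_terminate v)
  then obtain us where vs: "vs = v # us" "p = False" using chain_unblocked[OF assms(2)] by blast
  then have fr: "fr = (block G v, fst (snd (frame_of G v)), state G v) # map (frame_of G) us"
    using assms(2) by (simp add: chain_def frame_of_def)
  have "chain us (map (frame_of G) us) False (remove_task v G)"
    using assms(2) vs by (cases us) (auto simp: chain_def frame_of_def remove_task_def dest: set_zip_rightD)
  then show ?thesis unfolding fr vs(2) using step_terminate by (metis as_terminate)
next
  case (step_dequeue_concurrent q)
  then show ?thesis using cq by simp
next
  case (step_dequeue_serial q)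
  \<comment> \<open>A non-empty queue means that the top frame is a waiting call.\<close>
  have p: "p" using step_dequeue_serial(4) assms(2) by (auto simp: chain_def split: if_splits)
  then obtain v us where vs: "vs = v # us" using assms(2) by (cases vs) (auto simp: chain_def)
  then have q: "q = the (queue G v)" "fifo G q = [v]"
    using step_dequeue_serial(4) assms(2) p by (auto simp: chain_def split: if_splits)
  have fr: "fr = (block G v, fst (snd (frame_of G v)), state G v) # map (frame_of G) us"
    using assms(2) vs by (simp add: chain_def frame_of_def)
  have qv: "queue G v = Some q"
    using assms(2,3) p vs q by (auto simp: chain_def frame_of_def split: option.splits)
  have "fst (snd (frame_of G v)) \<notin> set (map (fst \<circ> snd) (map (frame_of G) us))"
    using step_dequeue_serial(5) assms(2) vs p qv by (auto simp: chain_def frame_of_def split: option.splits)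
  then have "astep A (fr, True, \<nu>) (fr, False, \<nu>)" unfolding fr by (rule as_dequeue)
  moreover have "chain vs fr False (dequeue q G)"
    using assms(2) vs p q by (auto simp: chain_def frame_of_def dequeue_def)
  ultimately show ?thesis using step_dequeue_serial p by auto
qed

lemma step_chain:
  assumes "astep A (fr, p, \<nu>) (fr', p', \<nu>')" "chain vs fr p G" "ainv A (fr, p, \<nu>)"
  shows "\<exists>vs' G'. step A (G, \<nu>) (G', \<nu>') \<and> chain vs' fr' p' G'"
  using assms(1)
proof cases
  case (as_guard s g s' b q r)
  then obtain v us where vs: "vs = v # us" "b = block G v" "s = state G v" "q = fst (snd (frame_of G v))" "r = map (frame_of G) us"
    using assms(2) by (auto simp: chain_def frame_of_def)
  have "step A (G, \<nu>) (set_state v s' G, \<nu>)"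
    using as_guard chain_hd_unblocked assms(2) vs by (intro step.step_guard) auto
  moreover have "chain vs fr' p' (set_state v s' G)"
    using assms(2) vs as_guard by (auto simp: chain_def frame_of_def set_state_def)
  ultimately show ?thesis using as_guard by metis
next
  case (as_assign s x d s' b q r)
  then obtain v us where vs: "vs = v # us" "b = block G v" "s = state G v" "q = fst (snd (frame_of G v))" "r = map (frame_of G) us"
    using assms(2) by (auto simp: chain_def frame_of_def)
  have "step A (G, \<nu>) (set_state v s' G, \<nu>(x := d))"
    using as_assign chain_hd_unblocked assms(2) vs by (intro step.step_assign) auto
  moreover have "chain vs fr' p' (set_state v s' G)"
    using assms(2) vs as_assign by (auto simp: chain_def frame_of_def set_state_def)
  ultimately show ?thesis using as_assign by metis
next
  case (as_dispatch s q' b' s' b q r)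
  then obtain v us where vs: "vs = v # us" "b = block G v" "s = state G v" "q = fst (snd (frame_of G v))" "r = map (frame_of G) us"
    using assms(2) by (auto simp: chain_def frame_of_def)
  obtain w where w: "w \<notin> set vs" using ex_new_if_finite[OF infinite_UNIV_nat, of "set vs"] by auto
  let ?G = "add_wait v w (add_call A w q' b' (set_state v s' G))"
  have "step A (G, \<nu>) (?G, \<nu>)"
    using as_dispatch chain_hd_unblocked assms(2) vs w chain_vertices[OF assms(2)] by (intro step.step_dispatch_s) auto
  moreover have "chain (w # vs) fr' p' ?G"
    using assms(2) vs w as_dispatch by (auto simp: chain_def frame_of_def set_state_def add_wait_def add_call_def)
  ultimately show ?thesis using as_dispatch by metis
next
  case (as_terminate s b q)
  then obtain v us where vs: "vs = v # us" "b = block G v" "s = state G v" "q = fst (snd (frame_of G v))" "fr' = map (frame_of G) us"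
    using assms(2) by (auto simp: chain_def frame_of_def)
  have "step A (G, \<nu>) (remove_task v G, \<nu>)"
    using as_terminate chain_hd_unblocked assms(2) vs by (intro step.step_terminate) auto
  moreover have "chain us fr' p' (remove_task v G)"
    using assms(2) vs as_terminate by (cases us) (auto simp: chain_def frame_of_def remove_task_def dest: set_zip_rightD)
  ultimately show ?thesis using as_terminate by metis
next
  case (as_dequeue q r b s)
  then obtain v us where vs: "vs = v # us" "b = block G v" "s = state G v" "q = fst (snd (frame_of G v))" "r = map (frame_of G) us"
    using assms(2) by (auto simp: chain_def frame_of_def)
  obtain q' where q': "q = [q']" "q' \<in> sqid A" using assms(3) as_dequeue by auto
  then have qv: "queue G v = Some q'" using vs(4) by (auto simp: frame_of_def split: option.splits)
  have "queue G u \<noteq> Some q'" if "u \<in> tasks G" for u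
  proof
    \<comment> \<open>A task with this queue would be a frame below the top carrying its label,
      against the condition of the abstract step.\<close>
    assume "queue G u = Some q'"
    then have "fst (snd (frame_of G u)) = q" using q' by (simp add: frame_of_def)
    moreover have "u \<in> set us" using that assms(2) vs(1) as_dequeue by (simp add: chain_def)
    ultimately have "q \<in> set (map (fst \<circ> snd) r)" using vs(5) by force
    with as_dequeue show False by blast
  qed
  then have "step A (G, \<nu>) (dequeue q' G, \<nu>)"
    using assms(2) vs(1) qv q' as_dequeue by (intro step.step_dequeue_serial) (auto simp: chain_def)
  moreover have "chain vs fr' p' (dequeue q' G)"
    using assms(2) vs qv as_dequeue by (auto simp: chain_def frame_of_def dequeue_def)
  ultimately show ?thesis using as_dequeue by metis
qed

lemma chain_parikh: "chain vs fr p G \<Longrightarrow> parikh G s = count_state fr s"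
proof -
  assume c: "chain vs fr p G"
  then have d: "distinct vs" and fr: "fr = map (frame_of G) vs" by (auto simp: chain_def)
  have "{v \<in> vertices G. state G v = s} = set (filter (\<lambda>v. state G v = s) vs)"
    unfolding chain_vertices[OF c] by auto
  then have "parikh G s = card (set (filter (\<lambda>v. state G v = s) vs))" by (simp only: parikh_def)
  also have "\<dots> = length (filter (\<lambda>v. state G v = s) vs)" by (rule distinct_card) (use d in simp)
  finally have "parikh G s = length (filter (\<lambda>v. state G v = s) vs)" .
  then show ?thesis unfolding count_state_def fr by (simp add: filter_map o_def frame_of_def)
qed

lemma chain_init: "chain [0] (fst (ainit A)) False (fst (init_config A))"
  by (simp add: chain_def frame_of_def ainit_def init_config_def)

lemma reachable_chain:
  "(step A)\<^sup>*\<^sup>* (init_config A) C \<Longrightarrow>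
   \<exists>vs fr p. (astep A)\<^sup>*\<^sup>* (ainit A) (fr, p, snd C) \<and> chain vs fr p (fst C) \<and> ainv A (fr, p, snd C)"
proof (induction rule: rtranclp_induct)
  case base
  have "ainit A = (fst (ainit A), False, snd (init_config A))" by (simp add: ainit_def init_config_def)
  then have "(astep A)\<^sup>*\<^sup>* (ainit A) (fst (ainit A), False, snd (init_config A))"
    "ainv A (fst (ainit A), False, snd (init_config A))" using ainv_ainit by simp_all
  with chain_init show ?case by blast
next
  case (step C D)
  then obtain vs fr p where IH: "(astep A)\<^sup>*\<^sup>* (ainit A) (fr, p, snd C)" "chain vs fr p (fst C)" "ainv A (fr, p, snd C)"
    by blast
  have "Defs.step A (fst C, snd C) (fst D, snd D)" using step(2) by simp
  then obtain vs' fr' p' where n: "astep A (fr, p, snd C) (fr', p', snd D)" "chain vs' fr' p' (fst D)"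
    using chain_step[OF _ IH(2,3)] by blast
  from rtranclp.rtrancl_into_rtrancl[OF IH(1) n(1)] ainv_astep[OF n(1) IH(3)] n(2) show ?case by blast
qed

lemma chain_reachable:
  "(astep A)\<^sup>*\<^sup>* (ainit A) C \<Longrightarrow>
   ainv A C \<and> (\<exists>vs G. (step A)\<^sup>*\<^sup>* (init_config A) (G, snd (snd C)) \<and> chain vs (fst C) (fst (snd C)) G)"
proof (induction rule: rtranclp_induct)
  case base
  have "init_config A = (fst (init_config A), snd (snd (ainit A)))" "fst (snd (ainit A)) = False"
    by (simp_all add: ainit_def init_config_def)
  then show ?case using chain_init ainv_ainit by (metis rtranclp.rtrancl_refl)
next
  case (step C D)
  obtain fr p \<nu> where C: "C = (fr, p, \<nu>)" by (metis prod_cases3)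
  obtain fr' p' \<nu>' where D: "D = (fr', p', \<nu>')" by (metis prod_cases3)
  obtain vs G where IH: "ainv A (fr, p, \<nu>)" "(Defs.step A)\<^sup>*\<^sup>* (init_config A) (G, \<nu>)" "chain vs fr p G"
    using step(3) C by auto
  obtain vs' G' where n: "Defs.step A (G, \<nu>) (G', \<nu>')" "chain vs' fr' p' G'"
    using step_chain[OF _ IH(3,1)] step(2) C D by blast
  from rtranclp.rtrancl_into_rtrancl[OF IH(2) n(1)] ainv_astep[OF step(2)] IH(1) n(2) C D show ?case by auto
qed

theorem parikh_coverable_iff:
  "parikh_coverable A f \<longleftrightarrow>
     (\<exists>C. (astep A)\<^sup>*\<^sup>* (ainit A) C \<and> (\<forall>s \<in> all_states A. f s \<le> count_state (fst C) s))"
proof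
  assume "parikh_coverable A f"
  then obtain G \<nu> where G: "(step A)\<^sup>*\<^sup>* (init_config A) (G, \<nu>)" "\<forall>s \<in> all_states A. f s \<le> parikh G s"
    unfolding parikh_coverable_def reachable_def by blast
  obtain vs fr p where c: "(astep A)\<^sup>*\<^sup>* (ainit A) (fr, p, \<nu>)" "chain vs fr p G"
    using reachable_chain[OF G(1)] by auto
  have "\<forall>s \<in> all_states A. f s \<le> count_state (fst (fr, p, \<nu>)) s"
    using G(2) chain_parikh[OF c(2)] by simp
  with c(1) show "\<exists>C. (astep A)\<^sup>*\<^sup>* (ainit A) C \<and> (\<forall>s \<in> all_states A. f s \<le> count_state (fst C) s)" by blast
next
  assume "\<exists>C. (astep A)\<^sup>*\<^sup>* (ainit A) C \<and> (\<forall>s \<in> all_states A. f s \<le> count_state (fst C) s)"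
  then obtain C where C: "(astep A)\<^sup>*\<^sup>* (ainit A) C" "\<forall>s \<in> all_states A. f s \<le> count_state (fst C) s" by blast
  obtain vs G where G: "(step A)\<^sup>*\<^sup>* (init_config A) (G, snd (snd C))" "chain vs (fst C) (fst (snd C)) G"
    using chain_reachable[OF C(1)] by blast
  have "\<forall>s \<in> all_states A. f s \<le> parikh G s" using C(2) chain_parikh[OF G(2)] by simp
  with G(1) show "parikh_coverable A f" unfolding parikh_coverable_def reachable_def by blast
qed

end

section \<open>Membership in polynomial space\<close>

subsection \<open>Binary increment\<close>

text \<open>Ripple-carry addition of the carry \<open>c\<close>, least significant digit
  first.\<close>

fun incr :: "bool \<Rightarrow> bool list \<Rightarrow> bool list" where
  "incr c [] = (if c then [True] else [])"
| "incr c (b # bs) = (c \<noteq> b) # incr (c \<and> b) bs"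

lemma incr_False [simp]: "incr False bs = bs"
  by (induction bs) auto

lemma binary_Suc: "binary (Suc n) = incr True (binary n)"
proof (induction n rule: less_induct)
  case (less n)
  consider "n = 0" | "n = 1" | "n \<ge> 2" by linarith
  then show ?case
  proof cases
    case 3
    have 1: "binary n = odd n # binary (n div 2)" using 3 by (subst binary.simps) simp
    have 2: "binary (Suc n) = odd (Suc n) # binary (Suc n div 2)" using 3 by (subst binary.simps) simp
    show ?thesis
    proof (cases "odd n")
      case True
      have "binary (Suc (n div 2)) = incr True (binary (n div 2))" using 3 by (intro less) auto
      then show ?thesis using True unfolding 1 2 by simp
    next
      case False
      then show ?thesis unfolding 1 2 by simp
    qed
  qed (simp_all add: binary.simps numeral_2_eq_2)
qed

text \<open>The increment as a left fold that keeps the carry and the reversed output in its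
  accumulator; a carry left at the end becomes the new most significant digit. In this form the fold
  rule gives polynomial time.\<close>

lemma foldl_incr:
  "(let s = foldl (\<lambda>s b. (fst s \<and> b, (fst s \<noteq> b) # snd s)) (c, acc) bs in rev (if fst s then True # snd s else snd s))
   = rev acc @ incr c bs"
  by (induction bs arbitrary: c acc) (auto simp: Let_def)

lemma ptime_Suc [ptime_intros]: "ptime f \<Longrightarrow> ptime (\<lambda>x. Suc (f x))"
proof -
  assume f: "ptime f"
  let ?f = "\<lambda>s b. (fst s \<and> b, (fst s \<noteq> b) # snd s)"
  have "ptime (\<lambda>x. foldl ?f (True, []) (binary (f x)))"
  proof (rule ptime_foldl_additive[where r = "[:20:]" and f = "\<lambda>_. ?f"])
    show "sz (?f acc a) \<le> sz acc + poly [:20:] (sz x + sz a)" for x :: 'a and acc a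
    proof -
      have "sz acc = Suc (sz (fst acc) + sz (snd acc))" by (cases acc) simp
      then show ?thesis
        using sz_bool[of "fst acc \<and> a"] sz_bool[of "fst acc \<noteq> a"] by simp
    qed
  qed (intro ptime_intros f)+
  then have "ptime (\<lambda>x. let s = foldl ?f (True, []) (binary (f x)) in rev (if fst s then True # snd s else snd s))"
    by (intro ptime_intros)
  then have "ptime (\<lambda>x. binary (Suc (f x)))" unfolding foldl_incr binary_Suc by simp
  from ptime_numof[OF _ this] show ?thesis by simp
qed

lemma sz_Suc: "sz (Suc n) \<le> sz n + 4"
proof -
  have "sz (incr c bs) \<le> sz bs + 4" for c bs
  proof (induction bs arbitrary: c)
    case (Cons b bs)
    show ?case using Cons.IH[of c] by (cases c; cases b) auto
  qed simp
  then show ?thesis using binary_Suc[of n] by (simp add: sz_def enc_nat_def)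
qed

text \<open>The number is in binary and may be exponentially large, so it is not turned into a list.
  Instead a counter runs along \<open>l\<close>, and the flag records whether it has met
  \<open>n\<close>.\<close>

definition le_length :: "nat \<Rightarrow> 'a list \<Rightarrow> bool" where
  "le_length n l \<longleftrightarrow> snd (foldl (\<lambda>s _. (Suc (fst s), snd s \<or> Suc (fst s) = n)) (0, n = 0) l)"

lemma le_length: "le_length n l \<longleftrightarrow> n \<le> length l"
proof -
  have "foldl (\<lambda>s _. (Suc (fst s), snd s \<or> Suc (fst s) = n)) (0, n = 0) l = (length l, n \<le> length l)"
    by (induction l rule: rev_induct) auto
  then show ?thesis by (simp add: le_length_def)
qed

lemma ptime_le_length: "ptime (\<lambda>z :: nat \<times> 'a::enc list. le_length (fst z) (snd z))"
  unfolding le_length_def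
proof (intro ptime_intros ptime_foldl_additive[where r = "[:20:]"])
  show "sz (Suc (fst acc), snd acc \<or> Suc (fst acc) = fst x) \<le> sz acc + poly [:20:] (sz x + sz a)"
    for acc and x :: "nat \<times> 'a list" and a :: 'a
  proof -
    have "sz acc = Suc (sz (fst acc) + sz (snd acc))" by (cases acc) simp
    then show ?thesis using sz_Suc[of "fst acc"] sz_bool[of "snd acc \<or> Suc (fst acc) = fst x"] by simp
  qed
qed

subsection \<open>Successors of a configuration\<close>

type_synonym cfg = "frame list \<times> bool \<times> (nat \<times> nat) list"

text \<open>The restriction of a valuation to the listed variables. Guards and assignments speak of
  no others, so it determines the successors.\<close>

definition vals :: "inst \<Rightarrow> (nat \<Rightarrow> nat) \<Rightarrow> (nat \<times> nat) list" where
  "vals I \<nu> = map (\<lambda>x. (x, \<nu> x)) (i_vars I)"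

text \<open>Tag 0 is \<open>Eq\<close>. The pair lies in the valuation exactly if the variable has
  that value, which must be the case for \<open>Eq\<close> and must fail for
  \<open>Neq\<close>.\<close>

definition sat_code :: "(nat \<times> nat) list \<Rightarrow> code \<Rightarrow> bool" where
  "sat_code val t \<longleftrightarrow> ((num (sub 1 t), num (sub 2 t)) \<in> set val) = (num (sub 0 t) = 0)"

definition act_succs :: "inst \<Rightarrow> frame list \<Rightarrow> (nat \<times> nat) list \<Rightarrow> code \<Rightarrow> cfg list" where
  "act_succs I fr val a =
     (if num (sub 0 a) = 1 then
        map (\<lambda>e. ((b_id e, [num (sub 1 a)], b_init e) # fr, True, val)) (filter (\<lambda>e. b_id e = num (sub 2 a)) (i_blocks I))
      else if num (sub 0 a) = 2 then
        (if \<forall>t \<in> set (kids (sub 1 a)). sat_code val t then [(fr, False, val)] else [])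
      else [(fr, False, map (\<lambda>p. if fst p = num (sub 1 a) then (fst p, num (sub 2 a)) else p) val)])"

definition block_succs :: "inst \<Rightarrow> cfg \<Rightarrow> binst \<Rightarrow> cfg list" where
  "block_succs I C e =
     (if snd (snd (hd (fst C))) = b_final e then [(tl (fst C), False, snd (snd C))] else []) @
     concat (map (\<lambda>t. if num (sub 0 t) = snd (snd (hd (fst C)))
       then act_succs I ((fst (hd (fst C)), fst (snd (hd (fst C))), num (sub 2 t)) # tl (fst C)) (snd (snd C)) (sub 1 t)
       else []) (b_trs e))"

definition succs :: "inst \<Rightarrow> cfg \<Rightarrow> cfg list" where
  "succs I C =
     (if fst C = [] then []
      else if fst (snd C) then
        (if fst (snd (hd (fst C))) \<in> set (map (\<lambda>f. fst (snd f)) (tl (fst C))) then [] else [(fst C, False, snd (snd C))])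
      else concat (map (\<lambda>e. if b_id e = fst (hd (fst C)) then block_succs I C e else []) (i_blocks I)))"

definition init_cfg :: "inst \<Rightarrow> cfg" where
  "init_cfg I = (map (\<lambda>e. (b_id e, [], b_init e)) (filter (\<lambda>e. b_id e = i_main I) (i_blocks I)), False,
     map (\<lambda>x. (x, i_d0 I)) (i_vars I))"

definition covers :: "inst \<Rightarrow> frame list \<Rightarrow> bool" where
  "covers I fr \<longleftrightarrow> (\<forall>e \<in> set (i_blocks I). \<forall>p \<in> set (b_sts e). le_length (snd p) (filter (\<lambda>f. snd (snd f) = fst p) fr))"

lemma ptime_succs: "ptime (\<lambda>z. succs (fst z) (snd z))"
proof -
  have 1: "ptime (\<lambda>z. sat_code (fst z) (snd z))"
    unfolding sat_code_def by (intro ptime_intros)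
  have 2: "ptime (\<lambda>z. act_succs (fst (fst z)) (fst (snd (fst z))) (snd (snd (fst z))) (snd z))"
    unfolding act_succs_def by (intro ptime_intros ptime_comp2[OF 1])
  have 2: "ptime f \<Longrightarrow> ptime g \<Longrightarrow> ptime h \<Longrightarrow> ptime k \<Longrightarrow> ptime (\<lambda>x. act_succs (f x) (g x) (h x) (k x))"
    for f :: "'z::enc \<Rightarrow> inst" and g h k
    using ptime_comp[OF 2, of "\<lambda>x. ((f x, g x, h x), k x)"] by (simp add: ptime_Pair)
  have 3: "ptime (\<lambda>z. block_succs (fst z) (fst (snd z)) (snd (snd z)))"
    unfolding block_succs_def by (intro ptime_intros 2)
  show ?thesis
    unfolding succs_def by (intro ptime_intros ptime_comp3[OF 3])
qed

lemma ptime_init_cfg: "ptime init_cfg"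
  unfolding init_cfg_def[abs_def] by (intro ptime_intros)

lemma ptime_covers: "ptime (\<lambda>z. covers (fst z) (snd z))"
  unfolding covers_def by (intro ptime_intros ptime_comp2[OF ptime_le_length])

lemma sat_code_atom:
  "atom_over (set (i_vars I)) D a \<Longrightarrow> sat_code (vals I \<nu>) (code_atom a) \<longleftrightarrow> sat_atom \<nu> a"
  by (cases a) (auto simp: sat_code_def vals_def)

lemma astep_call_iff:
  "astep A ((b, q, s) # r, True, \<nu>) C \<longleftrightarrow> q \<notin> set (map (fst \<circ> snd) r) \<and> C = ((b, q, s) # r, False, \<nu>)"
proof
  assume "astep A ((b, q, s) # r, True, \<nu>) C"
  then show "q \<notin> set (map (fst \<circ> snd) r) \<and> C = ((b, q, s) # r, False, \<nu>)" by cases auto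
qed (use as_dequeue in blast)

lemma vals_upd: "vals I (\<nu>(x := d)) = map (\<lambda>p. if fst p = x then (fst p, d) else p) (vals I \<nu>)"
  by (auto simp: vals_def)

locale represented = serial_synchronous A for A +
  fixes I :: inst and f :: "nat \<Rightarrow> nat"
  assumes rep: "represents I A f"
begin

lemma rep_simps:
  "set (i_data I) = data A" "i_d0 I = init_data A" "set (i_vars I) = variables A"
  "set (i_sq I) = sqid A" "set (map b_id (i_blocks I)) = blocks A" "i_main I = main_block A" "distinct (map b_id (i_blocks I))"
  "distinct (i_vars I)" "distinct (i_sq I)"
  using rep by (auto simp: represents_def lists_set_def)

lemma rep_block:
  assumes "e \<in> set (i_blocks I)"
  shows "set (map fst (b_sts e)) = states A (b_id e)" "\<forall>p \<in> set (b_sts e). snd p = f (fst p)"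
    "b_init e = init_state A (b_id e)" "b_final e = final_state A (b_id e)"
    "set (b_trs e) = code_transition ` transitions A (b_id e)" "b_id e \<in> blocks A"
  using rep assms rep_simps(5) by (auto simp: represents_def represents_block_def lists_set_def)

lemma block_entry: "b \<in> blocks A \<Longrightarrow> \<exists>e \<in> set (i_blocks I). b_id e = b"
  using rep_simps(5) by force

lemma act_succs_iff:
  assumes "(s, a, s') \<in> transitions A b" "b \<in> blocks A"
  shows "C' \<in> set (act_succs I ((b, q, s') # r) (vals I \<nu>) (code_action a)) \<longleftrightarrow>
    (\<exists>g. a = Guard g \<and> (\<forall>t \<in> set g. sat_atom \<nu> t) \<and> C' = ((b, q, s') # r, False, vals I \<nu>)) \<or>
    (\<exists>x d. a = Assign x d \<and> C' = ((b, q, s') # r, False, vals I (\<nu>(x := d)))) \<or>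
    (\<exists>q' b'. a = Dispatch_s q' b' \<and> C' = ((b', [q'], init_state A b') # (b, q, s') # r, True, vals I \<nu>))"
proof (cases a)
  case (Dispatch_a q' b')
  then show ?thesis using trans_ok(4)[OF assms] by blast
next
  case (Dispatch_s q' b')
  then have b': "b' \<in> blocks A" using trans_ok(3)[OF assms] by simp
  have "C' \<in> set (act_succs I ((b, q, s') # r) (vals I \<nu>) (code_action a)) \<longleftrightarrow>
    (\<exists>e \<in> set (i_blocks I). b_id e = b' \<and> C' = ((b', [q'], init_state A b') # (b, q, s') # r, True, vals I \<nu>))"
    using rep_block(3) by (auto simp: act_succs_def Dispatch_s)
  also have "\<dots> \<longleftrightarrow> C' = ((b', [q'], init_state A b') # (b, q, s') # r, True, vals I \<nu>)"
    using block_entry[OF b'] by blast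
  finally show ?thesis using Dispatch_s by simp
next
  case (Guard g)
  have "sat_code (vals I \<nu>) (code_atom t) \<longleftrightarrow> sat_atom \<nu> t" if "t \<in> set g" for t
    using trans_ok(3)[OF assms] Guard that by (intro sat_code_atom[where D = "data A"]) (simp add: rep_simps(3))
  then have "(\<forall>t \<in> set (map code_atom g). sat_code (vals I \<nu>) t) \<longleftrightarrow> (\<forall>t \<in> set g. sat_atom \<nu> t)" by simp
  then have "C' \<in> set (act_succs I ((b, q, s') # r) (vals I \<nu>) (code_action a)) \<longleftrightarrow>
    (\<forall>t \<in> set g. sat_atom \<nu> t) \<and> C' = ((b, q, s') # r, False, vals I \<nu>)"
    by (auto simp: act_succs_def Guard)
  then show ?thesis using Guard by simp
next
  case (Assign x d)
  have "C' \<in> set (act_succs I ((b, q, s') # r) (vals I \<nu>) (code_action a)) \<longleftrightarrow>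
    C' = ((b, q, s') # r, False, vals I (\<nu>(x := d)))"
    unfolding vals_upd by (simp add: act_succs_def Assign cong del: if_weak_cong)
  then show ?thesis using Assign by simp
qed

text \<open>The invariant supplies a listed block for the top frame, and distinct identifiers make
  it the only one whose successors are collected.\<close>

lemma succs_iff:
  assumes inv: "ainv A (fr, p, \<nu>)"
  shows "C' \<in> set (succs I (fr, p, vals I \<nu>)) \<longleftrightarrow>
    (\<exists>fr' p' \<nu>'. C' = (fr', p', vals I \<nu>') \<and> astep A (fr, p, \<nu>) (fr', p', \<nu>'))"
proof (cases fr)
  case Nil
  then show ?thesis by (auto simp: succs_def elim: astep.cases)
next
  case (Cons h r)
  obtain b q s where h: "h = (b, q, s)" by (metis prod_cases3)
  have b: "b \<in> blocks A" using inv Cons h by simp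
  show ?thesis
  proof (cases p)
    case True
    have "C' \<in> set (succs I (fr, p, vals I \<nu>)) \<longleftrightarrow> q \<notin> set (map (fst \<circ> snd) r) \<and> C' = (fr, False, vals I \<nu>)"
      using True Cons h by (simp add: succs_def)
    then show ?thesis using True Cons h by (auto simp only: astep_call_iff)
  next
    case False
    obtain e where e: "e \<in> set (i_blocks I)" "b_id e = b" using block_entry[OF b] by blast
    have uniq: "e' = e" if "e' \<in> set (i_blocks I)" "b_id e' = b" for e'
      using rep_simps(7) that e unfolding distinct_map by (metis inj_onD)
    have "C' \<in> set (succs I (fr, p, vals I \<nu>)) \<longleftrightarrow>
      (\<exists>e' \<in> set (i_blocks I). b_id e' = b \<and> C' \<in> set (block_succs I (fr, p, vals I \<nu>) e'))"
      using False Cons h by (auto simp: succs_def split: if_splits)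
    also have "\<dots> \<longleftrightarrow> C' \<in> set (block_succs I (fr, p, vals I \<nu>) e)" using uniq e by blast
    also have "\<dots> \<longleftrightarrow> (s = final_state A b \<and> C' = (r, False, vals I \<nu>)) \<or>
       (\<exists>a s'. (s, a, s') \<in> transitions A b \<and> C' \<in> set (act_succs I ((b, q, s') # r) (vals I \<nu>) (code_action a)))"
    proof -
      have t: "(\<exists>t \<in> set (b_trs e). P t) \<longleftrightarrow> (\<exists>u \<in> transitions A b. P (code_transition u))" for P
        unfolding rep_block(5)[OF e(1)] e(2) by blast
      have "C' \<in> set (block_succs I (fr, p, vals I \<nu>) e) \<longleftrightarrow> (s = final_state A b \<and> C' = (r, False, vals I \<nu>)) \<or>
         (\<exists>t \<in> set (b_trs e). num (sub 0 t) = s \<and> C' \<in> set (act_succs I ((b, q, num (sub 2 t)) # r) (vals I \<nu>) (sub 1 t)))"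
        using rep_block(4)[OF e(1)] e(2) Cons h by (auto simp: block_succs_def split: if_splits)
      then show ?thesis unfolding t by (force simp del: code_action.simps)
    qed
    also have "\<dots> \<longleftrightarrow> (\<exists>fr' p' \<nu>'. C' = (fr', p', vals I \<nu>') \<and> astep A (fr, p, \<nu>) (fr', p', \<nu>'))"
    proof
      assume "(s = final_state A b \<and> C' = (r, False, vals I \<nu>)) \<or>
       (\<exists>a s'. (s, a, s') \<in> transitions A b \<and> C' \<in> set (act_succs I ((b, q, s') # r) (vals I \<nu>) (code_action a)))"
      then show "\<exists>fr' p' \<nu>'. C' = (fr', p', vals I \<nu>') \<and> astep A (fr, p, \<nu>) (fr', p', \<nu>')"
      proof
        assume "s = final_state A b \<and> C' = (r, False, vals I \<nu>)"
        then show ?thesis using as_terminate[of s A b q r \<nu>] Cons h False by auto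
      next
        assume "\<exists>a s'. (s, a, s') \<in> transitions A b \<and> C' \<in> set (act_succs I ((b, q, s') # r) (vals I \<nu>) (code_action a))"
        then obtain a s' where t: "(s, a, s') \<in> transitions A b"
          and c: "C' \<in> set (act_succs I ((b, q, s') # r) (vals I \<nu>) (code_action a))" by blast
        from c consider g where "a = Guard g" "\<forall>t \<in> set g. sat_atom \<nu> t" "C' = ((b, q, s') # r, False, vals I \<nu>)"
          | x d where "a = Assign x d" "C' = ((b, q, s') # r, False, vals I (\<nu>(x := d)))"
          | q' b' where "a = Dispatch_s q' b'" "C' = ((b', [q'], init_state A b') # (b, q, s') # r, True, vals I \<nu>)"
          unfolding act_succs_iff[OF t b] by blast
        then show ?thesis
        proof cases
          case 1
          then have "astep A (fr, p, \<nu>) ((b, q, s') # r, False, \<nu>)" using as_guard t Cons h False by simp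
          with 1 show ?thesis by blast
        next
          case 2
          then have "astep A (fr, p, \<nu>) ((b, q, s') # r, False, \<nu>(x := d))" using as_assign t Cons h False by simp
          with 2 show ?thesis by blast
        next
          case 3
          then have "astep A (fr, p, \<nu>) ((b', [q'], init_state A b') # (b, q, s') # r, True, \<nu>)"
            using as_dispatch t Cons h False by simp
          with 3 show ?thesis by blast
        qed
      qed
    next
      assume "\<exists>fr' p' \<nu>'. C' = (fr', p', vals I \<nu>') \<and> astep A (fr, p, \<nu>) (fr', p', \<nu>')"
      then obtain fr' p' \<nu>' where C': "C' = (fr', p', vals I \<nu>')" and st: "astep A (fr, p, \<nu>) (fr', p', \<nu>')" by blast
      from st show "(s = final_state A b \<and> C' = (r, False, vals I \<nu>)) \<or>
       (\<exists>a s'. (s, a, s') \<in> transitions A b \<and> C' \<in> set (act_succs I ((b, q, s') # r) (vals I \<nu>) (code_action a)))"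
      proof cases
        case (as_guard s1 g s' b1 q1 r1)
        then have t: "(s, Guard g, s') \<in> transitions A b" using Cons h by simp
        have "C' \<in> set (act_succs I ((b, q, s') # r) (vals I \<nu>) (code_action (Guard g)))"
          unfolding act_succs_iff[OF t b] using as_guard C' Cons h by simp
        then show ?thesis using t by blast
      next
        case (as_assign s1 x d s' b1 q1 r1)
        then have t: "(s, Assign x d, s') \<in> transitions A b" using Cons h by simp
        have "C' \<in> set (act_succs I ((b, q, s') # r) (vals I \<nu>) (code_action (Assign x d)))"
          unfolding act_succs_iff[OF t b] using as_assign C' Cons h by simp
        then show ?thesis using t by blast
      next
        case (as_dispatch s1 q' b' s' b1 q1 r1)
        then have t: "(s, Dispatch_s q' b', s') \<in> transitions A b" using Cons h by simp
        have "C' \<in> set (act_succs I ((b, q, s') # r) (vals I \<nu>) (code_action (Dispatch_s q' b')))"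
          unfolding act_succs_iff[OF t b] using as_dispatch C' Cons h by simp
        then show ?thesis using t by blast
      next
        case (as_terminate s1 b1 q1)
        then show ?thesis using C' Cons h by auto
      next
        case (as_dequeue q1 r1 b1 s1)
        then show ?thesis using False by simp
      qed
    qed
    finally show ?thesis .
  qed
qed

lemma init_cfg: "init_cfg I = (fst (ainit A), False, vals I (snd (snd (ainit A))))"
proof -
  obtain e where e: "e \<in> set (i_blocks I)" "b_id e = main_block A"
    using block_entry[of "main_block A"] wf by (auto simp: wf_qdas_def)
  have "distinct (map b_id l) \<Longrightarrow> e \<in> set l \<Longrightarrow> filter (\<lambda>e'. b_id e' = b_id e) l = [e]" for l :: "binst list"
  proof (induction l)
    case (Cons a l)
    then show ?case by (cases "a = e") (auto simp: filter_empty_conv image_iff)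
  qed simp
  from this[OF rep_simps(7) e(1)] show ?thesis
    using e rep_block(3)[OF e(1)] by (simp add: init_cfg_def ainit_def vals_def rep_simps)
qed

lemma covers_iff: "covers I fr \<longleftrightarrow> (\<forall>s \<in> all_states A. f s \<le> count_state fr s)"
proof -
  have "covers I fr \<longleftrightarrow> (\<forall>e \<in> set (i_blocks I). \<forall>p \<in> set (b_sts e). f (fst p) \<le> count_state fr (fst p))"
    using rep_block(2) unfolding covers_def le_length count_state_def by simp
  also have "\<dots> \<longleftrightarrow> (\<forall>e \<in> set (i_blocks I). \<forall>s \<in> set (map fst (b_sts e)). f s \<le> count_state fr s)" by simp
  also have "\<dots> \<longleftrightarrow> (\<forall>e \<in> set (i_blocks I). \<forall>s \<in> states A (b_id e). f s \<le> count_state fr s)"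
    using rep_block(1) by simp
  also have "\<dots> \<longleftrightarrow> (\<forall>b \<in> set (map b_id (i_blocks I)). \<forall>s \<in> states A b. f s \<le> count_state fr s)" by simp
  finally show ?thesis unfolding rep_simps(5) all_states_def by blast
qed

end

subsection \<open>The configuration graph\<close>

definition code_of_conf :: "cfg \<Rightarrow> code" where
  "code_of_conf C = L [L (map (\<lambda>f. L [N (fst f), L (map N (fst (snd f))), N (snd (snd f))]) (fst C)),
     N (if fst (snd C) then 1 else 0), L (map (\<lambda>p. L [N (fst p), N (snd p)]) (snd (snd C)))]"

definition conf_of_code :: "code \<Rightarrow> cfg" where
  "conf_of_code c = (map (\<lambda>f. (num (sub 0 f), map num (kids (sub 1 f)), num (sub 2 f))) (kids (sub 0 c)),
     num (sub 1 c) = 1, map (\<lambda>p. (num (sub 0 p), num (sub 1 p))) (kids (sub 2 c)))"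

lemma conf_of_code [simp]: "conf_of_code (code_of_conf C) = C"
  by (simp add: conf_of_code_def code_of_conf_def o_def prod_eq_iff)

text \<open>A string that contains no code denotes the initial configuration. In particular the
  string of ones, of which stripping leaves nothing, can serve as the source.\<close>

definition conf :: "inst \<Rightarrow> bool list \<Rightarrow> cfg" where
  "conf I u = (case parse (strip u) of None \<Rightarrow> init_cfg I | Some c \<Rightarrow> conf_of_code c)"

text \<open>Its length bounds the length of the code of a reachable configuration.\<close>

definition width :: "bool list \<Rightarrow> bool list" where
  "width w = concat (map (\<lambda>_. w @ w @ w @ w @ replicate 40 False) (w @ w @ w @ w @ replicate 40 False))"

definition graph :: "bool list \<Rightarrow> bool list \<Rightarrow> bool list \<Rightarrow> bool" where
  "graph w u v \<longleftrightarrow> (case parse w of None \<Rightarrow> False | Some c \<Rightarrow>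
     c = code_of_inst (inst_of_code c) \<and> inst_ok (inst_of_code c) \<and>
     (if v = map (\<lambda>_. False) (width w) then covers (inst_of_code c) (fst (conf (inst_of_code c) u))
      else conf (inst_of_code c) v \<in> set (succs (inst_of_code c) (conf (inst_of_code c) u))))"

lemma length_width: "length (width w) = (4 * length w + 40) * (4 * length w + 40)"
proof -
  have 1: "length (concat (map (\<lambda>_. v) l)) = length l * length v" for v :: "bool list" and l :: "bool list"
    by (induction l) auto
  have 2: "length (w @ w @ w @ w @ replicate 40 False) = 4 * length w + 40" by simp
  show ?thesis unfolding width_def 1 2 ..
qed

lemma ptime_width: "ptime width"
  unfolding width_def[abs_def] by (intro ptime_intros)

lemma ptime_graph: "ptime (\<lambda>z. graph (fst z) (fst (snd z)) (snd (snd z)))"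
proof -
  have 1: "ptime (\<lambda>z. conf (fst z) (snd z))"
    unfolding conf_def conf_of_code_def
    by (intro ptime_intros ptime_comp[OF ptime_parse] ptime_comp[OF ptime_strip] ptime_comp[OF ptime_init_cfg])
  show ?thesis
    unfolding graph_def
    by (intro ptime_intros ptime_comp[OF ptime_parse] ptime_comp[OF ptime_inst_of_code] ptime_comp[OF ptime_code_of_inst]
      ptime_comp[OF ptime_inst_ok] ptime_comp2[OF ptime_covers] ptime_comp2[OF ptime_succs] ptime_comp2[OF 1] ptime_comp[OF ptime_width])
qed

section \<open>Length of the codes of reachable configurations\<close>

definition clen :: "code \<Rightarrow> nat" where
  "clen c = length (bits c)"

lemma clen_L: "clen (L cs) = 4 + sum_list (map clen cs)"
  by (simp add: clen_def[abs_def] length_concat o_def)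

lemma clen_pos: "1 \<le> clen c"
  by (cases c) (auto simp: clen_def)

lemma clen_mem: "c \<in> set cs \<Longrightarrow> clen c \<le> clen (L cs)"
  unfolding clen_L using member_le_sum_list[of "clen c" "map clen cs"] by simp

lemma length_le_clen: "length cs \<le> clen (L cs)"
proof (induction cs)
  case (Cons c cs) then show ?case using clen_pos[of c] by (simp add: clen_L)
qed simp

lemma clen_L_le: "(\<And>c. c \<in> set cs \<Longrightarrow> clen c \<le> B) \<Longrightarrow> clen (L cs) \<le> 4 + length cs * B"
proof (induction cs)
  case (Cons c cs)
  have "clen (L cs) \<le> 4 + length cs * B" using Cons by simp
  then show ?case using Cons.prems[of c] by (simp add: clen_L)
qed (simp add: clen_L)

context represented
begin

abbreviation W :: nat where "W \<equiv> clen (code_of_inst I)"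

lemma clen_field: "c \<in> {L (map N (i_data I)), L (map N (i_vars I)), L (map N (i_sq I)), L (map code_of_block (i_blocks I))} \<Longrightarrow> clen c \<le> W"
  unfolding code_of_inst_def by (rule clen_mem) auto

text \<open>Every identifier that a configuration can mention occurs in the code of the instance, so
  its own code is no longer than \<open>W\<close>.\<close>

lemma clen_ids:
  shows "x \<in> variables A \<Longrightarrow> clen (N x) \<le> W" "d \<in> data A \<Longrightarrow> clen (N d) \<le> W" "q \<in> sqid A \<Longrightarrow> clen (N q) \<le> W"
    "b \<in> blocks A \<Longrightarrow> clen (N b) \<le> W" "b \<in> blocks A \<Longrightarrow> s \<in> states A b \<Longrightarrow> clen (N s) \<le> W"
    "length (i_vars I) \<le> W" "length (i_sq I) \<le> W"
proof -
  have "clen (N n) \<le> clen (L (map N l))" if "n \<in> set l" for n l using that by (intro clen_mem) auto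
  then show "x \<in> variables A \<Longrightarrow> clen (N x) \<le> W" "d \<in> data A \<Longrightarrow> clen (N d) \<le> W" "q \<in> sqid A \<Longrightarrow> clen (N q) \<le> W"
    using clen_field unfolding rep_simps(1,3,4)[symmetric] by (meson insertCI le_trans)+
  have block: "clen (code_of_block e) \<le> W" if "e \<in> set (i_blocks I)" for e
    using clen_mem[of "code_of_block e" "map code_of_block (i_blocks I)"] clen_field that by fastforce
  show "clen (N b) \<le> W" if b: "b \<in> blocks A" for b
  proof -
    obtain e where e: "e \<in> set (i_blocks I)" "b_id e = b" using block_entry[OF b] by blast
    have "clen (N b) \<le> clen (code_of_block e)" unfolding code_of_block_def e(2) by (rule clen_mem) simp
    then show ?thesis using block[OF e(1)] by simp
  qed
  show "clen (N s) \<le> W" if b: "b \<in> blocks A" and s: "s \<in> states A b" for b s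
  proof -
    obtain e where e: "e \<in> set (i_blocks I)" "b_id e = b" using block_entry[OF b] by blast
    obtain p where p: "p \<in> set (b_sts e)" "fst p = s" using s rep_block(1)[OF e(1)] e(2) by force
    let ?l = "map (\<lambda>p. L [N (fst p), N (snd p)]) (b_sts e)"
    have "clen (N s) \<le> clen (L [N (fst p), N (snd p)])" unfolding p(2) by (rule clen_mem) simp
    also have "\<dots> \<le> clen (L ?l)" using p(1) by (intro clen_mem) auto
    also have "\<dots> \<le> clen (code_of_block e)" unfolding code_of_block_def by (rule clen_mem) simp
    finally show ?thesis using block[OF e(1)] by simp
  qed
  show "length (i_vars I) \<le> W" "length (i_sq I) \<le> W"
    using length_le_clen[of "map N (i_vars I)"] length_le_clen[of "map N (i_sq I)"]
      clen_field[of "L (map N (i_vars I))"] clen_field[of "L (map N (i_sq I))"] by auto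
qed

text \<open>The labels of the running frames are pairwise distinct and range over the singleton
  lists of queues and the empty list of \<open>main\<close>; a waiting call adds one frame. The
  number of queues is at most the length of the code that lists them.\<close>

lemma length_frames:
  assumes "ainv A (fr, p, \<nu>)"
  shows "length fr \<le> W + 2"
proof -
  let ?l = "map (fst \<circ> snd) (if p then tl fr else fr)"
  have "set (map (fst \<circ> snd) fr) \<subseteq> insert [] ((\<lambda>q. [q]) ` sqid A)" using assms by fastforce
  moreover have "set ?l \<subseteq> set (map (fst \<circ> snd) fr)" by (cases fr) auto
  ultimately have sub: "set ?l \<subseteq> insert [] ((\<lambda>q. [q]) ` set (i_sq I))" unfolding rep_simps(4) by blast
  have "length ?l = card (set ?l)" using assms by (intro distinct_card[symmetric]) simp
  also have "\<dots> \<le> card (insert [] ((\<lambda>q. [q]) ` set (i_sq I)))" by (rule card_mono[OF _ sub]) simp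
  also have "\<dots> \<le> Suc (card ((\<lambda>q. [q]) ` set (i_sq I)))" by (simp add: card_insert_if)
  also have "\<dots> \<le> Suc (card (set (i_sq I)))" by (simp add: card_image_le)
  also have "\<dots> \<le> Suc W" using card_length[of "i_sq I"] clen_ids(7) by simp
  finally show ?thesis by (cases fr) (auto split: if_splits)
qed

lemma clen_conf:
  assumes "ainv A (fr, p, \<nu>)"
  shows "clen (code_of_conf (fr, p, vals I \<nu>)) \<le> length (width (bits (code_of_inst I)))"
proof -
  have fr: "clen (L (map (\<lambda>f. L [N (fst f), L (map N (fst (snd f))), N (snd (snd f))]) fr)) \<le> 4 + length fr * (3 * W + 8)"
  proof -
    let ?l = "map (\<lambda>f. L [N (fst f), L (map N (fst (snd f))), N (snd (snd f))]) fr"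
    have "clen (L [N b, L (map N q), N s]) \<le> 3 * W + 8" if "(b, q, s) \<in> set fr" for b q s
    proof -
      have b: "b \<in> blocks A" "s \<in> states A b" and q: "q = [] \<or> (\<exists>q' \<in> sqid A. q = [q'])" using assms that by auto
      have "clen (L (map N q)) \<le> 4 + W" using q clen_ids(3) by (auto simp: clen_L)
      then show ?thesis using clen_ids(4)[OF b(1)] clen_ids(5)[OF b] unfolding clen_L[of "[N b, L (map N q), N s]"] by simp
    qed
    then have *: "clen c \<le> 3 * W + 8" if "c \<in> set (map (\<lambda>f. L [N (fst f), L (map N (fst (snd f))), N (snd (snd f))]) fr)" for c
      using that by auto
    have "clen (L ?l) \<le> 4 + length ?l * (3 * W + 8)" by (rule clen_L_le) (rule *)
    then show ?thesis by simp
  qed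
  have val: "clen (L (map (\<lambda>p. L [N (fst p), N (snd p)]) (vals I \<nu>))) \<le> 4 + length (i_vars I) * (2 * W + 4)"
  proof -
    let ?l = "map (\<lambda>p. L [N (fst p), N (snd p)]) (vals I \<nu>)"
    have "clen (L [N x, N (\<nu> x)]) \<le> 2 * W + 4" if "x \<in> set (i_vars I)" for x
      using assms that clen_ids(1)[of x] clen_ids(2)[of "\<nu> x"] rep_simps(3) by (simp add: clen_L)
    then have *: "clen c \<le> 2 * W + 4" if "c \<in> set (map (\<lambda>p. L [N (fst p), N (snd p)]) (vals I \<nu>))" for c
      using that by (auto simp: vals_def)
    have "clen (L ?l) \<le> 4 + length ?l * (2 * W + 4)" by (rule clen_L_le) (rule *)
    then show ?thesis by (simp add: vals_def)
  qed
  have flag: "clen (N (if p then 1 else 0)) \<le> 6" by (simp add: clen_def binary.simps)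
  have "length fr * (3 * W + 8) \<le> (W + 2) * (3 * W + 8)" "length (i_vars I) * (2 * W + 4) \<le> W * (2 * W + 4)"
    using length_frames[OF assms] clen_ids(6) by (intro mult_le_mono1; simp)+
  moreover have L3: "clen (L [a, b, c]) = 4 + clen a + clen b + clen c" for a b c by (simp add: clen_L)
  \<comment> \<open>The 18 is made up of 4 for each of the three lists and 6 for the flag. The
    square below is a rounding up that has the form of \<open>length_width\<close>.\<close>
  ultimately have "clen (code_of_conf (fr, p, vals I \<nu>)) \<le> (W + 2) * (3 * W + 8) + W * (2 * W + 4) + 18"
    using fr val flag unfolding code_of_conf_def fst_conv snd_conv L3 by linarith
  also have "\<dots> \<le> (4 * W + 40) * (4 * W + 40)" by (simp add: algebra_simps)
  also have "\<dots> = length (width (bits (code_of_inst I)))"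
    by (simp add: length_width clen_def)
  finally show ?thesis .
qed

text \<open>Each vertex denotes some configuration, and edges compare what their ends denote, so
  several strings for one configuration do no harm. Conversely every reachable configuration fits
  into \<open>M\<close> bits.\<close>

lemma graph_correct:
  fixes w M
  defines "w \<equiv> bits (code_of_inst I)" and "M \<equiv> length (width (bits (code_of_inst I)))"
  shows "(replicate M True, replicate M False) \<in> (edges (graph w) M)\<^sup>* \<longleftrightarrow> parikh_coverable A f"
proof -
  let ?s = "replicate M True" and ?t = "replicate M False"
  have ok: "inst_ok I" using inst_ok_iff[OF rep] wf ser syn by simp
  have t: "map (\<lambda>_. False) (width w) = ?t" by (simp add: M_def w_def map_replicate_const)
  have g: "graph w u v \<longleftrightarrow> (if v = ?t then covers I (fst (conf I u)) else conf I v \<in> set (succs I (conf I u)))" for u v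
    unfolding graph_def t by (simp add: w_def ok)
  have "0 < M" by (simp add: M_def length_width)
  then have st: "?s \<noteq> ?t" by (cases M) auto
  have parse_Nil: "parse [] = None" by (simp add: parse_def)
  let ?vc = "\<lambda>C. (fst C, fst (snd C), vals I (snd (snd C)))"
  have cs: "conf I ?s = ?vc (ainit A)"
    by (simp add: conf_def strip_ones parse_Nil init_cfg) (simp add: ainit_def)
  have succs_step: "C' \<in> set (succs I (?vc C)) \<longleftrightarrow> (\<exists>D. C' = ?vc D \<and> astep A C D)" if "ainv A C" for C C'
  proof -
    obtain fr p \<nu> where C: "C = (fr, p, \<nu>)" by (metis prod_cases3)
    then show ?thesis using succs_iff[of fr p \<nu> C'] that by (simp add: split_paired_Ex)
  qed
  show ?thesis
  proof
    assume path: "(?s, ?t) \<in> (edges (graph w) M)\<^sup>*"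
    \<comment> \<open>The first disjunct absorbs everything after a visit to the target, whose
      string would otherwise be read as a configuration.\<close>
    let ?P = "\<lambda>u. parikh_coverable A f \<or> u \<noteq> ?t \<and> (\<exists>C. (astep A)\<^sup>*\<^sup>* (ainit A) C \<and> conf I u = ?vc C)"
    have "?P x" if "(?s, x) \<in> (edges (graph w) M)\<^sup>*" for x
      using that
    proof (induction rule: rtrancl_induct)
      case base
      show ?case using st cs by blast
    next
      case (step u v)
      show ?case
      proof (cases "parikh_coverable A f")
        case False
        then obtain C where C: "(astep A)\<^sup>*\<^sup>* (ainit A) C" "conf I u = ?vc C" using step.IH by blast
        have inv: "ainv A C" using chain_reachable[OF C(1)] by blast
        have uv: "graph w u v" using step(2) by (simp add: edges_def)
        show ?thesis
        proof (cases "v = ?t")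
          case True
          then have "covers I (fst C)" using uv g C(2) by simp
          then show ?thesis using C(1) unfolding covers_iff parikh_coverable_iff by blast
        next
          case vt: False
          then have "conf I v \<in> set (succs I (?vc C))" using uv g C(2) by simp
          then obtain D where "conf I v = ?vc D" "astep A C D"
            using succs_step[OF inv] by blast
          then show ?thesis using vt rtranclp.rtrancl_into_rtrancl[OF C(1)] by blast
        qed
      qed simp
    qed
    from this[OF path] show "parikh_coverable A f" by blast
  next
    assume "parikh_coverable A f"
    then obtain C where C: "(astep A)\<^sup>*\<^sup>* (ainit A) C" "covers I (fst C)"
      unfolding covers_iff parikh_coverable_iff by blast
    have "\<exists>u. length u = M \<and> conf I u = ?vc C \<and> (?s, u) \<in> (edges (graph w) M)\<^sup>*" using C(1)
    proof (induction rule: rtranclp_induct)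
      case base
      show ?case using cs by (intro exI[of _ ?s]) simp
    next
      case (step C D)
      then obtain u where u: "length u = M" "conf I u = ?vc C" "(?s, u) \<in> (edges (graph w) M)\<^sup>*" by blast
      have inv: "ainv A C" using chain_reachable[OF step(1)] by blast
      have "ainv A (fst D, fst (snd D), snd (snd D))" using ainv_astep[OF step(2) inv] by simp
      from clen_conf[OF this] have le: "clen (code_of_conf (?vc D)) \<le> M" by (simp add: M_def)
      \<comment> \<open>The vertex chosen for the next configuration: its code, brought to length
        \<open>M\<close> by leading ones.\<close>
      define v where "v = replicate (M - clen (code_of_conf (?vc D))) True @ bits (code_of_conf (?vc D))"
      have lv: "length v = M" using le by (simp add: v_def clen_def)
      have cv: "conf I v = ?vc D" by (simp add: conf_def v_def strip_pad)
      \<comment> \<open>A code ends with a closing bracket, whose last bit is \<open>True\<close>;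
        this distinguishes the vertex from the target.\<close>
      have "last v" by (simp add: v_def code_of_conf_def)
      then have "v \<noteq> ?t" using \<open>0 < M\<close> last_replicate[of M False] by auto
      moreover have "?vc D \<in> set (succs I (?vc C))"
        using succs_step[OF inv] step(2) by blast
      ultimately have "graph w u v" using g u(2) cv by simp
      then have "(u, v) \<in> edges (graph w) M" using u(1) lv by (simp add: edges_def)
      from rtrancl.rtrancl_into_rtrancl[OF u(3) this] lv cv show ?case by blast
    qed
    then obtain u where u: "length u = M" "conf I u = ?vc C" "(?s, u) \<in> (edges (graph w) M)\<^sup>*" by blast
    have "graph w u ?t" using g u(2) C(2) by simp
    then have "(u, ?t) \<in> edges (graph w) M" using u(1) by (simp add: edges_def)
    then show "(?s, ?t) \<in> (edges (graph w) M)\<^sup>*" using u(3) by (meson rtrancl.rtrancl_into_rtrancl)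
  qed
qed

end

lemma representedI: "represents I A f \<Longrightarrow> inst_ok I \<Longrightarrow> represented A I f"
  using inst_ok_iff[of I A f] by unfold_locales auto

theorem PARIKH_COVERABILITY_in_PSPACE: "PARIKH_COVERABILITY {A. serial A \<and> synchronous A} \<in> PSPACE"
proof -
  let ?M = "\<lambda>w. length (width w)"
  have "w \<in> PARIKH_COVERABILITY {A. serial A \<and> synchronous A} \<longleftrightarrow>
     (replicate (?M w) True, replicate (?M w) False) \<in> (edges (graph w) (?M w))\<^sup>*" for w
  proof
    assume "w \<in> PARIKH_COVERABILITY {A. serial A \<and> synchronous A}"
    then obtain c A f where w: "w = bits c" and A: "serial A" "synchronous A" "wf_qdas A"
      and c: "c \<in> codes_instance A f" and cov: "parikh_coverable A f"
      unfolding PARIKH_COVERABILITY_def by blast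
    obtain I where I: "c = code_of_inst I" "represents I A f" using c codes_instance_iff by blast
    interpret represented A I f using I(2) A by unfold_locales
    show "(replicate (?M w) True, replicate (?M w) False) \<in> (edges (graph w) (?M w))\<^sup>*"
      using graph_correct cov unfolding w I(1) by blast
  next
    assume path: "(replicate (?M w) True, replicate (?M w) False) \<in> (edges (graph w) (?M w))\<^sup>*"
    have "0 < ?M w" by (simp add: length_width)
    then have "replicate (?M w) True \<noteq> replicate (?M w) False" by (cases "?M w") auto
    then obtain u v where "graph w u v" using path by (auto simp: edges_def elim: rtranclE)
    then obtain c where c: "parse w = Some c" "c = code_of_inst (inst_of_code c)" "inst_ok (inst_of_code c)"
      by (auto simp: graph_def split: option.splits)
    define I where "I = inst_of_code c"
    obtain A f where r: "represents I A f" using inst_ok_represents c(3) I_def by blast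
    interpret represented A I f using representedI[OF r] c(3) I_def by simp
    have w: "w = bits (code_of_inst I)" using parse_sound[OF c(1)] c(2) I_def by simp
    have "parikh_coverable A f" using path graph_correct unfolding w by blast
    moreover have "code_of_inst I \<in> codes_instance A f" using r codes_instance_iff by blast
    ultimately show "w \<in> PARIKH_COVERABILITY {A. serial A \<and> synchronous A}"
      unfolding PARIKH_COVERABILITY_def w using wf ser syn by blast
  qed
  then have "PARIKH_COVERABILITY {A. serial A \<and> synchronous A} =
     {w. (replicate (?M w) True, replicate (?M w) False) \<in> (edges (graph w) (?M w))\<^sup>*}" by blast
  then show ?thesis using PSPACE_reachability[OF ptime_width ptime_graph] by simp
qed

section \<open>The reduction\<close>

subsection \<open>Unary numbers and identifiers\<close>

abbreviation una :: "nat \<Rightarrow> bool list" where "una n \<equiv> replicate n False"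

text \<open>Identifiers are binary numbers whose digits spell a list of numbers in unary.\<close>

definition ident :: "bool list list \<Rightarrow> nat" where
  "ident us = numof (concat (map (\<lambda>u. map (\<lambda>_. False) u @ [True]) us) @ [True])"

definition idn :: "nat list \<Rightarrow> nat" where
  "idn ns = ident (map una ns)"

text \<open>Programs assemble identifiers from strings that serve as unary numbers, using
  \<open>ident\<close>; the correctness proof speaks of the numbers themselves, using
  \<open>idn\<close>.\<close>

lemma ident_idn: "ident us = idn (map length us)"
  by (simp add: ident_def idn_def map_replicate_const o_def)

lemma binary_ident: "binary (ident us) = concat (map (\<lambda>u. map (\<lambda>_. False) u @ [True]) us) @ [True]"
proof -
  have "canonical (rev (concat (map (\<lambda>u. map (\<lambda>_. False) u @ [True]) us) @ [True]))" by (simp add: canonical_def)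
  from binary_numof[OF this] show ?thesis by (simp add: ident_def)
qed

text \<open>A number is a block of \<open>False\<close> closed by \<open>True\<close>, so the digit
  string splits uniquely. The additional \<open>True\<close> at the end is the most significant
  digit and keeps the string canonical.\<close>

lemma idn_inj: "idn ns = idn ms \<longleftrightarrow> ns = ms"
proof
  let ?c = "\<lambda>ns. concat (map (\<lambda>n. una n @ [True]) ns)"
  have bi: "binary (idn ns) = ?c ns @ [True]" for ns
    unfolding idn_def binary_ident by (simp add: o_def map_replicate_const)
  have one: "una n @ True # l = una m @ True # l' \<Longrightarrow> n = m \<and> l = l'" for n m l l'
  proof (induction n arbitrary: m)
    case 0 then show ?case by (cases m) auto
  next
    case (Suc n) then show ?case by (cases m) auto
  qed
  have "?c ns @ [True] = ?c ms @ [True] \<Longrightarrow> ns = ms"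
  proof (induction ns arbitrary: ms)
    case Nil
    show ?case
    proof (cases ms)
      case (Cons m ms')
      then have "una 0 @ True # [] = una m @ True # (?c ms' @ [True])" using Nil by simp
      then have "[] = ?c ms' @ [True]" using one by blast
      then show ?thesis by simp
    qed simp
  next
    case (Cons n ns)
    show ?case
    proof (cases ms)
      case Nil
      then have "una n @ True # (?c ns @ [True]) = una 0 @ True # []" using Cons.prems by simp
      then have "?c ns @ [True] = []" using one by blast
      then show ?thesis by simp
    next
      case (Cons m ms')
      then have "una n @ True # (?c ns @ [True]) = una m @ True # (?c ms' @ [True])" using Cons.prems by simp
      then have "n = m" "?c ns @ [True] = ?c ms' @ [True]" using one by blast+
      then show ?thesis using Cons.IH[of ms'] \<open>ms = m # ms'\<close> by blast
    qed
  qed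
  moreover assume "idn ns = idn ms"
  then have "?c ns @ [True] = ?c ms @ [True]" using bi[of ns] bi[of ms] by simp
  ultimately show "ns = ms" by blast
qed simp

lemma ptime_ident [ptime_intros]: "ptime f \<Longrightarrow> ptime (\<lambda>x. ident (f x))"
  unfolding ident_def
proof (rule ptime_numof)
  show "binary (numof (concat (map (\<lambda>u. map (\<lambda>_. False) u @ [True]) (f x)) @ [True])) =
    concat (map (\<lambda>u. map (\<lambda>_. False) u @ [True]) (f x)) @ [True]" for x
    using binary_ident[of "f x"] by (simp add: ident_def)
qed (intro ptime_intros)

text \<open>Horner's scheme on unary numbers, where a product is a concatenation of copies.\<close>

lemma ptime_unary_poly: "\<exists>u :: bool list \<Rightarrow> bool list. ptime u \<and> (\<forall>w. length (u w) = poly p (length w))"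
proof (induction p)
  case 0
  show ?case by (rule exI[of _ "\<lambda>_. []"]) (simp add: ptime_const)
next
  case (pCons a p)
  then obtain u :: "bool list \<Rightarrow> bool list" where u: "ptime u" "\<forall>w. length (u w) = poly p (length w)" by blast
  have "length (concat (map (\<lambda>_. v) l)) = length l * length v" for v l :: "bool list"
    by (induction l) auto
  then show ?case
    using u by (intro exI[of _ "\<lambda>w. una a @ concat (map (\<lambda>_. u w) w)"])
      (auto intro!: ptime_intros ptime_comp[OF u(1)])
qed

text \<open>One string of each length up to that of \<open>u\<close>; only the lengths count, as the
  cell numbers in unary.\<close>

definition positions :: "bool list \<Rightarrow> bool list list" where
  "positions u = foldl (\<lambda>acc b. (b # hd acc) # acc) [[]] u"

lemma positions_snoc: "positions (u @ [b]) = (b # hd (positions u)) # positions u"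
  by (simp add: positions_def)

lemma length_positions: "length ` set (positions u) = {..length u}"
proof -
  have "positions u \<noteq> [] \<and> length (hd (positions u)) = length u \<and> length ` set (positions u) = {..length u}"
  proof (induction u rule: rev_induct)
    case Nil show ?case by (simp add: positions_def)
  next
    case (snoc b u) then show ?case by (auto simp: positions_snoc atMost_Suc)
  qed
  then show ?thesis by blast
qed

lemma sz_positions: "sz (positions u) \<le> (length u + 1) * (4 * length u + 2) + 1"
proof -
  have "length (positions u) = Suc (length u) \<and> (\<forall>v \<in> set (positions u). length v \<le> length u)"
  proof (induction u rule: rev_induct)
    case Nil show ?case by (simp add: positions_def)
  next
    case (snoc b u)
    have "hd (positions u) \<in> set (positions u)" using snoc by (intro hd_in_set) auto
    then show ?case using snoc by (auto simp: positions_snoc intro: le_SucI)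
  qed
  moreover have "(\<forall>v \<in> set l. length v \<le> n) \<Longrightarrow> sz l \<le> length l * (4 * n + 2) + 1" for l :: "bool list list" and n
  proof (induction l)
    case (Cons v l)
    then show ?case using sz_bits[of v] by auto
  qed simp
  ultimately show ?thesis by fastforce
qed

text \<open>A step adds a copy of the head of the accumulator, so its growth is not bounded in terms
  of context and element alone. The general fold rule is used with the quadratic bound on
  intermediate lists.\<close>

lemma ptime_positions: "ptime positions"
proof -
  have "pbounded sz (\<lambda>u :: bool list. (sz u + 1) * (4 * sz u + 2) + 1)" by (intro pbounded_intros)
  then obtain r where r: "\<And>u :: bool list. (sz u + 1) * (4 * sz u + 2) + 1 \<le> poly r (sz u)" unfolding pbounded_sz by blast
  have "ptime (\<lambda>u :: bool list. foldl (\<lambda>acc b. (b # hd acc) # acc) [[]] u)"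
  proof (rule ptime_foldl[where r = r])
    show "sz (foldl (\<lambda>acc b. (b # hd acc) # acc) [[]] (take k u)) \<le> poly r (sz u)" for k and u :: "bool list"
    proof -
      have "length (take k u) \<le> sz u" using length_sz[of u] by simp
      then have "(length (take k u) + 1) * (4 * length (take k u) + 2) + 1 \<le> (sz u + 1) * (4 * sz u + 2) + 1"
        by (intro add_mono mult_le_mono) auto
      then show ?thesis using sz_positions[of "take k u"] r[of u] unfolding positions_def by linarith
    qed
  qed (intro ptime_intros)+
  then show ?thesis by (simp add: positions_def[abs_def])
qed

definition dedup :: "'a list \<Rightarrow> 'a list" where
  "dedup l = foldl (\<lambda>acc a. if a \<in> set acc then acc else a # acc) [] l"

lemma dedup: "set (dedup l) = set l" "distinct (dedup l)"
proof -
  have "set (dedup l) = set l \<and> distinct (dedup l)"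
    by (induction l rule: rev_induct) (auto simp: dedup_def)
  then show "set (dedup l) = set l" "distinct (dedup l)" by auto
qed

lemma ptime_dedup [ptime_intros]: "ptime l \<Longrightarrow> ptime (\<lambda>x. dedup (l x))"
  unfolding dedup_def
  by (intro ptime_foldl_additive[where r = "[:1, 1:]"] ptime_intros) simp_all

text \<open>The list \<open>cs\<close> belongs to the fixed machine, so this is a finite
  composition, in which each \<open>f c\<close> may be computed by a program of its own.\<close>

lemma ptime_concat_const: "(\<And>c. ptime (\<lambda>x. f c x)) \<Longrightarrow> ptime (\<lambda>x. concat (map (\<lambda>c. f c x) cs))"
  by (induction cs) (simp_all add: ptime_const ptime_append)

text \<open>Writing out a code by unbounded recursion on its nesting would need a program with a
  stack of pending lists. The instances produced here have nesting depth at most 9, so a recursion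
  on a fixed depth, unfolded into a composition of maps, is enough.\<close>

fun bits_upto :: "nat \<Rightarrow> code \<Rightarrow> bool list" where
  "bits_upto 0 c = []"
| "bits_upto (Suc k) c = (if c = N (num c) then [False, False] @ concat (map (\<lambda>b. [True, b]) (binary (num c))) @ [False, True]
     else [False, False] @ concat (map (bits_upto k) (kids c)) @ [False, True])"

lemma ptime_bits_upto: "ptime (bits_upto k)"
proof (induction k)
  case 0 show ?case by (simp add: ptime_const)
next
  case (Suc k) show ?case by (subst bits_upto.simps[abs_def]) (intro ptime_intros ptime_comp[OF Suc])
qed

fun depth_le :: "nat \<Rightarrow> code \<Rightarrow> bool" where
  "depth_le 0 c \<longleftrightarrow> False"
| "depth_le (Suc k) c \<longleftrightarrow> (\<forall>d \<in> set (kids c). depth_le k d)"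

lemma bits_upto: "depth_le k c \<Longrightarrow> bits_upto k c = bits c"
proof (induction k arbitrary: c)
  case (Suc k)
  then have "map (bits_upto k) (kids c) = map bits (kids c)" by auto
  from arg_cong[OF this, of concat] show ?case by (cases c) auto
qed simp

subsection \<open>The instance simulating a machine\<close>

text \<open>Symbols are in unary: one for the marker, two and three for the bits, the empty string
  for the blank. The cell number \<open>j\<close> is a string as well, and the fold drops one list
  element for each of its bits.\<close>

definition content :: "bool list \<Rightarrow> bool list \<Rightarrow> bool list" where
  "content w j = (case foldl (\<lambda>l _. tl l) (una 1 # map (\<lambda>b. if b then una 3 else una 2) w) j of [] \<Rightarrow> [] | x # _ \<Rightarrow> x)"

lemma length_content: "length (content w j) = tape_content w (length j)"
proof -
  have d: "foldl (\<lambda>l _. tl l) xs j = drop (length j) xs" for xs :: "bool list list"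
    by (induction j arbitrary: xs) (auto simp: drop_Suc)
  show ?thesis
  proof (cases j)
    case Nil then show ?thesis by (simp add: content_def tape_content_def)
  next
    case (Cons b i)
    show ?thesis
    proof (cases "length i < length w")
      case True
      have "drop (length i) (map (\<lambda>b. if b then una 3 else una 2) w) =
         (if w ! length i then una 3 else una 2) # drop (Suc (length i)) (map (\<lambda>b. if b then una 3 else una 2) w)"
        using True by (subst Cons_nth_drop_Suc[symmetric]) auto
      then show ?thesis using True Cons unfolding content_def d by (simp add: tape_content_def bit_symbol_def)
    next
      case False
      then show ?thesis using Cons unfolding content_def d by (simp add: tape_content_def)
    qed
  qed
qed

lemma ptime_content: "ptime f \<Longrightarrow> ptime g \<Longrightarrow> ptime (\<lambda>x. content (f x) (g x))"
proof (rule ptime_comp2[of content])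
  show "ptime (\<lambda>z. content (fst z) (snd z))"
    unfolding content_def
  proof (intro ptime_intros ptime_foldl_additive[where r = "[:1:]"])
    show "sz (tl acc) \<le> sz acc + poly [:1:] (sz x + sz a)" for acc :: "bool list list" and x :: "bool list \<times> bool list" and a :: bool
      by (cases acc) auto
  qed
qed

fun shift :: "dir \<Rightarrow> bool list \<Rightarrow> bool list" where
  "shift Left j = tl j"
| "shift Stay j = j"
| "shift Right j = False # j"

lemma length_shift: "length (shift m j) = move m (length j)"
  by (cases m) auto

lemma ptime_shift: "ptime f \<Longrightarrow> ptime (\<lambda>x. shift m (f x))"
  by (cases m) (auto intro: ptime_intros)

definition cell_id :: "nat \<Rightarrow> bool list \<Rightarrow> nat" where "cell_id i j = ident [[], una i, j]"
definition head_id :: "nat \<Rightarrow> nat" where "head_id i = ident [una 1, una i]"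
definition tr_code :: "bool list list \<Rightarrow> code \<Rightarrow> bool list list \<Rightarrow> code" where
  "tr_code s a s' = L [N (ident s), a, N (ident s')]"
definition eq_code :: "nat \<Rightarrow> bool list \<Rightarrow> code" where "eq_code x d = L [N 0, N x, N (ident [d])]"
definition guard_code :: "code list \<Rightarrow> code" where "guard_code l = L [N 2, L l]"
definition assign_code :: "nat \<Rightarrow> bool list \<Rightarrow> code" where "assign_code x d = L [N 3, N x, N (ident [d])]"

definition running :: "tm \<Rightarrow> nat list" where
  "running M = filter (\<lambda>p. p \<noteq> accept M \<and> p \<noteq> reject M) [0..<nstates M]"

definition words :: "tm \<Rightarrow> nat \<Rightarrow> nat list list" where
  "words M n = List.n_lists n [0..<nsymbols M]"

text \<open>
  The value 0 of a cell variable stands for the initial content of the cell, the value \<open>a + 1\<close>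
  for the symbol \<open>a\<close>. One machine step first collects the symbols read in the control state,
  and then updates cell and head of one tape after the other.
\<close>

definition read_tr :: "tm \<Rightarrow> nat \<Rightarrow> nat \<Rightarrow> nat list \<Rightarrow> nat \<Rightarrow> bool list \<Rightarrow> bool list \<Rightarrow> code" where
  "read_tr M p i rs v w j =
     tr_code (map una (p # rs)) (guard_code [eq_code (head_id i) j, eq_code (cell_id i j) (una v)])
       (map una (p # rs) @ [if v = 0 then content (if i = 0 then w else []) j else una (v - 1)])"

text \<open>A transition either tests or assigns, and an assignment names its variable and its value
  outright. So the head position \<open>j\<close> is first copied into the control state by a guard,
  and then used to select the cell to be written and the new position.\<close>

definition write_tr :: "tm \<Rightarrow> nat \<Rightarrow> nat list \<Rightarrow> nat \<Rightarrow> bool list \<Rightarrow> code list" where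
  "write_tr M p rs i j =
     [tr_code (map una (p # rs @ [i])) (guard_code [eq_code (head_id i) j]) (map una (p # rs @ [i]) @ [j]),
      tr_code (map una (p # rs @ [i]) @ [j]) (assign_code (cell_id i j) (una (Suc (fst (snd (delta M p rs) ! i)))))
        (map una (p # rs @ [i]) @ [j, []]),
      tr_code (map una (p # rs @ [i]) @ [j, []]) (assign_code (head_id i) (shift (snd (snd (delta M p rs) ! i)) j))
        (map una (p # rs @ [Suc i]))]"

definition read_trs :: "tm \<Rightarrow> bool list \<Rightarrow> bool list list \<Rightarrow> code list" where
  "read_trs M w P = concat (map (\<lambda>p. concat (map (\<lambda>i. concat (map (\<lambda>rs. concat (map (\<lambda>v.
     map (read_tr M p i rs v w) P) [0..<Suc (nsymbols M)])) (words M i))) [0..<ntapes M])) (running M))"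

definition write_trs :: "tm \<Rightarrow> bool list list \<Rightarrow> code list" where
  "write_trs M P = concat (map (\<lambda>p. concat (map (\<lambda>rs.
     [tr_code (map una (p # rs)) (guard_code []) (map una (p # rs @ [0])),
      tr_code (map una (p # rs @ [ntapes M])) (guard_code []) (map una [fst (delta M p rs)])] @
     concat (map (\<lambda>i. concat (map (write_tr M p rs i) P)) [0..<ntapes M])) (words M (ntapes M)))) (running M))"

definition trs :: "tm \<Rightarrow> bool list \<Rightarrow> bool list list \<Rightarrow> code list" where
  "trs M w P = dedup (read_trs M w P @ write_trs M P)"

definition sim_states :: "tm \<Rightarrow> code list \<Rightarrow> nat list" where
  "sim_states M ts = dedup ([ident [una (start M)], ident [una (accept M)], ident []] @
     concat (map (\<lambda>t. [num (sub 0 t), num (sub 2 t)]) ts))"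

text \<open>The final state \<open>ident []\<close> is the end of no transition, so
  \<open>main\<close> never terminates. Queue 0 is present because a serial system has at least one
  queue. The data leave room for a head position one past the last cell and for symbols shifted by
  one.\<close>

definition sim_inst :: "tm \<Rightarrow> (bool list \<Rightarrow> bool list) \<Rightarrow> bool list \<Rightarrow> inst" where
  "sim_inst M u w =
     (dedup (map (\<lambda>j. ident [j]) (positions (u w @ una (nsymbols M + 2)))), ident [[]],
      dedup (concat (map (\<lambda>i. head_id i # map (cell_id i) (positions (u w))) [0..<ntapes M])), [], [0], 0,
      [(0, map (\<lambda>s. (s, if s = ident [una (accept M)] then 1 else 0)) (sim_states M (trs M w (positions (u w)))),
        ident [una (start M)], ident [], trs M w (positions (u w)))])"

definition reduction :: "tm \<Rightarrow> (bool list \<Rightarrow> bool list) \<Rightarrow> bool list \<Rightarrow> bool list" where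
  "reduction M u w = bits_upto 9 (code_of_inst (sim_inst M u w))"

lemma ptime_tr_code:
  "ptime f \<Longrightarrow> ptime g \<Longrightarrow> ptime h \<Longrightarrow> ptime (\<lambda>x. tr_code (f x) (g x) (h x))"
  unfolding tr_code_def by (intro ptime_intros)

lemma ptime_guard_code: "ptime f \<Longrightarrow> ptime (\<lambda>x. guard_code (f x))"
  unfolding guard_code_def by (intro ptime_intros)

lemma ptime_eq_code: "ptime f \<Longrightarrow> ptime g \<Longrightarrow> ptime (\<lambda>x. eq_code (f x) (g x))"
  unfolding eq_code_def by (intro ptime_intros)

lemma ptime_assign_code: "ptime f \<Longrightarrow> ptime g \<Longrightarrow> ptime (\<lambda>x. assign_code (f x) (g x))"
  unfolding assign_code_def by (intro ptime_intros)

lemma ptime_cell_id: "ptime f \<Longrightarrow> ptime (\<lambda>x. cell_id i (f x))"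
  unfolding cell_id_def by (intro ptime_intros)

lemma ptime_read_tr: "ptime f \<Longrightarrow> ptime g \<Longrightarrow> ptime (\<lambda>x. read_tr M p i rs v (f x) (g x))"
  unfolding read_tr_def
  by (intro ptime_tr_code ptime_guard_code ptime_eq_code ptime_cell_id ptime_content ptime_if ptime_Cons ptime_append ptime_const)

lemma ptime_write_tr: "ptime f \<Longrightarrow> ptime (\<lambda>x. write_tr M p rs i (f x))"
  unfolding write_tr_def
  by (intro ptime_Cons ptime_tr_code ptime_guard_code ptime_eq_code ptime_assign_code ptime_cell_id ptime_shift ptime_append ptime_const)

lemma ptime_trs: "ptime (\<lambda>z. trs M (fst z) (snd z))"
proof -
  have 1: "ptime (\<lambda>z. read_trs M (fst z) (snd z))"
    unfolding read_trs_def
    by (rule ptime_concat_const)+ (intro ptime_map[where f = "\<lambda>z j. read_tr M p i rs v (fst z) j" for p i rs v] ptime_read_tr ptime_fst ptime_snd ptime_id)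
  have 2: "ptime (\<lambda>z :: bool list \<times> bool list list. concat (map (\<lambda>i. concat (map (write_tr M p rs i) (snd z))) [0..<ntapes M]))" for p rs
    by (rule ptime_concat_const, rule ptime_concat, rule ptime_map[where f = "\<lambda>z j. write_tr M p rs i j" for i])
      (intro ptime_write_tr ptime_snd ptime_id)+
  have 3: "ptime (\<lambda>z :: bool list \<times> bool list list. write_trs M (snd z))"
    unfolding write_trs_def by (rule ptime_concat_const)+ (rule ptime_append[OF ptime_const 2])
  show ?thesis unfolding trs_def by (intro ptime_dedup ptime_append 1 3)
qed

lemma ptime_sim_inst:
  assumes u: "ptime u"
  shows "ptime (sim_inst M u)"
proof -
  have t: "ptime (\<lambda>w. trs M w (positions (u w)))"
    by (rule ptime_comp2[OF ptime_trs]) (intro ptime_intros ptime_comp[OF ptime_positions] u)+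
  have s: "ptime (sim_states M)" unfolding sim_states_def[abs_def] by (intro ptime_intros)
  have v: "ptime (\<lambda>w. concat (map (\<lambda>i. head_id i # map (cell_id i) (positions (u w))) [0..<ntapes M]))"
    unfolding cell_id_def[abs_def]
    by (intro ptime_concat_const) (intro ptime_intros ptime_comp[OF ptime_positions] u)
  show ?thesis
    unfolding sim_inst_def[abs_def]
    by (intro ptime_intros ptime_comp[OF ptime_positions] ptime_comp[OF s] t v u)
qed

lemma ptime_reduction: "ptime u \<Longrightarrow> ptime (reduction M u)"
  unfolding reduction_def[abs_def]
  by (intro ptime_comp[OF ptime_bits_upto] ptime_comp[OF ptime_code_of_inst] ptime_sim_inst)

subsection \<open>Correctness of the simulation\<close>

abbreviation D :: "nat \<Rightarrow> nat" where "D j \<equiv> idn [j]"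
abbreviation X :: "nat \<Rightarrow> nat \<Rightarrow> nat" where "X i j \<equiv> idn [0, i, j]"
abbreviation H :: "nat \<Rightarrow> nat" where "H i \<equiv> idn [1, i]"

type_synonym act = "(nat, nat, nat, nat) action"

text \<open>\<open>S\<close> is the number of the last cell.\<close>

inductive ttr :: "tm \<Rightarrow> bool list \<Rightarrow> nat \<Rightarrow> nat list \<Rightarrow> act \<Rightarrow> nat list \<Rightarrow> bool" for M w S where
  tr_read: "p \<in> set (running M) \<Longrightarrow> i < ntapes M \<Longrightarrow> rs \<in> set (words M i) \<Longrightarrow> v \<le> nsymbols M \<Longrightarrow> j \<le> S \<Longrightarrow>
    ttr M w S (p # rs) (Guard [Eq (H i) (D j), Eq (X i j) (D v)])
      (p # rs @ [if v = 0 then tape_content (if i = 0 then w else []) j else v - 1])"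
| tr_start: "p \<in> set (running M) \<Longrightarrow> rs \<in> set (words M (ntapes M)) \<Longrightarrow> ttr M w S (p # rs) (Guard []) (p # rs @ [0])"
| tr_next: "p \<in> set (running M) \<Longrightarrow> rs \<in> set (words M (ntapes M)) \<Longrightarrow>
    ttr M w S (p # rs @ [ntapes M]) (Guard []) [fst (delta M p rs)]"
| tr_find: "p \<in> set (running M) \<Longrightarrow> rs \<in> set (words M (ntapes M)) \<Longrightarrow> i < ntapes M \<Longrightarrow> j \<le> S \<Longrightarrow>
    ttr M w S (p # rs @ [i]) (Guard [Eq (H i) (D j)]) (p # rs @ [i, j])"
| tr_cell: "p \<in> set (running M) \<Longrightarrow> rs \<in> set (words M (ntapes M)) \<Longrightarrow> i < ntapes M \<Longrightarrow> j \<le> S \<Longrightarrow>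
    ttr M w S (p # rs @ [i, j]) (Assign (X i j) (D (Suc (fst (snd (delta M p rs) ! i))))) (p # rs @ [i, j, 0])"
| tr_head: "p \<in> set (running M) \<Longrightarrow> rs \<in> set (words M (ntapes M)) \<Longrightarrow> i < ntapes M \<Longrightarrow> j \<le> S \<Longrightarrow>
    ttr M w S (p # rs @ [i, j, 0]) (Assign (H i) (D (move (snd (snd (delta M p rs) ! i)) j))) (p # rs @ [Suc i])"

lemma words_iff: "rs \<in> set (words M n) \<longleftrightarrow> length rs = n \<and> set rs \<subseteq> {..<nsymbols M}"
  by (auto simp: words_def set_n_lists lessThan_atLeast0)

lemma running_iff: "p \<in> set (running M) \<longleftrightarrow> p < nstates M \<and> p \<noteq> accept M \<and> p \<noteq> reject M"
  by (auto simp: running_def)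

lemma read_tr_code:
  "read_tr M p i rs v w j = code_transition (idn (p # rs), Guard [Eq (H i) (D (length j)), Eq (X i (length j)) (D v)],
     idn (p # rs @ [if v = 0 then tape_content (if i = 0 then w else []) (length j) else v - 1]))"
  by (simp add: read_tr_def tr_code_def guard_code_def eq_code_def head_id_def cell_id_def ident_idn length_content o_def)

lemma write_tr_code:
  "write_tr M p rs i j = map code_transition
     [(idn (p # rs @ [i]), Guard [Eq (H i) (D (length j))], idn (p # rs @ [i, length j])),
      (idn (p # rs @ [i, length j]), Assign (X i (length j)) (D (Suc (fst (snd (delta M p rs) ! i)))), idn (p # rs @ [i, length j, 0])),
      (idn (p # rs @ [i, length j, 0]), Assign (H i) (D (move (snd (snd (delta M p rs) ! i)) (length j))), idn (p # rs @ [Suc i]))]"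
  by (simp add: write_tr_def tr_code_def guard_code_def eq_code_def assign_code_def head_id_def cell_id_def ident_idn length_shift o_def)

lemma set_concat_map: "c \<in> set (concat (map f xs)) \<longleftrightarrow> (\<exists>x \<in> set xs. c \<in> set (f x))"
  by auto

lemma read_trs_iff: "c \<in> set (read_trs M w P) \<longleftrightarrow> (\<exists>p \<in> set (running M). \<exists>i \<in> {0..<ntapes M}. \<exists>rs \<in> set (words M i).
    \<exists>v \<in> {0..<Suc (nsymbols M)}. \<exists>j \<in> set P. c = read_tr M p i rs v w j)"
  by (simp only: read_trs_def set_concat_map set_map image_iff set_upt)

lemma write_trs_iff: "c \<in> set (write_trs M P) \<longleftrightarrow> (\<exists>p \<in> set (running M). \<exists>rs \<in> set (words M (ntapes M)).
    c = tr_code (map una (p # rs)) (guard_code []) (map una (p # rs @ [0])) \<or>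
    c = tr_code (map una (p # rs @ [ntapes M])) (guard_code []) (map una [fst (delta M p rs)]) \<or>
    (\<exists>i \<in> {0..<ntapes M}. \<exists>j \<in> set P. c \<in> set (write_tr M p rs i j)))"
  by (simp only: write_trs_def set_concat_map set_append set_upt Un_iff list.set insert_iff empty_iff disj_assoc simp_thms)

lemma set_trs:
  assumes "length ` set P = {..S}"
  shows "set (trs M w P) = {code_transition (idn ns, a, idn ns') | ns a ns'. ttr M w S ns a ns'}" (is "_ = ?T")
proof
  show "set (trs M w P) \<subseteq> ?T"
  proof
    fix c assume "c \<in> set (trs M w P)"
    then consider "c \<in> set (read_trs M w P)" | "c \<in> set (write_trs M P)" by (auto simp: trs_def dedup)
    then show "c \<in> ?T"
    proof cases
      case 1
      then obtain p i rs v j where r: "p \<in> set (running M)" "i < ntapes M" "rs \<in> set (words M i)" "v < Suc (nsymbols M)" "j \<in> set P"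
        "c = read_tr M p i rs v w j"
        unfolding read_trs_iff by (metis atLeastLessThan_iff)
      have "length j \<le> S" "v \<le> nsymbols M" using r assms by auto
      then show ?thesis using tr_read[OF r(1-3)] r(6) read_tr_code by blast
    next
      case 2
      then obtain p rs where p: "p \<in> set (running M)" "rs \<in> set (words M (ntapes M))" and
        c: "c = tr_code (map una (p # rs)) (guard_code []) (map una (p # rs @ [0])) \<or>
          c = tr_code (map una (p # rs @ [ntapes M])) (guard_code []) (map una [fst (delta M p rs)]) \<or>
          (\<exists>i \<in> {0..<ntapes M}. \<exists>j \<in> set P. c \<in> set (write_tr M p rs i j))"
        unfolding write_trs_iff by blast
      from c consider "c = code_transition (idn (p # rs), Guard [], idn (p # rs @ [0]))"
        | "c = code_transition (idn (p # rs @ [ntapes M]), Guard [], idn [fst (delta M p rs)])"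
        | i j where "i < ntapes M" "j \<in> set P" "c \<in> set (write_tr M p rs i j)"
        by (auto simp: tr_code_def guard_code_def ident_idn o_def)
      then show ?thesis
      proof cases
        case 1 then show ?thesis using tr_start[OF p] by blast
      next
        case 2 then show ?thesis using tr_next[OF p] by blast
      next
        case (3 i j)
        have j: "length j \<le> S" and i: "i < ntapes M" using 3 assms by auto
        from 3(3) show ?thesis
          using tr_find[OF p i j] tr_cell[OF p i j] tr_head[OF p i j]
          unfolding write_tr_code list.map list.set insert_iff empty_iff simp_thms by blast
      qed
    qed
  qed
next
  have P: "\<exists>j' \<in> set P. length j' = j" if "j \<le> S" for j
    using that assms by (metis atMost_iff imageE)
  have W: "c \<in> set (write_trs M P)" if "p \<in> set (running M)" "rs \<in> set (words M (ntapes M))" "i < ntapes M" "j \<in> set P" "c \<in> set (write_tr M p rs i j)"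
    for c p rs i j
  proof -
    have "i \<in> {0..<ntapes M}" using that(3) by simp
    then show ?thesis using that unfolding write_trs_iff by blast
  qed
  show "?T \<subseteq> set (trs M w P)"
  proof
    fix c assume "c \<in> ?T"
    then obtain ns a ns' where c: "c = code_transition (idn ns, a, idn ns')" and t: "ttr M w S ns a ns'" by blast
    have "c \<in> set (read_trs M w P) \<or> c \<in> set (write_trs M P)" using t
    proof cases
      case (tr_read p i rs v j)
      obtain j' where j': "j' \<in> set P" "length j' = j" using P[OF tr_read(8)] by blast
      have "c = read_tr M p i rs v w j'" unfolding read_tr_code j' c tr_read ..
      moreover have "v < Suc (nsymbols M)" using tr_read by simp
      ultimately have "c \<in> set (read_trs M w P)"
        unfolding read_trs_iff using tr_read(4,5,6) j'(1) by (metis atLeastLessThan_iff less_eq_nat.simps(1))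
      then show ?thesis ..
    next
      case (tr_start p rs)
      have "c = tr_code (map una (p # rs)) (guard_code []) (map una (p # rs @ [0]))"
        unfolding c tr_start by (simp add: tr_code_def guard_code_def ident_idn o_def)
      then have "c \<in> set (write_trs M P)" unfolding write_trs_iff using tr_start by blast
      then show ?thesis ..
    next
      case (tr_next p rs)
      have "c = tr_code (map una (p # rs @ [ntapes M])) (guard_code []) (map una [fst (delta M p rs)])"
        unfolding c tr_next by (simp add: tr_code_def guard_code_def ident_idn o_def)
      then have "c \<in> set (write_trs M P)" unfolding write_trs_iff using tr_next by blast
      then show ?thesis ..
    next
      case (tr_find p rs i j)
      obtain j' where j': "j' \<in> set P" "length j' = j" using P[OF tr_find(7)] by blast
      have "c \<in> set (write_tr M p rs i j')" unfolding write_tr_code j' c tr_find by simp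
      then show ?thesis using W[OF tr_find(4,5,6) j'(1)] by blast
    next
      case (tr_cell p rs i j)
      obtain j' where j': "j' \<in> set P" "length j' = j" using P[OF tr_cell(7)] by blast
      have "c \<in> set (write_tr M p rs i j')" unfolding write_tr_code j' c tr_cell by simp
      then show ?thesis using W[OF tr_cell(4,5,6) j'(1)] by blast
    next
      case (tr_head p rs i j)
      obtain j' where j': "j' \<in> set P" "length j' = j" using P[OF tr_head(7)] by blast
      have "c \<in> set (write_tr M p rs i j')" unfolding write_tr_code j' c tr_head by simp
      then show ?thesis using W[OF tr_head(4,5,6) j'(1)] by blast
    qed
    then show "c \<in> set (trs M w P)" by (auto simp: trs_def dedup)
  qed
qed

section \<open>The block \<open>main\<close> as a transition system and the machine steps that it
  simulates\<close>

definition tstep :: "tm \<Rightarrow> bool list \<Rightarrow> nat \<Rightarrow> nat list \<times> (nat \<Rightarrow> nat) \<Rightarrow> nat list \<times> (nat \<Rightarrow> nat) \<Rightarrow> bool" where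
  "tstep M w S C C' \<longleftrightarrow> (\<exists>a. ttr M w S (fst C) a (fst C') \<and>
     ((\<exists>g. a = Guard g \<and> (\<forall>t \<in> set g. sat_atom (snd C) t) \<and> snd C' = snd C) \<or>
      (\<exists>x d. a = Assign x d \<and> snd C' = (snd C)(x := d))))"

lemma tstep_guard: "ttr M w S ns (Guard g) ns' \<Longrightarrow> (\<forall>t \<in> set g. sat_atom \<nu> t) \<Longrightarrow> tstep M w S (ns, \<nu>) (ns', \<nu>)"
  unfolding tstep_def fst_conv snd_conv by blast

lemma tstep_assign: "ttr M w S ns (Assign x d) ns' \<Longrightarrow> tstep M w S (ns, \<nu>) (ns', \<nu>(x := d))"
  unfolding tstep_def fst_conv snd_conv by blast

locale simulation =
  fixes M :: tm and w :: "bool list" and S :: nat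
  assumes wfM: "wf_tm M" and space: "\<And>t c h. (c, h) \<in> set (snd (tm_run M w t)) \<Longrightarrow> h \<le> S"
begin

abbreviation k :: nat where "k \<equiv> ntapes M"
abbreviation run :: "nat \<Rightarrow> tm_config" where "run t \<equiv> tm_run M w t"

definition reads :: "tape list \<Rightarrow> nat list" where
  "reads ts = map (\<lambda>(c, h). c h) ts"

lemma delta_wf:
  assumes "p < nstates M" "length rs = k" "set rs \<subseteq> {..<nsymbols M}"
  shows "fst (delta M p rs) < nstates M" "length (snd (delta M p rs)) = k" "i < k \<Longrightarrow> fst (snd (delta M p rs) ! i) < nsymbols M"
proof -
  have d: "fst (delta M p rs) < nstates M \<and> length (snd (delta M p rs)) = k \<and> fst ` set (snd (delta M p rs)) \<subseteq> {..<nsymbols M}"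
    using wfM assms unfolding wf_tm_def by (simp add: case_prod_beta)
  then show "fst (delta M p rs) < nstates M" "length (snd (delta M p rs)) = k" by auto
  show "fst (snd (delta M p rs) ! i) < nsymbols M" if "i < k"
  proof -
    have "fst (snd (delta M p rs) ! i) \<in> fst ` set (snd (delta M p rs))" using d that by (intro imageI nth_mem) simp
    then show ?thesis using d by auto
  qed
qed

lemma run_wf: "fst (run t) < nstates M \<and> length (snd (run t)) = k \<and> (\<forall>i < k. \<forall>j. fst (snd (run t) ! i) j < nsymbols M)"
proof (induction t)
  case 0
  have "tape_content v j < nsymbols M" for v j using wfM by (auto simp: wf_tm_def tape_content_def bit_symbol_def)
  then show ?case using wfM by (auto simp: tm_run_def tm_init_def wf_tm_def nth_Cons')
next
  case (Suc t)
  obtain p ts where r: "run t = (p, ts)" by fastforce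
  let ?rs = "map (\<lambda>(c, h). c h) ts"
  have rs: "length ?rs = k" "set ?rs \<subseteq> {..<nsymbols M}"
    using Suc r by (auto simp: in_set_conv_nth) (metis fst_conv)
  obtain p' acts where d: "delta M p ?rs = (p', acts)" by fastforce
  note D = delta_wf[OF _ rs, of p, unfolded d]
  have "run (Suc t) = tm_step M (p, ts)" using r by (simp add: tm_run_def)
  then show ?case
  proof (cases "halted M (p, ts)")
    case True
    then show ?thesis using Suc r \<open>run (Suc t) = tm_step M (p, ts)\<close> by (simp add: tm_step_def)
  next
    case False
    then have s: "run (Suc t) = (p', map2 act ts acts)"
      using \<open>run (Suc t) = tm_step M (p, ts)\<close> d by (simp add: tm_step_def)
    have "fst (map2 act ts acts ! i) j < nsymbols M" if "i < k" for i j
    proof -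
      obtain c h where c: "ts ! i = (c, h)" by fastforce
      obtain a m where a: "acts ! i = (a, m)" by fastforce
      have "c j < nsymbols M" "a < nsymbols M" using Suc r c a D(3)[of i] that by (metis fst_conv snd_conv)+
      then show ?thesis using that Suc r D(2) c a by simp
    qed
    then show ?thesis using s Suc r D by simp
  qed
qed

lemma run_Suc:
  assumes "run t = (p, ts)" "p \<in> set (running M)"
  shows "run (Suc t) = (fst (delta M p (reads ts)), map2 act ts (snd (delta M p (reads ts))))"
  using assms by (simp add: tm_run_def tm_step_def halted_def running_iff reads_def case_prod_beta)

text \<open>Only the cells up to \<open>S\<close> have variables; by the space bound no head ever
  stands beyond them. Only tape 0 starts with the input word.\<close>

definition trep :: "nat \<Rightarrow> (nat \<Rightarrow> nat) \<Rightarrow> tape \<Rightarrow> bool" where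
  "trep i \<nu> T \<longleftrightarrow> \<nu> (H i) = D (snd T) \<and> (\<forall>j \<le> S. \<nu> (X i j) = D (Suc (fst T j)) \<or>
     \<nu> (X i j) = D 0 \<and> fst T j = tape_content (if i = 0 then w else []) j)"

definition rep :: "(nat \<Rightarrow> nat) \<Rightarrow> tape list \<Rightarrow> bool" where
  "rep \<nu> ts \<longleftrightarrow> length ts = k \<and> (\<forall>i < k. trep i \<nu> (ts ! i))"

lemma rep_cell:
  assumes "rep \<nu> ts" "i < k" "ts ! i = (c, h)"
  shows "rep (\<nu>(X i h := D (Suc a))) (ts[i := (c(h := a), h)])"
  unfolding rep_def
proof (intro conjI allI impI)
  fix i' assume i': "i' < k"
  have t: "trep i' \<nu> (ts ! i')" "length ts = k" using assms i' by (auto simp: rep_def)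
  show "trep i' (\<nu>(X i h := D (Suc a))) (ts[i := (c(h := a), h)] ! i')"
  proof (cases "i' = i")
    case True then show ?thesis using t assms by (auto simp: trep_def idn_inj)
  next
    case False then show ?thesis using t by (auto simp: trep_def idn_inj)
  qed
qed (use assms in \<open>simp add: rep_def\<close>)

lemma rep_head:
  assumes "rep \<nu> ts" "i < k" "ts ! i = (c, h)"
  shows "rep (\<nu>(H i := D h')) (ts[i := (c, h')])"
  unfolding rep_def
proof (intro conjI allI impI)
  fix i' assume i': "i' < k"
  have t: "trep i' \<nu> (ts ! i')" "length ts = k" using assms i' by (auto simp: rep_def)
  show "trep i' (\<nu>(H i := D h')) (ts[i := (c, h')] ! i')"
  proof (cases "i' = i")
    case True then show ?thesis using t assms by (auto simp: trep_def idn_inj)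
  next
    case False then show ?thesis using t by (auto simp: trep_def idn_inj)
  qed
qed (use assms in \<open>simp add: rep_def\<close>)

text \<open>The length of a control list reveals the phase: at most \<open>k\<close> while reading,
  \<open>k + 1\<close> when all symbols are known, \<open>k + 2\<close> with a tape index,
  \<open>k + 3\<close> with a head position and \<open>k + 4\<close> once the cell is written. This
  makes the source of every transition unambiguous.\<close>

lemma ttr_length:
  assumes "ttr M w S ns a ns'"
  shows "(length ns \<le> k \<and> (\<exists>p i rs v j. p \<in> set (running M) \<and> ns = p # rs \<and> i = length rs \<and> j \<le> S \<and> a = Guard [Eq (H i) (D j), Eq (X i j) (D v)] \<and>
       ns' = p # rs @ [if v = 0 then tape_content (if i = 0 then w else []) j else v - 1])) \<or>
    (length ns = k + 1 \<and> a = Guard [] \<and> hd ns \<in> set (running M) \<and> ns' = ns @ [0]) \<or>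
    (length ns = k + 2 \<and> (\<exists>p rs. ns = p # rs @ [k] \<and> length rs = k \<and> a = Guard [] \<and> ns' = [fst (delta M p rs)])) \<or>
    (length ns = k + 2 \<and> (\<exists>i j. i < k \<and> last ns = i \<and> a = Guard [Eq (H i) (D j)] \<and> ns' = ns @ [j])) \<or>
    (length ns = k + 3 \<and> (\<exists>p rs i j. ns = p # rs @ [i, j] \<and> a = Assign (X i j) (D (Suc (fst (snd (delta M p rs) ! i)))) \<and> ns' = ns @ [0])) \<or>
    (length ns = k + 4 \<and> (\<exists>p rs i j. ns = p # rs @ [i, j, 0] \<and> a = Assign (H i) (D (move (snd (snd (delta M p rs) ! i)) j)) \<and> ns' = p # rs @ [Suc i]))"
  using assms
proof cases
  case (tr_read p i rs v j)
  then have "length ns \<le> k" "i = length rs" by (auto simp: words_iff)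
  with tr_read(1-4,8) show ?thesis by blast
next
  case (tr_start p rs)
  then have "length ns = k + 1" "hd ns \<in> set (running M)" "ns' = ns @ [0]" by (auto simp: words_iff)
  with tr_start(2) show ?thesis by blast
next
  case (tr_next p rs)
  then have "length ns = k + 2" "length rs = k" by (auto simp: words_iff)
  with tr_next(1-3) show ?thesis by blast
next
  case (tr_find p rs i j)
  then have "length ns = k + 2" "last ns = i" "ns' = ns @ [j]" by (auto simp: words_iff)
  with tr_find(2,6) show ?thesis by blast
next
  case (tr_cell p rs i j)
  then have "length ns = k + 3" "ns' = ns @ [0]" by (auto simp: words_iff)
  with tr_cell(1,2) show ?thesis by blast
next
  case (tr_head p rs i j)
  then have "length ns = k + 4" by (auto simp: words_iff)
  with tr_head(1-3) show ?thesis by blast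
qed

context
  fixes t p ts
  assumes rt: "run t = (p, ts)"
begin

lemma ts_facts:
  "p < nstates M" "length ts = k" "length (reads ts) = k" "set (reads ts) \<subseteq> {..<nsymbols M}"
  "i < k \<Longrightarrow> snd (ts ! i) \<le> S" "i < k \<Longrightarrow> reads ts ! i = fst (ts ! i) (snd (ts ! i))" "i < k \<Longrightarrow> reads ts ! i < nsymbols M"
proof -
  note r = run_wf[of t, unfolded rt fst_conv snd_conv]
  show 1: "p < nstates M" "length ts = k" "length (reads ts) = k" using r by (auto simp: reads_def)
  show 2: "i < k \<Longrightarrow> reads ts ! i = fst (ts ! i) (snd (ts ! i))" for i using 1 by (simp add: reads_def case_prod_beta)
  show 3: "i < k \<Longrightarrow> reads ts ! i < nsymbols M" for i using 2 r by simp
  show "set (reads ts) \<subseteq> {..<nsymbols M}" using 1 3 by (auto simp: in_set_conv_nth)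
  show "i < k \<Longrightarrow> snd (ts ! i) \<le> S" using space[of "fst (ts ! i)" "snd (ts ! i)" t] rt 1 by simp
qed

lemma words_take: "i \<le> k \<Longrightarrow> take i (reads ts) \<in> set (words M i)"
  using ts_facts(3,4) by (auto simp: words_iff dest: in_set_takeD)

lemma words_reads: "reads ts \<in> set (words M k)"
  using words_take[of k] ts_facts(3) by simp

lemma step_read:
  assumes p: "p \<in> set (running M)" and i: "i < k" and r: "rep \<nu> ts"
  shows "tstep M w S (p # take i (reads ts), \<nu>) C \<longleftrightarrow> C = (p # take (Suc i) (reads ts), \<nu>)"
proof -
  let ?h = "snd (ts ! i)" and ?c = "fst (ts ! i)"
  have len: "length (p # take i (reads ts)) = Suc i" using ts_facts(3) i by simp
  have take: "take (Suc i) (reads ts) = take i (reads ts) @ [?c ?h]"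
    using ts_facts(3,6) i by (simp add: take_Suc_conv_app_nth)
  have h: "\<nu> (H i) = D ?h" and c: "\<nu> (X i ?h) = D (Suc (?c ?h)) \<or> \<nu> (X i ?h) = D 0 \<and> ?c ?h = tape_content (if i = 0 then w else []) ?h"
    using r i ts_facts(5)[OF i] by (auto simp: rep_def trep_def)
  show ?thesis
  proof
    assume "tstep M w S (p # take i (reads ts), \<nu>) C"
    then obtain a where t: "ttr M w S (p # take i (reads ts)) a (fst C)"
      and a: "(\<exists>g. a = Guard g \<and> (\<forall>t \<in> set g. sat_atom \<nu> t) \<and> snd C = \<nu>) \<or> (\<exists>x d. a = Assign x d \<and> snd C = \<nu>(x := d))"
      unfolding tstep_def by auto
    from ttr_length[OF t] obtain v j where "a = Guard [Eq (H i) (D j), Eq (X i j) (D v)]"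
      "fst C = p # take i (reads ts) @ [if v = 0 then tape_content (if i = 0 then w else []) j else v - 1]"
      using len i ts_facts(3) by auto
    moreover from this a have "snd C = \<nu>" "\<nu> (H i) = D j" "\<nu> (X i j) = D v" by auto
    moreover from this h have "j = ?h" by (simp add: idn_inj)
    ultimately show "C = (p # take (Suc i) (reads ts), \<nu>)"
      using c take by (auto simp: prod_eq_iff idn_inj)
  next
    assume C: "C = (p # take (Suc i) (reads ts), \<nu>)"
    \<comment> \<open>The number stored for the scanned cell: 0 if it still has its initial value,
      otherwise its symbol plus one.\<close>
    define v where "v = (if \<nu> (X i ?h) = D 0 then 0 else Suc (?c ?h))"
    have v: "\<nu> (X i ?h) = D v" "v \<le> nsymbols M" "?c ?h = (if v = 0 then tape_content (if i = 0 then w else []) ?h else v - 1)"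
      using c ts_facts(6,7)[OF i] by (auto simp: v_def idn_inj)
    have "ttr M w S (p # take i (reads ts)) (Guard [Eq (H i) (D ?h), Eq (X i ?h) (D v)]) (p # take i (reads ts) @ [?c ?h])"
      using tr_read[OF p i words_take v(2) ts_facts(5)[OF i], of w] i v(3) by simp
    then show "tstep M w S (p # take i (reads ts), \<nu>) C"
      unfolding tstep_def C using take h v(1) by auto
  qed
qed

lemma step_start:
  assumes p: "p \<in> set (running M)"
  shows "tstep M w S (p # reads ts, \<nu>) C \<longleftrightarrow> C = (p # reads ts @ [0], \<nu>)"
proof
  assume "tstep M w S (p # reads ts, \<nu>) C"
  then obtain a where t: "ttr M w S (p # reads ts) a (fst C)"
    and a: "(\<exists>g. a = Guard g \<and> (\<forall>t \<in> set g. sat_atom \<nu> t) \<and> snd C = \<nu>) \<or> (\<exists>x d. a = Assign x d \<and> snd C = \<nu>(x := d))"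
    unfolding tstep_def by auto
  then show "C = (p # reads ts @ [0], \<nu>)" using ttr_length[OF t] ts_facts(3) by (auto simp: prod_eq_iff)
next
  assume "C = (p # reads ts @ [0], \<nu>)"
  then show "tstep M w S (p # reads ts, \<nu>) C" using tstep_guard[OF tr_start[OF p words_reads], of \<nu>] by simp
qed

lemma step_next:
  assumes p: "p \<in> set (running M)"
  shows "tstep M w S (p # reads ts @ [k], \<nu>) C \<longleftrightarrow> C = ([fst (delta M p (reads ts))], \<nu>)"
proof
  assume "tstep M w S (p # reads ts @ [k], \<nu>) C"
  then obtain a where t: "ttr M w S (p # reads ts @ [k]) a (fst C)"
    and a: "(\<exists>g. a = Guard g \<and> (\<forall>t \<in> set g. sat_atom \<nu> t) \<and> snd C = \<nu>) \<or> (\<exists>x d. a = Assign x d \<and> snd C = \<nu>(x := d))"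
    unfolding tstep_def by auto
  then show "C = ([fst (delta M p (reads ts))], \<nu>)" using ttr_length[OF t] ts_facts(3) by (auto simp: prod_eq_iff)
next
  assume "C = ([fst (delta M p (reads ts))], \<nu>)"
  then show "tstep M w S (p # reads ts @ [k], \<nu>) C" using tstep_guard[OF tr_next[OF p words_reads], of \<nu>] by simp
qed

lemma step_find:
  assumes p: "p \<in> set (running M)" and i: "i < k" and r: "\<nu> (H i) = D (snd (ts ! i))"
  shows "tstep M w S (p # reads ts @ [i], \<nu>) C \<longleftrightarrow> C = (p # reads ts @ [i, snd (ts ! i)], \<nu>)"
proof
  assume "tstep M w S (p # reads ts @ [i], \<nu>) C"
  then obtain a where t: "ttr M w S (p # reads ts @ [i]) a (fst C)"
    and a: "(\<exists>g. a = Guard g \<and> (\<forall>t \<in> set g. sat_atom \<nu> t) \<and> snd C = \<nu>) \<or> (\<exists>x d. a = Assign x d \<and> snd C = \<nu>(x := d))"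
    unfolding tstep_def by auto
  then show "C = (p # reads ts @ [i, snd (ts ! i)], \<nu>)" using ttr_length[OF t] ts_facts(3) i r by (auto simp: prod_eq_iff idn_inj)
next
  assume "C = (p # reads ts @ [i, snd (ts ! i)], \<nu>)"
  then show "tstep M w S (p # reads ts @ [i], \<nu>) C"
    using tstep_guard[OF tr_find[OF p words_reads i ts_facts(5)[OF i]], of \<nu> w] r by simp
qed

lemma step_cell:
  assumes p: "p \<in> set (running M)" and i: "i < k"
  shows "tstep M w S (p # reads ts @ [i, snd (ts ! i)], \<nu>) C \<longleftrightarrow>
    C = (p # reads ts @ [i, snd (ts ! i), 0], \<nu>(X i (snd (ts ! i)) := D (Suc (fst (snd (delta M p (reads ts)) ! i)))))"
proof
  assume "tstep M w S (p # reads ts @ [i, snd (ts ! i)], \<nu>) C"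
  then obtain a where t: "ttr M w S (p # reads ts @ [i, snd (ts ! i)]) a (fst C)"
    and a: "(\<exists>g. a = Guard g \<and> (\<forall>t \<in> set g. sat_atom \<nu> t) \<and> snd C = \<nu>) \<or> (\<exists>x d. a = Assign x d \<and> snd C = \<nu>(x := d))"
    unfolding tstep_def by auto
  then show "C = (p # reads ts @ [i, snd (ts ! i), 0], \<nu>(X i (snd (ts ! i)) := D (Suc (fst (snd (delta M p (reads ts)) ! i)))))"
    using ttr_length[OF t] ts_facts(3) by (auto simp: prod_eq_iff)
next
  assume "C = (p # reads ts @ [i, snd (ts ! i), 0], \<nu>(X i (snd (ts ! i)) := D (Suc (fst (snd (delta M p (reads ts)) ! i)))))"
  then show "tstep M w S (p # reads ts @ [i, snd (ts ! i)], \<nu>) C"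
    using tstep_assign[OF tr_cell[OF p words_reads i ts_facts(5)[OF i]], of w \<nu>] by simp
qed

lemma step_head:
  assumes p: "p \<in> set (running M)" and i: "i < k"
  shows "tstep M w S (p # reads ts @ [i, snd (ts ! i), 0], \<nu>) C \<longleftrightarrow>
    C = (p # reads ts @ [Suc i], \<nu>(H i := D (move (snd (snd (delta M p (reads ts)) ! i)) (snd (ts ! i)))))"
proof
  assume "tstep M w S (p # reads ts @ [i, snd (ts ! i), 0], \<nu>) C"
  then obtain a where t: "ttr M w S (p # reads ts @ [i, snd (ts ! i), 0]) a (fst C)"
    and a: "(\<exists>g. a = Guard g \<and> (\<forall>t \<in> set g. sat_atom \<nu> t) \<and> snd C = \<nu>) \<or> (\<exists>x d. a = Assign x d \<and> snd C = \<nu>(x := d))"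
    unfolding tstep_def by auto
  then show "C = (p # reads ts @ [Suc i], \<nu>(H i := D (move (snd (snd (delta M p (reads ts)) ! i)) (snd (ts ! i)))))"
    using ttr_length[OF t] ts_facts(3) by (auto simp: prod_eq_iff)
next
  assume "C = (p # reads ts @ [Suc i], \<nu>(H i := D (move (snd (snd (delta M p (reads ts)) ! i)) (snd (ts ! i)))))"
  then show "tstep M w S (p # reads ts @ [i, snd (ts ! i), 0], \<nu>) C"
    using tstep_assign[OF tr_head[OF p words_reads i ts_facts(5)[OF i]], of w \<nu>] by simp
qed

lemma step_halted: "p \<notin> set (running M) \<Longrightarrow> \<not> tstep M w S ([p], \<nu>) C"
proof
  assume p: "p \<notin> set (running M)" and "tstep M w S ([p], \<nu>) C"
  then obtain a where t: "ttr M w S [p] a (fst C)" unfolding tstep_def by auto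
  have "0 < k" using wfM by (simp add: wf_tm_def)
  with ttr_length[OF t] p show False by auto
qed

text \<open>The tapes in the middle of the update phase: those before \<open>i\<close> are finished,
  the others as before the machine step. In \<open>half\<close>, the cell of tape \<open>i\<close>
  is written and its head has not yet moved.\<close>

definition mix :: "nat \<Rightarrow> tape list" where
  "mix i = take i (map2 act ts (snd (delta M p (reads ts)))) @ drop i ts"

definition half :: "nat \<Rightarrow> tape list" where
  "half i = (mix i)[i := ((fst (ts ! i))(snd (ts ! i) := fst (snd (delta M p (reads ts)) ! i)), snd (ts ! i))]"

lemma delta_length: "length (snd (delta M p (reads ts))) = k"
  using delta_wf(2) ts_facts by blast

lemma mix_nth: "i < k \<Longrightarrow> mix i ! i = ts ! i"
  using ts_facts(2) delta_length by (simp add: mix_def nth_append)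

lemma mix_0: "mix 0 = ts" by (simp add: mix_def)

lemma mix_k: "mix k = map2 act ts (snd (delta M p (reads ts)))"
  using ts_facts(2) delta_length by (simp add: mix_def)

lemma mix_Suc:
  assumes i: "i < k"
  shows "mix (Suc i) = (half i)[i := (fst (half i ! i), move (snd (snd (delta M p (reads ts)) ! i)) (snd (half i ! i)))]"
proof (rule nth_equalityI)
  let ?acts = "snd (delta M p (reads ts))"
  show len: "length (mix (Suc i)) = length ((half i)[i := (fst (half i ! i), move (snd (?acts ! i)) (snd (half i ! i)))])"
    using ts_facts(2) delta_length i by (simp add: mix_def half_def)
  fix j assume "j < length (mix (Suc i))"
  then have j: "j < k" using ts_facts(2) delta_length i by (simp add: mix_def)
  have m: "mix n ! j = (if j < n then act (ts ! j) (?acts ! j) else ts ! j)" if "n \<le> k" for n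
    using that j ts_facts(2) delta_length by (auto simp: mix_def nth_append min_def)
  have lm: "length (mix i) = k" using ts_facts(2) delta_length i by (simp add: mix_def)
  show "mix (Suc i) ! j = (half i)[i := (fst (half i ! i), move (snd (?acts ! i)) (snd (half i ! i)))] ! j"
    using i j m[of i] m[of "Suc i"] lm
    by (cases "ts ! i"; cases "?acts ! i") (auto simp: half_def nth_list_update)
qed

lemma half_nth: "i < k \<Longrightarrow> half i ! i = ((fst (ts ! i))(snd (ts ! i) := fst (snd (delta M p (reads ts)) ! i)), snd (ts ! i))"
  using ts_facts(2) delta_length by (simp add: half_def mix_def)

lemma rep_half:
  assumes "i < k" "rep \<nu> (mix i)"
  shows "rep (\<nu>(X i (snd (ts ! i)) := D (Suc (fst (snd (delta M p (reads ts)) ! i))))) (half i)"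
  unfolding half_def by (rule rep_cell[OF assms(2,1)]) (simp add: mix_nth[OF assms(1)])

lemma rep_mix_Suc:
  assumes "i < k" "rep \<nu> (half i)"
  shows "rep (\<nu>(H i := D (move (snd (snd (delta M p (reads ts)) ! i)) (snd (ts ! i))))) (mix (Suc i))"
proof -
  have "snd (ts ! i) = snd (half i ! i)" using half_nth[OF assms(1)] by simp
  then show ?thesis unfolding mix_Suc[OF assms(1)] using rep_head[OF assms(2,1), of "fst (half i ! i)" "snd (half i ! i)"] by simp
qed

lemma rep_mix_head: "i < k \<Longrightarrow> rep \<nu> (mix i) \<Longrightarrow> \<nu> (H i) = D (snd (ts ! i))"
  using mix_nth by (auto simp: rep_def trep_def)

end

text \<open>One case for each phase of the simulation. The alternative \<open>i = 0\<close> in the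
  first case admits halted states, whose control list has the single entry \<open>p\<close>.\<close>

inductive sim :: "nat list \<times> (nat \<Rightarrow> nat) \<Rightarrow> bool" where
  sim_read: "run t = (p, ts) \<Longrightarrow> i \<le> k \<Longrightarrow> rep \<nu> ts \<Longrightarrow> p \<in> set (running M) \<or> i = 0 \<Longrightarrow> sim (p # take i (reads ts), \<nu>)"
| sim_find: "run t = (p, ts) \<Longrightarrow> p \<in> set (running M) \<Longrightarrow> i \<le> k \<Longrightarrow> rep \<nu> (mix p ts i) \<Longrightarrow> sim (p # reads ts @ [i], \<nu>)"
| sim_cell: "run t = (p, ts) \<Longrightarrow> p \<in> set (running M) \<Longrightarrow> i < k \<Longrightarrow> rep \<nu> (mix p ts i) \<Longrightarrow> sim (p # reads ts @ [i, snd (ts ! i)], \<nu>)"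
| sim_head: "run t = (p, ts) \<Longrightarrow> p \<in> set (running M) \<Longrightarrow> i < k \<Longrightarrow> rep \<nu> (half p ts i) \<Longrightarrow> sim (p # reads ts @ [i, snd (ts ! i), 0], \<nu>)"

text \<open>In each phase the next step is forced, so the invariant holds along every run of the
  block and not only along the intended one. This gives the direction from coverability to
  acceptance.\<close>

lemma sim_step: "sim C \<Longrightarrow> tstep M w S C C' \<Longrightarrow> sim C'"
proof (induction rule: sim.induct)
  case (sim_read t p ts i \<nu>)
  note f = ts_facts[OF sim_read(1)]
  show ?case
  proof (cases "p \<in> set (running M)")
    case False
    then show ?thesis using sim_read step_halted[OF sim_read(1)] by simp
  next
    case p: True
    show ?thesis
    proof (cases "i < k")
      case True
      then have "C' = (p # take (Suc i) (reads ts), \<nu>)" using sim_read step_read[OF sim_read(1) p True] by simp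
      then show ?thesis using sim.sim_read[OF sim_read(1) _ sim_read(3), of "Suc i"] p True by simp
    next
      case False
      then have "take i (reads ts) = reads ts" using f by simp
      then have "C' = (p # reads ts @ [0], \<nu>)" using sim_read step_start[OF sim_read(1) p] by simp
      then show ?thesis using sim.sim_find[OF sim_read(1) p, of 0 \<nu>] mix_0[OF sim_read(1)] sim_read(3) by simp
    qed
  qed
next
  case (sim_find t p ts i \<nu>)
  show ?case
  proof (cases "i < k")
    case True
    have "C' = (p # reads ts @ [i, snd (ts ! i)], \<nu>)"
      using sim_find step_find[where \<nu> = \<nu> and i = i, OF sim_find(1,2) True rep_mix_head[OF sim_find(1) True sim_find(4)]] by simp
    then show ?thesis using sim.sim_cell[OF sim_find(1,2) True sim_find(4)] by simp
  next
    case False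
    then have i: "i = k" using sim_find by simp
    then have C: "C' = ([fst (delta M p (reads ts))], \<nu>)" using sim_find step_next[OF sim_find(1,2)] by simp
    have "run (Suc t) = (fst (delta M p (reads ts)), mix p ts k)"
      using run_Suc[OF sim_find(1,2)] mix_k[OF sim_find(1)] by simp
    from sim.sim_read[OF this, of 0 \<nu>] show ?thesis using C sim_find(4) i by simp
  qed
next
  case (sim_cell t p ts i \<nu>)
  show ?case using sim_cell step_cell[OF sim_cell(1-3)] sim.sim_head[OF sim_cell(1-3) rep_half[OF sim_cell(1,3,4)]] by simp
next
  case (sim_head t p ts i \<nu>)
  show ?case using sim_head step_head[OF sim_head(1-3)] sim.sim_find[OF sim_head(1,2) _ rep_mix_Suc[OF sim_head(1,3,4)]] by simp
qed

lemma tstep_trans: "(tstep M w S)\<^sup>*\<^sup>* C C' \<Longrightarrow> tstep M w S C' C'' \<Longrightarrow> (tstep M w S)\<^sup>*\<^sup>* C C''"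
  by (rule rtranclp.rtrancl_into_rtrancl)

lemma reach_run:
  assumes r0: "rep \<nu>0 (snd (run 0))"
  shows "\<exists>\<nu>. (tstep M w S)\<^sup>*\<^sup>* ([start M], \<nu>0) ([fst (run t)], \<nu>) \<and> rep \<nu> (snd (run t))"
proof (induction t)
  case 0
  have "fst (run 0) = start M" by (simp add: tm_run_def tm_init_def)
  then show ?case using r0 by auto
next
  case (Suc t)
  obtain p ts where rt: "run t = (p, ts)" by fastforce
  obtain \<nu> where \<nu>: "(tstep M w S)\<^sup>*\<^sup>* ([start M], \<nu>0) ([p], \<nu>)" "rep \<nu> ts" using Suc rt by auto
  show ?case
  proof (cases "p \<in> set (running M)")
    case False
    then have "run (Suc t) = run t"
      using rt ts_facts(1)[OF rt] by (auto simp: tm_run_def tm_step_def halted_def running_iff)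
    then show ?thesis using \<nu> rt by auto
  next
    case p: True
    have 1: "(tstep M w S)\<^sup>*\<^sup>* ([p], \<nu>) (p # take i (reads ts), \<nu>)" if "i \<le> k" for i
      using that
    proof (induction i)
      case (Suc i)
      have "tstep M w S (p # take i (reads ts), \<nu>) (p # take (Suc i) (reads ts), \<nu>)"
        using step_read[OF rt p, of i \<nu>] \<nu>(2) Suc.prems by simp
      with Suc show ?case using tstep_trans by simp
    qed simp
    have 2: "tstep M w S (p # take k (reads ts), \<nu>) (p # reads ts @ [0], \<nu>)"
      using step_start[OF rt p] ts_facts(3)[OF rt] by simp
    have 3: "\<exists>\<nu>'. (tstep M w S)\<^sup>*\<^sup>* (p # reads ts @ [0], \<nu>) (p # reads ts @ [i], \<nu>') \<and> rep \<nu>' (mix p ts i)" if "i \<le> k" for i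
      using that
    proof (induction i)
      case 0
      then show ?case using \<nu>(2) mix_0[OF rt] by auto
    next
      case (Suc i)
      then obtain \<nu>' where s: "(tstep M w S)\<^sup>*\<^sup>* (p # reads ts @ [0], \<nu>) (p # reads ts @ [i], \<nu>')" "rep \<nu>' (mix p ts i)" by auto
      have i: "i < k" using Suc by simp
      let ?\<nu>1 = "\<nu>'(X i (snd (ts ! i)) := D (Suc (fst (snd (delta M p (reads ts)) ! i))))"
      let ?\<nu>2 = "?\<nu>1(H i := D (move (snd (snd (delta M p (reads ts)) ! i)) (snd (ts ! i))))"
      have a: "tstep M w S (p # reads ts @ [i], \<nu>') (p # reads ts @ [i, snd (ts ! i)], \<nu>')"
        using step_find[where \<nu> = \<nu>' and i = i, OF rt p i rep_mix_head[OF rt i s(2)]] by simp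
      have b: "tstep M w S (p # reads ts @ [i, snd (ts ! i)], \<nu>') (p # reads ts @ [i, snd (ts ! i), 0], ?\<nu>1)"
        using step_cell[OF rt p i] by simp
      have c: "tstep M w S (p # reads ts @ [i, snd (ts ! i), 0], ?\<nu>1) (p # reads ts @ [Suc i], ?\<nu>2)"
        using step_head[OF rt p i] by simp
      have d: "rep ?\<nu>2 (mix p ts (Suc i))" by (rule rep_mix_Suc[OF rt i rep_half[OF rt i s(2)]])
      show ?case by (intro exI[of _ ?\<nu>2] conjI d tstep_trans[OF tstep_trans[OF tstep_trans[OF s(1) a] b] c])
    qed
    obtain \<nu>' where n: "(tstep M w S)\<^sup>*\<^sup>* (p # reads ts @ [0], \<nu>) (p # reads ts @ [k], \<nu>')" "rep \<nu>' (mix p ts k)"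
      using 3[of k] by blast
    have 4: "tstep M w S (p # reads ts @ [k], \<nu>') ([fst (delta M p (reads ts))], \<nu>')" using step_next[OF rt p] by simp
    have "(tstep M w S)\<^sup>*\<^sup>* ([start M], \<nu>0) ([fst (delta M p (reads ts))], \<nu>')"
      using rtranclp_trans[OF \<nu>(1) rtranclp_trans[OF tstep_trans[OF 1[OF order_refl] 2]
         tstep_trans[OF n(1) 4]]] .
    then show ?thesis using n(2) run_Suc[OF rt p] mix_k[OF rt] by auto
  qed
qed

end

lemma depth_le_code_transition: "depth_le (Suc (Suc (Suc (Suc (Suc n))))) (code_transition t)"
proof -
  have "depth_le (Suc (Suc m)) (code_atom a)" for a m by (cases a) auto
  then have "depth_le (Suc (Suc (Suc (Suc n)))) (code_action a)" for a by (cases a) auto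
  then show ?thesis by (cases t) auto
qed

text \<open>The longest nesting passes through instance, list of blocks, block, list of transitions,
  transition, action, list of atoms, atom and number, nine levels in all.\<close>

lemma depth_le_code_of_inst:
  assumes "\<And>e. e \<in> set (i_blocks I) \<Longrightarrow> \<forall>c \<in> set (b_trs e). depth_le (Suc (Suc (Suc (Suc (Suc n))))) c"
  shows "depth_le (Suc (Suc (Suc (Suc (Suc (Suc (Suc (Suc (Suc n))))))))) (code_of_inst I)"
proof -
  have "depth_le (Suc (Suc (Suc (Suc (Suc (Suc (Suc n))))))) (code_of_block e)" if "e \<in> set (i_blocks I)" for e
    using assms[OF that] by (auto simp: code_of_block_def)
  then show ?thesis by (auto simp: code_of_inst_def)
qed

lemma halted_run: "halted M (tm_run M w t) \<Longrightarrow> tm_run M w (n + t) = tm_run M w t"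
  by (induction n) (simp_all add: tm_run_def tm_step_def)

text \<open>A halted configuration repeats forever, so a run cannot meet both
  \<open>accept M\<close> and \<open>reject M\<close>.\<close>

lemma decides_iff:
  assumes "wf_tm M" "decides M Y"
  shows "w \<in> Y \<longleftrightarrow> (\<exists>t. fst (tm_run M w t) = accept M)"
proof
  assume "w \<in> Y"
  then show "\<exists>t. fst (tm_run M w t) = accept M" using assms(2) unfolding decides_def by metis
next
  assume "\<exists>t. fst (tm_run M w t) = accept M"
  then obtain t where t: "fst (tm_run M w t) = accept M" ..
  show "w \<in> Y"
  proof (rule ccontr)
    assume "w \<notin> Y"
    then obtain t' where t': "fst (tm_run M w t') = reject M" using assms(2) unfolding decides_def by metis
    have "tm_run M w t = tm_run M w t'"
      using halted_run[of M w t t'] halted_run[of M w t' t] t t' by (simp add: halted_def add.commute)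
    then show False using t t' assms(1) by (simp add: wf_tm_def)
  qed
qed

section \<open>The constructed instance and its coverability\<close>

locale reduced = simulation +
  fixes u :: "bool list \<Rightarrow> bool list"
  assumes length_u: "length (u w) = S"
begin

abbreviation I :: inst where "I \<equiv> sim_inst M u w"

lemma trs_eq: "set (trs M w (positions (u w))) = {code_transition (idn ns, a, idn ns') | ns a ns'. ttr M w S ns a ns'}"
  using length_positions[of "u w"] length_u by (intro set_trs) simp

lemma data_eq: "set (i_data I) = D ` {..S + nsymbols M + 2}"
proof -
  have "set (i_data I) = D ` (length ` set (positions (u w @ una (nsymbols M + 2))))"
    by (simp add: sim_inst_def dedup ident_idn image_image)
  then show ?thesis by (simp add: length_positions length_u add.assoc)
qed

lemma vars_eq: "set (i_vars I) = (\<Union>i < k. insert (H i) (X i ` {..S}))"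
proof -
  have "cell_id i ` set (positions (u w)) = X i ` (length ` set (positions (u w)))" for i
    by (simp add: cell_id_def ident_idn image_image)
  then show ?thesis
    by (simp add: sim_inst_def dedup head_id_def ident_idn length_positions length_u lessThan_atLeast0)
qed

lemma states_eq: "set (sim_states M (trs M w (positions (u w)))) =
    {D (start M), D (accept M), idn []} \<union> {s. \<exists>ns a ns'. ttr M w S ns a ns' \<and> (s = idn ns \<or> s = idn ns')}"
proof -
  have s: "s \<in> set (concat (map (\<lambda>t. [num (sub 0 t), num (sub 2 t)]) (trs M w (positions (u w))))) \<longleftrightarrow>
    (\<exists>ns a ns'. ttr M w S ns a ns' \<and> (s = idn ns \<or> s = idn ns'))" for s
    unfolding set_concat_map trs_eq by force
  have "set (concat (map (\<lambda>t. [num (sub 0 t), num (sub 2 t)]) (trs M w (positions (u w))))) =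
    {s. \<exists>ns a ns'. ttr M w S ns a ns' \<and> (s = idn ns \<or> s = idn ns')}"
    by (rule set_eqI) (simp only: s mem_Collect_eq)
  then show ?thesis unfolding sim_states_def dedup set_append by (simp only: ident_idn list.set list.map length_replicate)
qed

lemma ttr_action:
  assumes "ttr M w S ns a ns'"
  shows "(\<exists>g. a = Guard g \<and> (\<forall>t \<in> set g. atom_over (set (i_vars I)) (set (i_data I)) t)) \<or>
    (\<exists>x d. a = Assign x d \<and> x \<in> set (i_vars I) \<and> d \<in> set (i_data I))"
proof -
  have h: "H i \<in> set (i_vars I)" if "i < k" for i using that unfolding vars_eq by blast
  have x: "X i j \<in> set (i_vars I)" if "i < k" "j \<le> S" for i j using that unfolding vars_eq by blast
  have d: "D n \<in> set (i_data I)" if "n \<le> S + nsymbols M + 2" for n using that unfolding data_eq by blast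
  from assms show ?thesis
  proof cases
    case (tr_read p i rs v j)
    then show ?thesis using h[of i] x[of i j] d[of j] d[of v] by simp
  next
    case (tr_find p rs i j)
    then show ?thesis using h[of i] d[of j] by simp
  next
    case (tr_cell p rs i j)
    have "fst (snd (delta M p rs) ! i) < nsymbols M"
      using tr_cell by (intro delta_wf(3)) (auto simp: words_iff running_iff)
    then show ?thesis using tr_cell x[of i j] d[of "Suc (fst (snd (delta M p rs) ! i))"] by simp
  next
    case (tr_head p rs i j)
    \<comment> \<open>The value \<open>S + 1\<close> is possible here, for a right move on the last
      cell; it still belongs to the data.\<close>
    have "move m j \<le> Suc j" for m by (cases m) auto
    from this[of "snd (snd (delta M p rs) ! i)"] show ?thesis
      using tr_head h[of i] d[of "move (snd (snd (delta M p rs) ! i)) j"] by simp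
  qed simp_all
qed

lemma action_ok_ttr:
  assumes "ttr M w S ns a ns'"
  shows "action_ok I (code_action a)"
  using ttr_action[OF assms]
proof
  assume "\<exists>g. a = Guard g \<and> (\<forall>t \<in> set g. atom_over (set (i_vars I)) (set (i_data I)) t)"
  then obtain g where g: "a = Guard g" "\<forall>t \<in> set g. atom_over (set (i_vars I)) (set (i_data I)) t" by blast
  have "\<forall>t \<in> set g. atom_ok I (code_atom t)" using g(2) unfolding atom_ok_iff by blast
  then show ?thesis unfolding action_ok_def g(1) by (intro disjI2 disjI1) simp
next
  assume "\<exists>x d. a = Assign x d \<and> x \<in> set (i_vars I) \<and> d \<in> set (i_data I)"
  then obtain x d where g: "a = Assign x d" "x \<in> set (i_vars I)" "d \<in> set (i_data I)" by blast
  then show ?thesis unfolding action_ok_def g(1) by (intro disjI2) simp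
qed

lemma inst_ok_sim_inst: "inst_ok I"
proof -
  define T where "T = trs M w (positions (u w))"
  define e :: binst where "e = (0, map (\<lambda>s. (s, if s = D (accept M) then 1 else 0)) (sim_states M T), D (start M), idn [], T)"
  have I: "i_blocks I = [e]" "i_d0 I = D 0" "i_cq I = []" "i_sq I = [0]" "i_main I = 0" "distinct (i_data I)" "distinct (i_vars I)"
    by (simp_all add: sim_inst_def e_def T_def ident_idn dedup)
  have b: "b_trs e = T" "map fst (b_sts e) = sim_states M T" "b_init e = D (start M)" "b_final e = idn []" "b_id e = 0"
    by (simp_all add: e_def o_def)
  have "transition_ok I e t" if t: "t \<in> set T" for t
  proof -
    obtain ns a ns' where n: "ttr M w S ns a ns'" "t = code_transition (idn ns, a, idn ns')" using t unfolding T_def trs_eq by blast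
    have "idn ns \<in> set (sim_states M T)" "idn ns' \<in> set (sim_states M T)"
      using n(1) unfolding T_def states_eq by blast+
    then show ?thesis unfolding transition_ok_def b n(2) using action_ok_ttr[OF n(1)] by simp
  qed
  moreover have "D (start M) \<in> set (sim_states M T)" "idn [] \<in> set (sim_states M T)"
    unfolding T_def states_eq by blast+
  moreover have "distinct (sim_states M T)" "distinct T" by (simp_all add: sim_states_def T_def trs_def dedup)
  ultimately have "block_ok I e" unfolding block_ok_def b I by (simp add: b(5))
  moreover have "D 0 \<in> set (i_data I)" unfolding data_eq by blast
  ultimately show ?thesis unfolding inst_ok_def I(1-5) using I(6,7) b(5) by simp
qed

lemma reduction_eq: "reduction M u w = bits (code_of_inst I)"
proof -
  have b: "b_trs e = trs M w (positions (u w))" if "e \<in> set (i_blocks I)" for e using that by (simp add: sim_inst_def)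
  have "depth_le (Suc (Suc (Suc (Suc (Suc (Suc (Suc (Suc (Suc 0))))))))) (code_of_inst I)"
  proof (intro depth_le_code_of_inst ballI)
    fix e c assume "e \<in> set (i_blocks I)" "c \<in> set (b_trs e)"
    then have "c \<in> set (trs M w (positions (u w)))" using b by simp
    then obtain ns a ns' where "c = code_transition (idn ns, a, idn ns')" unfolding trs_eq by blast
    then show "depth_le (Suc (Suc (Suc (Suc (Suc 0))))) c" by (simp only: depth_le_code_transition)
  qed
  moreover have "9 = Suc (Suc (Suc (Suc (Suc (Suc (Suc (Suc (Suc 0))))))))" by simp
  ultimately have "depth_le 9 (code_of_inst I)" by metis
  then show ?thesis unfolding reduction_def by (rule bits_upto)
qed

definition conf :: "nat list \<times> (nat \<Rightarrow> nat) \<Rightarrow> frame list \<times> bool \<times> (nat \<Rightarrow> nat)" where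
  "conf C = ([(0, [], idn (fst C))], False, snd C)"

lemma sim_init: "rep (\<lambda>_. D 0) (snd (run 0))" "sim ([start M], \<lambda>_. D 0)"
proof -
  have "trep i (\<lambda>_. D 0) (snd (run 0) ! i)" if "i < k" for i
    using that by (cases i) (auto simp: trep_def tm_run_def tm_init_def)
  moreover have "length (snd (run 0)) = k" using run_wf[of 0] by simp
  ultimately show r: "rep (\<lambda>_. D 0) (snd (run 0))" unfolding rep_def by blast
  have "run 0 = (start M, snd (run 0))" by (simp add: tm_run_def tm_init_def)
  from sim_read[OF this _ r, of 0] show "sim ([start M], \<lambda>_. D 0)" by simp
qed

context
  fixes A :: nat_qdas and f :: "nat \<Rightarrow> nat"
  assumes r: "represents I A f"
begin

interpretation rp: represented A I f
  using r inst_ok_sim_inst by (rule representedI)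

lemma main_eq: "blocks A = {0}" "main_block A = 0" "init_data A = D 0"
  using rp.rep_simps(2,5,6) by (simp_all add: sim_inst_def ident_idn)

lemma block_eq: "states A 0 = set (sim_states M (trs M w (positions (u w))))" "init_state A 0 = D (start M)" "final_state A 0 = idn []"
  "s \<in> states A 0 \<Longrightarrow> f s = (if s = D (accept M) then 1 else 0)"
  "(s, a, s') \<in> transitions A 0 \<longleftrightarrow> (\<exists>ns ns'. s = idn ns \<and> s' = idn ns' \<and> ttr M w S ns a ns')"
proof -
  let ?e = "hd (i_blocks I)"
  have e: "?e \<in> set (i_blocks I)" "b_id ?e = 0" "b_trs ?e = trs M w (positions (u w))"
    "b_sts ?e = map (\<lambda>s. (s, if s = D (accept M) then 1 else 0)) (sim_states M (trs M w (positions (u w))))"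
    "b_init ?e = D (start M)" "b_final ?e = idn []"
    by (simp_all add: sim_inst_def ident_idn)
  note b = rp.rep_block[OF e(1), unfolded e]
  show s: "states A 0 = set (sim_states M (trs M w (positions (u w))))" using b(1) by (simp add: image_image)
  show "init_state A 0 = D (start M)" "final_state A 0 = idn []" using b(3,4) by simp_all
  show "s \<in> states A 0 \<Longrightarrow> f s = (if s = D (accept M) then 1 else 0)" using b(2) unfolding s by auto
  have "(s, a, s') \<in> transitions A 0 \<longleftrightarrow> code_transition (s, a, s') \<in> set (trs M w (positions (u w)))"
    unfolding b(5) by (auto simp: image_iff code_transition_inj simp del: code_transition.simps)
  also have "\<dots> \<longleftrightarrow> (\<exists>ns ns'. s = idn ns \<and> s' = idn ns' \<and> ttr M w S ns a ns')"
    unfolding trs_eq by (auto simp: code_transition_inj simp del: code_transition.simps)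
  finally show "(s, a, s') \<in> transitions A 0 \<longleftrightarrow> (\<exists>ns ns'. s = idn ns \<and> s' = idn ns' \<and> ttr M w S ns a ns')" .
qed

lemma ainit_eq: "ainit A = conf ([start M], \<lambda>_. D 0)"
  by (simp add: ainit_def main_eq block_eq conf_def)

lemma tstep_astep:
  assumes "tstep M w S C C'"
  shows "astep A (conf C) (conf C')"
proof -
  obtain a where t: "ttr M w S (fst C) a (fst C')" and
    a: "(\<exists>g. a = Guard g \<and> (\<forall>t \<in> set g. sat_atom (snd C) t) \<and> snd C' = snd C) \<or> (\<exists>x d. a = Assign x d \<and> snd C' = (snd C)(x := d))"
    using assms unfolding tstep_def by blast
  have m: "(idn (fst C), a, idn (fst C')) \<in> transitions A 0" using t unfolding block_eq(5) by blast
  from a show ?thesis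
  proof
    assume "\<exists>g. a = Guard g \<and> (\<forall>t \<in> set g. sat_atom (snd C) t) \<and> snd C' = snd C"
    then obtain g where g: "a = Guard g" "\<forall>t \<in> set g. sat_atom (snd C) t" "snd C' = snd C" by blast
    show ?thesis unfolding conf_def g(3) by (rule as_guard[OF _ g(2)]) (use m g(1) in simp)
  next
    assume "\<exists>x d. a = Assign x d \<and> snd C' = (snd C)(x := d)"
    then obtain x d where g: "a = Assign x d" "snd C' = (snd C)(x := d)" by blast
    show ?thesis unfolding conf_def g(2) by (rule as_assign) (use m g(1) in simp)
  qed
qed

lemma sim_nonempty: "sim C \<Longrightarrow> fst C \<noteq> []"
  by (induction rule: sim.induct) auto

text \<open>No transition dispatches, and control lists are never empty, so the final state
  \<open>idn []\<close> is not met. The stack remains the single frame of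
  \<open>main\<close>.\<close>

lemma astep_sim:
  assumes "astep A (conf C) E" "sim C"
  shows "\<exists>C'. E = conf C' \<and> sim C'"
  using assms(1)[unfolded conf_def]
proof cases
  case (as_guard g s')
  then obtain ns' where n: "s' = idn ns'" "ttr M w S (fst C) (Guard g) ns'" unfolding block_eq(5) idn_inj by blast
  have "tstep M w S C (ns', snd C)" using tstep_guard[OF n(2), of "snd C"] as_guard by simp
  then have "sim (ns', snd C)" by (rule sim_step[OF assms(2)])
  then show ?thesis using as_guard n(1) by (intro exI[of _ "(ns', snd C)"]) (simp add: conf_def)
next
  case (as_assign x d s')
  then obtain ns' where n: "s' = idn ns'" "ttr M w S (fst C) (Assign x d) ns'" unfolding block_eq(5) idn_inj by blast
  have "tstep M w S C (ns', (snd C)(x := d))" using tstep_assign[OF n(2), of "snd C"] by simp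
  then have "sim (ns', (snd C)(x := d))" by (rule sim_step[OF assms(2)])
  then show ?thesis using as_assign n(1) by (intro exI[of _ "(ns', (snd C)(x := d))"]) (simp add: conf_def)
next
  case (as_dispatch q' b' s')
  then obtain ns' where "ttr M w S (fst C) (Dispatch_s q' b') ns'" unfolding block_eq(5) idn_inj by blast
  then show ?thesis using ttr_action by blast
next
  case as_terminate
  then show ?thesis using sim_nonempty[OF assms(2)] by (simp add: block_eq idn_inj)
qed simp

lemma coverable_iff: "parikh_coverable A f \<longleftrightarrow> (\<exists>t. fst (run t) = accept M)"
proof -
  have acc: "D (accept M) \<in> states A 0" unfolding block_eq(1) states_eq by blast
  \<comment> \<open>There is one frame, and \<open>f\<close> is 1 at the accepting state and 0
    elsewhere, so covering \<open>f\<close> means being in that state.\<close>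
  have cov: "(\<forall>s \<in> all_states A. f s \<le> count_state (fst (conf C)) s) \<longleftrightarrow> fst C = [accept M]" for C
  proof -
    have "(\<forall>s \<in> all_states A. f s \<le> count_state (fst (conf C)) s) \<longleftrightarrow> (\<forall>s \<in> states A 0. f s \<le> count_state (fst (conf C)) s)"
      by (simp add: all_states_def main_eq)
    also have "\<dots> \<longleftrightarrow> 1 \<le> count_state (fst (conf C)) (D (accept M))"
      using acc block_eq(4) by force
    also have "\<dots> \<longleftrightarrow> fst C = [accept M]" by (simp add: count_state_def conf_def idn_inj)
    finally show ?thesis .
  qed
  show ?thesis
  proof
    assume "parikh_coverable A f"
    then obtain E where E: "(astep A)\<^sup>*\<^sup>* (ainit A) E" "\<forall>s \<in> all_states A. f s \<le> count_state (fst E) s"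
      unfolding rp.parikh_coverable_iff by blast
    from E(1) have "\<exists>C. E = conf C \<and> sim C"
    proof (induction rule: rtranclp_induct)
      case base then show ?case using ainit_eq sim_init(2) by blast
    next
      case (step E E') then show ?case using astep_sim by blast
    qed
    then obtain C where C: "E = conf C" "sim C" by blast
    have "fst C = [accept M]" using E(2) cov C(1) by blast
    with C(2) show "\<exists>t. fst (run t) = accept M"
    \<comment> \<open>A control list with a single entry occurs only before the first symbol is
      read, where the entry is the machine state.\<close>
    proof cases
      case (sim_read t p ts i \<nu>)
      then show ?thesis using \<open>fst C = [accept M]\<close> by (intro exI[of _ t]) simp
    qed (auto simp: reads_def)
  next
    assume "\<exists>t. fst (run t) = accept M"
    then obtain t where t: "fst (run t) = accept M" ..
    obtain \<nu> where \<nu>: "(tstep M w S)\<^sup>*\<^sup>* ([start M], \<lambda>_. D 0) ([accept M], \<nu>)"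
      using reach_run[OF sim_init(1), of t] t by auto
    have "(astep A)\<^sup>*\<^sup>* (conf ([start M], \<lambda>_. D 0)) (conf C)" if "(tstep M w S)\<^sup>*\<^sup>* ([start M], \<lambda>_. D 0) C" for C
      using that
    proof (induction rule: rtranclp_induct)
      case (step C C')
      show ?case by (rule rtranclp.rtrancl_into_rtrancl[of "astep A"]) (rule step.IH, rule tstep_astep[OF step.hyps(2)])
    qed simp
    from this[OF \<nu>] have "(astep A)\<^sup>*\<^sup>* (ainit A) (conf ([accept M], \<nu>))" unfolding ainit_eq .
    moreover have "\<forall>s \<in> all_states A. f s \<le> count_state (fst (conf ([accept M], \<nu>))) s" unfolding cov by simp
    ultimately show "parikh_coverable A f" unfolding rp.parikh_coverable_iff by blast
  qed
qed

end

lemma reduction_iff: "reduction M u w \<in> PARIKH_COVERABILITY {A. serial A \<and> synchronous A} \<longleftrightarrow> (\<exists>t. fst (run t) = accept M)"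
proof
  assume "reduction M u w \<in> PARIKH_COVERABILITY {A. serial A \<and> synchronous A}"
  then obtain c A f where c: "bits (code_of_inst I) = bits c" "c \<in> codes_instance A f" "parikh_coverable A f"
    unfolding PARIKH_COVERABILITY_def reduction_eq by blast
  from c(2) obtain J where J: "c = code_of_inst J" "represents J A f" unfolding codes_instance_iff by blast
  \<comment> \<open>A word determines its description, so whichever system it codes is represented
    by \<open>I\<close>.\<close>
  have "inst_of_code (code_of_inst I) = inst_of_code (code_of_inst J)" using c(1) J(1) bits_inj by metis
  then have "represents I A f" using J(2) by simp
  from coverable_iff[OF this] c(3) show "\<exists>t. fst (run t) = accept M" by simp
next
  assume t: "\<exists>t. fst (run t) = accept M"
  obtain A f where r: "represents I A f" using inst_ok_represents[OF inst_ok_sim_inst] by blast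
  have "wf_qdas A" "serial A" "synchronous A" using inst_ok_iff[OF r] inst_ok_sim_inst by blast+
  moreover have "code_of_inst I \<in> codes_instance A f" unfolding codes_instance_iff using r by blast
  moreover have "parikh_coverable A f" using coverable_iff[OF r] t by simp
  ultimately show "reduction M u w \<in> PARIKH_COVERABILITY {A. serial A \<and> synchronous A}"
    unfolding PARIKH_COVERABILITY_def reduction_eq by blast
qed

end

lemma PARIKH_COVERABILITY_hard: "PSPACE_hard (PARIKH_COVERABILITY {A. serial A \<and> synchronous A})"
  unfolding PSPACE_hard_def
proof
  fix Y assume "Y \<in> PSPACE"
  then obtain M and p :: "nat poly" where M: "wf_tm M" "decides M Y" "runs_in_space M (poly p)"
    unfolding PSPACE_def by blast
  obtain u :: "bool list \<Rightarrow> bool list" where u: "ptime u" "\<And>w. length (u w) = poly p (length w)"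
    using ptime_unary_poly[of p] by blast
  have "w \<in> Y \<longleftrightarrow> reduction M u w \<in> PARIKH_COVERABILITY {A. serial A \<and> synchronous A}" for w
  proof -
    interpret reduced M w "poly p (length w)" u
    proof
      show "wf_tm M" "length (u w) = poly p (length w)" using M(1) u(2) by auto
      show "h \<le> poly p (length w)" if "(c, h) \<in> set (snd (tm_run M w t))" for t c h
        using M(3) that unfolding runs_in_space_def by fastforce
    qed
    show ?thesis unfolding reduction_iff by (rule decides_iff[OF M(1,2)])
  qed
  moreover have "polytime_computable (reduction M u)"
    by (rule ptime_polytime_computable[OF ptime_reduction[OF u(1)]])
  ultimately show "polytime_reducible Y (PARIKH_COVERABILITY {A. serial A \<and> synchronous A})"
    unfolding polytime_reducible_def by blast
qed

theorem theorem2: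
  shows "PSPACE_complete (PARIKH_COVERABILITY {A. serial A \<and> synchronous A})"
  unfolding PSPACE_complete_def
  using PARIKH_COVERABILITY_in_PSPACE PARIKH_COVERABILITY_hard ..

end
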